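(* For every natural number $n>1$ there exists a unitary operator $T$ on a separable Hilbert space such that its tensor power $T^{\otimes n}$ has singular spectrum, and the spectrum of the tensor power $T^{\otimes (n+1)}$ is absolutely continuous. Thus, for the spectral measure $\sigma$ (on the unit circle $\mathbb T$) of such an operator $T$, the convolution power $\sigma^{\ast n}$ is singular and the convolution power $\sigma^{\ast (n+1)}$ is absolutely continuous (both with respect to Lebesgue measure on $\mathbb T$).
   Context: Let $\mathbb T$ be the unit circle in the complex plane. By the spectral theorem, a unitary operator $S$ on a (nonzero) separable Hilbert space is unitarily equivalent to the multiplication operator $V$ acting in $L_2(\mathbb T\times\mathbb N,\sigma)$ by $Vf(t,n)=t f(t,n)$, where $\sigma$ is a normalized Borel measure on $\mathbb T\times\mathbb N$. The operator $S$ has singular spectrum if $\sigma$ is singular, i.e. its projection onto $\mathbb T$ is singular with respect to Lebesgue measure on $\mathbb T$. The operator $S$ has absolutely continuous spectrum if the projection of $\sigma$ onto $\mathbb T$ is absolutely continuous with respect to Lebesgue measure. When $\sigma$ is convolved as a measure on $\mathbb T$, it denotes this projection (a measure of maximal spectral type of the operator), and $\sigma^{\ast m}$ denotes the $m$-fold convolution on the group $\mathbb T$. *)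

theory Defs
  imports
    "HOL-Probability.Probability"
    "HOL-Algebra.Algebraic_Closure_Type"
    "HOL-Library.Poly_Mapping"
begin

section \<open>Hilbert spaces and unitary operators\<close>

text \<open>
  Hilbert spaces are carrier-based modules over the ring of complex numbers, so that spaces
  depending on a value (a measure, a tensor exponent) can be formed. The ring fields
  \<open>mult\<close> and \<open>one\<close> inherited from the record \<open>module\<close> play no role.
  Inner products are linear in the second argument.
\<close>

record 'a ip_module = "(complex, 'a) module" +
  ip :: "'a \<Rightarrow> 'a \<Rightarrow> complex"

definition hnorm :: "('a, 'm) ip_module_scheme \<Rightarrow> 'a \<Rightarrow> real" where
  "hnorm H x = sqrt (Re (ip H x x))"

definition hdist :: "('a, 'm) ip_module_scheme \<Rightarrow> 'a \<Rightarrow> 'a \<Rightarrow> real" where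
  "hdist H x y = hnorm H (x \<ominus>\<^bsub>H\<^esub> y)"

locale hilbert_space =
  module "ring_of_type_algebra :: complex ring" H
  for H :: "('a, 'm) ip_module_scheme" (structure) +
  assumes ip_add_right:
      "\<lbrakk>x \<in> carrier H; y \<in> carrier H; z \<in> carrier H\<rbrakk> \<Longrightarrow> ip H x (y \<oplus> z) = ip H x y + ip H x z"
    and ip_smult_right:
      "\<lbrakk>x \<in> carrier H; y \<in> carrier H\<rbrakk> \<Longrightarrow> ip H x (c \<odot> y) = c * ip H x y"
    and ip_commute:
      "\<lbrakk>x \<in> carrier H; y \<in> carrier H\<rbrakk> \<Longrightarrow> ip H y x = cnj (ip H x y)"
    and ip_nonneg: "x \<in> carrier H \<Longrightarrow> 0 \<le> Re (ip H x x)"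
    and ip_definite: "\<lbrakk>x \<in> carrier H; ip H x x = 0\<rbrakk> \<Longrightarrow> x = \<zero>"
    and complete: "Metric_space.mcomplete (carrier H) (hdist H)"

definition separable_hilbert_space :: "('a, 'm) ip_module_scheme \<Rightarrow> bool" where
  "separable_hilbert_space H \<longleftrightarrow>
     hilbert_space H \<and> separable_space (Metric_space.mtopology (carrier H) (hdist H))"

definition unitary_map ::
    "('a, 'm) ip_module_scheme \<Rightarrow> ('b, 'k) ip_module_scheme \<Rightarrow> ('a \<Rightarrow> 'b) \<Rightarrow> bool" where
  "unitary_map H K U \<longleftrightarrow>
     bij_betw U (carrier H) (carrier K) \<and>
     (\<forall>x\<in>carrier H. \<forall>y\<in>carrier H. U (x \<oplus>\<^bsub>H\<^esub> y) = U x \<oplus>\<^bsub>K\<^esub> U y) \<and>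
     (\<forall>c. \<forall>x\<in>carrier H. U (c \<odot>\<^bsub>H\<^esub> x) = c \<odot>\<^bsub>K\<^esub> U x) \<and>
     (\<forall>x\<in>carrier H. \<forall>y\<in>carrier H. ip K (U x) (U y) = ip H x y)"

abbreviation unitary_operator :: "('a, 'm) ip_module_scheme \<Rightarrow> ('a \<Rightarrow> 'a) \<Rightarrow> bool" where
  "unitary_operator H T \<equiv> unitary_map H H T"

definition unitarily_equivalent ::
    "('a, 'm) ip_module_scheme \<Rightarrow> ('a \<Rightarrow> 'a) \<Rightarrow> ('b, 'k) ip_module_scheme \<Rightarrow> ('b \<Rightarrow> 'b) \<Rightarrow> bool" where
  "unitarily_equivalent H S K V \<longleftrightarrow>
     (\<exists>U. unitary_map H K U \<and> (\<forall>x\<in>carrier H. U (S x) = V (U x)))"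


section \<open>The space of square-integrable functions\<close>

definition ae_class :: "'x measure \<Rightarrow> ('x \<Rightarrow> complex) \<Rightarrow> ('x \<Rightarrow> complex) set" where
  "ae_class M f = {g \<in> borel_measurable M. AE x in M. g x = f x}"

definition square_integrable :: "'x measure \<Rightarrow> ('x \<Rightarrow> complex) \<Rightarrow> bool" where
  "square_integrable M f \<longleftrightarrow> f \<in> borel_measurable M \<and> integrable M (\<lambda>x. (cmod (f x))\<^sup>2)"

definition rep :: "('x \<Rightarrow> complex) set \<Rightarrow> 'x \<Rightarrow> complex" where
  "rep A = (SOME f. f \<in> A)"

definition L2 :: "'x measure \<Rightarrow> ('x \<Rightarrow> complex) set ip_module" where
  "L2 M = \<lparr>carrier = ae_class M ` {f. square_integrable M f},
           mult = undefined,
           one = undefined,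
           zero = ae_class M (\<lambda>_. 0),
           add = (\<lambda>A B. ae_class M (\<lambda>x. rep A x + rep B x)),
           smult = (\<lambda>c A. ae_class M (\<lambda>x. c * rep A x)),
           ip = (\<lambda>A B. \<integral>x. cnj (rep A x) * rep B x \<partial>M)\<rparr>"


section \<open>Measures on the circle and spectral measures\<close>

definition circle_borel :: "complex measure" where
  "circle_borel = restrict_space borel (sphere 0 1)"

definition circle_lebesgue :: "complex measure" where
  "circle_lebesgue = distr (restrict_space lborel {0..<2 * pi}) circle_borel cis"

definition circle_convolution :: "complex measure \<Rightarrow> complex measure \<Rightarrow> complex measure" where
  "circle_convolution \<mu> \<nu> = distr (\<mu> \<Otimes>\<^sub>M \<nu>) circle_borel (\<lambda>(s, t). s * t)"

primrec convolution_power :: "complex measure \<Rightarrow> nat \<Rightarrow> complex measure" where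
  "convolution_power \<mu> 0 = return circle_borel 1"
| "convolution_power \<mu> (Suc m) = circle_convolution \<mu> (convolution_power \<mu> m)"

definition mutually_singular :: "'x measure \<Rightarrow> 'x measure \<Rightarrow> bool" where
  "mutually_singular M N \<longleftrightarrow>
     (\<exists>A \<in> sets M \<inter> sets N. emeasure M (space M - A) = 0 \<and> emeasure N A = 0)"

definition normalized_borel_measure :: "(complex \<times> nat) measure \<Rightarrow> bool" where
  "normalized_borel_measure \<sigma> \<longleftrightarrow>
     sets \<sigma> = sets (circle_borel \<Otimes>\<^sub>M count_space UNIV) \<and> prob_space \<sigma>"

definition circle_projection :: "(complex \<times> nat) measure \<Rightarrow> complex measure" where
  "circle_projection \<sigma> = distr \<sigma> circle_borel fst"

definition coordinate_multiplication ::
    "(complex \<times> nat) measure \<Rightarrow> (complex \<times> nat \<Rightarrow> complex) set \<Rightarrow> (complex \<times> nat \<Rightarrow> complex) set" where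
  "coordinate_multiplication \<sigma> A = ae_class \<sigma> (\<lambda>(t, k). t * rep A (t, k))"

definition is_spectral_measure ::
    "('a, 'm) ip_module_scheme \<Rightarrow> ('a \<Rightarrow> 'a) \<Rightarrow> (complex \<times> nat) measure \<Rightarrow> bool" where
  "is_spectral_measure H S \<sigma> \<longleftrightarrow>
     normalized_borel_measure \<sigma> \<and>
     unitarily_equivalent H S (L2 \<sigma>) (coordinate_multiplication \<sigma>)"

definition has_singular_spectrum :: "('a, 'm) ip_module_scheme \<Rightarrow> ('a \<Rightarrow> 'a) \<Rightarrow> bool" where
  "has_singular_spectrum H S \<longleftrightarrow>
     (\<exists>\<sigma>. is_spectral_measure H S \<sigma> \<and> mutually_singular (circle_projection \<sigma>) circle_lebesgue)"

text \<open>In the library, \<open>absolutely_continuous M N\<close> says that \<open>N\<close> is absolutely continuous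
  with respect to \<open>M\<close>.\<close>

definition has_absolutely_continuous_spectrum ::
    "('a, 'm) ip_module_scheme \<Rightarrow> ('a \<Rightarrow> 'a) \<Rightarrow> bool" where
  "has_absolutely_continuous_spectrum H S \<longleftrightarrow>
     (\<exists>\<sigma>. is_spectral_measure H S \<sigma> \<and> absolutely_continuous circle_lebesgue (circle_projection \<sigma>))"


section \<open>Tensor powers\<close>

text \<open>
  The elementary tensor \<open>y\<^sub>0 \<otimes> \<dots> \<otimes> y\<^sub>n\<^sub>-\<^sub>1\<close> is realised as the conjugate-multilinear form
  \<open>x \<mapsto> \<Prod>i<n. \<langle>x\<^sub>i, y\<^sub>i\<rangle>\<close> on \<open>n\<close>-tuples of vectors. The algebraic tensor power is the span of these
  forms, with the inner product determined by
  \<open>\<langle>x\<^sub>0 \<otimes> \<dots> \<otimes> x\<^sub>n\<^sub>-\<^sub>1, y\<^sub>0 \<otimes> \<dots> \<otimes> y\<^sub>n\<^sub>-\<^sub>1\<rangle> = \<Prod>i<n. \<langle>x\<^sub>i, y\<^sub>i\<rangle>\<close>. Its completion is again a space of forms: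
  since the value of a form at \<open>x\<close> is its inner product with the elementary tensor of \<open>x\<close>,
  a Cauchy sequence converges pointwise, and two Cauchy sequences have the same pointwise
  limit iff they have the same limit in the completion.
\<close>

definition tuples :: "nat \<Rightarrow> ('a, 'm) ip_module_scheme \<Rightarrow> (nat \<Rightarrow> 'a) set" where
  "tuples n H = {..<n} \<rightarrow>\<^sub>E carrier H"

definition elementary_tensor ::
    "nat \<Rightarrow> ('a, 'm) ip_module_scheme \<Rightarrow> (nat \<Rightarrow> 'a) \<Rightarrow> (nat \<Rightarrow> 'a) \<Rightarrow> complex" where
  "elementary_tensor n H y = (\<lambda>x\<in>tuples n H. \<Prod>i<n. ip H (x i) (y i))"

text \<open>A finitely supported \<open>a\<close> stands for the combination of the elementary tensors of \<open>y\<close>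
  with coefficients \<open>a y\<close>.\<close>

definition tensor_combination ::
    "nat \<Rightarrow> ('a, 'm) ip_module_scheme \<Rightarrow> ((nat \<Rightarrow> 'a) \<Rightarrow>\<^sub>0 complex) \<Rightarrow> (nat \<Rightarrow> 'a) \<Rightarrow> complex" where
  "tensor_combination n H a =
     (\<lambda>x\<in>tuples n H. \<Sum>y\<in>Poly_Mapping.keys a. Poly_Mapping.lookup a y * elementary_tensor n H y x)"

definition tensor_ip ::
    "nat \<Rightarrow> ('a, 'm) ip_module_scheme \<Rightarrow>
     ((nat \<Rightarrow> 'a) \<Rightarrow>\<^sub>0 complex) \<Rightarrow> ((nat \<Rightarrow> 'a) \<Rightarrow>\<^sub>0 complex) \<Rightarrow> complex" where
  "tensor_ip n H a b =
     (\<Sum>x\<in>Poly_Mapping.keys a. \<Sum>y\<in>Poly_Mapping.keys b.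
        cnj (Poly_Mapping.lookup a x) * Poly_Mapping.lookup b y * (\<Prod>i<n. ip H (x i) (y i)))"

definition tensor_approx ::
    "nat \<Rightarrow> ('a, 'm) ip_module_scheme \<Rightarrow>
     (nat \<Rightarrow> ((nat \<Rightarrow> 'a) \<Rightarrow>\<^sub>0 complex)) \<Rightarrow> ((nat \<Rightarrow> 'a) \<Rightarrow> complex) \<Rightarrow> bool" where
  "tensor_approx n H a F \<longleftrightarrow>
     (\<forall>m. Poly_Mapping.keys (a m) \<subseteq> tuples n H) \<and>
     (\<forall>e>0. \<exists>N. \<forall>p\<ge>N. \<forall>q\<ge>N. sqrt (Re (tensor_ip n H (a p - a q) (a p - a q))) < e) \<and>
     F \<in> extensional (tuples n H) \<and>
     (\<forall>x\<in>tuples n H. (\<lambda>m. tensor_combination n H (a m) x) \<longlonglongrightarrow> F x)"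

definition tensor_power ::
    "nat \<Rightarrow> ('a, 'm) ip_module_scheme \<Rightarrow> ((nat \<Rightarrow> 'a) \<Rightarrow> complex) ip_module" where
  "tensor_power n H =
     \<lparr>carrier = {F. \<exists>a. tensor_approx n H a F},
      mult = undefined,
      one = undefined,
      zero = (\<lambda>x\<in>tuples n H. 0),
      add = (\<lambda>F G. \<lambda>x\<in>tuples n H. F x + G x),
      smult = (\<lambda>c F. \<lambda>x\<in>tuples n H. c * F x),
      ip = (\<lambda>F G. THE l. \<forall>a b. tensor_approx n H a F \<longrightarrow> tensor_approx n H b G \<longrightarrow>
                               (\<lambda>m. tensor_ip n H (a m) (b m)) \<longlonglongrightarrow> l)\<rparr>"

text \<open>
  For unitary \<open>T\<close> the tensor power of \<open>T\<close> is composition of forms with the inverse (the adjoint)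
  of \<open>T\<close>. The lemma below shows that this is the operator sending \<open>y\<^sub>0 \<otimes> \<dots> \<otimes> y\<^sub>n\<^sub>-\<^sub>1\<close>
  to \<open>T y\<^sub>0 \<otimes> \<dots> \<otimes> T y\<^sub>n\<^sub>-\<^sub>1\<close>.
\<close>

definition tensor_power_operator ::
    "nat \<Rightarrow> ('a, 'm) ip_module_scheme \<Rightarrow> ('a \<Rightarrow> 'a) \<Rightarrow>
     ((nat \<Rightarrow> 'a) \<Rightarrow> complex) \<Rightarrow> (nat \<Rightarrow> 'a) \<Rightarrow> complex" where
  "tensor_power_operator n H T F =
     (\<lambda>x\<in>tuples n H. F (\<lambda>i\<in>{..<n}. inv_into (carrier H) T (x i)))"

lemma tensor_power_operator_elementary:
  assumes T: "unitary_operator H T" and y: "y \<in> tuples n H"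
  shows "tensor_power_operator n H T (elementary_tensor n H y) =
         elementary_tensor n H (\<lambda>i\<in>{..<n}. T (y i))"
proof
  fix x
  have bij: "bij_betw T (carrier H) (carrier H)"
    and ip: "\<And>u v. u \<in> carrier H \<Longrightarrow> v \<in> carrier H \<Longrightarrow> ip H (T u) (T v) = ip H u v"
    using T unfolding unitary_map_def by blast+
  show "tensor_power_operator n H T (elementary_tensor n H y) x =
        elementary_tensor n H (\<lambda>i\<in>{..<n}. T (y i)) x"
  proof (cases "x \<in> tuples n H")
    case True
    have inv: "inv_into (carrier H) T (x i) \<in> carrier H" "T (inv_into (carrier H) T (x i)) = x i"
      if "i < n" for i
    proof -
      have xi: "x i \<in> T ` carrier H"
        using True that bij_betw_imp_surj_on[OF bij] PiE_mem[of x "{..<n}" "\<lambda>_. carrier H" i]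
        by (simp add: tuples_def)
      show "inv_into (carrier H) T (x i) \<in> carrier H" by (rule inv_into_into[OF xi])
      show "T (inv_into (carrier H) T (x i)) = x i" by (rule f_inv_into_f[OF xi])
    qed
    have "(\<lambda>i\<in>{..<n}. inv_into (carrier H) T (x i)) \<in> tuples n H"
      unfolding tuples_def using inv(1) by (intro restrict_PiE_iff[THEN iffD2]) simp
    moreover have "ip H (inv_into (carrier H) T (x i)) (y i) = ip H (x i) (T (y i))" if "i < n" for i
      using ip[OF inv(1)[OF that], of "y i"] inv(2)[OF that] that
        PiE_mem[OF y[unfolded tuples_def], of i] by simp
    ultimately show ?thesis
      using True by (simp add: tensor_power_operator_def elementary_tensor_def)
  next
    case False
    then show ?thesis
      by (simp add: tensor_power_operator_def elementary_tensor_def)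
  qed
qed

end

theory Submission
  imports Defs
begin

text \<open>
  Let \<open>\<sigma>\<close> be the law of \<open>exp (2 \<pi> i \<Sum>k. a\<^sub>k(\<omega>\<^sub>k) / (m\<^sub>0 \<dots> m\<^sub>k))\<close>, where the \<open>\<omega>\<^sub>k < q\<^sub>k\<close> are independent and uniform.
  If \<open>2 q\<^sub>k\<^sup>n \<le> m\<^sub>k\<close>, sums of \<open>n\<close> digits miss at least half of the residues modulo \<open>m\<^sub>k\<close> at every level, so
  \<open>\<sigma>\<^bsup>*n\<^esup>\<close> lives on a null set. If \<open>q\<^sub>k\<^bsup>n + 1\<^esup>\<close> is much larger than \<open>m\<^sub>k\<close> and the digits are chosen at random, the sums of \<open>n + 1\<close>
  digits have almost as few coincidences as a uniform distribution; these second moments multiply over \<open>k\<close>, so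
  \<open>\<sigma>\<^bsup>*(n + 1)\<^esup>\<close> is absolutely continuous.

  The tensor power of multiplication by \<open>t\<close> on \<open>L2 \<sigma>\<close> is multiplication by \<open>t\<^sub>1 \<dots> t\<^sub>k\<close> on the \<open>L2\<close> space of the
  product measure, and a system of functions that is orthogonal relative to this product splits that space into
  spaces over the circle. The resulting spectral measure is dominated by the law \<open>\<sigma>\<^bsup>*k\<^esup>\<close> of the product. Conversely,
  any spectral measure dominates \<open>\<sigma>\<^bsup>*k\<^esup>\<close>, since the Fourier coefficients of \<open>|f|\<^sup>2\<close> are preserved by a unitary
  equivalence and determine a measure on the circle.\<close>

section \<open>Square-integrable functions\<close>

text \<open>The digits use the window between \<open>q ^ n\<close> and \<open>q ^ (n + 1)\<close>:
  the modulus \<open>m\<close> of level \<open>k\<close> is at least \<open>2 * q ^ n\<close> and at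
  most \<open>q ^ (n + 1) / 2 ^ k\<close>. By Cauchy-Schwarz, \<open>n + 1\<close>-fold sums have at
  least \<open>q ^ (2 * (n + 1)) / m\<close> coinciding pairs; the choice exceeds this minimum by a
  factor of at most \<open>1 + (1/2) ^ k\<close>, and the product of these factors converges.
  Carries couple the levels, but a shift never creates more coincidences than no shift.
  Cauchy-Schwarz again turns the bounded second moment into a small probability for small sets of
  cells. On the operator side, the spectral type of a tensor power is given by the existence of some
  spectral measure, while the claim about \<open>\<sigma>\<close> concerns an arbitrary one. Hence
  two comparisons are proved: some spectral measure of the tensor power lies below the convolution
  power, and every one lies above it. The tensor power is accessible only through inner products of
  elementary tensors, so it is treated as a space with a reproducing kernel, and unitary
  equivalences come from total families with equal Gram matrices.\<close>

definition l2ip :: "'x measure \<Rightarrow> ('x \<Rightarrow> complex) \<Rightarrow> ('x \<Rightarrow> complex) \<Rightarrow> complex" where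
  "l2ip M f g = (\<integral>x. cnj (f x) * g x \<partial>M)"

definition l2norm :: "'x measure \<Rightarrow> ('x \<Rightarrow> complex) \<Rightarrow> real" where
  "l2norm M f = sqrt (\<integral>x. (cmod (f x))\<^sup>2 \<partial>M)"

lemma borel_measurable_cnj [measurable (raw)]:
  "f \<in> borel_measurable M \<Longrightarrow> (\<lambda>x. cnj (f x)) \<in> borel_measurable M"
  by (rule measurable_compose[OF _ borel_measurable_continuous_onI]) (assumption, rule continuous_on_cnj[OF continuous_on_id])

lemma cnj_mult_self: "cnj z * z = complex_of_real ((cmod z)\<^sup>2)"
  by (metis complex_norm_square mult.commute)

lemma square_integrable_measurable: "square_integrable M f \<Longrightarrow> f \<in> borel_measurable M"
  by (simp add: square_integrable_def)

lemma square_integrable_cong_AE: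
  assumes "square_integrable M f" "g \<in> borel_measurable M" "AE x in M. g x = f x"
  shows "square_integrable M g"
proof -
  have "AE x in M. (cmod (g x))\<^sup>2 = (cmod (f x))\<^sup>2" using assms(3) by eventually_elim simp
  moreover have "integrable M (\<lambda>x. (cmod (f x))\<^sup>2)" using assms(1) by (simp add: square_integrable_def)
  moreover have "f \<in> borel_measurable M" using assms(1) by (simp add: square_integrable_def)
  ultimately have "integrable M (\<lambda>x. (cmod (g x))\<^sup>2)"
    using assms(2) by (subst integrable_cong_AE[where g="\<lambda>x. (cmod (f x))\<^sup>2"]) auto
  then show ?thesis using assms(2) by (simp add: square_integrable_def)
qed

lemma square_integrable_dominated:
  assumes "square_integrable M f" "g \<in> borel_measurable M" "AE x in M. cmod (g x) \<le> c * cmod (f x)"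
  shows "square_integrable M g"
proof -
  have "integrable M (\<lambda>x. (cmod (g x))\<^sup>2)"
  proof (rule Bochner_Integration.integrable_bound)
    show "integrable M (\<lambda>x. c\<^sup>2 * (cmod (f x))\<^sup>2)" using assms(1) by (simp add: square_integrable_def)
    show "(\<lambda>x. (cmod (g x))\<^sup>2) \<in> borel_measurable M" using assms(2) by measurable
    show "AE x in M. norm ((cmod (g x))\<^sup>2) \<le> norm (c\<^sup>2 * (cmod (f x))\<^sup>2)"
      using assms(3)
    proof eventually_elim
      case (elim x)
      then have "(cmod (g x))\<^sup>2 \<le> (c * cmod (f x))\<^sup>2" by (intro power_mono) auto
      then show ?case by (simp add: power_mult_distrib)
    qed
  qed
  then show ?thesis using assms(2) by (simp add: square_integrable_def)
qed

lemma square_integrable_add: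
  assumes "square_integrable M f" "square_integrable M g"
  shows "square_integrable M (\<lambda>x. f x + g x)"
proof -
  have [measurable]: "f \<in> borel_measurable M" "g \<in> borel_measurable M"
    using assms by (auto simp: square_integrable_def)
  have "integrable M (\<lambda>x. (cmod (f x + g x))\<^sup>2)"
  proof (rule Bochner_Integration.integrable_bound)
    show "integrable M (\<lambda>x. 2 * (cmod (f x))\<^sup>2 + 2 * (cmod (g x))\<^sup>2)"
      using assms by (simp add: square_integrable_def)
    show "(\<lambda>x. (cmod (f x + g x))\<^sup>2) \<in> borel_measurable M" by measurable
    have "(cmod (f x + g x))\<^sup>2 \<le> 2 * (cmod (f x))\<^sup>2 + 2 * (cmod (g x))\<^sup>2" for x
    proof -
      have "(cmod (f x + g x))\<^sup>2 \<le> (cmod (f x) + cmod (g x))\<^sup>2"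
        by (intro power_mono norm_triangle_ineq) auto
      also have "\<dots> \<le> 2 * (cmod (f x))\<^sup>2 + 2 * (cmod (g x))\<^sup>2"
        using zero_le_power2[of "cmod (f x) - cmod (g x)"] by (simp add: power2_eq_square algebra_simps)
      finally show ?thesis .
    qed
    then show "AE x in M. norm ((cmod (f x + g x))\<^sup>2) \<le> norm (2 * (cmod (f x))\<^sup>2 + 2 * (cmod (g x))\<^sup>2)"
      by (intro always_eventually) auto
  qed
  then show ?thesis by (simp add: square_integrable_def)
qed

lemma square_integrable_cmult:
  "square_integrable M f \<Longrightarrow> square_integrable M (\<lambda>x. c * f x)"
  by (rule square_integrable_dominated[of M f _ "cmod c"])
     (auto simp: square_integrable_def norm_mult intro!: borel_measurable_times)

lemma square_integrable_diff:
  assumes "square_integrable M f" "square_integrable M g"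
  shows "square_integrable M (\<lambda>x. f x - g x)"
  using square_integrable_add[OF assms(1) square_integrable_cmult[OF assms(2), of "-1"]] by simp

lemma square_integrable_zero [simp]: "square_integrable M (\<lambda>_. 0)"
  by (simp add: square_integrable_def)

lemma square_integrable_sum:
  "(\<And>i. i \<in> I \<Longrightarrow> square_integrable M (f i)) \<Longrightarrow> square_integrable M (\<lambda>x. \<Sum>i\<in>I. f i x)"
  by (induction I rule: infinite_finite_induct) (auto intro: square_integrable_add)

lemma square_integrable_bounded_mult:
  assumes "square_integrable M f" "h \<in> borel_measurable M" "AE x in M. cmod (h x) \<le> c"
  shows "square_integrable M (\<lambda>x. h x * f x)"
  using assms(3)
  by (intro square_integrable_dominated[OF assms(1), of _ c] borel_measurable_times assms(2)
        square_integrable_measurable[OF assms(1)])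
     (auto elim!: eventually_mono simp: norm_mult intro!: mult_right_mono)

lemma (in finite_measure) square_integrable_bounded:
  assumes "f \<in> borel_measurable M" "AE x in M. cmod (f x) \<le> c"
  shows "square_integrable M f"
proof -
  have "square_integrable M (\<lambda>_. 1)" by (simp add: square_integrable_def)
  from square_integrable_bounded_mult[OF this assms] show ?thesis by simp
qed

lemma (in finite_measure) square_integrable_indicator:
  "A \<in> sets M \<Longrightarrow> square_integrable M (indicator A)"
  by (rule square_integrable_bounded[of _ 1]) (auto simp: indicator_def)

lemma integrable_cnj_mult:
  assumes "square_integrable M f" "square_integrable M g"
  shows "integrable M (\<lambda>x. cnj (f x) * g x)"
proof (rule Bochner_Integration.integrable_bound)
  have [measurable]: "f \<in> borel_measurable M" "g \<in> borel_measurable M"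
    using assms by (auto simp: square_integrable_def)
  show "integrable M (\<lambda>x. (cmod (f x))\<^sup>2 + (cmod (g x))\<^sup>2)"
    using assms by (simp add: square_integrable_def)
  show "(\<lambda>x. cnj (f x) * g x) \<in> borel_measurable M" by measurable
  have "cmod (f x) * cmod (g x) \<le> (cmod (f x))\<^sup>2 + (cmod (g x))\<^sup>2" for x
  proof -
    have "0 \<le> (cmod (f x) - cmod (g x))\<^sup>2 + (cmod (f x))\<^sup>2 + (cmod (g x))\<^sup>2" by simp
    then show ?thesis by (simp add: power2_eq_square algebra_simps)
  qed
  then show "AE x in M. norm (cnj (f x) * g x) \<le> norm ((cmod (f x))\<^sup>2 + (cmod (g x))\<^sup>2)"
    by (intro always_eventually) (auto simp: norm_mult)
qed

lemma l2ip_add_right: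
  assumes "square_integrable M f" "square_integrable M g" "square_integrable M h"
  shows "l2ip M f (\<lambda>x. g x + h x) = l2ip M f g + l2ip M f h"
  unfolding l2ip_def using integrable_cnj_mult[OF assms(1,2)] integrable_cnj_mult[OF assms(1,3)]
  by (simp add: distrib_left)

lemma l2ip_diff_right:
  assumes "square_integrable M f" "square_integrable M g" "square_integrable M h"
  shows "l2ip M f (\<lambda>x. g x - h x) = l2ip M f g - l2ip M f h"
  unfolding l2ip_def using integrable_cnj_mult[OF assms(1,2)] integrable_cnj_mult[OF assms(1,3)]
  by (simp add: right_diff_distrib)

lemma l2ip_cmult_right: "l2ip M f (\<lambda>x. c * g x) = c * l2ip M f g"
  unfolding l2ip_def by (simp add: mult.left_commute)

lemma l2ip_commute: "l2ip M g f = cnj (l2ip M f g)"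
proof -
  have "cnj (l2ip M f g) = (\<integral>x. cnj (cnj (f x) * g x) \<partial>M)"
    unfolding l2ip_def by (rule Bochner_Integration.integral_cnj[symmetric])
  then show ?thesis by (simp add: l2ip_def mult.commute)
qed

lemma l2ip_diff_left:
  assumes "square_integrable M f" "square_integrable M g" "square_integrable M h"
  shows "l2ip M (\<lambda>x. g x - h x) f = l2ip M g f - l2ip M h f"
  using l2ip_diff_right[OF assms] by (metis complex_cnj_diff l2ip_commute)

lemma l2ip_sum_right:
  assumes "square_integrable M f" "\<And>i. i \<in> I \<Longrightarrow> square_integrable M (g i)"
  shows "l2ip M f (\<lambda>x. \<Sum>i\<in>I. g i x) = (\<Sum>i\<in>I. l2ip M f (g i))"
  unfolding l2ip_def sum_distrib_left
  by (rule Bochner_Integration.integral_sum) (intro integrable_cnj_mult assms)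

lemma l2ip_sum_left:
  assumes "square_integrable M f" "\<And>i. i \<in> I \<Longrightarrow> square_integrable M (g i)"
  shows "l2ip M (\<lambda>x. \<Sum>i\<in>I. g i x) f = (\<Sum>i\<in>I. l2ip M (g i) f)"
proof -
  have "l2ip M (\<lambda>x. \<Sum>i\<in>I. g i x) f = cnj (\<Sum>i\<in>I. l2ip M f (g i))"
    by (subst l2ip_commute, subst l2ip_sum_right) (use assms in auto)
  also have "\<dots> = (\<Sum>i\<in>I. l2ip M (g i) f)"
    unfolding cnj_sum by (intro sum.cong refl, subst l2ip_commute) simp
  finally show ?thesis .
qed

lemma l2ip_cmult_left: "l2ip M (\<lambda>x. c * f x) g = cnj c * l2ip M f g"
  unfolding l2ip_def by (simp add: mult.assoc)

lemma l2ip_self: "l2ip M f f = of_real ((l2norm M f)\<^sup>2)"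
proof -
  have "l2ip M f f = (\<integral>x. complex_of_real ((cmod (f x))\<^sup>2) \<partial>M)"
    unfolding l2ip_def cnj_mult_self ..
  then show ?thesis by (simp add: l2norm_def del: of_real_power)
qed

lemma l2norm_nonneg [simp]: "0 \<le> l2norm M f"
  by (simp add: l2norm_def)

lemma l2norm_cong_AE:
  assumes "f \<in> borel_measurable M" "g \<in> borel_measurable M" "AE x in M. f x = g x"
  shows "l2norm M f = l2norm M g"
proof -
  have "AE x in M. (cmod (f x))\<^sup>2 = (cmod (g x))\<^sup>2" using assms(3) by eventually_elim simp
  then show ?thesis unfolding l2norm_def using assms
    by (intro arg_cong[where f=sqrt] integral_cong_AE) auto
qed

lemma l2ip_cong_AE:
  assumes "f \<in> borel_measurable M" "g \<in> borel_measurable M" "f' \<in> borel_measurable M" "g' \<in> borel_measurable M"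
    and "AE x in M. f x = f' x" "AE x in M. g x = g' x"
  shows "l2ip M f g = l2ip M f' g'"
proof -
  have "AE x in M. cnj (f x) * g x = cnj (f' x) * g' x"
    using assms(5,6) by eventually_elim simp
  moreover have "(\<lambda>x. cnj (f x)) \<in> borel_measurable M" "(\<lambda>x. cnj (f' x)) \<in> borel_measurable M"
    using assms(1,3) by measurable
  ultimately show ?thesis unfolding l2ip_def using assms(1-4)
    by (intro integral_cong_AE borel_measurable_times) auto
qed

lemma l2norm_eq_0_iff:
  assumes "square_integrable M f"
  shows "l2norm M f = 0 \<longleftrightarrow> (AE x in M. f x = 0)"
proof -
  have "(\<integral>x. (cmod (f x))\<^sup>2 \<partial>M) = 0 \<longleftrightarrow> (AE x in M. (cmod (f x))\<^sup>2 = 0)"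
    using assms by (intro integral_nonneg_eq_0_iff_AE) (auto simp: square_integrable_def)
  then show ?thesis by (simp add: l2norm_def)
qed

lemma l2norm_cmult: "l2norm M (\<lambda>x. c * f x) = cmod c * l2norm M f"
  by (simp add: l2norm_def norm_mult power_mult_distrib real_sqrt_mult)

lemma l2norm_minus_commute: "l2norm M (\<lambda>x. f x - g x) = l2norm M (\<lambda>x. g x - f x)"
  by (simp add: l2norm_def norm_minus_commute)

lemma l2ip_Cauchy_Schwarz:
  assumes f: "square_integrable M f" and g: "square_integrable M g"
  shows "cmod (l2ip M f g) \<le> l2norm M f * l2norm M g"
proof (cases "l2norm M f = 0")
  case True
  then have "AE x in M. f x = 0" using f by (simp add: l2norm_eq_0_iff)
  then have "l2ip M f g = l2ip M (\<lambda>_. 0) g"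
    using f g by (intro l2ip_cong_AE) (auto simp: square_integrable_def)
  then show ?thesis by (simp add: l2ip_def)
next
  case False
  define a where "a = l2ip M f g"
  define s where "s = (l2norm M f)\<^sup>2"
  have s: "s > 0" using False l2norm_nonneg[of M f] by (simp add: s_def)
  \<comment> \<open>\<open>c f\<close> is the orthogonal projection of \<open>g\<close> onto
    \<open>f\<close>; the squared norm of \<open>g - c f\<close> is
    \<open>|g|^2 - |a|^2 / s\<close>, and its nonnegativity is the claim.\<close>
  define c where "c = a / of_real s"
  note cf = square_integrable_cmult[OF f, of c]
  note d = square_integrable_diff[OF g cf]
  have "l2ip M (\<lambda>x. g x - c * f x) (\<lambda>x. g x - c * f x)
      = l2ip M g g - c * cnj a - (cnj c * a - cnj c * c * of_real s)"
    by (simp only: l2ip_diff_right[OF d g cf] l2ip_diff_left[OF g g cf] l2ip_diff_left[OF f g cf]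
          l2ip_cmult_left l2ip_cmult_right l2ip_self[of M f] s_def a_def l2ip_commute[of M g f])
       (simp add: algebra_simps)
  also have "\<dots> = of_real ((l2norm M g)\<^sup>2 - (cmod a)\<^sup>2 / s)"
  proof -
    have aa: "cnj a * a = of_real ((cmod a)\<^sup>2)" "a * cnj a = of_real ((cmod a)\<^sup>2)"
      using cnj_mult_self[of a] by (simp_all add: mult.commute)
    have "c * cnj a = of_real ((cmod a)\<^sup>2 / s)" "cnj c * a = of_real ((cmod a)\<^sup>2 / s)"
      using aa by (simp_all add: c_def)
    moreover have "cnj c * c * of_real s = of_real ((cmod a)\<^sup>2 / s)"
      using aa s by (simp add: c_def field_simps)
    ultimately show ?thesis by (simp add: l2ip_self)
  qed
  finally have "of_real ((l2norm M (\<lambda>x. g x - c * f x))\<^sup>2) = complex_of_real ((l2norm M g)\<^sup>2 - (cmod a)\<^sup>2 / s)"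
    by (simp add: l2ip_self)
  then have "0 \<le> (l2norm M g)\<^sup>2 - (cmod a)\<^sup>2 / s" 
    by (metis of_real_eq_iff zero_le_power2)
  then have "(cmod a)\<^sup>2 \<le> (l2norm M f * l2norm M g)\<^sup>2"
    using s by (simp add: field_simps s_def)
  then show ?thesis unfolding a_def by (rule power2_le_imp_le) simp
qed

lemma l2norm_triangle:
  assumes f: "square_integrable M f" and g: "square_integrable M g"
  shows "l2norm M (\<lambda>x. f x + g x) \<le> l2norm M f + l2norm M g"
proof (rule power2_le_imp_le)
  note fg = square_integrable_add[OF f g]
  have "of_real ((l2norm M (\<lambda>x. f x + g x))\<^sup>2) = l2ip M (\<lambda>x. f x + g x) f + l2ip M (\<lambda>x. f x + g x) g"
    using l2ip_add_right[OF fg f g] by (simp add: l2ip_self)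
  also have "\<dots> = cnj (l2ip M f f + l2ip M f g) + cnj (l2ip M g f + l2ip M g g)"
    by (subst (1 2) l2ip_commute) (simp add: l2ip_add_right f g)
  finally have "(l2norm M (\<lambda>x. f x + g x))\<^sup>2 = Re (cnj (l2ip M f f + l2ip M f g) + cnj (l2ip M g f + l2ip M g g))"
    by (metis Re_complex_of_real)
  also have "\<dots> = (l2norm M f)\<^sup>2 + (l2norm M g)\<^sup>2 + 2 * Re (l2ip M f g)"
    by (simp add: l2ip_self l2ip_commute[of M g f])
  also have "\<dots> \<le> (l2norm M f)\<^sup>2 + (l2norm M g)\<^sup>2 + 2 * (l2norm M f * l2norm M g)"
    using l2ip_Cauchy_Schwarz[OF f g] complex_Re_le_cmod[of "l2ip M f g"] by simp
  finally show "(l2norm M (\<lambda>x. f x + g x))\<^sup>2 \<le> (l2norm M f + l2norm M g)\<^sup>2"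
    by (simp add: power2_sum)
qed simp

lemma l2norm_triangle_diff:
  assumes "square_integrable M f" "square_integrable M g" "square_integrable M h"
  shows "l2norm M (\<lambda>x. f x - h x) \<le> l2norm M (\<lambda>x. f x - g x) + l2norm M (\<lambda>x. g x - h x)"
  using l2norm_triangle[OF square_integrable_diff[OF assms(1,2)] square_integrable_diff[OF assms(2,3)]]
  by simp

text \<open>Riesz-Fischer: a rapidly Cauchy subsequence converges almost everywhere, because
  finiteness of the measure turns its \<open>L2\<close> bounds into summable \<open>L1\<close>
  bounds. Fatou's lemma then gives \<open>L2\<close> convergence of the whole sequence.\<close>

lemma (in finite_measure) l2_complete:
  assumes f: "\<And>m. square_integrable M (f m)"
    and Cauchy: "\<And>e. e > 0 \<Longrightarrow> \<exists>N. \<forall>p\<ge>N. \<forall>q\<ge>N. l2norm M (\<lambda>x. f p x - f q x) < e"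
  shows "\<exists>g. square_integrable M g \<and> (\<lambda>m. l2norm M (\<lambda>x. f m x - g x)) \<longlonglongrightarrow> 0"
proof -
  have [measurable]: "f m \<in> borel_measurable M" for m using f by (simp add: square_integrable_def)
  obtain N where N: "\<And>k p q. p \<ge> N k \<Longrightarrow> q \<ge> N k \<Longrightarrow> l2norm M (\<lambda>x. f p x - f q x) < (1/2)^k"
    using Cauchy[of "(1/2)^k" for k] by (metis half_gt_zero_iff zero_less_one zero_less_power)
  \<comment> \<open>Summing the thresholds puts both \<open>r k\<close> and \<open>r (Suc k)\<close>
    beyond \<open>N k\<close>; the added \<open>k\<close> makes \<open>r\<close> unbounded.\<close>
  define r where "r k = (\<Sum>i\<le>k. N i) + k" for k
  have rN: "r k \<ge> N k" for k unfolding r_def by (rule trans_le_add1, rule member_le_sum) auto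
  have rS: "r (Suc k) \<ge> N k" for k using rN[of k] by (simp add: r_def)
  have rk: "r k \<ge> k" for k by (simp add: r_def)
  define d where "d k x = f (r (Suc k)) x - f (r k) x" for k x
  have d_sq: "square_integrable M (d k)" for k unfolding d_def by (intro square_integrable_diff f)
  have [measurable]: "d k \<in> borel_measurable M" for k unfolding d_def by measurable
  define c where "c = l2norm M (\<lambda>_. 1)"
  have one: "square_integrable M (\<lambda>_. 1)" by (simp add: square_integrable_def)
  have int_d: "integrable M (\<lambda>x. cmod (d k x))" for k
    using integrable_norm[OF integrable_cnj_mult[OF one d_sq[of k]]] by simp
  \<comment> \<open>Cauchy-Schwarz against the constant \<open>1\<close>, whose norm
    \<open>c\<close> is finite.\<close>
  have d_le: "(\<integral>x. cmod (d k x) \<partial>M) \<le> c * (1/2)^k" for k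
  proof -
    have n: "square_integrable M (\<lambda>x. of_real (cmod (d k x)))"
      by (rule square_integrable_dominated[OF d_sq, of _ 1]) auto
    have "(\<integral>x. cmod (d k x) \<partial>M) = cmod (l2ip M (\<lambda>_. 1) (\<lambda>x. of_real (cmod (d k x))))"
      by (simp add: l2ip_def abs_of_nonneg integral_nonneg_AE)
    also have "\<dots> \<le> c * l2norm M (\<lambda>x. of_real (cmod (d k x)))"
      unfolding c_def by (rule l2ip_Cauchy_Schwarz[OF one n])
    also have "l2norm M (\<lambda>x. of_real (cmod (d k x))) = l2norm M (d k)" by (simp add: l2norm_def)
    also have "c * l2norm M (d k) \<le> c * (1/2)^k"
      unfolding d_def using N[OF rS rN, of k] by (intro mult_left_mono) (auto simp: c_def)
    finally show ?thesis .
  qed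
  have "(\<integral>\<^sup>+x. (suminf (\<lambda>k. ennreal (cmod (d k x)))) \<partial>M) = (suminf (\<lambda>k. \<integral>\<^sup>+x. ennreal (cmod (d k x)) \<partial>M))"
    by (rule nn_integral_suminf) measurable
  also have "\<dots> = (suminf (\<lambda>k. ennreal (\<integral>x. cmod (d k x) \<partial>M)))"
    by (intro suminf_cong nn_integral_eq_integral int_d) auto
  also have "\<dots> \<le> (suminf (\<lambda>k. ennreal (c * (1/2)^k)))"
    by (intro suminf_le ennreal_leI d_le) auto
  also have "\<dots> = ennreal (suminf (\<lambda>k. c * (1/2)^k))"
    by (rule suminf_ennreal2) (auto simp: c_def intro!: summable_mult summable_geometric)
  finally have "(\<integral>\<^sup>+x. (suminf (\<lambda>k. ennreal (cmod (d k x)))) \<partial>M) \<noteq> \<infinity>" 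
    by (metis ennreal_less_top infinity_ennreal_def leD)
  then have "AE x in M. (suminf (\<lambda>k. ennreal (cmod (d k x)))) \<noteq> \<infinity>"
    by (intro nn_integral_PInf_AE) auto
  then have conv: "AE x in M. convergent (\<lambda>k. f (r k) x)"
  proof eventually_elim
    case (elim x)
    then have "summable (\<lambda>k. cmod (d k x))" by (intro summable_suminf_not_top) auto
    then have "summable (\<lambda>k. d k x)" by (rule summable_norm_cancel)
    then have "convergent (\<lambda>n. \<Sum>k<n. d k x)" by (simp add: summable_iff_convergent)
    moreover have "(\<Sum>k<n. d k x) = f (r n) x - f (r 0) x" for n
      unfolding d_def by (rule sum_lessThan_telescope)
    ultimately have "convergent (\<lambda>n. f (r n) x - f (r 0) x)" by simp
    then have "convergent (\<lambda>n. (f (r n) x - f (r 0) x) + f (r 0) x)" by (intro convergent_add convergent_const)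
    then show ?case by simp
  qed
  define g where "g x = lim (\<lambda>k. f (r k) x)" for x
  have g_meas [measurable]: "g \<in> borel_measurable M" unfolding g_def by measurable
  have lim: "AE x in M. (\<lambda>k. f (r k) x) \<longlonglongrightarrow> g x"
    using conv by eventually_elim (simp add: g_def convergent_LIMSEQ_iff)
  \<comment> \<open>Fatou's lemma along the subsequence: a bound on \<open>f p - f q\<close> for all
    large \<open>q\<close> passes to the limit in \<open>q\<close>.\<close>
  have bound: "(\<integral>\<^sup>+x. ennreal ((cmod (f p x - g x))\<^sup>2) \<partial>M) \<le> ennreal (e\<^sup>2)"
    if p: "\<forall>q\<ge>n. l2norm M (\<lambda>x. f p x - f q x) < e" for p n and e :: real
  proof -
    have "(\<integral>\<^sup>+x. ennreal ((cmod (f p x - g x))\<^sup>2) \<partial>M)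
        = (\<integral>\<^sup>+x. liminf (\<lambda>k. ennreal ((cmod (f p x - f (r k) x))\<^sup>2)) \<partial>M)"
    proof (rule nn_integral_cong_AE)
      show "AE x in M. ennreal ((cmod (f p x - g x))\<^sup>2) = liminf (\<lambda>k. ennreal ((cmod (f p x - f (r k) x))\<^sup>2))"
        using lim
      proof eventually_elim
        case (elim x)
        then have "(\<lambda>k. ennreal ((cmod (f p x - f (r k) x))\<^sup>2)) \<longlonglongrightarrow> ennreal ((cmod (f p x - g x))\<^sup>2)"
          by (intro tendsto_intros)
        then show ?case using lim_imp_Liminf trivial_limit_sequentially by metis
      qed
    qed
    also have "\<dots> \<le> liminf (\<lambda>k. \<integral>\<^sup>+x. ennreal ((cmod (f p x - f (r k) x))\<^sup>2) \<partial>M)"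
      by (rule nn_integral_liminf) measurable
    also have "\<dots> \<le> liminf (\<lambda>k::nat. ennreal (e\<^sup>2))"
    proof (rule Liminf_mono)
      have ev: "\<forall>\<^sub>F k in sequentially. l2norm M (\<lambda>x. f p x - f (r k) x) \<le> e"
        using p rk by (intro eventually_sequentiallyI[of n]) (meson less_imp_le order_trans)
      show "\<forall>\<^sub>F k in sequentially. (\<integral>\<^sup>+x. ennreal ((cmod (f p x - f (r k) x))\<^sup>2) \<partial>M) \<le> ennreal (e\<^sup>2)"
        using ev
      proof eventually_elim
        case (elim k)
        have "integrable M (\<lambda>x. (cmod (f p x - f (r k) x))\<^sup>2)"
          using square_integrable_diff[OF f[of p] f[of "r k"]] by (simp add: square_integrable_def)
        then have "(\<integral>\<^sup>+x. ennreal ((cmod (f p x - f (r k) x))\<^sup>2) \<partial>M) = ennreal ((l2norm M (\<lambda>x. f p x - f (r k) x))\<^sup>2)"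
          by (subst nn_integral_eq_integral) (auto simp: l2norm_def)
        then show ?case using elim by (simp add: power_mono)
      qed
    qed
    also have "\<dots> = ennreal (e\<^sup>2)" by (simp add: Liminf_const)
    finally show ?thesis .
  qed
  have diff: "square_integrable M (\<lambda>x. f p x - g x) \<and> l2norm M (\<lambda>x. f p x - g x) \<le> e"
    if p: "\<forall>q\<ge>n. l2norm M (\<lambda>x. f p x - f q x) < e" "e > 0" for p n e
  proof -
    note b = bound[OF p(1)]
    have "integrable M (\<lambda>x. (cmod (f p x - g x))\<^sup>2)"
      using b by (intro integrableI_nonneg) (auto simp: ennreal_less_top order.strict_trans1)
    moreover from this have "(\<integral>x. (cmod (f p x - g x))\<^sup>2 \<partial>M) \<le> e\<^sup>2"
      using b by (subst (asm) nn_integral_eq_integral) (auto simp: ennreal_le_iff)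
    then have "l2norm M (\<lambda>x. f p x - g x) \<le> e"
      unfolding l2norm_def using p(2) by (intro real_le_lsqrt) auto
    ultimately show ?thesis by (simp add: square_integrable_def)
  qed
  obtain n1 where n1: "\<forall>p\<ge>n1. \<forall>q\<ge>n1. l2norm M (\<lambda>x. f p x - f q x) < 1" using Cauchy[of 1] by auto
  have "square_integrable M (\<lambda>x. f n1 x - g x)" using diff[of n1 n1 1] n1 by simp
  from square_integrable_diff[OF f[of n1] this] have g: "square_integrable M g" by simp
  have "(\<lambda>m. l2norm M (\<lambda>x. f m x - g x)) \<longlonglongrightarrow> 0"
  proof (rule LIMSEQ_I)
    fix e :: real assume "e > 0"
    then obtain n where n: "\<forall>p\<ge>n. \<forall>q\<ge>n. l2norm M (\<lambda>x. f p x - f q x) < e/2" using Cauchy[of "e/2"] by auto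
    have "norm (l2norm M (\<lambda>x. f m x - g x) - 0) < e" if "m \<ge> n" for m
      using diff[of n m "e/2"] n that \<open>e > 0\<close> by simp
    then show "\<exists>no. \<forall>m\<ge>no. norm (l2norm M (\<lambda>x. f m x - g x) - 0) < e" by blast
  qed
  with g show ?thesis by blast
qed

lemma l2_dominated_convergence:
  assumes "\<And>m. f m \<in> borel_measurable M" "g \<in> borel_measurable M" "square_integrable M w"
    and "AE x in M. (\<lambda>m. f m x) \<longlonglongrightarrow> g x"
    and "\<And>m. AE x in M. cmod (f m x - g x) \<le> cmod (w x)"
  shows "(\<lambda>m. l2norm M (\<lambda>x. f m x - g x)) \<longlonglongrightarrow> 0"
proof -
  have "(\<lambda>m. \<integral>x. (cmod (f m x - g x))\<^sup>2 \<partial>M) \<longlonglongrightarrow> (\<integral>x. 0 \<partial>M)"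
  proof (rule integral_dominated_convergence)
    show "integrable M (\<lambda>x. (cmod (w x))\<^sup>2)" using assms(3) by (simp add: square_integrable_def)
    show "AE x in M. (\<lambda>m. (cmod (f m x - g x))\<^sup>2) \<longlonglongrightarrow> 0"
      using assms(4)
    proof eventually_elim
      case (elim x)
      then have "(\<lambda>m. (cmod (f m x - g x))\<^sup>2) \<longlonglongrightarrow> (cmod (g x - g x))\<^sup>2" by (intro tendsto_intros)
      then show ?case by simp
    qed
    show "AE x in M. norm ((cmod (f m x - g x))\<^sup>2) \<le> (cmod (w x))\<^sup>2" for m
      using assms(5)[of m] by eventually_elim (auto intro: power_mono)
  qed (use assms(1,2) in measurable)
  then have "(\<lambda>m. sqrt (\<integral>x. (cmod (f m x - g x))\<^sup>2 \<partial>M)) \<longlonglongrightarrow> sqrt 0" by (intro tendsto_real_sqrt) simp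
  then show ?thesis by (simp add: l2norm_def)
qed

lemma l2ip_tendsto:
  assumes f: "\<And>m. square_integrable M (f m)" "square_integrable M F"
    and g: "\<And>m. square_integrable M (g m)" "square_integrable M G"
    and lim: "(\<lambda>m. l2norm M (\<lambda>x. f m x - F x)) \<longlonglongrightarrow> 0" "(\<lambda>m. l2norm M (\<lambda>x. g m x - G x)) \<longlonglongrightarrow> 0"
  shows "(\<lambda>m. l2ip M (f m) (g m)) \<longlonglongrightarrow> l2ip M F G"
proof -
  \<comment> \<open>Expanding around the limits, the difference of the inner products becomes three
    terms, each containing a factor whose norm tends to zero.\<close>
  let ?df = "\<lambda>m x. f m x - F x" and ?dg = "\<lambda>m x. g m x - G x"
  have eq: "l2ip M (f m) (g m) - l2ip M F G = l2ip M (?df m) (?dg m) + l2ip M (?df m) G + l2ip M F (?dg m)" for m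
  proof -
    have "l2ip M (?df m) (?dg m) = l2ip M (?df m) (g m) - l2ip M (?df m) G"
      by (rule l2ip_diff_right[OF square_integrable_diff[OF f(1) f(2)] g(1) g(2)])
    moreover have "l2ip M F (?dg m) = l2ip M F (g m) - l2ip M F G"
      by (rule l2ip_diff_right[OF f(2) g(1) g(2)])
    moreover have "l2ip M (?df m) (g m) = l2ip M (f m) (g m) - l2ip M F (g m)"
      by (rule l2ip_diff_left[OF g(1) f(1) f(2)])
    ultimately show ?thesis by simp
  qed
  let ?B = "\<lambda>m. l2norm M (?df m) * l2norm M (?dg m) + l2norm M (?df m) * l2norm M G + l2norm M F * l2norm M (?dg m)"
  have b: "cmod (l2ip M (f m) (g m) - l2ip M F G) \<le> ?B m" for m
  proof -
    have "cmod (l2ip M (f m) (g m) - l2ip M F G)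
        \<le> cmod (l2ip M (?df m) (?dg m)) + cmod (l2ip M (?df m) G) + cmod (l2ip M F (?dg m))"
      unfolding eq by (rule order_trans[OF norm_triangle_ineq add_right_mono[OF norm_triangle_ineq]])
    also have "\<dots> \<le> ?B m"
      by (intro add_mono l2ip_Cauchy_Schwarz square_integrable_diff f g)
    finally show ?thesis .
  qed
  have "?B \<longlonglongrightarrow> 0 * 0 + 0 * l2norm M G + l2norm M F * 0"
    by (rule tendsto_add tendsto_mult tendsto_const lim)+
  then have "?B \<longlonglongrightarrow> 0" by simp
  then have "(\<lambda>m. l2ip M (f m) (g m) - l2ip M F G) \<longlonglongrightarrow> 0"
    by (rule Lim_null_comparison[rotated]) (use b in \<open>intro always_eventually allI\<close>)
  then show ?thesis by (rule LIM_zero_cancel)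
qed

subsection \<open>Finite linear combinations and total families\<close>

text \<open>The coefficients have the type used in \<open>tensor_combination\<close>, so that one
  finitely supported map can be read both as a form and as a function.\<close>

definition comb :: "('l \<Rightarrow> 'x \<Rightarrow> complex) \<Rightarrow> ('l \<Rightarrow>\<^sub>0 complex) \<Rightarrow> 'x \<Rightarrow> complex" where
  "comb u p = (\<lambda>x. \<Sum>y\<in>Poly_Mapping.keys p. Poly_Mapping.lookup p y * u y x)"

lemma comb_superset:
  assumes "finite S" "Poly_Mapping.keys p \<subseteq> S"
  shows "comb u p x = (\<Sum>y\<in>S. Poly_Mapping.lookup p y * u y x)"
  unfolding comb_def using assms
  by (intro sum.mono_neutral_left) (auto simp: in_keys_iff)

lemma comb_diff: "comb u (p - q) x = comb u p x - comb u q x"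
proof -
  let ?S = "Poly_Mapping.keys p \<union> Poly_Mapping.keys q"
  have "Poly_Mapping.keys (p - q) \<subseteq> ?S" by (rule keys_diff)
  then show ?thesis
    by (simp add: comb_superset[of ?S] lookup_minus left_diff_distrib sum_subtractf)
qed

lemma comb_add: "comb u (p + q) x = comb u p x + comb u q x"
proof -
  let ?S = "Poly_Mapping.keys p \<union> Poly_Mapping.keys q"
  have "Poly_Mapping.keys (p + q) \<subseteq> ?S" by (rule Poly_Mapping.keys_add)
  then show ?thesis
    by (simp add: comb_superset[of ?S] lookup_add distrib_right sum.distrib)
qed

lemma lookup_map_times: "Poly_Mapping.lookup (Poly_Mapping.map ((*) c) p) y = c * Poly_Mapping.lookup p y"
  for p :: "'l \<Rightarrow>\<^sub>0 complex"
  by (simp add: Poly_Mapping.map.rep_eq when_def)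

lemma keys_map_times: "Poly_Mapping.keys (Poly_Mapping.map ((*) c) p) \<subseteq> Poly_Mapping.keys p"
  for p :: "'l \<Rightarrow>\<^sub>0 complex"
  by (auto simp: in_keys_iff lookup_map_times)

lemma comb_cmult: "comb u (Poly_Mapping.map ((*) c) p) x = c * comb u p x"
  unfolding comb_superset[OF finite_keys keys_map_times]
  by (simp add: comb_def lookup_map_times sum_distrib_left mult.assoc)

lemma comb_single: "comb u (Poly_Mapping.single a c) x = c * u a x"
  by (simp add: comb_def)

lemma square_integrable_comb:
  assumes "\<And>y. y \<in> Poly_Mapping.keys p \<Longrightarrow> square_integrable M (u y)"
  shows "square_integrable M (comb u p)"
  unfolding comb_def by (intro square_integrable_sum square_integrable_cmult assms)

text \<open>This is the closed linear span of the family in \<open>L2\<close>, kept at the level of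
  functions so that representatives of classes do not intervene.\<close>

definition l2_span :: "'x measure \<Rightarrow> 'l set \<Rightarrow> ('l \<Rightarrow> 'x \<Rightarrow> complex) \<Rightarrow> ('x \<Rightarrow> complex) set" where
  "l2_span M \<Lambda> u = {f. square_integrable M f \<and>
     (\<forall>e>0. \<exists>p. Poly_Mapping.keys p \<subseteq> \<Lambda> \<and> l2norm M (\<lambda>x. f x - comb u p x) < e)}"

definition l2_total :: "'x measure \<Rightarrow> 'l set \<Rightarrow> ('l \<Rightarrow> 'x \<Rightarrow> complex) \<Rightarrow> bool" where
  "l2_total M \<Lambda> u \<longleftrightarrow> (\<forall>a\<in>\<Lambda>. square_integrable M (u a)) \<and> (\<forall>f. square_integrable M f \<longrightarrow> f \<in> l2_span M \<Lambda> u)"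

lemma l2_spanE:
  assumes "f \<in> l2_span M \<Lambda> u" "e > 0"
  obtains p where "Poly_Mapping.keys p \<subseteq> \<Lambda>" "l2norm M (\<lambda>x. f x - comb u p x) < e"
  using assms unfolding l2_span_def by auto

lemma l2_span_sq: "f \<in> l2_span M \<Lambda> u \<Longrightarrow> square_integrable M f"
  by (simp add: l2_span_def)

context
  fixes M :: "'x measure" and \<Lambda> :: "'l set" and u :: "'l \<Rightarrow> 'x \<Rightarrow> complex"
  assumes u: "\<And>a. a \<in> \<Lambda> \<Longrightarrow> square_integrable M (u a)"
begin

lemma l2_span_base: "a \<in> \<Lambda> \<Longrightarrow> u a \<in> l2_span M \<Lambda> u"
proof -
  assume a: "a \<in> \<Lambda>"
  have "l2norm M (\<lambda>x. u a x - comb u (Poly_Mapping.single a 1) x) = 0"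
    by (simp add: comb_single l2norm_def)
  then show ?thesis using a u[OF a]
    unfolding l2_span_def by (auto intro!: exI[of _ "Poly_Mapping.single a 1"])
qed

lemma l2_span_limit:
  assumes "\<And>m. f m \<in> l2_span M \<Lambda> u" "square_integrable M g"
    and "(\<lambda>m. l2norm M (\<lambda>x. f m x - g x)) \<longlonglongrightarrow> 0"
  shows "g \<in> l2_span M \<Lambda> u"
proof -
  have "\<exists>p. Poly_Mapping.keys p \<subseteq> \<Lambda> \<and> l2norm M (\<lambda>x. g x - comb u p x) < e" if "e > 0" for e
  proof -
    from assms(3) \<open>e > 0\<close> have "\<forall>\<^sub>F m in sequentially. l2norm M (\<lambda>x. f m x - g x) < e/2"
      by (intro order_tendstoD(2)[of _ 0]) auto
    then obtain m where m: "l2norm M (\<lambda>x. f m x - g x) < e/2" by (auto simp: eventually_sequentially)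
    obtain p where p: "Poly_Mapping.keys p \<subseteq> \<Lambda>" "l2norm M (\<lambda>x. f m x - comb u p x) < e/2"
      using l2_spanE[OF assms(1)[of m] half_gt_zero[OF \<open>e > 0\<close>]] .
    have "square_integrable M (comb u p)" using p(1) u by (intro square_integrable_comb) auto
    from l2norm_triangle_diff[OF assms(2) l2_span_sq[OF assms(1)] this, of m] m p(2)
    have "l2norm M (\<lambda>x. g x - comb u p x) < e" by (simp add: l2norm_minus_commute)
    with p(1) show ?thesis by blast
  qed
  with assms(2) show ?thesis by (simp add: l2_span_def)
qed

lemma l2_span_cong_AE:
  assumes "f \<in> l2_span M \<Lambda> u" "g \<in> borel_measurable M" "AE x in M. g x = f x"
  shows "g \<in> l2_span M \<Lambda> u"
proof (rule l2_span_limit[where f="\<lambda>_. f"])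
  show g: "square_integrable M g" using l2_span_sq[OF assms(1)] assms(2,3) by (rule square_integrable_cong_AE)
  have "l2norm M (\<lambda>x. f x - g x) = 0"
    using l2_span_sq[OF assms(1)] g assms(3) by (subst l2norm_eq_0_iff) (auto intro: square_integrable_diff)
  then show "(\<lambda>m::nat. l2norm M (\<lambda>x. f x - g x)) \<longlonglongrightarrow> 0" by simp
qed (fact assms)

lemma l2_span_add:
  assumes f: "f \<in> l2_span M \<Lambda> u" and g: "g \<in> l2_span M \<Lambda> u"
  shows "(\<lambda>x. f x + g x) \<in> l2_span M \<Lambda> u"
proof -
  have "\<exists>p. Poly_Mapping.keys p \<subseteq> \<Lambda> \<and> l2norm M (\<lambda>x. (f x + g x) - comb u p x) < e" if "e > 0" for e
  proof -
    obtain p where p: "Poly_Mapping.keys p \<subseteq> \<Lambda>" "l2norm M (\<lambda>x. f x - comb u p x) < e/2"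
      using l2_spanE[OF f half_gt_zero[OF \<open>e > 0\<close>]] .
    obtain q where q: "Poly_Mapping.keys q \<subseteq> \<Lambda>" "l2norm M (\<lambda>x. g x - comb u q x) < e/2"
      using l2_spanE[OF g half_gt_zero[OF \<open>e > 0\<close>]] .
    have "square_integrable M (comb u p)" "square_integrable M (comb u q)"
      using p(1) q(1) u by (auto intro!: square_integrable_comb)
    from l2norm_triangle[OF square_integrable_diff[OF l2_span_sq[OF f] this(1)]
        square_integrable_diff[OF l2_span_sq[OF g] this(2)]] p q
    have "l2norm M (\<lambda>x. (f x + g x) - comb u (p + q) x) < e"
      by (simp add: comb_add algebra_simps)
    moreover have "Poly_Mapping.keys (p + q) \<subseteq> \<Lambda>" using p(1) q(1) Poly_Mapping.keys_add[of p q] by blast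
    ultimately show ?thesis by blast
  qed
  then show ?thesis using l2_span_sq[OF f] l2_span_sq[OF g] by (simp add: l2_span_def square_integrable_add)
qed

lemma l2_span_zero: "(\<lambda>_. 0) \<in> l2_span M \<Lambda> u"
  unfolding l2_span_def by (auto simp: l2norm_def comb_def intro!: exI[of _ 0])

lemma l2_span_cmult:
  assumes f: "f \<in> l2_span M \<Lambda> u"
  shows "(\<lambda>x. c * f x) \<in> l2_span M \<Lambda> u"
proof (cases "c = 0")
  case False
  have "\<exists>p. Poly_Mapping.keys p \<subseteq> \<Lambda> \<and> l2norm M (\<lambda>x. c * f x - comb u p x) < e" if "e > 0" for e
  proof -
    have "e / cmod c > 0" using that False by simp
    with f obtain p where p: "Poly_Mapping.keys p \<subseteq> \<Lambda>" "l2norm M (\<lambda>x. f x - comb u p x) < e / cmod c"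
      unfolding l2_span_def by blast
    have "l2norm M (\<lambda>x. c * f x - comb u (Poly_Mapping.map ((*) c) p) x) = cmod c * l2norm M (\<lambda>x. f x - comb u p x)"
      by (simp add: comb_cmult flip: l2norm_cmult right_diff_distrib)
    also have "\<dots> < e" using p(2) False by (simp add: pos_less_divide_eq mult.commute)
    finally show ?thesis using p(1) keys_map_times[of c p] by blast
  qed
  then show ?thesis using l2_span_sq[OF f] by (simp add: l2_span_def square_integrable_cmult)
qed (simp add: l2_span_zero)

lemma l2_span_diff:
  assumes "f \<in> l2_span M \<Lambda> u" "g \<in> l2_span M \<Lambda> u"
  shows "(\<lambda>x. f x - g x) \<in> l2_span M \<Lambda> u"
  using l2_span_add[OF assms(1) l2_span_cmult[OF assms(2), of "-1"]] by simp

lemma l2_span_sum: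
  "(\<And>i. i \<in> I \<Longrightarrow> f i \<in> l2_span M \<Lambda> u) \<Longrightarrow> (\<lambda>x. \<Sum>i\<in>I. f i x) \<in> l2_span M \<Lambda> u"
  by (induction I rule: infinite_finite_induct) (auto intro: l2_span_add l2_span_zero)

text \<open>The sets whose indicators lie in the span form a Dynkin system, hence include everything
  generated by the intersection-stable \<open>P\<close>; simple functions and dominated convergence
  do the rest. The whole space is a separate premise because complements are taken relative to it,
  and it may lie outside \<open>P\<close>.\<close>

lemma l2_totalI:
  assumes M: "finite_measure M"
    and gen: "sets M = sigma_sets (space M) P" "Int_stable P" "P \<subseteq> Pow (space M)"
    and ind: "\<And>A. A \<in> P \<Longrightarrow> indicator A \<in> l2_span M \<Lambda> u" "indicator (space M) \<in> l2_span M \<Lambda> u"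
  shows "l2_total M \<Lambda> u"
proof -
  interpret finite_measure M by fact
  have one: "square_integrable M (\<lambda>_. 1)" by (simp add: square_integrable_def)
  have I: "indicator A \<in> l2_span M \<Lambda> u" if "A \<in> sigma_sets (space M) P" for A
    using gen(2,3) that
  proof (induction rule: sigma_sets_induct_disjoint)
    case (basic A) then show ?case by (rule ind)
  next
    case empty show ?case using l2_span_zero by (simp add: indicator_def)
  next
    case (compl A)
    have "(\<lambda>x. indicator (space M) x - indicator A x) \<in> l2_span M \<Lambda> u"
      by (intro l2_span_diff ind compl)
    moreover have "A \<subseteq> space M" using compl(1) gen(3) by (meson sigma_sets_into_sp)
    then have "(\<lambda>x. indicator (space M) x - indicator A x) = (indicator (space M - A) :: 'x \<Rightarrow> complex)"
      by (auto simp: fun_eq_iff indicator_def)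
    ultimately show ?case by simp
  next
    case (union A)
    have Am [measurable]: "A i \<in> sets M" for i using union(2) gen(1) by auto
    show ?case
    proof (rule l2_span_limit)
      show "(\<lambda>x. \<Sum>i<m. indicator (A i) x) \<in> l2_span M \<Lambda> u" for m
        by (intro l2_span_sum union)
      show "square_integrable M (indicator (\<Union> (range A)))" by (intro square_integrable_indicator) auto
      show "(\<lambda>m. l2norm M (\<lambda>x. (\<Sum>i<m. indicator (A i) x) - indicator (\<Union> (range A)) x)) \<longlonglongrightarrow> 0"
      proof (rule l2_dominated_convergence[OF _ _ one])
        have eq: "(\<Sum>i<m. indicator (A i) x) = (indicator (\<Union>i<m. A i) x :: complex)" for m x
          by (subst indicator_UN_disjoint)
             (use union(1) in \<open>auto simp: disjoint_family_on_def\<close>)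
        show "AE x in M. (\<lambda>m. \<Sum>i<m. indicator (A i) x :: complex) \<longlonglongrightarrow> indicator (\<Union> (range A)) x"
          unfolding eq by (intro always_eventually allI LIMSEQ_indicator_UN)
        show "AE x in M. cmod ((\<Sum>i<m. indicator (A i) x) - indicator (\<Union> (range A)) x) \<le> cmod 1" for m
          unfolding eq by (intro always_eventually) (auto simp: indicator_def)
      qed measurable
    qed
  qed
  have "f \<in> l2_span M \<Lambda> u" if f: "square_integrable M f" for f
  proof -
    have [measurable]: "f \<in> borel_measurable M" using f by (simp add: square_integrable_def)
    obtain s where s: "\<And>i. simple_function M (s i)" "\<And>x. x \<in> space M \<Longrightarrow> (\<lambda>i. s i x) \<longlonglongrightarrow> f x"
      "\<And>i x. x \<in> space M \<Longrightarrow> norm (s i x) \<le> 2 * norm (f x)"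
      using borel_measurable_implies_sequence_metric[OF \<open>f \<in> borel_measurable M\<close>, of 0] unfolding norm_conv_dist by blast
    have sm: "s i \<in> borel_measurable M" for i using s(1) by (rule borel_measurable_simple_function)
    have simple: "s i \<in> l2_span M \<Lambda> u" for i
    proof (rule l2_span_cong_AE)
      have fin: "finite (s i ` space M)" using s(1) by (rule simple_functionD)
      have ms: "s i -` {v} \<inter> space M \<in> sets M" for v using s(1) by (rule simple_functionD)
      show "(\<lambda>x. \<Sum>v\<in>s i ` space M. v * indicator (s i -` {v} \<inter> space M) x) \<in> l2_span M \<Lambda> u"
        using ms by (intro l2_span_sum l2_span_cmult I) (auto simp: gen(1))
      have "s i x = (\<Sum>v\<in>s i ` space M. v * indicator (s i -` {v} \<inter> space M) x)" if "x \<in> space M" for x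
      proof -
        have "(\<Sum>v\<in>s i ` space M. v * indicator (s i -` {v} \<inter> space M) x) = (\<Sum>v\<in>s i ` space M. if v = s i x then v else 0)"
          using that by (intro sum.cong) (auto simp: indicator_def)
        also have "\<dots> = s i x" using fin that by simp
        finally show ?thesis by simp
      qed
      then show "AE x in M. s i x = (\<Sum>v\<in>s i ` space M. v * indicator (s i -` {v} \<inter> space M) x)" by (intro AE_I2)
    qed (fact sm)
    show ?thesis
    proof (rule l2_span_limit[OF simple f])
      show "(\<lambda>m. l2norm M (\<lambda>x. s m x - f x)) \<longlonglongrightarrow> 0"
      proof (rule l2_dominated_convergence[OF sm _ square_integrable_cmult[OF f, of 3]])
        have "cmod (s m x - f x) \<le> 3 * cmod (f x)" if "x \<in> space M" for m x
          using norm_triangle_ineq4[of "s m x" "f x"] s(3)[OF that, of m] by simp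
        then show "AE x in M. cmod (s m x - f x) \<le> cmod (3 * f x)" for m by (auto simp: norm_mult)
        show "AE x in M. (\<lambda>m. s m x) \<longlonglongrightarrow> f x" using s(2) by auto
      qed measurable
    qed
  qed
  then show ?thesis using u by (simp add: l2_total_def)
qed

end

section \<open>The Hilbert space of square-integrable functions\<close>

lemma ae_class_eq_iff:
  assumes "f \<in> borel_measurable M" "g \<in> borel_measurable M"
  shows "ae_class M f = ae_class M g \<longleftrightarrow> (AE x in M. f x = g x)"
proof
  assume "ae_class M f = ae_class M g"
  moreover have "f \<in> ae_class M f" using assms by (simp add: ae_class_def)
  ultimately have "f \<in> ae_class M g" by simp
  then show "AE x in M. f x = g x" by (simp add: ae_class_def)
next
  assume ae: "AE x in M. f x = g x"
  have "(AE x in M. h x = f x) \<longleftrightarrow> (AE x in M. h x = g x)" for h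
  proof
    assume "AE x in M. h x = f x" then show "AE x in M. h x = g x" using ae by eventually_elim simp
  next
    assume "AE x in M. h x = g x" then show "AE x in M. h x = f x" using ae by eventually_elim simp
  qed
  then show "ae_class M f = ae_class M g" by (simp add: ae_class_def)
qed

lemma rep_ae_class:
  assumes "f \<in> borel_measurable M"
  shows "rep (ae_class M f) \<in> borel_measurable M" "AE x in M. rep (ae_class M f) x = f x"
proof -
  have "f \<in> ae_class M f" using assms by (simp add: ae_class_def)
  then have "rep (ae_class M f) \<in> ae_class M f" by (auto simp: rep_def some_in_eq)
  then show "rep (ae_class M f) \<in> borel_measurable M" "AE x in M. rep (ae_class M f) x = f x"
    by (auto simp: ae_class_def)
qed

lemma L2_carrierI: "square_integrable M f \<Longrightarrow> ae_class M f \<in> carrier (L2 M)"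
  by (simp add: L2_def)

lemma L2_carrierE:
  assumes "A \<in> carrier (L2 M)"
  obtains f where "square_integrable M f" "A = ae_class M f"
  using assms by (auto simp: L2_def)

lemma square_integrable_rep_ae_class:
  "square_integrable M f \<Longrightarrow> square_integrable M (rep (ae_class M f))"
  by (rule square_integrable_cong_AE[OF _ rep_ae_class]) (simp_all add: square_integrable_measurable)

lemma square_integrable_rep: "A \<in> carrier (L2 M) \<Longrightarrow> square_integrable M (rep A)"
  by (elim L2_carrierE) (simp add: square_integrable_rep_ae_class)

lemma ae_class_rep: "A \<in> carrier (L2 M) \<Longrightarrow> ae_class M (rep A) = A"
  by (elim L2_carrierE) (simp add: ae_class_eq_iff rep_ae_class square_integrable_measurable)

lemma ae_class_cong:
  assumes "f \<in> borel_measurable M" "g \<in> borel_measurable M" "AE x in M. f x = g x"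
  shows "ae_class M f = ae_class M g"
  using assms by (simp add: ae_class_eq_iff)

lemma ip_L2: "ip (L2 M) A B = l2ip M (rep A) (rep B)"
  by (simp add: L2_def l2ip_def)

lemma ip_L2_class:
  assumes "square_integrable M f" "square_integrable M g"
  shows "ip (L2 M) (ae_class M f) (ae_class M g) = l2ip M f g"
  unfolding ip_L2 using assms
  by (intro l2ip_cong_AE rep_ae_class square_integrable_measurable)

lemma add_L2: "A \<oplus>\<^bsub>L2 M\<^esub> B = ae_class M (\<lambda>x. rep A x + rep B x)"
  by (simp add: L2_def)

lemma smult_L2: "c \<odot>\<^bsub>L2 M\<^esub> A = ae_class M (\<lambda>x. c * rep A x)"
  by (simp add: L2_def)

lemma zero_L2: "\<zero>\<^bsub>L2 M\<^esub> = ae_class M (\<lambda>_. 0)"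
  by (simp add: L2_def)

lemma add_L2_class:
  assumes "f \<in> borel_measurable M" "g \<in> borel_measurable M"
  shows "ae_class M f \<oplus>\<^bsub>L2 M\<^esub> ae_class M g = ae_class M (\<lambda>x. f x + g x)"
proof -
  have "AE x in M. rep (ae_class M f) x + rep (ae_class M g) x = f x + g x"
    using rep_ae_class(2)[OF assms(1)] rep_ae_class(2)[OF assms(2)] by eventually_elim simp
  then show ?thesis
    unfolding add_L2 using assms by (intro ae_class_cong borel_measurable_add rep_ae_class)
qed

lemma smult_L2_class:
  assumes "f \<in> borel_measurable M"
  shows "c \<odot>\<^bsub>L2 M\<^esub> ae_class M f = ae_class M (\<lambda>x. c * f x)"
proof -
  have "AE x in M. c * rep (ae_class M f) x = c * f x"
    using rep_ae_class(2)[OF assms(1)] by eventually_elim simp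
  then show ?thesis
    unfolding smult_L2 using assms by (intro ae_class_cong borel_measurable_times rep_ae_class) auto
qed

lemma L2_add_closed: "A \<in> carrier (L2 M) \<Longrightarrow> B \<in> carrier (L2 M) \<Longrightarrow> A \<oplus>\<^bsub>L2 M\<^esub> B \<in> carrier (L2 M)"
  unfolding add_L2 by (intro L2_carrierI square_integrable_add square_integrable_rep)

lemma L2_smult_closed: "A \<in> carrier (L2 M) \<Longrightarrow> c \<odot>\<^bsub>L2 M\<^esub> A \<in> carrier (L2 M)"
  unfolding smult_L2 by (intro L2_carrierI square_integrable_cmult square_integrable_rep)

lemma unitary_mapI:
  assumes "bij_betw U (carrier H) (carrier K)"
    and "\<And>x y. x \<in> carrier H \<Longrightarrow> y \<in> carrier H \<Longrightarrow> U (x \<oplus>\<^bsub>H\<^esub> y) = U x \<oplus>\<^bsub>K\<^esub> U y"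
    and "\<And>c x. x \<in> carrier H \<Longrightarrow> U (c \<odot>\<^bsub>H\<^esub> x) = c \<odot>\<^bsub>K\<^esub> U x"
    and "\<And>x y. x \<in> carrier H \<Longrightarrow> y \<in> carrier H \<Longrightarrow> ip K (U x) (U y) = ip H x y"
  shows "unitary_map H K U"
  using assms by (simp add: unitary_map_def)

lemma unitary_mapD:
  assumes "unitary_map H K U"
  shows "bij_betw U (carrier H) (carrier K)"
    and "\<And>x y. x \<in> carrier H \<Longrightarrow> y \<in> carrier H \<Longrightarrow> U (x \<oplus>\<^bsub>H\<^esub> y) = U x \<oplus>\<^bsub>K\<^esub> U y"
    and "\<And>c x. x \<in> carrier H \<Longrightarrow> U (c \<odot>\<^bsub>H\<^esub> x) = c \<odot>\<^bsub>K\<^esub> U x"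
    and "\<And>x y. x \<in> carrier H \<Longrightarrow> y \<in> carrier H \<Longrightarrow> ip K (U x) (U y) = ip H x y"
    and "\<And>x. x \<in> carrier H \<Longrightarrow> U x \<in> carrier K"
  using assms by (auto simp: unitary_map_def bij_betw_apply)

lemma unitary_map_comp:
  assumes "unitary_map H K U" "unitary_map K L V"
  shows "unitary_map H L (\<lambda>x. V (U x))"
  by (rule unitary_mapI)
     (simp_all add: unitary_mapD[OF assms(1)] unitary_mapD[OF assms(2)]
        bij_betw_comp_iff[OF unitary_mapD(1)[OF assms(1)], of V, unfolded o_def, THEN iffD1])

text \<open>\<open>unitary_map\<close> relates the operations of the two spaces without asserting
  that they stay inside the carriers. The closure premises allow \<open>U\<close> to be cancelled at
  a sum or a multiple of preimages.\<close>

lemma unitary_map_inv_into: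
  assumes U: "unitary_map H K U"
    and closed: "\<And>x y. x \<in> carrier H \<Longrightarrow> y \<in> carrier H \<Longrightarrow> x \<oplus>\<^bsub>H\<^esub> y \<in> carrier H"
      "\<And>c x. x \<in> carrier H \<Longrightarrow> c \<odot>\<^bsub>H\<^esub> x \<in> carrier H"
  shows "unitary_map K H (inv_into (carrier H) U)"
proof -
  note bij = unitary_mapD(1)[OF U]
  let ?V = "inv_into (carrier H) U"
  have V: "?V y \<in> carrier H" "U (?V y) = y" if "y \<in> carrier K" for y
    using that bij by (auto simp: bij_betw_def inv_into_into f_inv_into_f)
  have VU: "?V (U x) = x" if "x \<in> carrier H" for x
    using that bij by (simp add: bij_betw_def)
  show ?thesis
  proof (rule unitary_mapI)
    show "bij_betw ?V (carrier K) (carrier H)" using bij by (rule bij_betw_inv_into)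
    show "?V (x \<oplus>\<^bsub>K\<^esub> y) = ?V x \<oplus>\<^bsub>H\<^esub> ?V y" if "x \<in> carrier K" "y \<in> carrier K" for x y
      using VU[OF closed(1)[OF V(1)[OF that(1)] V(1)[OF that(2)]]] that
      by (simp add: unitary_mapD(2)[OF U] V)
    show "?V (c \<odot>\<^bsub>K\<^esub> x) = c \<odot>\<^bsub>H\<^esub> ?V x" if "x \<in> carrier K" for c x
      using VU[OF closed(2)[OF V(1)[OF that]], of c] that by (simp add: unitary_mapD(3)[OF U] V)
    show "ip H (?V x) (?V y) = ip K x y" if "x \<in> carrier K" "y \<in> carrier K" for x y
      using unitary_mapD(4)[OF U V(1)[OF that(1)] V(1)[OF that(2)]] that by (simp add: V)
  qed
qed

section \<open>Spaces of forms with a reproducing kernel\<close>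

text \<open>The construction of \<open>tensor_power\<close>, with the tuples replaced by an arbitrary index set and
  the inner products of elementary tensors by an arbitrary kernel.\<close>

definition kernel_ip :: "('l \<Rightarrow> 'l \<Rightarrow> complex) \<Rightarrow> ('l \<Rightarrow>\<^sub>0 complex) \<Rightarrow> ('l \<Rightarrow>\<^sub>0 complex) \<Rightarrow> complex" where
  "kernel_ip k a b = (\<Sum>x\<in>Poly_Mapping.keys a. \<Sum>y\<in>Poly_Mapping.keys b.
        cnj (Poly_Mapping.lookup a x) * Poly_Mapping.lookup b y * k x y)"

definition kernel_approx ::
    "'l set \<Rightarrow> ('l \<Rightarrow> 'l \<Rightarrow> complex) \<Rightarrow> (nat \<Rightarrow> ('l \<Rightarrow>\<^sub>0 complex)) \<Rightarrow> ('l \<Rightarrow> complex) \<Rightarrow> bool" where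
  "kernel_approx \<Lambda> k a F \<longleftrightarrow>
     (\<forall>m. Poly_Mapping.keys (a m) \<subseteq> \<Lambda>) \<and>
     (\<forall>e>0. \<exists>N. \<forall>p\<ge>N. \<forall>q\<ge>N. sqrt (Re (kernel_ip k (a p - a q) (a p - a q))) < e) \<and>
     F \<in> extensional \<Lambda> \<and>
     (\<forall>x\<in>\<Lambda>. (\<lambda>m. comb (\<lambda>y x. k x y) (a m) x) \<longlonglongrightarrow> F x)"

definition kernel_space :: "'l set \<Rightarrow> ('l \<Rightarrow> 'l \<Rightarrow> complex) \<Rightarrow> ('l \<Rightarrow> complex) ip_module" where
  "kernel_space \<Lambda> k =
     \<lparr>carrier = {F. \<exists>a. kernel_approx \<Lambda> k a F},
      mult = undefined,
      one = undefined,
      zero = (\<lambda>x\<in>\<Lambda>. 0),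
      add = (\<lambda>F G. \<lambda>x\<in>\<Lambda>. F x + G x),
      smult = (\<lambda>c F. \<lambda>x\<in>\<Lambda>. c * F x),
      ip = (\<lambda>F G. THE l. \<forall>a b. kernel_approx \<Lambda> k a F \<longrightarrow> kernel_approx \<Lambda> k b G \<longrightarrow>
                               (\<lambda>m. kernel_ip k (a m) (b m)) \<longlonglongrightarrow> l)\<rparr>"

lemma tensor_power_eq_kernel_space:
  "tensor_power n H = kernel_space (tuples n H) (\<lambda>x y. \<Prod>i<n. ip H (x i) (y i))"
proof -
  have "tensor_approx n H = kernel_approx (tuples n H) (\<lambda>x y. \<Prod>i<n. ip H (x i) (y i))"
    by (intro ext) (simp add: tensor_approx_def kernel_approx_def tensor_ip_def kernel_ip_def
        tensor_combination_def elementary_tensor_def comb_def)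
  then show ?thesis
    by (simp add: tensor_power_def kernel_space_def tensor_ip_def kernel_ip_def)
qed

text \<open>The analysis map of the family \<open>u\<close>: for a total family with Gram matrix
  \<open>k\<close> it identifies \<open>L2 M\<close> with the reproducing kernel space of
  \<open>k\<close>.\<close>

definition form_of :: "'x measure \<Rightarrow> 'l set \<Rightarrow> ('l \<Rightarrow> 'x \<Rightarrow> complex) \<Rightarrow> ('x \<Rightarrow> complex) set \<Rightarrow> 'l \<Rightarrow> complex" where
  "form_of M \<Lambda> u A = (\<lambda>x\<in>\<Lambda>. l2ip M (u x) (rep A))"

context
  fixes M :: "'x measure" and \<Lambda> :: "'l set" and u :: "'l \<Rightarrow> 'x \<Rightarrow> complex" and k
  assumes M: "finite_measure M" and total: "l2_total M \<Lambda> u"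
    and k: "\<And>x y. x \<in> \<Lambda> \<Longrightarrow> y \<in> \<Lambda> \<Longrightarrow> k x y = l2ip M (u x) (u y)"
begin

interpretation finite_measure M by (rule M)

lemma total_sq: "x \<in> \<Lambda> \<Longrightarrow> square_integrable M (u x)"
  using total by (simp add: l2_total_def)

lemma total_comb_sq: "Poly_Mapping.keys p \<subseteq> \<Lambda> \<Longrightarrow> square_integrable M (comb u p)"
  by (intro square_integrable_comb total_sq) auto

lemma kernel_ip_eq:
  assumes a: "Poly_Mapping.keys a \<subseteq> \<Lambda>" and b: "Poly_Mapping.keys b \<subseteq> \<Lambda>"
  shows "kernel_ip k a b = l2ip M (comb u a) (comb u b)"
proof -
  have "l2ip M (comb u a) (comb u b)
      = (\<Sum>x\<in>Poly_Mapping.keys a. l2ip M (\<lambda>z. Poly_Mapping.lookup a x * u x z) (comb u b))"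
    unfolding comb_def[of u a] using a
    by (intro l2ip_sum_left total_comb_sq b square_integrable_cmult total_sq) auto
  also have "\<dots> = (\<Sum>x\<in>Poly_Mapping.keys a. cnj (Poly_Mapping.lookup a x) *
      (\<Sum>y\<in>Poly_Mapping.keys b. l2ip M (u x) (\<lambda>z. Poly_Mapping.lookup b y * u y z)))"
    unfolding l2ip_cmult_left comb_def[of u b] using a b
    by (intro sum.cong refl arg_cong2[of _ _ _ _ "(*)"] l2ip_sum_right square_integrable_cmult total_sq) auto
  also have "\<dots> = kernel_ip k a b"
    unfolding kernel_ip_def l2ip_cmult_right sum_distrib_left using a b
    by (intro sum.cong refl) (auto simp: k mult.assoc subset_iff)
  finally show ?thesis ..
qed

lemma kernel_norm_eq:
  assumes a: "Poly_Mapping.keys a \<subseteq> \<Lambda>" and b: "Poly_Mapping.keys b \<subseteq> \<Lambda>"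
  shows "sqrt (Re (kernel_ip k (a - b) (a - b))) = l2norm M (\<lambda>x. comb u a x - comb u b x)"
proof -
  have "Poly_Mapping.keys (a - b) \<subseteq> \<Lambda>" using keys_diff[of a b] a b by blast
  moreover have "comb u (a - b) = (\<lambda>x. comb u a x - comb u b x)" by (simp add: comb_diff fun_eq_iff)
  ultimately show ?thesis by (simp add: kernel_ip_eq l2ip_self flip: of_real_power)
qed

lemma kernel_comb_eq:
  assumes "x \<in> \<Lambda>" "Poly_Mapping.keys a \<subseteq> \<Lambda>"
  shows "comb (\<lambda>y x. k x y) a x = l2ip M (u x) (comb u a)"
proof -
  have "l2ip M (u x) (comb u a) = (\<Sum>y\<in>Poly_Mapping.keys a. l2ip M (u x) (\<lambda>z. Poly_Mapping.lookup a y * u y z))"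
    unfolding comb_def using assms by (intro l2ip_sum_right square_integrable_cmult total_sq) auto
  also have "\<dots> = comb (\<lambda>y x. k x y) a x"
    unfolding comb_def l2ip_cmult_right using assms by (intro sum.cong refl) (auto simp: k subset_iff)
  finally show ?thesis ..
qed

text \<open>The value of a form at \<open>x\<close> is an inner product with \<open>u x\<close>,
  which is continuous in \<open>L2\<close>; so norm convergence of the combinations gives both the
  Cauchy condition and pointwise convergence of the forms.\<close>

lemma kernel_approx_limit:
  assumes keys: "\<And>m. Poly_Mapping.keys (a m) \<subseteq> \<Lambda>" and f: "square_integrable M f"
    and lim: "(\<lambda>m. l2norm M (\<lambda>x. comb u (a m) x - f x)) \<longlonglongrightarrow> 0"
  shows "kernel_approx \<Lambda> k a (\<lambda>x\<in>\<Lambda>. l2ip M (u x) f)"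
  unfolding kernel_approx_def
proof (intro conjI allI impI ballI)
  fix e :: real assume "e > 0"
  then obtain N where N: "\<And>m. m \<ge> N \<Longrightarrow> l2norm M (\<lambda>x. comb u (a m) x - f x) < e/2"
    using LIMSEQ_D[OF lim, of "e/2"] by auto
  have "l2norm M (\<lambda>x. comb u (a p) x - comb u (a q) x) < e" if "p \<ge> N" "q \<ge> N" for p q
    using l2norm_triangle_diff[OF total_comb_sq[OF keys] f total_comb_sq[OF keys], of p q] N[OF that(1)] N[OF that(2)]
    by (simp add: l2norm_minus_commute[of M f])
  then show "\<exists>N. \<forall>p\<ge>N. \<forall>q\<ge>N. sqrt (Re (kernel_ip k (a p - a q) (a p - a q))) < e"
    unfolding kernel_norm_eq[OF keys keys] by blast
next
  fix x assume x: "x \<in> \<Lambda>"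
  have "(\<lambda>m. l2ip M (u x) (comb u (a m))) \<longlonglongrightarrow> l2ip M (u x) f"
    by (rule l2ip_tendsto) (simp_all add: total_sq[OF x] total_comb_sq[OF keys] f lim, simp add: l2norm_def)
  then show "(\<lambda>m. comb (\<lambda>y x. k x y) (a m) x) \<longlonglongrightarrow> (\<lambda>x\<in>\<Lambda>. l2ip M (u x) f) x"
    using x by (simp add: kernel_comb_eq[OF x keys])
qed (use keys in auto)

text \<open>On combinations the kernel seminorm is the \<open>L2\<close> norm, so completeness of
  \<open>L2\<close> supplies a limit \<open>f\<close>; the form of \<open>f\<close> is
  \<open>F\<close> by uniqueness of pointwise limits.\<close>

lemma kernel_approx_converges:
  assumes "kernel_approx \<Lambda> k a F"
  obtains f where "square_integrable M f" "F = (\<lambda>x\<in>\<Lambda>. l2ip M (u x) f)"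
    "(\<lambda>m. l2norm M (\<lambda>x. comb u (a m) x - f x)) \<longlonglongrightarrow> 0"
proof -
  have keys: "\<And>m. Poly_Mapping.keys (a m) \<subseteq> \<Lambda>" using assms by (simp add: kernel_approx_def)
  have "\<exists>N. \<forall>p\<ge>N. \<forall>q\<ge>N. l2norm M (\<lambda>x. comb u (a p) x - comb u (a q) x) < e" if "e > 0" for e
    using assms that unfolding kernel_approx_def kernel_norm_eq[OF keys keys] by blast
  from l2_complete[OF total_comb_sq[OF keys] this] obtain f where
    f: "square_integrable M f" "(\<lambda>m. l2norm M (\<lambda>x. comb u (a m) x - f x)) \<longlonglongrightarrow> 0" by blast
  have "F = (\<lambda>x\<in>\<Lambda>. l2ip M (u x) f)"
  proof
    fix x
    show "F x = (\<lambda>x\<in>\<Lambda>. l2ip M (u x) f) x"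
    proof (cases "x \<in> \<Lambda>")
      case True
      have "(\<lambda>m. comb (\<lambda>y x. k x y) (a m) x) \<longlonglongrightarrow> (\<lambda>x\<in>\<Lambda>. l2ip M (u x) f) x"
        using kernel_approx_limit[OF keys f] True by (simp only: kernel_approx_def)
      moreover have "(\<lambda>m. comb (\<lambda>y x. k x y) (a m) x) \<longlonglongrightarrow> F x"
        using assms True by (simp only: kernel_approx_def)
      ultimately show ?thesis by (rule LIMSEQ_unique[symmetric])
    next
      case False
      then show ?thesis using assms by (simp add: kernel_approx_def extensional_def)
    qed
  qed
  with f that show ?thesis by blast
qed

lemma kernel_approx_exists:
  assumes f: "square_integrable M f"
  obtains a where "kernel_approx \<Lambda> k a (\<lambda>x\<in>\<Lambda>. l2ip M (u x) f)"
proof -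
  have "f \<in> l2_span M \<Lambda> u" using total f by (simp add: l2_total_def)
  then have "\<exists>p. Poly_Mapping.keys p \<subseteq> \<Lambda> \<and> l2norm M (\<lambda>x. f x - comb u p x) < 1 / real (Suc m)" for m
    unfolding l2_span_def by simp
  then obtain a where a: "\<And>m. Poly_Mapping.keys (a m) \<subseteq> \<Lambda>"
    "\<And>m. l2norm M (\<lambda>x. f x - comb u (a m) x) < 1 / real (Suc m)" by metis
  have "(\<lambda>m. l2norm M (\<lambda>x. comb u (a m) x - f x)) \<longlonglongrightarrow> 0"
  proof (rule Lim_null_comparison[OF always_eventually])
    show "\<forall>m. norm (l2norm M (\<lambda>x. comb u (a m) x - f x)) \<le> 1 / real (Suc m)"
      using a(2) by (simp add: l2norm_minus_commute[of M f] less_imp_le)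
    show "(\<lambda>m. 1 / real (Suc m)) \<longlonglongrightarrow> 0" using LIMSEQ_inverse_real_of_nat by (simp add: inverse_eq_divide)
  qed
  from kernel_approx_limit[OF a(1) f this] that show ?thesis by blast
qed

text \<open>The difference \<open>h\<close> is orthogonal to the family, hence to every combination.
  Approximating \<open>h\<close> itself by a combination within \<open>e\<close> gives
  \<open>|h|^2 \<le> e |h|\<close>, so \<open>h\<close> vanishes.\<close>

lemma form_injective:
  assumes f: "square_integrable M f" and g: "square_integrable M g"
    and eq: "\<And>x. x \<in> \<Lambda> \<Longrightarrow> l2ip M (u x) f = l2ip M (u x) g"
  shows "AE x in M. f x = g x"
proof -
  define h where "h x = f x - g x" for x
  have h: "square_integrable M h" unfolding h_def using f g by (rule square_integrable_diff)
  have ux: "l2ip M (u x) h = 0" if "x \<in> \<Lambda>" for x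
    unfolding h_def using eq[OF that] by (simp add: l2ip_diff_right total_sq[OF that] f g)
  have uc: "l2ip M (comb u p) h = 0" if "Poly_Mapping.keys p \<subseteq> \<Lambda>" for p
  proof -
    have "l2ip M (comb u p) h = (\<Sum>x\<in>Poly_Mapping.keys p. l2ip M (\<lambda>z. Poly_Mapping.lookup p x * u x z) h)"
      unfolding comb_def using that by (intro l2ip_sum_left square_integrable_cmult total_sq h) auto
    also have "\<dots> = 0" unfolding l2ip_cmult_left using ux that by (intro sum.neutral) auto
    finally show ?thesis .
  qed
  have "l2norm M h \<le> e" if "e > 0" for e
  proof -
    have "h \<in> l2_span M \<Lambda> u" using total h by (simp add: l2_total_def)
    then obtain p where p: "Poly_Mapping.keys p \<subseteq> \<Lambda>" "l2norm M (\<lambda>x. h x - comb u p x) < e"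
      using \<open>e > 0\<close> by (rule l2_spanE)
    note cp = total_comb_sq[OF p(1)]
    have "complex_of_real ((l2norm M h)\<^sup>2) = l2ip M (\<lambda>x. h x - comb u p x) h"
      unfolding l2ip_diff_left[OF h h cp] uc[OF p(1)] l2ip_self by simp
    then have "(l2norm M h)\<^sup>2 = cmod (l2ip M (\<lambda>x. h x - comb u p x) h)"
      using norm_of_real[of "(l2norm M h)\<^sup>2", where 'a=complex] by simp
    also have "\<dots> \<le> l2norm M (\<lambda>x. h x - comb u p x) * l2norm M h"
      by (intro l2ip_Cauchy_Schwarz square_integrable_diff h cp)
    also have "\<dots> \<le> e * l2norm M h" using p(2) by (intro mult_right_mono) auto
    finally have "l2norm M h * l2norm M h \<le> e * l2norm M h" by (simp add: power2_eq_square)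
    note le = this
    show ?thesis
    proof (cases "l2norm M h = 0")
      case False
      then have "l2norm M h > 0" using l2norm_nonneg[of M h] by linarith
      with le show ?thesis by (rule mult_right_le_imp_le)
    qed (use that in simp)
  qed
  then have "l2norm M h \<le> 0" by (rule field_le_epsilon) simp
  then have "l2norm M h = 0" using l2norm_nonneg[of M h] by linarith
  then have "AE x in M. h x = 0" unfolding l2norm_eq_0_iff[OF h] .
  then show ?thesis by (simp add: h_def)
qed

text \<open>By \<open>form_injective\<close>, every approximating sequence of the form of
  \<open>f\<close> converges in \<open>L2\<close> to \<open>f\<close>, so the limit in the definite
  description is the same for all choices.\<close>

lemma kernel_space_ip:
  assumes f: "square_integrable M f" and g: "square_integrable M g"
  shows "ip (kernel_space \<Lambda> k) (\<lambda>x\<in>\<Lambda>. l2ip M (u x) f) (\<lambda>x\<in>\<Lambda>. l2ip M (u x) g) = l2ip M f g"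
proof -
  let ?F = "\<lambda>x\<in>\<Lambda>. l2ip M (u x) f" and ?G = "\<lambda>x\<in>\<Lambda>. l2ip M (u x) g"
  have lim: "(\<lambda>m. l2norm M (\<lambda>x. comb u (a m) x - h x)) \<longlonglongrightarrow> 0"
    if a: "kernel_approx \<Lambda> k a (\<lambda>x\<in>\<Lambda>. l2ip M (u x) h)" and h: "square_integrable M h" for a h
  proof -
    have keys: "\<And>m. Poly_Mapping.keys (a m) \<subseteq> \<Lambda>" using a by (simp add: kernel_approx_def)
    obtain h' where h': "square_integrable M h'" "(\<lambda>x\<in>\<Lambda>. l2ip M (u x) h) = (\<lambda>x\<in>\<Lambda>. l2ip M (u x) h')"
      "(\<lambda>m. l2norm M (\<lambda>x. comb u (a m) x - h' x)) \<longlonglongrightarrow> 0"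
      using kernel_approx_converges[OF a] .
    have "l2ip M (u x) h = l2ip M (u x) h'" if "x \<in> \<Lambda>" for x
      using fun_cong[OF h'(2), of x] that by simp
    then have ae: "AE x in M. h x = h' x" by (rule form_injective[OF h h'(1)])
    have "l2norm M (\<lambda>x. comb u (a m) x - h x) = l2norm M (\<lambda>x. comb u (a m) x - h' x)" for m
      using ae by (intro l2norm_cong_AE borel_measurable_diff square_integrable_measurable total_comb_sq[OF keys] h h'(1)) auto
    then show ?thesis using h'(3) by simp
  qed
  have conv: "(\<lambda>m. kernel_ip k (a m) (b m)) \<longlonglongrightarrow> l2ip M f g"
    if a: "kernel_approx \<Lambda> k a ?F" and b: "kernel_approx \<Lambda> k b ?G" for a b
  proof -
    have keys: "\<And>m. Poly_Mapping.keys (a m) \<subseteq> \<Lambda>" "\<And>m. Poly_Mapping.keys (b m) \<subseteq> \<Lambda>"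
      using a b by (simp_all add: kernel_approx_def)
    show ?thesis unfolding kernel_ip_eq[OF keys]
      by (rule l2ip_tendsto) (rule total_comb_sq keys f g lim a b)+
  qed
  \<comment> \<open>Without at least one approximating pair, every number would satisfy the
    description vacuously.\<close>
  obtain a where a: "kernel_approx \<Lambda> k a ?F" using kernel_approx_exists[OF f] .
  obtain b where b: "kernel_approx \<Lambda> k b ?G" using kernel_approx_exists[OF g] .
  have "(THE l. \<forall>a b. kernel_approx \<Lambda> k a ?F \<longrightarrow> kernel_approx \<Lambda> k b ?G \<longrightarrow>
                               (\<lambda>m. kernel_ip k (a m) (b m)) \<longlonglongrightarrow> l) = l2ip M f g"
  proof (rule the_equality)
    fix l assume "\<forall>a b. kernel_approx \<Lambda> k a ?F \<longrightarrow> kernel_approx \<Lambda> k b ?G \<longrightarrow> (\<lambda>m. kernel_ip k (a m) (b m)) \<longlonglongrightarrow> l"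
    then have "(\<lambda>m. kernel_ip k (a m) (b m)) \<longlonglongrightarrow> l" using a b by blast
    then show "l = l2ip M f g" using conv[OF a b] by (rule LIMSEQ_unique)
  qed (use conv in blast)
  then show ?thesis by (simp add: kernel_space_def)
qed

lemma form_of_class:
  assumes f: "square_integrable M f"
  shows "form_of M \<Lambda> u (ae_class M f) = (\<lambda>x\<in>\<Lambda>. l2ip M (u x) f)"
  unfolding form_of_def using f
  by (intro restrict_ext l2ip_cong_AE square_integrable_measurable[OF total_sq] rep_ae_class)
     (auto intro: square_integrable_measurable)

text \<open>The completion built from a kernel is a copy of \<open>L2 M\<close> as soon as some
  total family in \<open>L2 M\<close> has this kernel as its Gram matrix. It serves for tensor
  powers and, applied on both sides, for comparing two \<open>L2\<close> spaces.\<close>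

theorem form_of_unitary: "unitary_map (L2 M) (kernel_space \<Lambda> k) (form_of M \<Lambda> u)"
proof (rule unitary_mapI)
  show "bij_betw (form_of M \<Lambda> u) (carrier (L2 M)) (carrier (kernel_space \<Lambda> k))"
  proof (rule bij_betw_imageI)
    show "inj_on (form_of M \<Lambda> u) (carrier (L2 M))"
    proof (rule inj_onI)
      fix A B assume A: "A \<in> carrier (L2 M)" and B: "B \<in> carrier (L2 M)" 
        and eq: "form_of M \<Lambda> u A = form_of M \<Lambda> u B"
      have "AE x in M. rep A x = rep B x"
      proof (rule form_injective)
        show "l2ip M (u x) (rep A) = l2ip M (u x) (rep B)" if "x \<in> \<Lambda>" for x
          using fun_cong[OF eq, of x] that by (simp add: form_of_def)
      qed (use A B in \<open>auto intro: square_integrable_rep\<close>)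
      then have "ae_class M (rep A) = ae_class M (rep B)"
        by (intro ae_class_cong square_integrable_measurable square_integrable_rep A B)
      then show "A = B" using A B by (simp add: ae_class_rep)
    qed
    show "form_of M \<Lambda> u ` carrier (L2 M) = carrier (kernel_space \<Lambda> k)"
    proof (intro equalityI subsetI)
      fix F assume "F \<in> form_of M \<Lambda> u ` carrier (L2 M)"
      then obtain f where f: "square_integrable M f" "F = (\<lambda>x\<in>\<Lambda>. l2ip M (u x) f)"
        by (auto elim!: L2_carrierE simp: form_of_class)
      obtain a where "kernel_approx \<Lambda> k a F" using kernel_approx_exists[OF f(1)] unfolding f(2) .
      then show "F \<in> carrier (kernel_space \<Lambda> k)" by (auto simp: kernel_space_def)
    next
      fix F assume "F \<in> carrier (kernel_space \<Lambda> k)"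
      then obtain a where "kernel_approx \<Lambda> k a F" by (auto simp: kernel_space_def)
      then obtain f where f: "square_integrable M f" "F = (\<lambda>x\<in>\<Lambda>. l2ip M (u x) f)"
        by (rule kernel_approx_converges)
      then have "F = form_of M \<Lambda> u (ae_class M f)" by (simp add: form_of_class)
      then show "F \<in> form_of M \<Lambda> u ` carrier (L2 M)" using L2_carrierI[OF f(1)] by blast
    qed
  qed
next
  fix A B assume "A \<in> carrier (L2 M)" "B \<in> carrier (L2 M)"
  then obtain f g where f: "square_integrable M f" "A = ae_class M f" 
    and g: "square_integrable M g" "B = ae_class M g" by (metis L2_carrierE)
  show "form_of M \<Lambda> u (A \<oplus>\<^bsub>L2 M\<^esub> B) = form_of M \<Lambda> u A \<oplus>\<^bsub>kernel_space \<Lambda> k\<^esub> form_of M \<Lambda> u B"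
    by (simp add: f g add_L2_class square_integrable_measurable form_of_class square_integrable_add
        kernel_space_def restrict_def fun_eq_iff l2ip_add_right total_sq)
  show "ip (kernel_space \<Lambda> k) (form_of M \<Lambda> u A) (form_of M \<Lambda> u B) = ip (L2 M) A B"
    by (simp add: f g form_of_class kernel_space_ip ip_L2_class)
next
  fix A c assume "A \<in> carrier (L2 M)"
  then obtain f where f: "square_integrable M f" "A = ae_class M f" by (metis L2_carrierE)
  show "form_of M \<Lambda> u (c \<odot>\<^bsub>L2 M\<^esub> A) = c \<odot>\<^bsub>kernel_space \<Lambda> k\<^esub> form_of M \<Lambda> u A"
    by (simp add: f smult_L2_class square_integrable_measurable form_of_class square_integrable_cmult
        kernel_space_def restrict_def fun_eq_iff l2ip_cmult_right total_sq)
qed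

end

definition l2_mult :: "'x measure \<Rightarrow> ('x \<Rightarrow> complex) \<Rightarrow> ('x \<Rightarrow> complex) set \<Rightarrow> ('x \<Rightarrow> complex) set" where
  "l2_mult M \<phi> A = ae_class M (\<lambda>x. \<phi> x * rep A x)"

lemma l2_mult_class:
  assumes "f \<in> borel_measurable M" "\<phi> \<in> borel_measurable M"
  shows "l2_mult M \<phi> (ae_class M f) = ae_class M (\<lambda>x. \<phi> x * f x)"
proof -
  have "AE x in M. \<phi> x * rep (ae_class M f) x = \<phi> x * f x"
    using rep_ae_class(2)[OF assms(1)] by eventually_elim simp
  then show ?thesis
    unfolding l2_mult_def using assms by (intro ae_class_cong borel_measurable_times rep_ae_class)
qed

lemma l2_mult_carrier:
  assumes "A \<in> carrier (L2 M)" "\<phi> \<in> borel_measurable M" "AE x in M. cmod (\<phi> x) \<le> c"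
  shows "l2_mult M \<phi> A \<in> carrier (L2 M)"
  unfolding l2_mult_def
  by (rule L2_carrierI, rule square_integrable_bounded_mult[OF square_integrable_rep[OF assms(1)] assms(2,3)])

lemma coordinate_multiplication_eq: "coordinate_multiplication \<sigma> = l2_mult \<sigma> fst"
  by (intro ext) (simp add: coordinate_multiplication_def l2_mult_def case_prod_unfold)

text \<open>The adjoint of multiplication by the unimodular \<open>\<phi>\<close> is multiplication
  by its conjugate, which acts on the family \<open>u\<close> as the relabelling \<open>s\<close>.
  This has the shape of \<open>tensor_power_operator\<close>, which also composes a form with a map
  of its arguments.\<close>

lemma form_of_mult:
  assumes M: "finite_measure M" and total: "l2_total M \<Lambda> u" and A: "A \<in> carrier (L2 M)"
    and \<phi>: "\<phi> \<in> borel_measurable M" "AE x in M. cmod (\<phi> x) = 1"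
    and s: "\<And>x. x \<in> \<Lambda> \<Longrightarrow> s x \<in> \<Lambda>" "\<And>x. x \<in> \<Lambda> \<Longrightarrow> AE z in M. u (s x) z = cnj (\<phi> z) * u x z"
  shows "form_of M \<Lambda> u (l2_mult M \<phi> A) = (\<lambda>x\<in>\<Lambda>. form_of M \<Lambda> u A (s x))"
proof -
  obtain f where f: "square_integrable M f" "A = ae_class M f" using A by (rule L2_carrierE)
  have [measurable]: "f \<in> borel_measurable M" "\<phi> \<in> borel_measurable M"
    using f \<phi> by (auto simp: square_integrable_def)
  have u: "u x \<in> borel_measurable M" if "x \<in> \<Lambda>" for x
    using total that by (simp add: l2_total_def square_integrable_def)
  have "AE x in M. cmod (\<phi> x) \<le> 1" using \<phi>(2) by eventually_elim simp
  then have \<phi>f: "square_integrable M (\<lambda>x. \<phi> x * f x)" by (rule square_integrable_bounded_mult[OF f(1) \<phi>(1)])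
  have "l2ip M (u x) (\<lambda>z. \<phi> z * f z) = l2ip M (u (s x)) f" if x: "x \<in> \<Lambda>" for x
    unfolding l2ip_def
  proof (rule integral_cong_AE)
    have [measurable]: "u x \<in> borel_measurable M" "u (s x) \<in> borel_measurable M" using u s x by auto
    show "(\<lambda>z. cnj (u x z) * (\<phi> z * f z)) \<in> borel_measurable M" by measurable
    show "(\<lambda>z. cnj (u (s x) z) * f z) \<in> borel_measurable M" by measurable
    show "AE z in M. cnj (u x z) * (\<phi> z * f z) = cnj (u (s x) z) * f z"
      using s(2)[OF x] by eventually_elim simp
  qed
  then show ?thesis
    by (simp add: f l2_mult_class form_of_class[OF M total] \<phi>f restrict_def fun_eq_iff s)
qed

section \<open>Measures on the circle\<close>

lemma space_circle_borel [simp]: "space circle_borel = sphere 0 1"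
  by (simp add: circle_borel_def space_restrict_space)

lemma measurable_circle_borel_iff:
  "f \<in> measurable M circle_borel \<longleftrightarrow> f \<in> borel_measurable M \<and> (\<forall>x\<in>space M. cmod (f x) = 1)"
  by (auto simp: circle_borel_def measurable_restrict_space2_iff)

lemma measurable_circle_borel_D:
  "f \<in> measurable M circle_borel \<Longrightarrow> f \<in> borel_measurable M"
  by (simp add: measurable_circle_borel_iff)

lemma circle_measurable_id: "(\<lambda>x. x) \<in> measurable circle_borel borel"
  by (simp add: circle_borel_def measurable_restrict_space1)

lemma measurable_circle_mult [measurable (raw)]:
  "f \<in> measurable M circle_borel \<Longrightarrow> g \<in> measurable M circle_borel \<Longrightarrow> (\<lambda>x. f x * g x) \<in> measurable M circle_borel"
  by (auto simp: measurable_circle_borel_iff norm_mult)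

lemma measurable_circle_prod [measurable (raw)]:
  "(\<And>i. i \<in> I \<Longrightarrow> f i \<in> measurable M circle_borel) \<Longrightarrow> (\<lambda>x. \<Prod>i\<in>I. f i x) \<in> measurable M circle_borel"
  by (simp add: measurable_circle_borel_iff borel_measurable_prod flip: prod_norm)

lemma measurable_PiM_component:
  "f \<in> measurable M N \<Longrightarrow> i \<in> I \<Longrightarrow> (\<lambda>\<omega>. f (\<omega> i)) \<in> measurable (PiM I (\<lambda>_. M)) N"
  by (rule measurable_compose[OF measurable_component_singleton[of i I "\<lambda>_. M"]])

text \<open>Convolution on the circle is the law of a product of independent variables. The
  induction identifies the product of \<open>M\<close> with the \<open>n\<close>-fold space as the
  space with the extra coordinate \<open>n\<close>.\<close>

lemma convolution_power_distr:
  assumes M: "prob_space M" and f: "f \<in> measurable M circle_borel"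
  shows "convolution_power (distr M circle_borel f) n
       = distr (PiM {..<n} (\<lambda>_. M)) circle_borel (\<lambda>\<omega>. \<Prod>i<n. f (\<omega> i))"
proof (induction n)
  case 0
  \<comment> \<open>The product over the empty index set is the point mass at the only function in
    it.\<close>
  have ret: "PiM {} (\<lambda>_. M) = return (PiM {} (\<lambda>_. M)) (\<lambda>_. undefined)"
    unfolding PiM_empty
    by (intro measure_eqI) (auto simp: emeasure_count_space_finite indicator_def subset_singleton_iff)
  have "distr (return (PiM {} (\<lambda>_. M)) (\<lambda>_. undefined)) circle_borel (\<lambda>\<omega>. 1::complex) = return circle_borel 1"
    by (subst distr_return) (auto simp: measurable_circle_borel_iff space_PiM_empty)
  then show ?case unfolding ret[symmetric] by (simp add: eq_commute)
next
  case (Suc n)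
  interpret M: prob_space M by fact
  have [measurable]: "f \<in> measurable M circle_borel" by fact
  have [measurable]: "(\<lambda>\<omega>. \<Prod>i<n. f (\<omega> i)) \<in> measurable (PiM {..<n} (\<lambda>_. M)) circle_borel"
    by (intro measurable_circle_prod measurable_PiM_component f) auto
  have [measurable]: "(\<lambda>\<omega>. \<Prod>i<Suc n. f (\<omega> i)) \<in> measurable (PiM (insert n {..<n}) (\<lambda>_. M)) circle_borel"
    by (intro measurable_circle_prod measurable_PiM_component f) auto
  interpret P: prob_space "PiM {..<n} (\<lambda>_. M)" by (intro prob_space_PiM M)
  interpret D: prob_space "distr (PiM {..<n} (\<lambda>_. M)) circle_borel (\<lambda>\<omega>. \<Prod>i<n. f (\<omega> i))"
    by (rule P.prob_space_distr) measurable
  have mult [measurable]: "(\<lambda>(s, t). s * t) \<in> measurable (circle_borel \<Otimes>\<^sub>M circle_borel) circle_borel"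
    unfolding case_prod_unfold by measurable
  have "convolution_power (distr M circle_borel f) (Suc n)
      = distr (distr M circle_borel f \<Otimes>\<^sub>M distr (PiM {..<n} (\<lambda>_. M)) circle_borel (\<lambda>\<omega>. \<Prod>i<n. f (\<omega> i)))
          circle_borel (\<lambda>(s, t). s * t)"
    by (simp add: Suc circle_convolution_def)
  also have "\<dots> = distr (distr (M \<Otimes>\<^sub>M PiM {..<n} (\<lambda>_. M)) (circle_borel \<Otimes>\<^sub>M circle_borel)
        (\<lambda>(x, y). (f x, \<Prod>i<n. f (y i)))) circle_borel (\<lambda>(s, t). s * t)"
    by (subst pair_measure_distr) (auto simp: D.sigma_finite_measure_axioms)
  also have "\<dots> = distr (M \<Otimes>\<^sub>M PiM {..<n} (\<lambda>_. M)) circle_borel (\<lambda>(x, y). f x * (\<Prod>i<n. f (y i)))"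
    by (subst distr_distr) (auto simp: o_def case_prod_unfold)
  also have "\<dots> = distr (distr (M \<Otimes>\<^sub>M PiM {..<n} (\<lambda>_. M)) (PiM (insert n {..<n}) (\<lambda>_. M)) (\<lambda>(x, \<omega>). fun_upd \<omega> n x))
       circle_borel (\<lambda>\<omega>. \<Prod>i<Suc n. f (\<omega> i))"
    by (subst distr_distr) (auto simp: o_def case_prod_unfold mult.commute intro!: arg_cong2[of _ _ _ _ "(*)"] distr_cong prod.cong)
  also have "distr (M \<Otimes>\<^sub>M PiM {..<n} (\<lambda>_. M)) (PiM (insert n {..<n}) (\<lambda>_. M)) (\<lambda>(x, \<omega>). fun_upd \<omega> n x) = PiM (insert n {..<n}) (\<lambda>_. M)"
    using distr_pair_PiM_eq_PiM[of "{..<n}" "\<lambda>_. M" n] M by simp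
  finally show ?case by (simp add: lessThan_Suc)
qed

section \<open>Tensor powers of operators with a spectral measure\<close>

lemma normalized_borel_measure_space:
  "normalized_borel_measure \<sigma> \<Longrightarrow> space \<sigma> = sphere 0 1 \<times> UNIV"
  unfolding normalized_borel_measure_def
  by (drule conjunct1, drule sets_eq_imp_space_eq) (simp add: space_pair_measure)

lemma normalized_borel_measure_fst:
  assumes "normalized_borel_measure \<sigma>"
  shows "fst \<in> measurable \<sigma> circle_borel"
  using assms measurable_fst unfolding normalized_borel_measure_def
  by (metis measurable_cong_sets)

context
  fixes H :: "('a, 'm) ip_module_scheme" and T :: "'a \<Rightarrow> 'a" and \<sigma> and U0
  assumes \<sigma>: "normalized_borel_measure \<sigma>"
    and U0: "unitary_map H (L2 \<sigma>) U0"
    and U0T: "\<And>x. x \<in> carrier H \<Longrightarrow> U0 (T x) = coordinate_multiplication \<sigma> (U0 x)"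
    and T: "unitary_operator H T"
begin

text \<open>The function on the product space that corresponds to the elementary tensor of
  \<open>x\<close> after each factor is transported by \<open>U0\<close>.\<close>

definition tensor_fun :: "nat \<Rightarrow> (nat \<Rightarrow> 'a) \<Rightarrow> (nat \<Rightarrow> complex \<times> nat) \<Rightarrow> complex" where
  "tensor_fun n x \<omega> = (\<Prod>i<n. rep (U0 (x i)) (\<omega> i))"

interpretation \<sigma>: prob_space \<sigma> using \<sigma> by (simp add: normalized_borel_measure_def)
interpretation S: product_sigma_finite "\<lambda>_::nat. \<sigma>" by standard

lemma tensor_prob: "prob_space (PiM {..<n} (\<lambda>_. \<sigma>))"
  by (intro prob_space_PiM \<sigma>.prob_space_axioms)

lemma U0_sq: "x \<in> carrier H \<Longrightarrow> square_integrable \<sigma> (rep (U0 x))"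
  by (intro square_integrable_rep unitary_mapD(5)[OF U0])

lemma tuples_mem: "x \<in> tuples n H \<Longrightarrow> i < n \<Longrightarrow> x i \<in> carrier H"
  by (auto simp: tuples_def)

lemma tensor_fun_sq:
  assumes "x \<in> tuples n H"
  shows "square_integrable (PiM {..<n} (\<lambda>_. \<sigma>)) (tensor_fun n x)"
  unfolding square_integrable_def
proof
  show "tensor_fun n x \<in> borel_measurable (PiM {..<n} (\<lambda>_. \<sigma>))"
    unfolding tensor_fun_def
    by (intro borel_measurable_prod measurable_PiM_component
          square_integrable_measurable[OF U0_sq] tuples_mem[OF assms]) auto
  have "integrable (PiM {..<n} (\<lambda>_. \<sigma>)) (\<lambda>\<omega>. \<Prod>i<n. (cmod (rep (U0 (x i)) (\<omega> i)))\<^sup>2)"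
    using U0_sq[OF tuples_mem[OF assms]]
    by (intro S.product_integrable_prod) (auto simp: square_integrable_def)
  then show "integrable (PiM {..<n} (\<lambda>_. \<sigma>)) (\<lambda>\<omega>. (cmod (tensor_fun n x \<omega>))\<^sup>2)"
    by (simp add: tensor_fun_def prod_power_distrib flip: prod_norm)
qed

text \<open>Fubini's theorem. It exhibits the kernel of \<open>tensor_power\<close> as the Gram
  matrix of product functions, as \<open>form_of_unitary\<close> requires.\<close>

lemma tensor_fun_gram:
  assumes x: "x \<in> tuples n H" and y: "y \<in> tuples n H"
  shows "(\<Prod>i<n. ip H (x i) (y i)) = l2ip (PiM {..<n} (\<lambda>_. \<sigma>)) (tensor_fun n x) (tensor_fun n y)"
proof -
  have "(\<Prod>i<n. ip H (x i) (y i)) = (\<Prod>i<n. \<integral>z. cnj (rep (U0 (x i)) z) * rep (U0 (y i)) z \<partial>\<sigma>)"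
    using unitary_mapD(4)[OF U0 tuples_mem[OF x] tuples_mem[OF y]]
    by (intro prod.cong refl) (auto simp: ip_L2 l2ip_def)
  also have "\<dots> = (\<integral>\<omega>. (\<Prod>i<n. cnj (rep (U0 (x i)) (\<omega> i)) * rep (U0 (y i)) (\<omega> i)) \<partial>PiM {..<n} (\<lambda>_. \<sigma>))"
    by (rule S.product_integral_prod[symmetric])
       (auto intro!: integrable_cnj_mult U0_sq tuples_mem[OF x] tuples_mem[OF y])
  also have "\<dots> = l2ip (PiM {..<n} (\<lambda>_. \<sigma>)) (tensor_fun n x) (tensor_fun n y)"
    by (simp add: l2ip_def tensor_fun_def prod.distrib)
  finally show ?thesis .
qed

text \<open>The indicator of a box is almost everywhere a product of indicators of its sides, hence
  a \<open>tensor_fun\<close>; boxes are stable under intersection and generate the product.\<close>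

lemma tensor_total: "l2_total (PiM {..<n} (\<lambda>_. \<sigma>)) (tuples n H) (tensor_fun n)"
proof (rule l2_totalI)
  let ?M = "PiM {..<n} (\<lambda>_. \<sigma>)"
  show "square_integrable ?M (tensor_fun n a)" if "a \<in> tuples n H" for a
    using that by (rule tensor_fun_sq)
  show "finite_measure ?M" using tensor_prob by (rule prob_space.axioms(1))
  show "sets ?M = sigma_sets (space ?M) (prod_algebra {..<n} (\<lambda>_. \<sigma>))"
    by (simp add: sets_PiM space_PiM)
  show "Int_stable (prod_algebra {..<n} (\<lambda>_. \<sigma>))" by (rule Int_stable_prod_algebra)
  show "prod_algebra {..<n} (\<lambda>_. \<sigma>) \<subseteq> Pow (space ?M)"
    using prod_algebra_sets_into_space by (simp add: space_PiM)
  have box: "indicator (\<Pi>\<^sub>E i\<in>{..<n}. B i) \<in> l2_span ?M (tuples n H) (tensor_fun n)"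
    if B: "\<And>i. i < n \<Longrightarrow> B i \<in> sets \<sigma>" for B
  proof -
    \<comment> \<open>Surjectivity of \<open>U0\<close> provides a vector of \<open>H\<close> for
      each side of the box.\<close>
    have "\<exists>y. y \<in> carrier H \<and> U0 y = ae_class \<sigma> (indicator (B i))" if "i < n" for i
    proof -
      have "ae_class \<sigma> (indicator (B i)) \<in> U0 ` carrier H"
        unfolding bij_betw_imp_surj_on[OF unitary_mapD(1)[OF U0]]
        by (intro L2_carrierI \<sigma>.square_integrable_indicator B that)
      then show ?thesis by auto
    qed
    then obtain y where y: "\<And>i. i < n \<Longrightarrow> y i \<in> carrier H" "\<And>i. i < n \<Longrightarrow> U0 (y i) = ae_class \<sigma> (indicator (B i))"
      by metis
    define y' where "y' = restrict y {..<n}"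
    have y': "y' \<in> tuples n H" using y by (auto simp: tuples_def y'_def)
    have "AE \<omega> in ?M. rep (U0 (y i)) (\<omega> i) = indicator (B i) (\<omega> i)" if "i \<in> {..<n}" for i
    proof -
      have "AE z in \<sigma>. rep (U0 (y i)) z = indicator (B i) z"
        using that B y(2) by (auto intro!: rep_ae_class)
      then show ?thesis using that by (intro AE_PiM_component \<sigma>.prob_space_axioms)
    qed
    then have "AE \<omega> in ?M. \<forall>i\<in>{..<n}. rep (U0 (y i)) (\<omega> i) = indicator (B i) (\<omega> i)"
      by (intro AE_finite_allI) auto
    moreover have "AE \<omega> in ?M. \<omega> \<in> space ?M" by (rule AE_space)
    ultimately have ae: "AE \<omega> in ?M. indicator (\<Pi>\<^sub>E i\<in>{..<n}. B i) \<omega> = tensor_fun n y' \<omega>"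
    proof eventually_elim
      case (elim \<omega>)
      have "\<omega> \<in> (\<Pi>\<^sub>E i\<in>{..<n}. B i) \<longleftrightarrow> (\<forall>i<n. \<omega> i \<in> B i)"
        using elim(2) by (auto simp: space_PiM PiE_iff)
      then have "indicator (\<Pi>\<^sub>E i\<in>{..<n}. B i) \<omega> = (\<Prod>i<n. indicator (B i) (\<omega> i) :: complex)"
        by (auto simp: indicator_def)
      also have "\<dots> = tensor_fun n y' \<omega>"
        unfolding tensor_fun_def using elim(1) by (intro prod.cong refl) (simp add: y'_def)
      finally show ?case .
    qed
    have "(\<Pi>\<^sub>E i\<in>{..<n}. B i) \<in> sets ?M" using B by (intro sets_PiM_I_finite) auto
    then show ?thesis
      using ae by (intro l2_span_cong_AE[OF tensor_fun_sq l2_span_base[OF tensor_fun_sq y']]) auto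
  qed
  show "indicator A \<in> l2_span ?M (tuples n H) (tensor_fun n)" if "A \<in> prod_algebra {..<n} (\<lambda>_. \<sigma>)" for A
    using that box by (auto simp: prod_algebra_eq_finite)
  show "indicator (space ?M) \<in> l2_span ?M (tuples n H) (tensor_fun n)"
    using box[of "\<lambda>_. space \<sigma>"] by (simp add: space_PiM)
qed

definition tensor_form :: "nat \<Rightarrow> ((nat \<Rightarrow> complex \<times> nat) \<Rightarrow> complex) set \<Rightarrow> (nat \<Rightarrow> 'a) \<Rightarrow> complex" where
  "tensor_form n = form_of (PiM {..<n} (\<lambda>_. \<sigma>)) (tuples n H) (tensor_fun n)"

lemma tensor_form_unitary:
  "unitary_map (L2 (PiM {..<n} (\<lambda>_. \<sigma>))) (tensor_power n H) (tensor_form n)"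
  unfolding tensor_power_eq_kernel_space tensor_form_def
  by (rule form_of_unitary[OF prob_space.axioms(1)[OF tensor_prob] tensor_total tensor_fun_gram])

text \<open>In the model \<open>T\<close> is multiplication by the coordinate, which has modulus
  one, so the inverse is multiplication by its conjugate.\<close>

lemma U0_inv:
  assumes "v \<in> carrier H"
  shows "AE z in \<sigma>. rep (U0 (inv_into (carrier H) T v)) z = cnj (fst z) * rep (U0 v) z"
proof -
  let ?w = "inv_into (carrier H) T v"
  have surj: "T ` carrier H = carrier H" using unitary_mapD(1)[OF T] by (rule bij_betw_imp_surj_on)
  have w: "?w \<in> carrier H" "T ?w = v"
    using assms surj by (auto intro: inv_into_into f_inv_into_f)
  have fst: "fst \<in> borel_measurable \<sigma>" 
    using normalized_borel_measure_fst[OF \<sigma>] by (rule measurable_circle_borel_D)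
  have m: "rep (U0 ?w) \<in> borel_measurable \<sigma>" using U0_sq[OF w(1)] by (rule square_integrable_measurable)
  have "U0 v = ae_class \<sigma> (\<lambda>z. fst z * rep (U0 ?w) z)"
    using U0T[OF w(1)] w(2) by (simp add: coordinate_multiplication_eq l2_mult_def)
  then have "AE z in \<sigma>. rep (U0 v) z = fst z * rep (U0 ?w) z"
    using fst m by (auto intro!: rep_ae_class)
  moreover have "AE z in \<sigma>. z \<in> space \<sigma>" by (rule AE_space)
  ultimately show ?thesis
  proof eventually_elim
    case (elim z)
    then have "cnj (fst z) * fst z = 1"
      by (auto simp: normalized_borel_measure_space[OF \<sigma>] cnj_mult_self)
    then show ?case using elim(1) by (simp flip: mult.assoc)
  qed
qed

text \<open>\<open>tensor_power_operator\<close> applies the inverse of \<open>T\<close> to every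
  argument, which multiplies the product function by the conjugate of the product of the
  coordinates; moved across the inner product, this is multiplication by the product itself.\<close>

lemma tensor_form_operator:
  assumes A: "A \<in> carrier (L2 (PiM {..<n} (\<lambda>_. \<sigma>)))"
  shows "tensor_form n (l2_mult (PiM {..<n} (\<lambda>_. \<sigma>)) (\<lambda>\<omega>. \<Prod>i<n. fst (\<omega> i)) A)
       = tensor_power_operator n H T (tensor_form n A)"
proof -
  let ?M = "PiM {..<n} (\<lambda>_. \<sigma>)"
  define s where "s x = (\<lambda>i\<in>{..<n}. inv_into (carrier H) T (x i))" for x
  have \<phi>: "(\<lambda>\<omega>. \<Prod>i<n. fst (\<omega> i)) \<in> measurable ?M circle_borel"
    by (intro measurable_circle_prod measurable_PiM_component normalized_borel_measure_fst[OF \<sigma>]) auto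
  have surj: "T ` carrier H = carrier H" using unitary_mapD(1)[OF T] by (rule bij_betw_imp_surj_on)
  have sx: "s x \<in> tuples n H" if "x \<in> tuples n H" for x
    using tuples_mem[OF that] unfolding tuples_def s_def by (auto intro!: inv_into_into simp: surj)
  have ae: "AE z in ?M. tensor_fun n (s x) z = cnj (\<Prod>i<n. fst (z i)) * tensor_fun n x z"
    if x: "x \<in> tuples n H" for x
  proof -
    have "AE \<omega> in ?M. rep (U0 (s x i)) (\<omega> i) = cnj (fst (\<omega> i)) * rep (U0 (x i)) (\<omega> i)" if "i \<in> {..<n}" for i
    proof -
      have "AE z in \<sigma>. rep (U0 (s x i)) z = cnj (fst z) * rep (U0 (x i)) z"
        using that U0_inv[OF tuples_mem[OF x, of i]] by (simp add: s_def)
      from AE_PiM_component[OF \<sigma>.prob_space_axioms that this] show ?thesis .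
    qed
    then have "AE \<omega> in ?M. \<forall>i\<in>{..<n}. rep (U0 (s x i)) (\<omega> i) = cnj (fst (\<omega> i)) * rep (U0 (x i)) (\<omega> i)"
      by (intro AE_finite_allI) auto
    then show ?thesis
      by eventually_elim (simp add: tensor_fun_def prod.distrib)
  qed
  have "form_of ?M (tuples n H) (tensor_fun n) (l2_mult ?M (\<lambda>\<omega>. \<Prod>i<n. fst (\<omega> i)) A)
      = (\<lambda>x\<in>tuples n H. form_of ?M (tuples n H) (tensor_fun n) A (s x))"
    using \<phi> by (intro form_of_mult tensor_total A sx ae prob_space.axioms(1) tensor_prob measurable_circle_borel_D)
       (auto simp: measurable_circle_borel_iff)
  then show ?thesis by (simp add: tensor_form_def tensor_power_operator_def s_def)
qed

lemma tensor_power_model: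
  fixes n :: nat
  defines "M \<equiv> PiM {..<n} (\<lambda>_. \<sigma>)" and "\<phi> \<equiv> \<lambda>\<omega>. \<Prod>i<n. fst (\<omega> i)"
  obtains W where "unitary_map (L2 M) (tensor_power n H) W"
    and "\<And>A. A \<in> carrier (L2 M) \<Longrightarrow> W (l2_mult M \<phi> A) = tensor_power_operator n H T (W A)"
  using tensor_form_unitary tensor_form_operator unfolding M_def \<phi>_def by blast

end

lemma convolution_power_projection:
  assumes \<sigma>: "normalized_borel_measure \<sigma>"
  shows "convolution_power (circle_projection \<sigma>) n
       = distr (PiM {..<n} (\<lambda>_. \<sigma>)) circle_borel (\<lambda>\<omega>. \<Prod>i<n. fst (\<omega> i))"
  unfolding circle_projection_def
  using \<sigma> normalized_borel_measure_fst by (intro convolution_power_distr) (auto simp: normalized_borel_measure_def)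

section \<open>Uniqueness of Fourier coefficients on the circle\<close>

lemma circle_space_eq: "sets \<mu> = sets circle_borel \<Longrightarrow> space \<mu> = sphere 0 1"
  using sets_eq_imp_space_eq[of \<mu> circle_borel] by simp

lemma circle_borel_measurable:
  assumes "sets \<mu> = sets circle_borel" "g \<in> borel_measurable borel"
  shows "g \<in> borel_measurable \<mu>"
proof -
  have "g \<in> borel_measurable circle_borel"
    using measurable_compose[OF circle_measurable_id assms(2)] .
  then show ?thesis using measurable_cong_sets[OF assms(1) refl] by blast
qed

lemma circle_continuous_integrable:
  fixes g :: "complex \<Rightarrow> 'b::{banach, second_countable_topology}"
  assumes \<mu>: "finite_measure \<mu>" "sets \<mu> = sets circle_borel" and g: "continuous_on UNIV g"
  shows "integrable \<mu> g"
proof -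
  interpret finite_measure \<mu> by fact
  have "bounded (g ` sphere 0 1)"
    by (rule compact_imp_bounded[OF compact_continuous_image[OF continuous_on_subset[OF g subset_UNIV] compact_sphere]])
  then obtain B where "\<forall>w\<in>g ` sphere 0 1. norm w \<le> B" unfolding bounded_iff by blast
  then have B: "norm (g z) \<le> B" if "z \<in> sphere 0 1" for z using that by blast
  show ?thesis
  proof (rule integrable_const_bound)
    show "AE x in \<mu>. norm (g x) \<le> B" using B by (intro AE_I2) (simp add: circle_space_eq[OF \<mu>(2)])
    show "g \<in> borel_measurable \<mu>" by (rule circle_borel_measurable[OF \<mu>(2) borel_measurable_continuous_onI[OF g]])
  qed
qed

text \<open>On the circle \<open>cnj z\<close> is the inverse of \<open>z\<close>, so the moments
  with nonnegative exponents and their conjugates cover all mixed monomials.\<close>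

lemma circle_monomial:
  fixes z :: complex
  assumes "cmod z = 1"
  shows "z ^ i * cnj z ^ j = (if j \<le> i then z ^ (i - j) else cnj (z ^ (j - i)))"
proof -
  have 1: "z * cnj z = 1" using assms by (simp add: complex_norm_square[symmetric])
  then have p: "z ^ m * cnj z ^ m = 1" for m by (simp add: power_mult_distrib[symmetric])
  show ?thesis
  proof (cases "j \<le> i")
    case True
    then have "z ^ i * cnj z ^ j = z ^ (i - j) * (z ^ j * cnj z ^ j)"
      by (simp add: mult.assoc[symmetric] power_add[symmetric])
    then show ?thesis using True p by simp
  next
    case False
    then have "z ^ i * cnj z ^ j = cnj z ^ (j - i) * (z ^ i * cnj z ^ i)"
      by (simp add: mult.commute mult.left_commute power_add[symmetric])
    then show ?thesis using False p by simp
  qed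
qed

text \<open>Real polynomial functions of the plane are polynomials in \<open>z\<close> and
  \<open>cnj z\<close>, whose integrals over the circle are determined by the moments. By
  Stone-Weierstrass they approximate \<open>f\<close> uniformly on the circle.\<close>

lemma circle_moments_integral_eq:
  assumes \<mu>: "finite_measure \<mu>" "sets \<mu> = sets circle_borel"
    and \<nu>: "finite_measure \<nu>" "sets \<nu> = sets circle_borel"
    and mom: "\<And>k. (\<integral>z. z ^ k \<partial>\<mu>) = (\<integral>z. z ^ k \<partial>\<nu>)"
    and f: "continuous_on UNIV (f :: complex \<Rightarrow> real)"
  shows "(\<integral>z. f z \<partial>\<mu>) = (\<integral>z. f z \<partial>\<nu>)"
proof -
  note int = circle_continuous_integrable[OF \<mu>] circle_continuous_integrable[OF \<nu>]
  \<comment> \<open>Quantifying over all test monomials inside the class makes it stable under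
    multiplication by \<open>z\<close> and by \<open>cnj z\<close>; this lets the induction on
    polynomial functions handle products by carrying along a factor \<open>g\<close>.\<close>
  define G where "G = {g :: complex \<Rightarrow> complex. continuous_on UNIV g \<and>
      (\<forall>i j. (\<integral>z. g z * (z ^ i * cnj z ^ j) \<partial>\<mu>) = (\<integral>z. g z * (z ^ i * cnj z ^ j) \<partial>\<nu>))}"
  have cont [continuous_intros]: "continuous_on UNIV (\<lambda>z. g z * (z ^ i * cnj z ^ j))" if "continuous_on UNIV g" for g i j
    using that by (intro continuous_intros)
  have G_add: "(\<lambda>z. g z + h z) \<in> G" if "g \<in> G" "h \<in> G" for g h
  proof -
    have c: "continuous_on UNIV g" "continuous_on UNIV h" using that by (auto simp: G_def)
    show ?thesis using that unfolding G_def
      by (auto intro!: continuous_on_add simp: distrib_right int[OF cont] c)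
  qed
  have G_scale: "(\<lambda>z. c * g z) \<in> G" if "g \<in> G" for g c
    using that unfolding G_def by (auto intro!: continuous_on_mult_left simp: mult.assoc)
  have G_z: "(\<lambda>z. z * g z) \<in> G" if "g \<in> G" for g
  proof -
    have "z * g z * (z ^ i * cnj z ^ j) = g z * (z ^ Suc i * cnj z ^ j)" for i j z by simp
    moreover have "continuous_on UNIV (\<lambda>z. z * g z)" using that by (intro continuous_intros) (auto simp: G_def)
    ultimately show ?thesis using that unfolding G_def mem_Collect_eq by presburger
  qed
  have G_cnj: "(\<lambda>z. cnj z * g z) \<in> G" if "g \<in> G" for g
  proof -
    have "cnj z * g z * (z ^ i * cnj z ^ j) = g z * (z ^ i * cnj z ^ Suc j)" for i j z by simp
    moreover have "continuous_on UNIV (\<lambda>z. cnj z * g z)" using that by (intro continuous_intros) (auto simp: G_def)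
    ultimately show ?thesis using that unfolding G_def mem_Collect_eq by presburger
  qed
  have sp: "space \<mu> = sphere 0 1" "space \<nu> = sphere 0 1" using \<mu> \<nu> by (auto simp: circle_space_eq)
  have mono: "(\<integral>z. z ^ i * cnj z ^ j \<partial>\<mu>) = (\<integral>z. z ^ i * cnj z ^ j \<partial>\<nu>)" for i j
  proof (cases "j \<le> i")
    case True
    have "(\<integral>z. z ^ i * cnj z ^ j \<partial>\<mu>) = (\<integral>z. z ^ (i - j) \<partial>\<mu>)" "(\<integral>z. z ^ i * cnj z ^ j \<partial>\<nu>) = (\<integral>z. z ^ (i - j) \<partial>\<nu>)"
      using True by (auto intro!: Bochner_Integration.integral_cong simp: sp circle_monomial)
    then show ?thesis using mom by simp
  next
    case False
    have "(\<integral>z. z ^ i * cnj z ^ j \<partial>\<mu>) = (\<integral>z. cnj (z ^ (j - i)) \<partial>\<mu>)" 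
      "(\<integral>z. z ^ i * cnj z ^ j \<partial>\<nu>) = (\<integral>z. cnj (z ^ (j - i)) \<partial>\<nu>)"
      using False by (auto intro!: Bochner_Integration.integral_cong simp: sp circle_monomial)
    then show ?thesis using mom by (simp only: Bochner_Integration.integral_cnj)
  qed
  have poly: "(\<lambda>z. of_real (p z) * g z) \<in> G" if "real_polynomial_function p" "g \<in> G" for p g
    using that
  proof (induction p arbitrary: g rule: real_polynomial_function.induct)
    case (linear p)
    interpret p: bounded_linear p by fact
    \<comment> \<open>A real-linear function is \<open>Re z * p 1 + Im z * p \<i>\<close>; here the
      two parts are written through \<open>z\<close> and \<open>cnj z\<close>.\<close>
    have eq: "complex_of_real (p z) * g z = (of_real (p 1) / 2 + of_real (p \<i>) / (2 * \<i>)) * (z * g z)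
        + (of_real (p 1) / 2 - of_real (p \<i>) / (2 * \<i>)) * (cnj z * g z)" for z
    proof -
      have "p z = p (Re z *\<^sub>R 1 + Im z *\<^sub>R \<i>)" by (rule arg_cong[of _ _ p]) (simp add: complex_eq_iff)
      also have "\<dots> = Re z * p 1 + Im z * p \<i>" by (simp only: p.add p.scaleR real_scaleR_def)
      finally have "complex_of_real (p z) = of_real (Re z) * of_real (p 1) + of_real (Im z) * of_real (p \<i>)"
        by (simp only: of_real_add of_real_mult)
      also have "complex_of_real (Re z) = (z + cnj z) / 2" by (auto simp: complex_eq_iff)
      also have "complex_of_real (Im z) = (z - cnj z) / (2 * \<i>)" by (auto simp: complex_eq_iff)
      finally have pz: "complex_of_real (p z)
          = (z + cnj z) / 2 * of_real (p 1) + (z - cnj z) / (2 * \<i>) * of_real (p \<i>)" .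
      show ?thesis unfolding pz by (simp add: add_divide_distrib diff_divide_distrib algebra_simps)
    qed
    show ?case unfolding eq by (intro G_add G_scale G_z G_cnj linear)
  next
    case (add p q)
    then show ?case by (auto simp: distrib_right intro!: G_add)
  next
    case (mult p q)
    have "(\<lambda>z. of_real (p z) * (of_real (q z) * g z)) \<in> G" by (intro mult)
    then show ?case by (simp add: mult.assoc)
  qed (intro G_scale)
  have one: "(\<lambda>_. 1) \<in> G" unfolding G_def using mono by auto
  have poly_eq: "(\<integral>z. p z \<partial>\<mu>) = (\<integral>z. p z \<partial>\<nu>)" if "real_polynomial_function p" for p
  proof -
    have "(\<integral>z. of_real (p z) * 1 * (z ^ 0 * cnj z ^ 0) \<partial>\<mu>) = (\<integral>z. of_real (p z) * 1 * (z ^ 0 * cnj z ^ 0) \<partial>\<nu>)"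
      using poly[OF that one] unfolding G_def by blast
    then have "complex_of_real (\<integral>z. p z \<partial>\<mu>) = complex_of_real (\<integral>z. p z \<partial>\<nu>)" by simp
    then show ?thesis by (rule of_real_eq_iff[THEN iffD1])
  qed
  have "\<bar>(\<integral>z. f z \<partial>\<mu>) - (\<integral>z. f z \<partial>\<nu>)\<bar> \<le> (measure \<mu> (space \<mu>) + measure \<nu> (space \<nu>)) * e" if e: "e > 0" for e
  proof -
    obtain p where p: "real_polynomial_function p" "\<And>z. z \<in> sphere 0 1 \<Longrightarrow> \<bar>f z - p z\<bar> < e"
      using that by (rule Stone_Weierstrass_real_polynomial_function[OF compact_sphere continuous_on_subset[OF f subset_UNIV] e])
    have pc: "continuous_on UNIV p"
      using p(1) by (simp add: real_polynomial_function_eq continuous_on_polymonial_function)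
    have b: "\<bar>(\<integral>z. f z \<partial>\<kappa>) - (\<integral>z. p z \<partial>\<kappa>)\<bar> \<le> measure \<kappa> (space \<kappa>) * e"
      if \<kappa>: "finite_measure \<kappa>" "sets \<kappa> = sets circle_borel" for \<kappa>
    proof -
      interpret \<kappa>: finite_measure \<kappa> by fact
      note i = circle_continuous_integrable[OF \<kappa> f] circle_continuous_integrable[OF \<kappa> pc]
      have "(\<integral>z. f z \<partial>\<kappa>) - (\<integral>z. p z \<partial>\<kappa>) = (\<integral>z. f z - p z \<partial>\<kappa>)" using i by simp
      also have "\<bar>\<dots>\<bar> \<le> (\<integral>z. \<bar>f z - p z\<bar> \<partial>\<kappa>)" by (rule integral_abs_bound)
      also have "\<dots> \<le> (\<integral>z. e \<partial>\<kappa>)"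
        using i p(2) by (intro integral_mono) (auto simp: circle_space_eq[OF \<kappa>(2)] less_imp_le)
      finally show ?thesis by simp
    qed
    show ?thesis using b[OF \<mu>] b[OF \<nu>] poly_eq[OF p(1)] by (simp add: distrib_right)
  qed
  note bound = this
  \<comment> \<open>The summand \<open>1\<close> keeps \<open>m\<close> positive even if both
    measures are zero, so that division by \<open>m\<close> is possible.\<close>
  define m where "m = measure \<mu> (space \<mu>) + measure \<nu> (space \<nu>) + 1"
  have m: "m > 0" unfolding m_def by (intro add_nonneg_pos add_nonneg_nonneg measure_nonneg) auto
  have "\<bar>(\<integral>z. f z \<partial>\<mu>) - (\<integral>z. f z \<partial>\<nu>)\<bar> \<le> 0 + e" if "e > 0" for e
  proof -
    have "\<bar>(\<integral>z. f z \<partial>\<mu>) - (\<integral>z. f z \<partial>\<nu>)\<bar> \<le> (m - 1) * (e / m)"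
      using bound[of "e / m"] m that by (simp add: m_def)
    also have "\<dots> \<le> m * (e / m)" using m that by (intro mult_right_mono) auto
    finally show ?thesis using m by simp
  qed
  then have "\<bar>(\<integral>z. f z \<partial>\<mu>) - (\<integral>z. f z \<partial>\<nu>)\<bar> \<le> 0" by (rule field_le_epsilon)
  then show ?thesis by simp
qed

text \<open>The indicator of a closed set is the pointwise limit of the bounded continuous functions
  \<open>max 0 (1 - k d(z, F))\<close>, and closed sets form an intersection-stable
  generator.\<close>

theorem circle_moments_unique:
  assumes \<mu>: "finite_measure \<mu>" "sets \<mu> = sets circle_borel"
    and \<nu>: "finite_measure \<nu>" "sets \<nu> = sets circle_borel"
    and mom: "\<And>k. (\<integral>z. z ^ k \<partial>\<mu>) = (\<integral>z. z ^ k \<partial>\<nu>)"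
  shows "\<mu> = \<nu>"
proof -
  have closed_eq: "emeasure \<mu> (F \<inter> sphere 0 1) = emeasure \<nu> (F \<inter> sphere 0 1)" if F: "closed F" for F
  proof (cases "F = {}")
    case False
    define f where "f k z = max 0 (1 - real k * infdist z F)" for k z
    have fc: "continuous_on UNIV (f k)" for k unfolding f_def by (intro continuous_intros)
    have lim: "(\<lambda>k. f k z) \<longlonglongrightarrow> indicator F z" for z
    proof (cases "z \<in> F")
      case True
      then show ?thesis by (simp add: f_def)
    next
      case False
      then have d: "infdist z F > 0" using F \<open>F \<noteq> {}\<close> 
        by (metis in_closed_iff_infdist_zero infdist_nonneg less_eq_real_def)
      obtain K where K: "real K * infdist z F > 1" using reals_Archimedean3[OF d] by blast
      have "f k z = 0" if "k \<ge> K" for k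
      proof -
        have "real K * infdist z F \<le> real k * infdist z F" using that d by (intro mult_right_mono) auto
        then show ?thesis using K by (simp add: f_def)
      qed
      then have "(\<lambda>k. f k z) \<longlonglongrightarrow> 0"
        by (intro tendsto_eventually eventually_sequentiallyI[of K]) auto
      then show ?thesis using False by simp
    qed
    have conv: "(\<lambda>k. \<integral>z. f k z \<partial>\<kappa>) \<longlonglongrightarrow> measure \<kappa> (F \<inter> sphere 0 1)"
      if \<kappa>: "finite_measure \<kappa>" "sets \<kappa> = sets circle_borel" for \<kappa>
    proof -
      interpret \<kappa>: finite_measure \<kappa> by fact
      have Fm: "indicator F \<in> borel_measurable borel" using F by (intro borel_measurable_indicator) auto
      have "(\<lambda>k. \<integral>z. f k z \<partial>\<kappa>) \<longlonglongrightarrow> (\<integral>z. indicator F z \<partial>\<kappa>)"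
      proof (rule integral_dominated_convergence[where w="\<lambda>_. 1"])
        show "(indicator F :: _ \<Rightarrow> real) \<in> borel_measurable \<kappa>" by (rule circle_borel_measurable[OF \<kappa>(2) Fm])
        show "f k \<in> borel_measurable \<kappa>" for k
          by (rule circle_borel_measurable[OF \<kappa>(2) borel_measurable_continuous_onI[OF fc]])
        show "AE z in \<kappa>. norm (f k z) \<le> 1" for k by (auto simp: f_def infdist_nonneg)
      qed (use lim in auto)
      moreover have "(\<integral>z. indicator F z \<partial>\<kappa>) = measure \<kappa> (F \<inter> sphere 0 1)"
        by (simp add: circle_space_eq[OF \<kappa>(2)])
      ultimately show ?thesis by simp
    qed
    have "measure \<mu> (F \<inter> sphere 0 1) = measure \<nu> (F \<inter> sphere 0 1)"
      using conv[OF \<mu>] conv[OF \<nu>] circle_moments_integral_eq[OF \<mu> \<nu> mom fc]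
      by (simp add: LIMSEQ_unique)
    then show ?thesis using \<mu>(1) \<nu>(1) by (simp add: finite_measure.emeasure_eq_measure)
  qed simp
  have id: "(\<lambda>z. z) \<in> measurable \<kappa> borel" if "sets \<kappa> = sets circle_borel" for \<kappa>
    using circle_borel_measurable[OF that, of "\<lambda>z. z"] by simp
  \<comment> \<open>Both measures are pushed to the whole plane, where closed sets generate
    \<open>borel\<close>, and are recovered afterwards because they live on the circle.\<close>
  have "distr \<mu> borel (\<lambda>z. z) = distr \<nu> borel (\<lambda>z. z)"
  proof (rule measure_eqI_generator_eq[where E="Collect closed" and \<Omega>=UNIV and A="\<lambda>_. UNIV"])
    show "emeasure (distr \<mu> borel (\<lambda>z. z)) F = emeasure (distr \<nu> borel (\<lambda>z. z)) F" if "F \<in> Collect closed" for F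
    proof -
      have "F \<in> sets borel" using that by simp
      then show ?thesis
        using closed_eq[of F] that id[OF \<mu>(2)] id[OF \<nu>(2)]
        by (simp add: emeasure_distr circle_space_eq \<mu>(2) \<nu>(2) vimage_def)
    qed
    show "sets (distr \<mu> borel (\<lambda>z. z)) = sigma_sets UNIV (Collect closed)"
      "sets (distr \<nu> borel (\<lambda>z. z)) = sigma_sets UNIV (Collect closed)"
      by (simp_all add: borel_eq_closed)
    show "emeasure (distr \<mu> borel (\<lambda>z. z)) UNIV \<noteq> \<infinity>"
      using \<mu>(1) id[OF \<mu>(2)] by (simp add: emeasure_distr finite_measure.emeasure_finite)
  qed (auto simp: Int_stable_def)
  then have eq: "emeasure (distr \<mu> borel (\<lambda>z. z)) A = emeasure (distr \<nu> borel (\<lambda>z. z)) A" for A by simp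
  show ?thesis
  proof (rule measure_eqI)
    fix A assume "A \<in> sets \<mu>"
    then have A: "A \<subseteq> sphere 0 1" "A \<in> sets borel"
      unfolding \<mu>(2) circle_borel_def by (auto simp: sets_restrict_space)
    then show "emeasure \<mu> A = emeasure \<nu> A"
      using eq[of A] id[OF \<mu>(2)] id[OF \<nu>(2)]
      by (simp add: emeasure_distr circle_space_eq \<mu>(2) \<nu>(2) vimage_def Int_absorb1 Int_absorb2)
  qed (simp add: \<mu>(2) \<nu>(2))
qed

section \<open>Spectral measures dominate the laws of multiplication operators\<close>

lemma ae_class_one_power:
  assumes "prob_space M" "\<phi> \<in> measurable M circle_borel"
  shows "square_integrable M (\<lambda>x. \<phi> x ^ k)"
proof -
  interpret prob_space M by fact
  show ?thesis
    using assms(2) by (intro square_integrable_bounded[of _ 1]) (auto simp: measurable_circle_borel_iff norm_power)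
qed

text \<open>Let \<open>g\<close> be the image of the constant \<open>1\<close>. Intertwining sends
  the powers of \<open>\<phi>\<close> to \<open>z ^ k g\<close>, so preservation of inner products
  says that the law of \<open>\<phi>\<close> and the projection of \<open>|g|^2 d\<tau>\<close> have
  the same moments. They coincide, and the latter is absolutely continuous with respect to the
  projection of \<open>\<tau>\<close>.\<close>

theorem spectral_measure_dominates:
  assumes M: "prob_space M" and \<phi>: "\<phi> \<in> measurable M circle_borel"
    and \<tau>: "normalized_borel_measure \<tau>"
    and R: "unitary_map (L2 M) (L2 \<tau>) R"
    and RT: "\<And>A. A \<in> carrier (L2 M) \<Longrightarrow> R (l2_mult M \<phi> A) = coordinate_multiplication \<tau> (R A)"
  shows "absolutely_continuous (circle_projection \<tau>) (distr M circle_borel \<phi>)"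
proof -
  interpret M: prob_space M by fact
  interpret \<tau>: prob_space \<tau> using \<tau> by (simp add: normalized_borel_measure_def)
  note sq = ae_class_one_power[OF M \<phi>]
  have \<phi>b [measurable]: "\<phi> \<in> borel_measurable M" using \<phi> by (rule measurable_circle_borel_D)
  have fst_circle [measurable]: "fst \<in> measurable \<tau> circle_borel" using \<tau> by (rule normalized_borel_measure_fst)
  have fst_b [measurable]: "fst \<in> borel_measurable \<tau>" using fst_circle by (rule measurable_circle_borel_D)
  define g where "g = rep (R (ae_class M (\<lambda>_. 1)))"
  have c1: "ae_class M (\<lambda>x. \<phi> x ^ k) \<in> carrier (L2 M)" for k using sq by (rule L2_carrierI)
  have g: "square_integrable \<tau> g" unfolding g_def
    using unitary_mapD(5)[OF R c1[of 0]] by (intro square_integrable_rep) simp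
  have g_m [measurable]: "g \<in> borel_measurable \<tau>" using g by (rule square_integrable_measurable)
  have pk: "square_integrable \<tau> (\<lambda>z. fst z ^ k * g z)" for k
    using fst_circle by (intro square_integrable_bounded_mult[OF g, of _ 1]) (auto simp: measurable_circle_borel_iff norm_power)
  have Rk: "R (ae_class M (\<lambda>x. \<phi> x ^ k)) = ae_class \<tau> (\<lambda>z. fst z ^ k * g z)" for k
  proof (induction k)
    case 0
    show ?case using unitary_mapD(5)[OF R c1[of 0]] by (simp add: g_def ae_class_rep)
  next
    case (Suc k)
    have "ae_class M (\<lambda>x. \<phi> x ^ Suc k) = l2_mult M \<phi> (ae_class M (\<lambda>x. \<phi> x ^ k))"
      by (subst l2_mult_class) auto
    then have "R (ae_class M (\<lambda>x. \<phi> x ^ Suc k)) = l2_mult \<tau> fst (ae_class \<tau> (\<lambda>z. fst z ^ k * g z))"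
      using RT[OF c1[of k]] by (simp add: Suc coordinate_multiplication_eq)
    also have "\<dots> = ae_class \<tau> (\<lambda>z. fst z * (fst z ^ k * g z))"
      by (rule l2_mult_class) measurable
    finally show ?case by (simp add: mult.assoc)
  qed
  define \<kappa> where "\<kappa> = distr (density \<tau> (\<lambda>z. ennreal ((cmod (g z))\<^sup>2))) circle_borel fst"
  have gint: "integrable \<tau> (\<lambda>z. (cmod (g z))\<^sup>2)" using g by (simp add: square_integrable_def)
  have fm: "finite_measure (density \<tau> (\<lambda>z. ennreal ((cmod (g z))\<^sup>2)))"
  proof
    have "emeasure (density \<tau> (\<lambda>z. ennreal ((cmod (g z))\<^sup>2))) (space \<tau>) = (\<integral>\<^sup>+z. ennreal ((cmod (g z))\<^sup>2) \<partial>\<tau>)"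
      by (subst emeasure_density) (auto intro!: nn_integral_cong)
    also have "\<dots> < \<infinity>" using gint by (simp add: nn_integral_eq_integral)
    finally show "emeasure (density \<tau> (\<lambda>z. ennreal ((cmod (g z))\<^sup>2))) (space (density \<tau> (\<lambda>z. ennreal ((cmod (g z))\<^sup>2)))) \<noteq> \<infinity>" by simp
  qed
  have "distr M circle_borel \<phi> = \<kappa>"
  proof (rule circle_moments_unique)
    interpret D: prob_space "distr M circle_borel \<phi>" using \<phi> by (rule M.prob_space_distr)
    show "finite_measure (distr M circle_borel \<phi>)" by (rule D.finite_measure_axioms)
    show "finite_measure \<kappa>" unfolding \<kappa>_def by (rule finite_measure.finite_measure_distr[OF fm]) simp
    fix k
    have zk: "(\<lambda>z. z ^ k :: complex) \<in> borel_measurable circle_borel" by (rule circle_borel_measurable) auto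
    \<comment> \<open>The constant \<open>1\<close> is written as a zeroth power so that
      \<open>Rk\<close> applies to both arguments of the inner product.\<close>
    have "(\<integral>z. z ^ k \<partial>distr M circle_borel \<phi>) = l2ip M (\<lambda>x. \<phi> x ^ 0) (\<lambda>x. \<phi> x ^ k)"
      using zk \<phi> by (simp add: integral_distr l2ip_def)
    also have "\<dots> = ip (L2 \<tau>) (R (ae_class M (\<lambda>x. \<phi> x ^ 0))) (R (ae_class M (\<lambda>x. \<phi> x ^ k)))"
      unfolding unitary_mapD(4)[OF R c1 c1] by (rule ip_L2_class[OF sq sq, symmetric])
    also have "\<dots> = l2ip \<tau> (\<lambda>z. fst z ^ 0 * g z) (\<lambda>z. fst z ^ k * g z)"
      unfolding Rk by (rule ip_L2_class[OF pk pk])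
    also have "\<dots> = (\<integral>z. (cmod (g z))\<^sup>2 *\<^sub>R fst z ^ k \<partial>\<tau>)"
      unfolding l2ip_def
      by (intro Bochner_Integration.integral_cong refl)
         (simp add: scaleR_conv_of_real cnj_mult_self[symmetric] mult.commute mult.left_commute del: of_real_power)
    also have "\<dots> = (\<integral>z. fst z ^ k \<partial>density \<tau> (\<lambda>z. (cmod (g z))\<^sup>2))"
      by (rule integral_density[symmetric]) auto
    also have "\<dots> = (\<integral>z. z ^ k \<partial>\<kappa>)" unfolding \<kappa>_def using zk by (subst integral_distr) auto
    finally show "(\<integral>z. z ^ k \<partial>distr M circle_borel \<phi>) = (\<integral>z. z ^ k \<partial>\<kappa>)" .
  qed (simp_all add: \<kappa>_def)
  moreover have "absolutely_continuous (circle_projection \<tau>) \<kappa>"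
    unfolding absolutely_continuous_def
  proof
    fix A assume A: "A \<in> null_sets (circle_projection \<tau>)"
    then have [measurable]: "A \<in> sets circle_borel" by (auto simp: circle_projection_def)
    have "fst -` A \<inter> space \<tau> \<in> null_sets \<tau>"
      using A by (auto simp: circle_projection_def null_sets_def emeasure_distr)
    then have "AE z in \<tau>. fst z \<notin> A" by (intro AE_I'[of "fst -` A \<inter> space \<tau>"]) auto
    then have "AE z in \<tau>. z \<in> fst -` A \<inter> space \<tau> \<longrightarrow> ennreal ((cmod (g z))\<^sup>2) = 0" by eventually_elim simp
    then have "fst -` A \<inter> space \<tau> \<in> null_sets (density \<tau> (\<lambda>z. ennreal ((cmod (g z))\<^sup>2)))"
      by (subst null_sets_density_iff) auto
    then show "A \<in> null_sets \<kappa>" unfolding \<kappa>_def by (auto simp: null_sets_def emeasure_distr)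
  qed
  ultimately show ?thesis by simp
qed

text \<open>The product model followed by the given equivalence intertwines multiplication by the
  product of the coordinates with \<open>coordinate_multiplication\<close>; the law of that product
  is the convolution power.\<close>

theorem tensor_power_spectral_measure_dominates:
  assumes T: "unitary_operator H T" and \<sigma>: "is_spectral_measure H T \<sigma>"
    and \<tau>: "is_spectral_measure (tensor_power n H) (tensor_power_operator n H T) \<tau>"
  shows "absolutely_continuous (circle_projection \<tau>) (convolution_power (circle_projection \<sigma>) n)"
proof -
  let ?M = "PiM {..<n} (\<lambda>_. \<sigma>)" and ?\<phi> = "\<lambda>\<omega>. \<Prod>i<n. fst (\<omega> i) :: complex"
  from \<sigma> obtain U0 where n\<sigma>: "normalized_borel_measure \<sigma>" and U0: "unitary_map H (L2 \<sigma>) U0"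
    "\<And>x. x \<in> carrier H \<Longrightarrow> U0 (T x) = coordinate_multiplication \<sigma> (U0 x)"
    by (auto simp: is_spectral_measure_def unitarily_equivalent_def)
  from \<tau> obtain U where n\<tau>: "normalized_borel_measure \<tau>" and U: "unitary_map (tensor_power n H) (L2 \<tau>) U"
    "\<And>x. x \<in> carrier (tensor_power n H) \<Longrightarrow> U (tensor_power_operator n H T x) = coordinate_multiplication \<tau> (U x)"
    by (auto simp: is_spectral_measure_def unitarily_equivalent_def)
  obtain W where W: "unitary_map (L2 ?M) (tensor_power n H) W"
    "\<And>A. A \<in> carrier (L2 ?M) \<Longrightarrow> W (l2_mult ?M ?\<phi> A) = tensor_power_operator n H T (W A)"
    using U0(2) that by (rule tensor_power_model[where n=n, OF n\<sigma> U0(1) _ T])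
  have M: "prob_space ?M" using n\<sigma> by (intro prob_space_PiM) (simp add: normalized_borel_measure_def)
  have \<phi>: "?\<phi> \<in> measurable ?M circle_borel"
    by (intro measurable_circle_prod measurable_PiM_component normalized_borel_measure_fst n\<sigma>)
  show ?thesis
    unfolding convolution_power_projection[OF n\<sigma>]
    using unitary_map_comp[OF W(1) U(1)]
    by (rule spectral_measure_dominates[OF M \<phi> n\<tau>]) (simp add: W(2) U(2) unitary_mapD(5)[OF W(1)])
qed

lemma mutually_singular_dominated:
  assumes "mutually_singular \<kappa> N" "absolutely_continuous \<kappa> \<mu>" "sets \<mu> = sets \<kappa>"
  shows "mutually_singular \<mu> N"
proof -
  from assms(1) obtain A where A: "A \<in> sets \<kappa> \<inter> sets N" "emeasure \<kappa> (space \<kappa> - A) = 0" "emeasure N A = 0"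
    unfolding mutually_singular_def by blast
  then have "space \<kappa> - A \<in> null_sets \<kappa>" by auto
  then have "space \<kappa> - A \<in> null_sets \<mu>" using assms(2) by (auto simp: absolutely_continuous_def)
  moreover have "space \<mu> = space \<kappa>" using assms(3) by (rule sets_eq_imp_space_eq)
  ultimately show ?thesis using A assms(3) unfolding mutually_singular_def by (auto simp: null_sets_def)
qed

lemma absolutely_continuous_trans:
  "absolutely_continuous L M \<Longrightarrow> absolutely_continuous M N \<Longrightarrow> absolutely_continuous L N"
  by (auto simp: absolutely_continuous_def)

section \<open>Spectral measures of multiplication operators\<close>

text \<open>Equal Gram matrices mean that both \<open>L2\<close> spaces are identified with the same
  kernel space, and \<open>R\<close> is one identification followed by the inverse of the other. The
  two multiplications correspond because both act on forms by the same relabelling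
  \<open>s\<close>.\<close>

lemma gram_unitary:
  assumes M: "finite_measure M" "l2_total M \<Lambda> u" and N: "finite_measure N" "l2_total N \<Lambda> v"
    and gram: "\<And>x y. x \<in> \<Lambda> \<Longrightarrow> y \<in> \<Lambda> \<Longrightarrow> l2ip M (u x) (u y) = l2ip N (v x) (v y)"
    and \<phi>: "\<phi> \<in> borel_measurable M" "AE x in M. cmod (\<phi> x) = 1"
    and \<psi>: "\<psi> \<in> borel_measurable N" "AE x in N. cmod (\<psi> x) = 1"
    and s: "\<And>x. x \<in> \<Lambda> \<Longrightarrow> s x \<in> \<Lambda>" "\<And>x. x \<in> \<Lambda> \<Longrightarrow> AE z in M. u (s x) z = cnj (\<phi> z) * u x z"
      "\<And>x. x \<in> \<Lambda> \<Longrightarrow> AE z in N. v (s x) z = cnj (\<psi> z) * v x z"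
  obtains R where "unitary_map (L2 M) (L2 N) R"
    "\<And>A. A \<in> carrier (L2 M) \<Longrightarrow> R (l2_mult M \<phi> A) = l2_mult N \<psi> (R A)"
proof -
  define k where "k x y = l2ip M (u x) (u y)" for x y
  let ?U = "form_of M \<Lambda> u" and ?V = "form_of N \<Lambda> v"
  have U: "unitary_map (L2 M) (kernel_space \<Lambda> k) ?U" by (rule form_of_unitary[OF M k_def])
  have V: "unitary_map (L2 N) (kernel_space \<Lambda> k) ?V"
    by (rule form_of_unitary[OF N]) (simp add: k_def gram)
  define R where "R A = inv_into (carrier (L2 N)) ?V (?U A)" for A
  have Vi: "unitary_map (kernel_space \<Lambda> k) (L2 N) (inv_into (carrier (L2 N)) ?V)"
    by (rule unitary_map_inv_into[OF V L2_add_closed L2_smult_closed])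
  have R: "unitary_map (L2 M) (L2 N) R" unfolding R_def by (rule unitary_map_comp[OF U Vi])
  have VR: "?V (R A) = ?U A" if "A \<in> carrier (L2 M)" for A
    using unitary_mapD(5)[OF U that] bij_betw_imp_surj_on[OF unitary_mapD(1)[OF V]]
    unfolding R_def by (intro f_inv_into_f) simp
  have le1: "AE x in M. cmod (\<phi> x) \<le> 1" "AE x in N. cmod (\<psi> x) \<le> 1"
    using \<phi>(2) \<psi>(2) by (auto elim!: eventually_mono)
  have "R (l2_mult M \<phi> A) = l2_mult N \<psi> (R A)" if A: "A \<in> carrier (L2 M)" for A
  \<comment> \<open>Equality is tested after applying the injective \<open>?V\<close>, where both
    sides become the form of \<open>A\<close> composed with \<open>s\<close>.\<close>
  proof (rule inj_onD[OF bij_betw_imp_inj_on[OF unitary_mapD(1)[OF V]]])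
    have RA: "R A \<in> carrier (L2 N)" using unitary_mapD(5)[OF R A] .
    have mA: "l2_mult M \<phi> A \<in> carrier (L2 M)" by (rule l2_mult_carrier[OF A \<phi>(1) le1(1)])
    show "R (l2_mult M \<phi> A) \<in> carrier (L2 N)" using unitary_mapD(5)[OF R mA] .
    show "l2_mult N \<psi> (R A) \<in> carrier (L2 N)" by (rule l2_mult_carrier[OF RA \<psi>(1) le1(2)])
    show "?V (R (l2_mult M \<phi> A)) = ?V (l2_mult N \<psi> (R A))"
    proof -
      have "?U (l2_mult M \<phi> A) = (\<lambda>x\<in>\<Lambda>. ?U A (s x))" by (rule form_of_mult[OF M A \<phi>]) (fact s)+
      moreover have "?V (l2_mult N \<psi> (R A)) = (\<lambda>x\<in>\<Lambda>. ?V (R A) (s x))" by (rule form_of_mult[OF N RA \<psi>]) (fact s)+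
      ultimately show ?thesis by (simp only: VR[OF mA] VR[OF A])
    qed
  qed
  with R that show ?thesis by blast
qed

text \<open>These functions act as scalars: through composition with \<open>\<phi>\<close>,
  \<open>L2 M\<close> is a module over them, and boundedness keeps products square
  integrable.\<close>

definition circle_bounded :: "(complex \<Rightarrow> complex) set" where
  "circle_bounded = {h \<in> borel_measurable circle_borel. \<exists>c. \<forall>z\<in>sphere 0 1. cmod (h z) \<le> c}"

lemma circle_boundedE:
  assumes "h \<in> circle_bounded"
  obtains c where "\<And>z. z \<in> sphere 0 1 \<Longrightarrow> cmod (h z) \<le> c"
  using assms unfolding circle_bounded_def by blast

lemma circle_bounded_const: "(\<lambda>_. c) \<in> circle_bounded"
  by (auto simp: circle_bounded_def)

lemma circle_bounded_mult:
  assumes "g \<in> circle_bounded" "h \<in> circle_bounded"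
  shows "(\<lambda>z. g z * h z) \<in> circle_bounded"
proof -
  obtain c d where "\<forall>z\<in>sphere 0 1. cmod (g z) \<le> c" "\<forall>z\<in>sphere 0 1. cmod (h z) \<le> d"
    using assms unfolding circle_bounded_def by blast
  then have "\<forall>z\<in>sphere 0 1. cmod (g z * h z) \<le> \<bar>c\<bar> * \<bar>d\<bar>"
    by (auto simp: norm_mult intro!: mult_mono)
  then show ?thesis using assms by (auto simp: circle_bounded_def intro!: borel_measurable_times exI)
qed

lemma circle_bounded_cnj: "cnj \<in> circle_bounded"
  using borel_measurable_cnj[OF circle_measurable_id] by (auto simp: circle_bounded_def intro!: exI[of _ 1])

lemma circle_bounded_cnj': "h \<in> circle_bounded \<Longrightarrow> (\<lambda>z. cnj (h z)) \<in> circle_bounded"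
  using borel_measurable_cnj[of h circle_borel] by (auto simp: circle_bounded_def)

lemma circle_bounded_indicator: "E \<in> sets circle_borel \<Longrightarrow> indicator E \<in> circle_bounded"
  by (auto simp: circle_bounded_def indicator_def intro!: exI[of _ 1] borel_measurable_indicator)

lemma circle_bounded_of_real:
  assumes "p \<in> borel_measurable circle_borel" "\<And>z. z \<in> sphere 0 1 \<Longrightarrow> \<bar>p z\<bar> \<le> c"
  shows "(\<lambda>z. of_real (p z)) \<in> circle_bounded"
  using assms by (auto simp: circle_bounded_def intro!: exI[of _ c])

text \<open>A system \<open>g\<close> orthogonal over the functions of \<open>\<phi>\<close> splits \<open>L2 M\<close> into copies of spaces over the
  circle; \<open>\<tau>\<close> has \<open>t\<close>-marginals \<open>a\<^sub>k |g\<^sub>k|\<^sup>2 dM\<close> transported by \<open>\<phi>\<close>, with weights \<open>a\<^sub>k > 0\<close> making it a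
  probability measure.\<close>

lemma orthogonal_system_spectral_measure:
  fixes g :: "nat \<Rightarrow> 'x \<Rightarrow> real" and \<phi> :: "'x \<Rightarrow> complex"
  defines "\<Lambda> \<equiv> circle_bounded \<times> (UNIV :: nat set)" and "u \<equiv> \<lambda>(h, j) x. h (\<phi> x) * of_real (g j x)"
  assumes M: "prob_space M" and \<phi>: "\<phi> \<in> measurable M circle_borel"
    and g: "\<And>k. g k \<in> borel_measurable M" "\<And>k x. \<bar>g k x\<bar> \<le> 1" "\<And>x. x \<in> space M \<Longrightarrow> g 0 x = 1"
    and orth: "\<And>h j k. h \<in> circle_bounded \<Longrightarrow> j \<noteq> k \<Longrightarrow> (\<integral>x. h (\<phi> x) * of_real (g j x * g k x) \<partial>M) = 0"
    and total: "l2_total M \<Lambda> u"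
  obtains \<tau> R where "normalized_borel_measure \<tau>" "unitary_map (L2 M) (L2 \<tau>) R"
    "\<And>A. A \<in> carrier (L2 M) \<Longrightarrow> R (l2_mult M \<phi> A) = coordinate_multiplication \<tau> (R A)"
    "absolutely_continuous (distr M circle_borel \<phi>) (circle_projection \<tau>)"
proof -
  interpret M: prob_space M by fact
  have [measurable]: "\<phi> \<in> measurable M circle_borel" "\<And>k. g k \<in> borel_measurable M" by (fact \<phi>, fact g(1))
  let ?N = "count_space (UNIV :: nat set)"
  interpret N: sigma_finite_measure ?N by (rule sigma_finite_measure_count_space)
  interpret MN: pair_sigma_finite M ?N ..
  have g2: "(g k x)\<^sup>2 \<le> 1" for k x using g(2)[of k x] by (simp add: abs_square_le_1)
  have gint: "integrable M (\<lambda>x. (g k x)\<^sup>2)" for k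
    using g2 by (intro M.integrable_const_bound[of _ 1]) auto
  define b where "b k = (\<integral>x. (g k x)\<^sup>2 \<partial>M)" for k
  have b0: "b k \<ge> 0" for k unfolding b_def by (rule integral_nonneg_AE) auto
  have b1: "b k \<le> 1" for k
  proof -
    have "b k \<le> (\<integral>x. 1 \<partial>M)" unfolding b_def using g2 by (intro integral_mono gint) auto
    then show ?thesis by (simp add: M.prob_space)
  qed
  have "b 0 = (\<integral>x. 1 \<partial>M)" unfolding b_def using g(3) by (intro Bochner_Integration.integral_cong) auto
  then have b00: "b 0 = 1" by (simp add: M.prob_space)
  define s where "s = suminf (\<lambda>k. (1/2)^Suc k * b k)"
  have sm: "summable (\<lambda>k. (1/2)^Suc k * b k)"
  proof (rule summable_comparison_test'[where N=0])
    show "summable (\<lambda>k. (1/2::real)^Suc k)"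
      by (subst summable_Suc_iff[of "\<lambda>k. (1/2)^k"]) (rule summable_geometric, simp)
    show "norm ((1/2)^Suc k * b k) \<le> (1/2)^Suc k" for k
    proof -
      have "norm ((1/2)^Suc k * b k) = (1/2)^Suc k * b k" using b0[of k] by simp
      also have "\<dots> \<le> (1/2)^Suc k * 1" by (rule mult_left_mono[OF b1]) simp
      finally show ?thesis by simp
    qed
  qed
  \<comment> \<open>The index \<open>0\<close> alone contributes \<open>1/2\<close>, since
    \<open>g 0 = 1\<close> on the space.\<close>
  have "(\<Sum>k<1. (1/2)^Suc k * b k) \<le> s"
    unfolding s_def using b0 by (intro sum_le_suminf sm) auto
  then have s0: "s > 0" using b00 by simp
  \<comment> \<open>All weights are positive, also where \<open>g k\<close> vanishes almost
    everywhere: they are inverted below, and a vanishing \<open>g k\<close> merely makes slice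
    \<open>k\<close> of \<open>\<tau>\<close> a null set.\<close>
  define a where "a k = (1/2)^Suc k / s" for k :: nat
  have a0: "a k > 0" for k using s0 by (simp add: a_def)
  have sums: "(\<lambda>k. a k * b k) sums 1"
  proof -
    have "(\<lambda>k. (1/2)^Suc k * b k / s) sums (s / s)" using sm unfolding s_def by (intro sums_divide summable_sums)
    then show ?thesis using s0 by (simp add: a_def)
  qed
  define d where "d = (\<lambda>(x, k). a k * (g k x)\<^sup>2)"
  have d0: "d p \<ge> 0" for p using a0[THEN less_imp_le] by (simp add: d_def split: prod.split)
  have [measurable]: "(\<lambda>p. g (snd p) (fst p)) \<in> borel_measurable (M \<Otimes>\<^sub>M ?N)"
    by (rule measurable_compose_countable'[where f="\<lambda>k p. g k (fst p)" and g=snd and I=UNIV]) auto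
  have [measurable]: "(\<lambda>p. a (snd p)) \<in> borel_measurable (M \<Otimes>\<^sub>M ?N)"
    by (rule measurable_compose[OF measurable_snd]) simp
  have d_m [measurable]: "d \<in> borel_measurable (M \<Otimes>\<^sub>M ?N)"
    unfolding d_def case_prod_unfold by measurable
  define D where "D = density (M \<Otimes>\<^sub>M ?N) (\<lambda>p. ennreal (d p))"
  define \<Phi> where "\<Phi> = (\<lambda>p :: 'x \<times> nat. (\<phi> (fst p), snd p))"
  have \<Phi> [measurable]: "\<Phi> \<in> measurable (M \<Otimes>\<^sub>M ?N) (circle_borel \<Otimes>\<^sub>M ?N)" unfolding \<Phi>_def by measurable
  define \<tau> where "\<tau> = distr D (circle_borel \<Otimes>\<^sub>M ?N) \<Phi>"
  have sets_\<tau>: "sets \<tau> = sets (circle_borel \<Otimes>\<^sub>M ?N)" by (simp add: \<tau>_def)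
  have nn: "(\<integral>\<^sup>+p. F p \<partial>\<tau>) = (\<integral>\<^sup>+x. suminf (\<lambda>k. ennreal (a k * (g k x)\<^sup>2) * F (\<phi> x, k)) \<partial>M)"
    if [measurable]: "F \<in> borel_measurable (circle_borel \<Otimes>\<^sub>M ?N)" for F
  proof -
    have "(\<integral>\<^sup>+p. F p \<partial>\<tau>) = (\<integral>\<^sup>+p. ennreal (d p) * F (\<Phi> p) \<partial>(M \<Otimes>\<^sub>M ?N))"
      unfolding \<tau>_def D_def by (subst nn_integral_distr) (auto simp: nn_integral_density)
    also have "\<dots> = (\<integral>\<^sup>+x. \<integral>\<^sup>+k. ennreal (d (x, k)) * F (\<Phi> (x, k)) \<partial>?N \<partial>M)"
      by (rule N.nn_integral_fst[symmetric]) measurable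
    finally show ?thesis by (simp add: nn_integral_count_space_nat d_def \<Phi>_def)
  qed
  have "emeasure \<tau> (space \<tau>) = (\<integral>\<^sup>+p. 1 \<partial>\<tau>)" by simp
  also have "\<dots> = (\<integral>\<^sup>+x. suminf (\<lambda>k. ennreal (a k * (g k x)\<^sup>2)) \<partial>M)" by (subst nn) auto
  also have "\<dots> = suminf (\<lambda>k. \<integral>\<^sup>+x. ennreal (a k * (g k x)\<^sup>2) \<partial>M)" by (rule nn_integral_suminf) measurable
  also have "\<dots> = suminf (\<lambda>k. ennreal (a k * b k))"
    using a0 by (intro suminf_cong) (simp add: b_def nn_integral_eq_integral gint less_imp_le)
  also have "\<dots> = ennreal (suminf (\<lambda>k. a k * b k))"
    using a0 b0 sums by (intro suminf_ennreal2) (auto simp: less_imp_le sums_iff)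
  also have "\<dots> = 1" using sums by (simp add: sums_iff)
  finally have \<tau>p: "prob_space \<tau>" by (rule prob_spaceI)
  interpret \<tau>: prob_space \<tau> by (rule \<tau>p)
  have n\<tau>: "normalized_borel_measure \<tau>" by (simp add: normalized_borel_measure_def sets_\<tau> \<tau>p)
  have sp\<tau>: "space \<tau> = sphere 0 1 \<times> UNIV" by (rule normalized_borel_measure_space[OF n\<tau>])
  have m\<tau>: "borel_measurable \<tau> = borel_measurable (circle_borel \<Otimes>\<^sub>M ?N)"
    using measurable_cong_sets[OF sets_\<tau> refl] .
  have h_m [measurable]: "h \<in> borel_measurable circle_borel" if "h \<in> circle_bounded" for h
    using that by (simp add: circle_bounded_def)
  \<comment> \<open>Integration over the discrete coordinate leaves only the index \<open>j\<close>,
    so the slice of \<open>\<tau>\<close> at \<open>j\<close> is the image under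
    \<open>\<phi>\<close> of \<open>a j * (g j)^2 dM\<close>.\<close>
  have slice: "(\<integral>p. h (fst p) * of_bool (snd p = j) \<partial>\<tau>) = (\<integral>x. h (\<phi> x) * of_real (a j * (g j x)\<^sup>2) \<partial>M)"
    if h: "h \<in> circle_bounded" for h j
  proof -
    have [measurable]: "h \<in> borel_measurable circle_borel" using h by (rule h_m)
    define F where "F p = h (fst p) * of_bool (snd p = j)" for p :: "complex \<times> nat"
    have [measurable]: "(\<lambda>p. of_bool (snd p = j) :: complex) \<in> borel_measurable (circle_borel \<Otimes>\<^sub>M ?N)"
      by (rule measurable_compose[OF measurable_snd]) simp
    have F [measurable]: "F \<in> borel_measurable (circle_borel \<Otimes>\<^sub>M ?N)" unfolding F_def by measurable
    obtain c where c: "\<And>z. z \<in> sphere 0 1 \<Longrightarrow> cmod (h z) \<le> c" using circle_boundedE[OF h] by blast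
    have "cmod (F p) \<le> \<bar>c\<bar>" if "fst p \<in> sphere 0 1" for p
      using c[OF that] by (auto simp: F_def norm_mult)
    then have Fint: "integrable \<tau> F"
      using F m\<tau> by (intro \<tau>.integrable_const_bound[of _ "\<bar>c\<bar>"]) (auto simp: sp\<tau>)
    have "integrable D (\<lambda>p. F (\<Phi> p))"
      using Fint unfolding \<tau>_def D_def by (subst (asm) integrable_distr_eq) auto
    then have i: "integrable (M \<Otimes>\<^sub>M ?N) (\<lambda>p. d p *\<^sub>R F (\<Phi> p))"
      unfolding D_def using d0 by (subst (asm) integrable_density) auto
    have "(\<integral>p. F p \<partial>\<tau>) = (\<integral>p. d p *\<^sub>R F (\<Phi> p) \<partial>(M \<Otimes>\<^sub>M ?N))"
      unfolding \<tau>_def D_def using d0 by (subst integral_distr) (auto simp: integral_density)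
    also have "\<dots> = (\<integral>x. \<integral>k. d (x, k) *\<^sub>R F (\<Phi> (x, k)) \<partial>?N \<partial>M)"
      by (rule MN.integral_fst'[OF i, symmetric])
    also have "\<dots> = (\<integral>x. h (\<phi> x) * of_real (a j * (g j x)\<^sup>2) \<partial>M)"
    proof (intro Bochner_Integration.integral_cong refl)
      fix x
      have "(\<integral>k. d (x, k) *\<^sub>R F (\<Phi> (x, k)) \<partial>?N) = (\<Sum>k\<in>{j}. d (x, k) *\<^sub>R F (\<Phi> (x, k)))"
      proof -
        have "(\<integral>k. d (x, k) *\<^sub>R F (\<Phi> (x, k)) \<partial>?N) = (\<Sum>k | d (x, k) *\<^sub>R F (\<Phi> (x, k)) \<noteq> 0. d (x, k) *\<^sub>R F (\<Phi> (x, k)))"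
          by (subst lebesgue_integral_count_space_finite_support)
             (auto intro: finite_subset[of _ "{j}"] simp: F_def \<Phi>_def)
        also have "\<dots> = (\<Sum>k\<in>{j}. d (x, k) *\<^sub>R F (\<Phi> (x, k)))"
          by (intro sum.mono_neutral_left) (auto simp: F_def \<Phi>_def)
        finally show ?thesis .
      qed
      also have "\<dots> = h (\<phi> x) * of_real (a j * (g j x)\<^sup>2)"
        by (simp add: F_def \<Phi>_def d_def scaleR_conv_of_real)
      finally show "(\<integral>k. d (x, k) *\<^sub>R F (\<Phi> (x, k)) \<partial>?N) = h (\<phi> x) * of_real (a j * (g j x)\<^sup>2)" .
    qed
    finally show ?thesis by (simp add: F_def)
  qed
  \<comment> \<open>The factor \<open>1 / sqrt (a j)\<close> cancels the weight \<open>a j\<close>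
    of the slice, so that the Gram matrices of \<open>u\<close> and \<open>v\<close> agree.\<close>
  define v where "v = (\<lambda>(h, j) (p :: complex \<times> nat). of_real (1 / sqrt (a j)) * (h (fst p) * of_bool (snd p = j)) :: complex)"
  have slice_m: "(\<lambda>p. h (fst p) * of_bool (snd p = j)) \<in> borel_measurable \<tau>" if h: "h \<in> circle_bounded" for h j
  proof -
    have [measurable]: "h \<in> borel_measurable circle_borel" using h by (rule h_m)
    have [measurable]: "(\<lambda>p. of_bool (snd p = j) :: complex) \<in> borel_measurable (circle_borel \<Otimes>\<^sub>M ?N)"
      by (rule measurable_compose[OF measurable_snd]) simp
    show ?thesis unfolding m\<tau> by measurable
  qed
  have v_sq: "square_integrable \<tau> (v x)" if xL: "x \<in> \<Lambda>" for x
  proof -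
    obtain h j where x: "x = (h, j)" "h \<in> circle_bounded" using xL by (auto simp: \<Lambda>_def)
    obtain c where c: "\<And>z. z \<in> sphere 0 1 \<Longrightarrow> cmod (h z) \<le> c" using circle_boundedE[OF x(2)] by blast
    have b: "cmod (h (fst p) * of_bool (snd p = j)) \<le> \<bar>c\<bar>" if "fst p \<in> sphere 0 1" for p :: "complex \<times> nat"
      using c[OF that] by (auto simp: norm_mult)
    have "square_integrable \<tau> (\<lambda>p. h (fst p) * of_bool (snd p = j))"
      by (rule \<tau>.square_integrable_bounded[OF slice_m[OF x(2)], of _ "\<bar>c\<bar>"], intro AE_I2 b) (auto simp: sp\<tau>)
    then show ?thesis unfolding x(1) v_def prod.case by (rule square_integrable_cmult)
  qed
  \<comment> \<open>For different indices both sides vanish: the slices are disjoint on one side,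
    and \<open>orth\<close> applies on the other. For equal indices \<open>slice\<close> carries the
    integral from \<open>\<tau>\<close> to \<open>M\<close>.\<close>
  have gram: "l2ip M (u x) (u y) = l2ip \<tau> (v x) (v y)" if xyL: "x \<in> \<Lambda>" "y \<in> \<Lambda>" for x y
  proof -
    obtain h j h' j' where xy: "x = (h, j)" "y = (h', j')" and h: "h \<in> circle_bounded" "h' \<in> circle_bounded"
      using xyL by (auto simp: \<Lambda>_def)
    have hh: "(\<lambda>z. cnj (h z) * h' z) \<in> circle_bounded" by (intro circle_bounded_mult circle_bounded_cnj' h)
    have L: "l2ip M (u x) (u y) = (\<integral>x. (cnj (h (\<phi> x)) * h' (\<phi> x)) * of_real (g j x * g j' x) \<partial>M)"
      unfolding l2ip_def xy u_def by (intro Bochner_Integration.integral_cong refl) (simp add: mult_ac)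
    show ?thesis
    proof (cases "j = j'")
      case False
      have "l2ip \<tau> (v x) (v y) = (\<integral>p. 0 \<partial>\<tau>)"
        unfolding l2ip_def xy v_def using False by (intro Bochner_Integration.integral_cong refl) auto
      moreover have "l2ip M (u x) (u y) = 0" unfolding L using orth[OF hh False] by simp
      ultimately show ?thesis by simp
    next
      case True
      define r where "r = complex_of_real (1 / sqrt (a j))"
      have cr: "cnj r = r" by (simp add: r_def)
      have "r * r = complex_of_real (1 / sqrt (a j) * (1 / sqrt (a j)))" unfolding r_def by (rule of_real_mult[symmetric])
      also have "1 / sqrt (a j) * (1 / sqrt (a j)) = 1 / a j" using a0[of j] by simp
      finally have sq: "r * r = complex_of_real (1 / a j)" .
      have pt: "cnj (r * (h z * of_bool P)) * (r * (h' z * of_bool P)) = r * r * ((cnj (h z) * h' z) * of_bool P)" for z P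
        by (cases P) (simp_all add: cr mult_ac)
      have "l2ip \<tau> (v x) (v y) = (\<integral>p. of_real (1 / a j) * ((cnj (h (fst p)) * h' (fst p)) * of_bool (snd p = j)) \<partial>\<tau>)"
        unfolding l2ip_def xy v_def True[symmetric] prod.case r_def[symmetric] sq[symmetric] pt ..
      also have "\<dots> = of_real (1 / a j) * (\<integral>x. (cnj (h (\<phi> x)) * h' (\<phi> x)) * of_real (a j * (g j x)\<^sup>2) \<partial>M)"
        using slice[OF hh, of j] by simp
      also have "\<dots> = (\<integral>x. of_real (1 / a j) * ((cnj (h (\<phi> x)) * h' (\<phi> x)) * of_real (a j * (g j x)\<^sup>2)) \<partial>M)"
        by (rule integral_mult_right_zero[symmetric])
      also have "\<dots> = l2ip M (u x) (u y)"
        unfolding L True[symmetric] using a0[of j]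
        by (intro Bochner_Integration.integral_cong refl) (simp add: power2_eq_square)
      finally show ?thesis ..
    qed
  qed
  have total_\<tau>: "l2_total \<tau> \<Lambda> v"
  proof (rule l2_totalI)
    let ?P = "{E \<times> F | E F. E \<in> sets circle_borel \<and> F \<in> sets ?N}"
    show "square_integrable \<tau> (v x)" if "x \<in> \<Lambda>" for x using v_sq[OF that] .
    show "finite_measure \<tau>" by (rule \<tau>.finite_measure_axioms)
    show "sets \<tau> = sigma_sets (space \<tau>) ?P" unfolding sets_\<tau> sets_pair_measure by (simp add: sp\<tau>)
    show "Int_stable ?P" by (rule Int_stable_pair_measure_generator)
    show "?P \<subseteq> Pow (space \<tau>)" using sets.sets_into_space[of _ circle_borel] by (auto simp: sp\<tau>)
    note sp = l2_span_limit[of \<Lambda> \<tau> v, OF v_sq] l2_span_sum[of \<Lambda> \<tau> v, OF v_sq] l2_span_cmult[of \<Lambda> \<tau> v, OF v_sq]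
      l2_span_base[of \<Lambda> \<tau> v, OF v_sq]
    show ind: "indicator A \<in> l2_span \<tau> \<Lambda> v" if AP: "A \<in> ?P" for A
    proof -
      obtain E F where A: "A = E \<times> F" and E: "E \<in> sets circle_borel" using AP by auto
      have sl: "(\<lambda>p. indicator E (fst p) * of_bool (snd p = j)) \<in> l2_span \<tau> \<Lambda> v" for j
      proof -
        have "v (indicator E, j) \<in> l2_span \<tau> \<Lambda> v"
          by (rule sp(4)) (auto simp: \<Lambda>_def circle_bounded_indicator E)
        from sp(3)[OF _ this, of "of_real (sqrt (a j))"] show ?thesis
          using a0[of j] by (simp add: v_def mult.assoc[symmetric] flip: of_real_mult)
      qed
      \<comment> \<open>A rectangle may meet infinitely many slices, so its indicator is reached as
        the limit over its first \<open>m\<close> slices.\<close>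
      define f where "f m p = (\<Sum>j\<in>F \<inter> {..<m}. indicator E (fst p) * of_bool (snd p = j) :: complex)" for m p
      have f: "f m \<in> l2_span \<tau> \<Lambda> v" for m unfolding f_def using sl by (intro sp(2)) auto
      have feq: "f m p = indicator (E \<times> (F \<inter> {..<m})) p" for m p
      proof -
        have "f m p = (\<Sum>j\<in>F \<inter> {..<m}. if j = snd p then indicator E (fst p) else 0)"
          unfolding f_def by (intro sum.cong) auto
        also have "\<dots> = indicator (E \<times> (F \<inter> {..<m})) p" by (cases p) (auto simp: indicator_def)
        finally show ?thesis .
      qed
      have ms: "E \<times> F' \<in> sets \<tau>" for F' unfolding sets_\<tau> using E by (intro pair_measureI) auto
      have one: "square_integrable \<tau> (\<lambda>_. 1)" by (simp add: square_integrable_def)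
      show ?thesis unfolding A
      proof (rule sp(1)[of f])
        show "(\<lambda>m. l2norm \<tau> (\<lambda>p. f m p - indicator (E \<times> F) p)) \<longlonglongrightarrow> 0"
        proof (rule l2_dominated_convergence[OF _ _ one])
          show "f m \<in> borel_measurable \<tau>" for m using f[of m] by (intro square_integrable_measurable) (rule l2_span_sq)
          show "AE p in \<tau>. cmod (f m p - indicator (E \<times> F) p) \<le> cmod 1" for m
            unfolding feq by (intro always_eventually) (auto simp: indicator_def)
          have "(\<lambda>m. f m p) \<longlonglongrightarrow> indicator (E \<times> F) p" for p
            unfolding feq by (intro tendsto_eventually eventually_sequentiallyI[of "Suc (snd p)"])
              (auto simp: indicator_def)
          then show "AE p in \<tau>. (\<lambda>m. f m p) \<longlonglongrightarrow> indicator (E \<times> F) p" by simp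
        qed (intro borel_measurable_indicator ms)
      qed (use f ms in \<open>auto intro!: \<tau>.square_integrable_indicator\<close>)
    qed
    have "sphere 0 1 \<in> sets circle_borel" using sets.top[of circle_borel] by simp
    then show "indicator (space \<tau>) \<in> l2_span \<tau> \<Lambda> v" by (intro ind) (auto simp: sp\<tau>)
  qed
  have fst_b: "fst \<in> measurable \<tau> circle_borel" by (rule normalized_borel_measure_fst[OF n\<tau>])
  obtain R where R: "unitary_map (L2 M) (L2 \<tau>) R"
    "\<And>A. A \<in> carrier (L2 M) \<Longrightarrow> R (l2_mult M \<phi> A) = l2_mult \<tau> fst (R A)"
  \<comment> \<open>The relabelling multiplies the scalar \<open>h\<close> by \<open>cnj z\<close>,
    which stays inside \<open>circle_bounded\<close>, and leaves the index of the slice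
    alone.\<close>
  proof (rule gram_unitary[where \<phi>=\<phi> and \<psi>=fst and s="\<lambda>(h, j). (\<lambda>z. cnj z * h z, j)",
        OF M.finite_measure_axioms total \<tau>.finite_measure_axioms total_\<tau> gram])
    show "\<phi> \<in> borel_measurable M" "fst \<in> borel_measurable \<tau>" using \<phi> fst_b by (auto intro: measurable_circle_borel_D)
    show "AE x in M. cmod (\<phi> x) = 1" "AE x in \<tau>. cmod (fst x) = 1"
      using \<phi> fst_b by (auto simp: measurable_circle_borel_iff)
    show "(case x of (h, j) \<Rightarrow> (\<lambda>z. cnj z * h z, j)) \<in> \<Lambda>" if "x \<in> \<Lambda>" for x
      using that by (auto simp: \<Lambda>_def circle_bounded_mult circle_bounded_cnj)
  qed (auto simp: u_def v_def mult_ac)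
  have "absolutely_continuous (distr M circle_borel \<phi>) (circle_projection \<tau>)"
    unfolding absolutely_continuous_def
  proof
    fix A assume A: "A \<in> null_sets (distr M circle_borel \<phi>)"
    then have As [measurable]: "A \<in> sets circle_borel" by auto
    have "\<phi> -` A \<inter> space M \<in> null_sets M" using A by (auto simp: null_sets_def emeasure_distr)
    then have ae: "AE x in M. \<phi> x \<notin> A" by (intro AE_I'[of "\<phi> -` A \<inter> space M"]) auto
    have "emeasure (circle_projection \<tau>) A = (\<integral>\<^sup>+z. indicator A z \<partial>circle_projection \<tau>)"
      by (rule nn_integral_indicator[symmetric]) (simp add: circle_projection_def)
    also have "\<dots> = (\<integral>\<^sup>+p. indicator A (fst p) \<partial>\<tau>)"
      unfolding circle_projection_def by (rule nn_integral_distr[OF fst_b]) simp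
    also have "\<dots> = (\<integral>\<^sup>+x. suminf (\<lambda>k. ennreal (a k * (g k x)\<^sup>2) * indicator A (\<phi> x)) \<partial>M)"
      by (subst nn) auto
    also have "\<dots> = (\<integral>\<^sup>+x. 0 \<partial>M)"
      using ae by (intro nn_integral_cong_AE) (auto elim!: eventually_mono)
    finally show "A \<in> null_sets (circle_projection \<tau>)" by (auto simp: null_sets_def circle_projection_def)
  qed
  with n\<tau> R that show ?thesis by (simp add: coordinate_multiplication_eq)
qed

section \<open>Conditional probabilities given a circle-valued map, and the relative Haar
  system\<close>

lemma integrable_circle_bounded_mult:
  assumes M: "prob_space M" and \<phi>: "\<phi> \<in> measurable M circle_borel" and h: "h \<in> circle_bounded"
    and f: "f \<in> borel_measurable M" "\<And>x. x \<in> space M \<Longrightarrow> \<bar>f x\<bar> \<le> (c :: real)"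
  shows "integrable M (\<lambda>x. h (\<phi> x) * of_real (f x))"
proof -
  interpret M: prob_space M by fact
  obtain d where d: "\<And>z. z \<in> sphere 0 1 \<Longrightarrow> cmod (h z) \<le> d" using circle_boundedE[OF h] by blast
  have h_m: "h \<in> borel_measurable circle_borel" using h by (simp add: circle_bounded_def)
  have b: "cmod (h (\<phi> x) * of_real (f x)) \<le> \<bar>d\<bar> * \<bar>c\<bar>" if "x \<in> space M" for x
  proof -
    have "\<phi> x \<in> sphere 0 1" using \<phi> that by (simp add: measurable_circle_borel_iff)
    then have "cmod (h (\<phi> x)) \<le> \<bar>d\<bar>" using d[of "\<phi> x"] by linarith
    moreover have "cmod (of_real (f x)) \<le> \<bar>c\<bar>" using f(2)[OF that] by simp
    ultimately show ?thesis unfolding norm_mult by (rule mult_mono) auto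
  qed
  show ?thesis
  proof (rule M.integrable_const_bound)
    show "AE x in M. norm (h (\<phi> x) * of_real (f x)) \<le> \<bar>d\<bar> * \<bar>c\<bar>" using b by (rule AE_I2)
    show "(\<lambda>x. h (\<phi> x) * of_real (f x)) \<in> borel_measurable M"
      using measurable_compose[OF \<phi> h_m] f(1) by (intro borel_measurable_times) simp_all
  qed
qed

text \<open>\<open>p\<close> is the Radon-Nikodym derivative of the law of \<open>\<phi>\<close>
  restricted to \<open>S\<close> with respect to the full law of \<open>\<phi>\<close>. The bounds
  are wanted at every point, not just almost everywhere, so the derivative is truncated at
  \<open>1\<close>.\<close>

lemma conditional_probability_exists:
  assumes M: "prob_space M" and \<phi> [measurable]: "\<phi> \<in> measurable M circle_borel" and S [measurable]: "S \<in> sets M"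
  shows "\<exists>p \<in> borel_measurable circle_borel. (\<forall>z. 0 \<le> p z \<and> p z \<le> (1::real)) \<and>
    (\<forall>h\<in>circle_bounded. (\<integral>x. h (\<phi> x) * of_real (indicator S x) \<partial>M) = (\<integral>x. h (\<phi> x) * of_real (p (\<phi> x)) \<partial>M))"
proof -
  interpret M: prob_space M by fact
  let ?\<kappa> = "distr M circle_borel \<phi>"
  let ?D = "density M (\<lambda>x. ennreal (indicator S x))"
  let ?\<kappa>S = "distr ?D circle_borel \<phi>"
  interpret \<kappa>: prob_space ?\<kappa> by (rule M.prob_space_distr) measurable
  have eS: "emeasure ?\<kappa>S E = emeasure M (S \<inter> (\<phi> -` E \<inter> space M))" if [measurable]: "E \<in> sets circle_borel" for E
  proof -
    have "emeasure ?\<kappa>S E = emeasure ?D (\<phi> -` E \<inter> space M)" by (subst emeasure_distr) auto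
    also have "\<dots> = (\<integral>\<^sup>+x. ennreal (indicator S x) * indicator (\<phi> -` E \<inter> space M) x \<partial>M)"
      by (rule emeasure_density) measurable
    also have "\<dots> = (\<integral>\<^sup>+x. indicator (S \<inter> (\<phi> -` E \<inter> space M)) x \<partial>M)"
      by (rule nn_integral_cong) (simp split: split_indicator)
    also have "\<dots> = emeasure M (S \<inter> (\<phi> -` E \<inter> space M))" by (rule nn_integral_indicator) measurable
    finally show ?thesis .
  qed
  have e\<kappa>: "emeasure ?\<kappa> E = emeasure M (\<phi> -` E \<inter> space M)" if "E \<in> sets circle_borel" for E
    using that by (simp add: emeasure_distr)
  have le: "emeasure ?\<kappa>S E \<le> emeasure ?\<kappa> E" if [measurable]: "E \<in> sets circle_borel" for E
    unfolding eS[OF that] e\<kappa>[OF that] by (rule emeasure_mono) auto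
  have "absolutely_continuous ?\<kappa> ?\<kappa>S"
    unfolding absolutely_continuous_def
  proof
    fix E assume "E \<in> null_sets ?\<kappa>"
    then have E: "E \<in> sets circle_borel" "emeasure ?\<kappa> E = 0" by auto
    then show "E \<in> null_sets ?\<kappa>S" using le[OF E(1)] by (auto simp: null_sets_def)
  qed
  from \<kappa>.Radon_Nikodym[OF this] obtain f where f [measurable]: "f \<in> borel_measurable circle_borel" 
    and fd: "density ?\<kappa> f = ?\<kappa>S" by auto
  \<comment> \<open>On \<open>E\<close> the derivative exceeds \<open>1\<close>, so the integral of
    \<open>f - 1\<close> over \<open>E\<close> would be positive unless \<open>E\<close> is null;
    but the restricted law is at most the full law.\<close>
  define E where "E = {z \<in> space circle_borel. f z > 1}"
  have E [measurable]: "E \<in> sets circle_borel" unfolding E_def by measurable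
  have "(\<integral>\<^sup>+z. (f z - 1) * indicator E z \<partial>?\<kappa>) = (\<integral>\<^sup>+z. f z * indicator E z - indicator E z \<partial>?\<kappa>)"
    by (intro nn_integral_cong) (auto simp: indicator_def)
  also have "\<dots> = (\<integral>\<^sup>+z. f z * indicator E z \<partial>?\<kappa>) - (\<integral>\<^sup>+z. indicator E z \<partial>?\<kappa>)"
  proof (rule nn_integral_diff)
    show "(\<integral>\<^sup>+z. indicator E z \<partial>?\<kappa>) \<noteq> \<infinity>" using \<kappa>.emeasure_finite[of E] by simp
    show "AE z in ?\<kappa>. indicator E z \<le> f z * indicator E z"
      by (intro AE_I2) (auto simp: E_def split: split_indicator intro: less_imp_le)
  qed measurable
  also have "(\<integral>\<^sup>+z. f z * indicator E z \<partial>?\<kappa>) = emeasure ?\<kappa>S E"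
    unfolding fd[symmetric] by (rule emeasure_density[symmetric]) auto
  also have "emeasure ?\<kappa>S E - (\<integral>\<^sup>+z. indicator E z \<partial>?\<kappa>) = 0"
  proof -
    have "emeasure ?\<kappa>S E \<noteq> \<infinity>" using le[OF E] \<kappa>.emeasure_finite[of E] by (auto simp: top_unique)
    then have "emeasure ?\<kappa>S E - emeasure ?\<kappa> E = 0"
      using le[OF E] by (simp add: diff_eq_0_iff_ennreal less_top[symmetric])
    then show ?thesis by simp
  qed
  finally have "AE z in ?\<kappa>. (f z - 1) * indicator E z = 0"
    by (subst (asm) nn_integral_0_iff_AE) auto
  then have f1: "AE z in ?\<kappa>. f z \<le> 1"
    using AE_space[of ?\<kappa>] by eventually_elim
      (auto simp: E_def diff_eq_0_iff_ennreal split: split_indicator_asm)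
  \<comment> \<open>By \<open>f1\<close> the truncation changes \<open>f\<close> only on a null
    set.\<close>
  define p where "p z = enn2real (min 1 (f z))" for z
  have p [measurable]: "p \<in> borel_measurable circle_borel" unfolding p_def by measurable
  have p01: "0 \<le> p z \<and> p z \<le> 1" for z
    unfolding p_def by (auto intro: enn2real_leI)
  have "density ?\<kappa> (\<lambda>z. ennreal (p z)) = density ?\<kappa> f"
  proof (rule density_cong)
    show "AE z in ?\<kappa>. ennreal (p z) = f z"
      using f1 
    proof eventually_elim
      case (elim z)
      then have "min 1 (f z) = f z" by (rule min_absorb2)
      moreover have "f z < \<infinity>" using elim by (rule order.strict_trans1) simp
      ultimately show ?case by (simp add: p_def)
    qed
  qed auto
  then have pd: "density ?\<kappa> (\<lambda>z. ennreal (p z)) = ?\<kappa>S" using fd by simp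
  have "(\<integral>x. h (\<phi> x) * of_real (indicator S x) \<partial>M) = (\<integral>x. h (\<phi> x) * of_real (p (\<phi> x)) \<partial>M)"
    if h: "h \<in> circle_bounded" for h
  proof -
    have [measurable]: "h \<in> borel_measurable circle_borel" using h by (simp add: circle_bounded_def)
    have "(\<integral>x. h (\<phi> x) * of_real (indicator S x) \<partial>M) = (\<integral>x. indicator S x *\<^sub>R h (\<phi> x) \<partial>M)"
      by (simp add: scaleR_conv_of_real mult.commute)
    also have "\<dots> = (\<integral>x. h (\<phi> x) \<partial>?D)" by (subst integral_density) auto
    also have "\<dots> = (\<integral>z. h z \<partial>?\<kappa>S)" by (subst integral_distr) auto
    also have "\<dots> = (\<integral>z. p z *\<^sub>R h z \<partial>?\<kappa>)" unfolding pd[symmetric] using p01 by (subst integral_density) auto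
    also have "\<dots> = (\<integral>x. p (\<phi> x) *\<^sub>R h (\<phi> x) \<partial>M)" by (subst integral_distr) auto
    finally show ?thesis by (simp add: scaleR_conv_of_real mult.commute)
  qed
  with p p01 show ?thesis by blast
qed

text \<open>The orthogonal system is a relative Haar system: the atom \<open>A\<close> of the partition generated by
  \<open>B 0, \<dots>, B (k - 1)\<close> is split by \<open>B k\<close>, and the conditional probabilities \<open>p\<close> given \<open>\<phi>\<close> make
  \<open>1\<^bsub>A \<inter> B\<^esub> p(A - B) - 1\<^bsub>A - B\<^esub> p(A \<inter> B)\<close> orthogonal to all functions of \<open>\<phi>\<close> on \<open>A\<close>.\<close>

theorem multiplication_spectral_measure:
  fixes B :: "nat \<Rightarrow> 'x set" and \<phi> :: "'x \<Rightarrow> complex"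
  assumes M: "prob_space M" and \<phi>: "\<phi> \<in> measurable M circle_borel"
    and gen: "sets M = sigma_sets (space M) (range B)" "range B \<subseteq> Pow (space M)"
  obtains \<tau> R where "normalized_borel_measure \<tau>" "unitary_map (L2 M) (L2 \<tau>) R"
    "\<And>A. A \<in> carrier (L2 M) \<Longrightarrow> R (l2_mult M \<phi> A) = coordinate_multiplication \<tau> (R A)"
    "absolutely_continuous (distr M circle_borel \<phi>) (circle_projection \<tau>)"
proof -
  interpret M: prob_space M by fact
  have ind_of_real: "complex_of_real (indicator A x) = indicator A x" for A and x :: 'x
    by (simp add: indicator_def)
  have [measurable]: "\<phi> \<in> measurable M circle_borel" by fact
  have Bs [measurable]: "B i \<in> sets M" for i using gen(1) by auto
  have "\<forall>S\<in>sets M. \<exists>q. q \<in> borel_measurable circle_borel \<and> (\<forall>z. 0 \<le> q z \<and> q z \<le> (1::real)) \<and>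
      (\<forall>h\<in>circle_bounded. (\<integral>x. h (\<phi> x) * of_real (indicator S x) \<partial>M) = (\<integral>x. h (\<phi> x) * of_real (q (\<phi> x)) \<partial>M))"
  proof
    fix S assume "S \<in> sets M"
    from conditional_probability_exists[OF M \<phi> this]
    show "\<exists>q. q \<in> borel_measurable circle_borel \<and> (\<forall>z. 0 \<le> q z \<and> q z \<le> (1::real)) \<and>
      (\<forall>h\<in>circle_bounded. (\<integral>x. h (\<phi> x) * of_real (indicator S x) \<partial>M) = (\<integral>x. h (\<phi> x) * of_real (q (\<phi> x)) \<partial>M))"
      unfolding Bex_def .
  qed
  from bchoice[OF this] obtain p where
    pp: "\<forall>S\<in>sets M. p S \<in> borel_measurable circle_borel \<and> (\<forall>z. 0 \<le> p S z \<and> p S z \<le> (1::real)) \<and>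
      (\<forall>h\<in>circle_bounded. (\<integral>x. h (\<phi> x) * of_real (indicator S x) \<partial>M) = (\<integral>x. h (\<phi> x) * of_real (p S (\<phi> x)) \<partial>M))" ..
  have p: "\<And>S. S \<in> sets M \<Longrightarrow> p S \<in> borel_measurable circle_borel"
    "\<And>S z. S \<in> sets M \<Longrightarrow> 0 \<le> p S z \<and> p S z \<le> (1::real)"
    "\<And>S h. S \<in> sets M \<Longrightarrow> h \<in> circle_bounded \<Longrightarrow>
      (\<integral>x. h (\<phi> x) * of_real (indicator S x) \<partial>M) = (\<integral>x. h (\<phi> x) * of_real (p S (\<phi> x)) \<partial>M)"
    using pp[THEN bspec] by (simp_all only:)
  have p_cb: "(\<lambda>z. of_real (p S z)) \<in> circle_bounded" if "S \<in> sets M" for S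
    using p(1,2)[OF that] by (intro circle_bounded_of_real[of _ 1]) auto
  \<comment> \<open>The cell of the partition generated by \<open>B 0, ..., B (k - 1)\<close> in
    which \<open>w\<close> records the sets containing the point.\<close>
  define atom where "atom k w = {x \<in> space M. \<forall>i<k. x \<in> B i \<longleftrightarrow> i \<in> w}" for k :: nat and w
  have atom_s [measurable]: "atom k w \<in> sets M" for k w unfolding atom_def by measurable
  define A1 where "A1 k w = atom k w \<inter> B k" for k w
  define A2 where "A2 k w = atom k w - B k" for k w
  have A12 [measurable]: "A1 k w \<in> sets M" "A2 k w \<in> sets M" for k w unfolding A1_def A2_def by measurable
  define G where "G k w x = indicator (A1 k w) x * p (A2 k w) (\<phi> x) - indicator (A2 k w) x * p (A1 k w) (\<phi> x)" for k w x
  have p\<phi> [measurable]: "(\<lambda>x. p S (\<phi> x)) \<in> borel_measurable M" if "S \<in> sets M" for S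
    using measurable_compose[OF \<phi> p(1)[OF that]] .
  have G_m [measurable]: "G k w \<in> borel_measurable M" for k w
    unfolding G_def by measurable
  have G_b: "\<bar>G k w x\<bar> \<le> 1" for k w x
    using p(2)[OF A12(1), of k w "\<phi> x"] p(2)[OF A12(2), of k w "\<phi> x"]
    by (auto simp: G_def indicator_def A1_def A2_def)
  have int: "integrable M (\<lambda>x. h (\<phi> x) * of_real (f x))"
    if "h \<in> circle_bounded" "f \<in> borel_measurable M" "\<And>x. \<bar>f x\<bar> \<le> 1" for h and f :: "'x \<Rightarrow> real"
    using integrable_circle_bounded_mult[OF M \<phi> that(1,2)] that(3) by blast
  \<comment> \<open>Conditioning replaces each indicator by its conditional probability, after which
    both terms are the integral of \<open>h\<close> times the product of the probabilities of
    \<open>A1 k w\<close> and \<open>A2 k w\<close>.\<close>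
  have G0: "(\<integral>x. h (\<phi> x) * of_real (G k w x) \<partial>M) = 0" if h: "h \<in> circle_bounded" for h k w
  proof -
    let ?h1 = "\<lambda>z. h z * of_real (p (A2 k w) z)" and ?h2 = "\<lambda>z. h z * of_real (p (A1 k w) z)"
    have h12: "?h1 \<in> circle_bounded" "?h2 \<in> circle_bounded" by (intro circle_bounded_mult h p_cb A12)+
    have i: "integrable M (\<lambda>x. ?h1 (\<phi> x) * of_real (indicator (A1 k w) x))"
      "integrable M (\<lambda>x. ?h2 (\<phi> x) * of_real (indicator (A2 k w) x))"
      by (rule int[OF h12(1)], simp, simp add: indicator_def, rule int[OF h12(2)], simp, simp add: indicator_def)
    have "(\<integral>x. h (\<phi> x) * of_real (G k w x) \<partial>M)
      = (\<integral>x. ?h1 (\<phi> x) * of_real (indicator (A1 k w) x) - ?h2 (\<phi> x) * of_real (indicator (A2 k w) x) \<partial>M)"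
      by (intro Bochner_Integration.integral_cong refl) (simp add: G_def algebra_simps)
    also have "\<dots> = (\<integral>x. ?h1 (\<phi> x) * of_real (p (A1 k w) (\<phi> x)) \<partial>M) - (\<integral>x. ?h2 (\<phi> x) * of_real (p (A2 k w) (\<phi> x)) \<partial>M)"
      unfolding Bochner_Integration.integral_diff[OF i] p(3)[OF A12(1) h12(1)] p(3)[OF A12(2) h12(2)] ..
    also have "\<dots> = 0" by (simp add: mult_ac)
    finally show ?thesis .
  qed
  have G_supp: "G k w x = 0" if "x \<notin> atom k w" for k w x
    using that by (simp add: G_def A1_def A2_def)
  have orth_lt: "(\<integral>x. h (\<phi> x) * of_real (G k w x * G k' w' x) \<partial>M) = 0"
    if h: "h \<in> circle_bounded" and k: "k < k'" for h k k' w w'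
  proof -
    \<comment> \<open>The finer atom \<open>atom k' w'\<close> lies on one side of the split of
      \<open>atom k w\<close> or is disjoint from it. There \<open>G k w\<close> is therefore a
      function \<open>q\<close> of \<open>\<phi>\<close>, and \<open>G0\<close> for the finer
      function applies.\<close>
    define q where "q = (if \<forall>i<k. i \<in> w \<longleftrightarrow> i \<in> w' then if k \<in> w' then p (A2 k w) else (\<lambda>z. - p (A1 k w) z) else (\<lambda>_. 0))"
    have q_cb: "(\<lambda>z. of_real (q z)) \<in> circle_bounded"
      using p(1,2)[OF A12(1)[of k w]] p(1,2)[OF A12(2)[of k w]]
      by (intro circle_bounded_of_real[of _ 1]) (auto simp: q_def)
    have "G k w x * G k' w' x = q (\<phi> x) * G k' w' x" if x: "x \<in> space M" for x
    proof (cases "x \<in> atom k' w'")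
      case True
      then have *: "x \<in> B i \<longleftrightarrow> i \<in> w'" if "i < k'" for i using that by (auto simp: atom_def)
      then have "x \<in> atom k w \<longleftrightarrow> (\<forall>i<k. i \<in> w \<longleftrightarrow> i \<in> w')" using k x by (auto simp: atom_def)
      then have "G k w x = q (\<phi> x)" using *[OF k] by (auto simp: q_def G_def A1_def A2_def)
      then show ?thesis by simp
    qed (simp add: G_supp)
    then have "(\<integral>x. h (\<phi> x) * of_real (G k w x * G k' w' x) \<partial>M) = (\<integral>x. (h (\<phi> x) * of_real (q (\<phi> x))) * of_real (G k' w' x) \<partial>M)"
      by (intro Bochner_Integration.integral_cong refl) simp
    also have "\<dots> = 0" by (rule G0[OF circle_bounded_mult[OF h q_cb]])
    finally show ?thesis .
  qed
  have orth_G: "(\<integral>x. h (\<phi> x) * of_real (G k w x * G k' w' x) \<partial>M) = 0"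
    if h: "h \<in> circle_bounded" and w: "w \<subseteq> {..<k}" "w' \<subseteq> {..<k'}" and ne: "(k, w) \<noteq> (k', w')" for h k k' w w'
  proof -
    consider "k < k'" | "k' < k" | "k = k'" "w \<noteq> w'" using ne by fastforce
    then show ?thesis
    proof cases
      case 1 then show ?thesis by (rule orth_lt[OF h])
    next
      case 2 then show ?thesis using orth_lt[OF h 2, of w' w] by (simp add: mult.commute)
    next
      case 3
      have z: "G k w x * G k' w' x = 0" for x
      proof (rule ccontr)
        assume "G k w x * G k' w' x \<noteq> 0"
        then have "x \<in> atom k w" "x \<in> atom k w'" using G_supp 3(1) by force+
        then have "w = w'" using w 3(1) by (auto simp: atom_def)
        then show False using 3 by simp
      qed
      show ?thesis unfolding z by simp
    qed
  qed
  \<comment> \<open>Index \<open>0\<close> is reserved for the constant. The condition on the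
    decoded set makes each atom appear with only one code, as \<open>atom k w\<close> depends only
    on the part of \<open>w\<close> below \<open>k\<close>; codes violating it give the zero
    function.\<close>
  define g where "g j x = (case j of 0 \<Rightarrow> 1 | Suc m \<Rightarrow>
      if set_decode (snd (prod_decode m)) \<subseteq> {..<fst (prod_decode m)}
      then G (fst (prod_decode m)) (set_decode (snd (prod_decode m))) x else 0)" for j x
  have g0: "g 0 x = 1" for x by (simp add: g_def)
  have gG: "g (Suc m) = G (fst (prod_decode m)) (set_decode (snd (prod_decode m))) \<or> g (Suc m) = (\<lambda>_. 0)" for m
    by (cases "set_decode (snd (prod_decode m)) \<subseteq> {..<fst (prod_decode m)}") (simp_all add: g_def fun_eq_iff)
  have g_m: "g j \<in> borel_measurable M" for j
  proof (cases j)
    case 0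
    have "g 0 = (\<lambda>_. 1)" by (simp add: g_def fun_eq_iff)
    then show ?thesis unfolding 0 by simp
  next
    case (Suc m) then show ?thesis using gG[of m] G_m by (elim disjE) simp_all
  qed
  have g_b: "\<bar>g j x\<bar> \<le> 1" for j x
  proof (cases j)
    case 0 then show ?thesis by (simp add: g_def)
  next
    case (Suc m) then show ?thesis using gG[of m] G_b by (elim disjE) simp_all
  qed
  have g_orth0: "(\<integral>x. h (\<phi> x) * of_real (g (Suc m) x) \<partial>M) = 0" if "h \<in> circle_bounded" for h m
    using gG[of m] G0[OF that] by (elim disjE) simp_all
  have orth: "(\<integral>x. h (\<phi> x) * of_real (g j x * g k x) \<partial>M) = 0" if h: "h \<in> circle_bounded" and "j \<noteq> k" for h j k
  proof -
    consider m where "j = 0" "k = Suc m" | m where "k = 0" "j = Suc m" | m m' where "j = Suc m" "k = Suc m'" "m \<noteq> m'"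
      using \<open>j \<noteq> k\<close> by (metis not0_implies_Suc)
    then show ?thesis
    proof cases
      case (3 m m')
      let ?k = "fst (prod_decode m)" and ?w = "set_decode (snd (prod_decode m))"
      let ?k' = "fst (prod_decode m')" and ?w' = "set_decode (snd (prod_decode m'))"
      have ne: "(?k, ?w) \<noteq> (?k', ?w')"
      proof
        assume "(?k, ?w) = (?k', ?w')"
        then have "fst (prod_decode m) = fst (prod_decode m')" "snd (prod_decode m) = snd (prod_decode m')"
          by (auto dest: arg_cong[of _ _ set_encode])
        then have "prod_decode m = prod_decode m'" by (rule prod_eqI)
        then show False using 3(3) by (metis prod_decode_inverse)
      qed
      show ?thesis
      proof (cases "?w \<subseteq> {..<?k} \<and> ?w' \<subseteq> {..<?k'}")
        case True
        then have "g j = G ?k ?w" "g k = G ?k' ?w'" by (auto simp: 3 g_def fun_eq_iff)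
        then show ?thesis using orth_G[OF h _ _ ne] True by simp
      next
        case False
        then have "g j = (\<lambda>_. 0) \<or> g k = (\<lambda>_. 0)" by (auto simp: 3 g_def fun_eq_iff)
        then show ?thesis by (elim disjE) simp_all
      qed
    qed (use g_orth0[OF h] g0 in simp_all)
  qed
  define \<Lambda> where "\<Lambda> = circle_bounded \<times> (UNIV :: nat set)"
  define u where "u = (\<lambda>(h, j) x. h (\<phi> x) * complex_of_real (g j x))"
  have hm: "(\<lambda>x. h (\<phi> x)) \<in> borel_measurable M" if "h \<in> circle_bounded" for h
    using that measurable_compose[OF \<phi>, of h borel] by (simp add: circle_bounded_def)
  have hsq: "square_integrable M (\<lambda>x. h (\<phi> x) * of_real (f x))"
    if h: "h \<in> circle_bounded" and f: "f \<in> borel_measurable M" "\<And>x. \<bar>f x\<bar> \<le> 1" for h and f :: "'x \<Rightarrow> real"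
  proof -
    obtain c where c: "\<And>z. z \<in> sphere 0 1 \<Longrightarrow> cmod (h z) \<le> c" using circle_boundedE[OF h] by blast
    have "square_integrable M (\<lambda>x. of_real (f x) :: complex)"
      using f by (intro M.square_integrable_bounded[of _ 1]) auto
    moreover have "AE x in M. cmod (h (\<phi> x)) \<le> c"
      using c \<phi> by (intro AE_I2) (simp add: measurable_circle_borel_iff)
    ultimately show ?thesis by (rule square_integrable_bounded_mult[OF _ hm[OF h]])
  qed
  have u_sq: "square_integrable M (u a)" if "a \<in> \<Lambda>" for a
    using that hsq[OF _ g_m g_b] by (auto simp: \<Lambda>_def u_def)
  let ?V = "l2_span M \<Lambda> u"
  note V_limit = l2_span_limit[of \<Lambda> M u, OF u_sq] and V_sum = l2_span_sum[of \<Lambda> M u, OF u_sq]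
    and V_add = l2_span_add[of \<Lambda> M u, OF u_sq] and V_diff = l2_span_diff[of \<Lambda> M u, OF u_sq]
    and V_base = l2_span_base[of \<Lambda> M u, OF u_sq] and V_cong = l2_span_cong_AE[of \<Lambda> M u, OF u_sq]
  have V_G: "(\<lambda>x. h (\<phi> x) * of_real (G k w x)) \<in> ?V" if h: "h \<in> circle_bounded" and w: "w \<subseteq> {..<k}" for h k w
  proof -
    have "set_decode (set_encode w) = w" using w by (intro set_encode_inverse finite_subset[OF w]) simp
    then have "g (Suc (prod_encode (k, set_encode w))) = G k w" using w by (simp add: g_def fun_eq_iff)
    then have "u (h, Suc (prod_encode (k, set_encode w))) = (\<lambda>x. h (\<phi> x) * of_real (G k w x))"
      by (simp add: u_def fun_eq_iff)
    then show ?thesis using V_base[of "(h, Suc (prod_encode (k, set_encode w)))"] h by (simp add: \<Lambda>_def)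
  qed
  \<comment> \<open>The identity behind this is
    \<open>1_A1 (p(A1) + p(A2)) = G + p(A1) 1_atom\<close>: the indicator of half an atom is
    recovered from \<open>G\<close> and the indicator of the atom by dividing.\<close>
  have V_A1: "(\<lambda>x. h (\<phi> x) * indicator (A1 k w) x) \<in> ?V"
    if h: "h \<in> circle_bounded" and w: "w \<subseteq> {..<k}"
      and IH: "\<And>h. h \<in> circle_bounded \<Longrightarrow> (\<lambda>x. h (\<phi> x) * indicator (atom k w) x) \<in> ?V" for h k w
  proof -
    let ?p1 = "p (A1 k w)" and ?p2 = "p (A2 k w)"
    note p1 = p(1,2)[OF A12(1)[of k w]] and p2 = p(1,2)[OF A12(2)[of k w]]
    \<comment> \<open>A truncated inverse of \<open>p(A1) + p(A2)\<close>: bounded by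
      \<open>Suc N\<close>, hence an admissible scalar, and equal to the inverse for large
      \<open>N\<close> wherever the sum is positive.\<close>
    define q where "q N z = (if ?p1 z + ?p2 z > 1 / real (Suc N) then 1 / (?p1 z + ?p2 z) else 0)" for N z
    have q_b: "\<bar>q N z\<bar> \<le> real (Suc N)" for N z
    proof (cases "?p1 z + ?p2 z > 1 / real (Suc N)")
      case True
      have "1 / real (Suc N) > 0" by simp
      then have pos: "?p1 z + ?p2 z > 0" using True by linarith
      have "1 / (?p1 z + ?p2 z) \<le> 1 / (1 / real (Suc N))"
        using True pos by (intro divide_left_mono) (auto intro!: mult_pos_pos)
      then show ?thesis using True pos by (simp add: q_def)
    qed (simp add: q_def)
    have q_m: "q N \<in> borel_measurable circle_borel" for N
      unfolding q_def using p1(1) p2(1) by measurable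
    have q_cb: "(\<lambda>z. of_real (q N z)) \<in> circle_bounded" for N
      using q_b by (intro circle_bounded_of_real[OF q_m]) blast
    define f where "f N x = h (\<phi> x) * of_real (q N (\<phi> x)) * of_real (G k w x)
        + h (\<phi> x) * of_real (q N (\<phi> x)) * of_real (?p1 (\<phi> x)) * indicator (atom k w) x" for N x
    have fV: "f N \<in> ?V" for N
    proof -
      have "(\<lambda>x. h (\<phi> x) * of_real (q N (\<phi> x)) * of_real (G k w x)) \<in> ?V"
        by (rule V_G[OF circle_bounded_mult[OF h q_cb] w])
      moreover have "(\<lambda>x. h (\<phi> x) * of_real (q N (\<phi> x)) * of_real (?p1 (\<phi> x)) * indicator (atom k w) x) \<in> ?V"
        by (rule IH[OF circle_bounded_mult[OF circle_bounded_mult[OF h q_cb] p_cb[OF A12(1)]]])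
      ultimately show ?thesis unfolding f_def by (rule V_add[rotated -2])
    qed
    have feq: "f N x = h (\<phi> x) * indicator (A1 k w) x * of_bool (?p1 (\<phi> x) + ?p2 (\<phi> x) > 1 / real (Suc N))" for N x
    proof -
      have s: "q N z * (?p1 z + ?p2 z) = of_bool (?p1 z + ?p2 z > 1 / real (Suc N))" for z
      proof (cases "?p1 z + ?p2 z > 1 / real (Suc N)")
        case True
        have "1 / real (Suc N) > 0" by simp
        then have "?p1 z + ?p2 z \<noteq> 0" using True by linarith
        then show ?thesis using True by (simp add: q_def)
      qed (simp add: q_def)
      have at: "indicator (atom k w) x = (indicator (A1 k w) x + indicator (A2 k w) x :: real)"
        by (auto simp: A1_def A2_def indicator_def)
      have r: "q N (\<phi> x) * G k w x + q N (\<phi> x) * ?p1 (\<phi> x) * indicator (atom k w) x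
          = indicator (A1 k w) x * (q N (\<phi> x) * (?p1 (\<phi> x) + ?p2 (\<phi> x)))"
        unfolding at G_def by (simp add: algebra_simps)
      have "f N x = h (\<phi> x) * of_real (q N (\<phi> x) * G k w x + q N (\<phi> x) * ?p1 (\<phi> x) * indicator (atom k w) x)"
        by (simp add: f_def algebra_simps ind_of_real)
      then show ?thesis unfolding r s by (simp add: ind_of_real)
    qed
    have sq1: "square_integrable M (\<lambda>x. h (\<phi> x) * indicator (A1 k w) x)"
      using hsq[OF h borel_measurable_indicator[OF A12(1)], of k w] by (simp add: ind_of_real)
    have sqh: "square_integrable M (\<lambda>x. h (\<phi> x))" using hsq[OF h, of "\<lambda>_. 1"] by simp
    \<comment> \<open>Testing the conditional probability against the indicator of its own zero set
      shows that \<open>A1\<close> has no mass where the probability vanishes.\<close>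
    have pos: "AE x in M. x \<in> A1 k w \<longrightarrow> ?p1 (\<phi> x) > 0"
    proof -
      let ?Z = "{z \<in> space circle_borel. ?p1 z = 0}"
      have Z [measurable]: "?Z \<in> sets circle_borel" using p1(1) by measurable
      let ?k = "\<lambda>x. indicator ?Z (\<phi> x) * indicator (A1 k w) x :: real"
      have im: "(\<lambda>x. indicator ?Z (\<phi> x) :: real) \<in> borel_measurable M"
        by (rule measurable_compose[OF \<phi>]) (rule borel_measurable_indicator[OF Z])
      have "complex_of_real (\<integral>x. ?k x \<partial>M) = (\<integral>x. indicator ?Z (\<phi> x) * of_real (indicator (A1 k w) x) \<partial>M)"
        by (subst integral_complex_of_real[symmetric]) (intro Bochner_Integration.integral_cong refl, auto simp: indicator_def)
      also have "\<dots> = (\<integral>x. indicator ?Z (\<phi> x) * of_real (?p1 (\<phi> x)) \<partial>M)"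
        by (rule p(3)[OF A12(1) circle_bounded_indicator[OF Z]])
      also have "\<dots> = (\<integral>x. 0 \<partial>M)" by (intro Bochner_Integration.integral_cong refl) (auto simp: indicator_def)
      finally have "(\<integral>x. ?k x \<partial>M) = 0" by simp
      moreover have "integrable M ?k"
        using im by (intro M.integrable_const_bound[of _ 1]) (auto simp: indicator_def)
      ultimately have "AE x in M. ?k x = 0" by (subst (asm) integral_nonneg_eq_0_iff_AE) auto
      then show ?thesis using AE_space
      proof eventually_elim
        case (elim x)
        then have "\<phi> x \<in> space circle_borel" using \<phi> by (simp add: measurable_circle_borel_iff)
        then show ?case using elim p1(2)[of "\<phi> x"] by (auto simp: indicator_def less_le)
      qed
    qed
    show ?thesis
    proof (rule V_limit[where f=f])
      show "(\<lambda>N. l2norm M (\<lambda>x. f N x - h (\<phi> x) * indicator (A1 k w) x)) \<longlonglongrightarrow> 0"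
      proof (rule l2_dominated_convergence[OF _ _ sqh])
        show "f N \<in> borel_measurable M" for N using square_integrable_measurable[OF l2_span_sq[OF fV]] .
        show "(\<lambda>x. h (\<phi> x) * indicator (A1 k w) x) \<in> borel_measurable M" using square_integrable_measurable[OF sq1] .
        show "AE x in M. cmod (f N x - h (\<phi> x) * indicator (A1 k w) x) \<le> cmod (h (\<phi> x))" for N
          unfolding feq by (intro AE_I2) (auto simp: indicator_def)
        show "AE x in M. (\<lambda>N. f N x) \<longlonglongrightarrow> h (\<phi> x) * indicator (A1 k w) x"
          using pos
        proof eventually_elim
          case (elim x)
          show ?case
          proof (cases "x \<in> A1 k w")
            case True
            then have "?p1 (\<phi> x) + ?p2 (\<phi> x) > 0" using elim p2(2)[of "\<phi> x"] by simp
            then obtain N0 where N0: "1 / real (Suc N0) < ?p1 (\<phi> x) + ?p2 (\<phi> x)"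
              using reals_Archimedean by (auto simp: inverse_eq_divide)
            show ?thesis
            proof (rule tendsto_eventually, rule eventually_sequentiallyI[of N0])
              fix N assume "N \<ge> N0"
              then have "1 / real (Suc N) \<le> 1 / real (Suc N0)" by (intro divide_left_mono) auto
              then show "f N x = h (\<phi> x) * indicator (A1 k w) x" unfolding feq using N0 by simp
            qed
          qed (simp add: feq)
        qed
      qed
    qed (rule fV sq1 | assumption)+
  qed
  have V_atom: "(\<lambda>x. h (\<phi> x) * indicator (atom k w) x) \<in> ?V" if "h \<in> circle_bounded" "w \<subseteq> {..<k}" for h k w
    using that
  proof (induction k arbitrary: h w)
    case 0
    have "u (h, 0) \<in> ?V" using V_base[of "(h, 0)"] 0 by (simp add: \<Lambda>_def)
    then show ?case
    proof (rule V_cong[rotated])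
      show "AE x in M. h (\<phi> x) * indicator (atom 0 w) x = u (h, 0) x"
        by (intro AE_I2) (simp add: u_def g0 atom_def)
      show "(\<lambda>x. h (\<phi> x) * indicator (atom 0 w) x) \<in> borel_measurable M"
        using hm[OF 0(1)] by (intro borel_measurable_times borel_measurable_indicator atom_s)
    qed
  next
    case (Suc k)
    define v where "v = w - {k}"
    have v: "v \<subseteq> {..<k}" using Suc.prems(2) by (auto simp: v_def less_Suc_eq)
    have iv: "i \<in> v \<longleftrightarrow> i \<in> w" if "i < k" for i using that by (auto simp: v_def)
    have A1V: "(\<lambda>x. h (\<phi> x) * indicator (A1 k v) x) \<in> ?V" by (rule V_A1[OF Suc.prems(1) v Suc.IH[OF _ v]])
    show ?case
    proof (cases "k \<in> w")
      case True
      then have "atom (Suc k) w = A1 k v" using iv by (auto simp: atom_def A1_def less_Suc_eq)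
      then show ?thesis using A1V by simp
    next
      case False
      then have "atom (Suc k) w = A2 k v" using iv by (auto simp: atom_def A2_def less_Suc_eq)
      then have "(\<lambda>x. h (\<phi> x) * indicator (atom (Suc k) w) x)
          = (\<lambda>x. h (\<phi> x) * indicator (atom k v) x - h (\<phi> x) * indicator (A1 k v) x)"
        by (auto simp: fun_eq_iff A1_def A2_def indicator_def)
      then show ?thesis using V_diff[OF _ Suc.IH[OF Suc.prems(1) v] A1V] by simp
    qed
  qed
  \<comment> \<open>Finite intersections make the generating sequence stable under intersection; the
    empty index set yields the whole space.\<close>
  let ?P = "{space M \<inter> (\<Inter>i\<in>J. B i) | J. finite J}"
  have total: "l2_total M \<Lambda> u"
  proof (rule l2_totalI[OF u_sq M.finite_measure_axioms])
    have "sigma_sets (space M) ?P = sigma_sets (space M) (range B)"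
    proof (rule sigma_sets_eqI)
      fix A assume "A \<in> ?P"
      then obtain J where J: "finite J" "A = space M \<inter> (\<Inter>i\<in>J. B i)" by blast
      have "A \<in> sets M" unfolding J(2) using J(1)
        by (induction J rule: finite_induct) (auto simp: Int_left_commute)
      then show "A \<in> sigma_sets (space M) (range B)" using gen(1) by simp
    next
      fix A assume "A \<in> range B"
      then obtain i where A: "A = B i" by blast
      have "space M \<inter> (\<Inter>i\<in>{i}. B i) \<in> ?P" by blast
      moreover have "space M \<inter> (\<Inter>i\<in>{i}. B i) = A" using gen(2) A by auto
      ultimately show "A \<in> sigma_sets (space M) ?P" by (metis (no_types, lifting) sigma_sets.Basic)
    qed
    then show "sets M = sigma_sets (space M) ?P" using gen(1) by simp
    show "Int_stable ?P"
    proof (rule Int_stableI)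
      fix a b assume "a \<in> ?P" "b \<in> ?P"
      then obtain J K where JK: "finite J" "finite K" "a = space M \<inter> (\<Inter>i\<in>J. B i)" "b = space M \<inter> (\<Inter>i\<in>K. B i)" by blast
      then have "a \<inter> b = space M \<inter> (\<Inter>i\<in>J \<union> K. B i)" by auto
      then show "a \<inter> b \<in> ?P" using JK(1,2) by blast
    qed
    show "?P \<subseteq> Pow (space M)" by auto
    show ind: "indicator A \<in> ?V" if "A \<in> ?P" for A
    proof -
      obtain J where J: "finite J" "A = space M \<inter> (\<Inter>i\<in>J. B i)" using \<open>A \<in> ?P\<close> by blast
      obtain k where k: "J \<subseteq> {..<k}" using J(1) finite_nat_iff_bounded by blast
      let ?W = "{w \<in> Pow {..<k}. J \<subseteq> w}"
      have As: "A \<in> sets M" unfolding J(2) using J(1)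
        by (induction J rule: finite_induct) (auto simp: Int_left_commute)
      \<comment> \<open>The intersection over \<open>J\<close> is the disjoint union of the atoms of
        level \<open>k\<close> whose code contains \<open>J\<close>.\<close>
      have "(\<lambda>x. \<Sum>w\<in>?W. 1 * indicator (atom k w) x) \<in> ?V"
        by (intro V_sum V_atom[OF circle_bounded_const[of 1]]) auto
      then show ?thesis
      proof (rule V_cong[rotated])
        show "(indicator A :: 'x \<Rightarrow> complex) \<in> borel_measurable M" using As by (rule borel_measurable_indicator)
        show "AE x in M. indicator A x = (\<Sum>w\<in>?W. 1 * indicator (atom k w) x :: complex)"
        proof (rule AE_I2)
          fix x assume x: "x \<in> space M"
          define wx where "wx = {i. i < k \<and> x \<in> B i}"
          have "(\<Sum>w\<in>?W. 1 * indicator (atom k w) x :: complex) = (\<Sum>w\<in>?W. if w = wx then 1 else 0)"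
            using x by (intro sum.cong refl) (auto simp: indicator_def atom_def wx_def)
          also have "\<dots> = (if wx \<in> ?W then 1 else 0)" by simp
          also have "\<dots> = indicator A x"
            using x k by (auto simp: J(2) wx_def indicator_def)
          finally show "indicator A x = (\<Sum>w\<in>?W. 1 * indicator (atom k w) x :: complex)" ..
        qed
      qed
    qed
    have "space M \<in> ?P" by (auto intro!: exI[of _ "{}"])
    then show "indicator (space M) \<in> ?V" by (rule ind)
  qed
  show ?thesis
    by (rule orthogonal_system_spectral_measure[OF M \<phi> g_m g_b g0 orth total[unfolded \<Lambda>_def u_def]])
      (assumption | rule that)+
qed

section \<open>Countably generated measures\<close>

text \<open>The generators come as a sequence because the relative Haar system refines a partition
  by one set at a time.\<close>

definition countably_generated :: "'x measure \<Rightarrow> bool" where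
  "countably_generated M \<longleftrightarrow>
     (\<exists>B :: nat \<Rightarrow> 'x set. range B \<subseteq> Pow (space M) \<and> sets M = sigma_sets (space M) (range B))"

lemma countably_generatedI:
  assumes C: "countable C" "C \<subseteq> sets M" and gen: "sets M \<subseteq> sigma_sets (space M) C"
  shows "countably_generated M"
proof -
  \<comment> \<open>The empty set is added so that there is something to enumerate even when
    \<open>C\<close> is empty.\<close>
  let ?B = "from_nat_into (insert {} C)"
  have r: "range ?B = insert {} C" using C(1) by (intro range_from_nat_into) auto
  have sub: "insert {} C \<subseteq> sets M" using C(2) by auto
  have "sigma_sets (space M) (insert {} C) \<subseteq> sets M" by (rule sets.sigma_sets_subset[OF sub])
  moreover have "sets M \<subseteq> sigma_sets (space M) (insert {} C)"
    using gen sigma_sets_mono'[of C "insert {} C" "space M"] by blast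
  ultimately have "sets M = sigma_sets (space M) (range ?B)" unfolding r by blast
  moreover have "range ?B \<subseteq> Pow (space M)" unfolding r using sub sets.sets_into_space by blast
  ultimately show ?thesis unfolding countably_generated_def by blast
qed

lemma countably_generatedE:
  assumes "countably_generated M"
  obtains C where "countable C" "C \<subseteq> sets M" "sets M = sigma_sets (space M) C"
proof -
  obtain B :: "nat \<Rightarrow> _" where B: "sets M = sigma_sets (space M) (range B)"
    using assms unfolding countably_generated_def by blast
  show ?thesis
  proof (rule that)
    show "countable (range B)" by simp
    show "range B \<subseteq> sets M" unfolding B by (auto intro: sigma_sets.Basic)
  qed (rule B)
qed

lemma countably_generated_cong:
  "sets M = sets N \<Longrightarrow> countably_generated M \<Longrightarrow> countably_generated N"
  unfolding countably_generated_def using sets_eq_imp_space_eq by metis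

lemma sigma_sets_vimage_mem:
  assumes f: "f \<in> \<Omega>' \<rightarrow> \<Omega>" and A: "A \<in> sigma_sets \<Omega> C"
  shows "f -` A \<inter> \<Omega>' \<in> sigma_sets \<Omega>' ((\<lambda>c. f -` c \<inter> \<Omega>') ` C)"
proof -
  have "f -` A \<inter> \<Omega>' \<in> {f -` c \<inter> \<Omega>' |c. c \<in> sigma_sets \<Omega> C}" using A by blast
  also have "\<dots> = sigma_sets \<Omega>' {f -` c \<inter> \<Omega>' |c. c \<in> C}" by (rule sigma_sets_vimage_commute[OF f])
  also have "{f -` c \<inter> \<Omega>' |c. c \<in> C} = (\<lambda>c. f -` c \<inter> \<Omega>') ` C" by auto
  finally show ?thesis .
qed

lemma countably_generated_circle_borel: "countably_generated circle_borel"
proof -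
  obtain D :: "complex set set" where D: "countable D" "topological_basis D"
    using ex_countable_basis by blast
  let ?f = "\<lambda>z. z :: complex"
  have b: "sets (borel :: complex measure) = sigma_sets UNIV D"
    by (subst borel_eq_countable_basis[OF D]) (rule sets_measure_of, simp)
  show ?thesis
  proof (rule countably_generatedI)
    show "countable ((\<lambda>c. ?f -` c \<inter> sphere 0 1) ` D)" using D(1) by (rule countable_image)
    show "(\<lambda>c. ?f -` c \<inter> sphere 0 1) ` D \<subseteq> sets circle_borel"
      using b by (auto simp: circle_borel_def sets_restrict_space)
    show "sets circle_borel \<subseteq> sigma_sets (space circle_borel) ((\<lambda>c. ?f -` c \<inter> sphere 0 1) ` D)"
    proof
      fix A assume "A \<in> sets circle_borel"
      then obtain A' where A': "A' \<in> sigma_sets UNIV D" "A = sphere 0 1 \<inter> A'"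
        using b by (auto simp: circle_borel_def sets_restrict_space)
      have "?f -` A' \<inter> sphere 0 1 \<in> sigma_sets (sphere 0 1) ((\<lambda>c. ?f -` c \<inter> sphere 0 1) ` D)"
        by (rule sigma_sets_vimage_mem[OF _ A'(1)]) simp
      then show "A \<in> sigma_sets (space circle_borel) ((\<lambda>c. ?f -` c \<inter> sphere 0 1) ` D)"
        unfolding A'(2) space_circle_borel by (simp add: vimage_def Int_commute)
    qed
  qed
qed

lemma countably_generated_count_space: "countably_generated (count_space (UNIV :: 'a :: countable set))"
proof (rule countably_generatedI)
  let ?C = "range (\<lambda>x :: 'a. {x})"
  show "countable ?C" by simp
  show "sets (count_space UNIV) \<subseteq> sigma_sets (space (count_space UNIV)) ?C"
  proof
    fix A :: "'a set"
    have "(\<Union>x\<in>A. {x}) \<in> sigma_sets UNIV ?C"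
      by (rule sigma_sets_UNION) (auto intro: countable_subset)
    then show "A \<in> sigma_sets (space (count_space UNIV)) ?C" by simp
  qed
qed auto

lemma countably_generated_pair:
  assumes "countably_generated M" "countably_generated N"
  shows "countably_generated (M \<Otimes>\<^sub>M N)"
proof -
  obtain C where C: "countable C" "C \<subseteq> sets M" "sets M = sigma_sets (space M) C"
    using assms(1) by (rule countably_generatedE)
  obtain D where D: "countable D" "D \<subseteq> sets N" "sets N = sigma_sets (space N) D"
    using assms(2) by (rule countably_generatedE)
  let ?\<Omega> = "space M \<times> space N"
  let ?E = "(\<lambda>c. fst -` c \<inter> ?\<Omega>) ` C \<union> (\<lambda>d. snd -` d \<inter> ?\<Omega>) ` D"
  show ?thesis
  proof (rule countably_generatedI)
    show "countable ?E" using C(1) D(1) by (intro countable_Un countable_image)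
    show "?E \<subseteq> sets (M \<Otimes>\<^sub>M N)"
      using C(2) D(2) measurable_sets[OF measurable_fst, of _ M N] measurable_sets[OF measurable_snd, of _ N M]
      by (auto simp: space_pair_measure)
    have sp: "?E \<subseteq> Pow ?\<Omega>" by auto
    have Int: "x \<inter> y \<in> sigma_sets ?\<Omega> ?E" if "x \<in> sigma_sets ?\<Omega> ?E" "y \<in> sigma_sets ?\<Omega> ?E" for x y
    proof -
      interpret E: sigma_algebra ?\<Omega> "sigma_sets ?\<Omega> ?E" by (rule sigma_algebra_sigma_sets[OF sp])
      show ?thesis using that by (rule E.Int)
    qed
    show "sets (M \<Otimes>\<^sub>M N) \<subseteq> sigma_sets (space (M \<Otimes>\<^sub>M N)) ?E"
      unfolding sets_pair_measure space_pair_measure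
    proof (rule sigma_sets_mono, safe)
      fix a b assume a: "a \<in> sets M" and b: "b \<in> sets N"
      have "fst -` a \<inter> ?\<Omega> \<in> sigma_sets ?\<Omega> ((\<lambda>c. fst -` c \<inter> ?\<Omega>) ` C)"
        using a C(3) by (intro sigma_sets_vimage_mem[where \<Omega>="space M"]) auto
      then have 1: "fst -` a \<inter> ?\<Omega> \<in> sigma_sets ?\<Omega> ?E" by (rule subsetD[OF sigma_sets_mono', rotated]) simp
      have "snd -` b \<inter> ?\<Omega> \<in> sigma_sets ?\<Omega> ((\<lambda>d. snd -` d \<inter> ?\<Omega>) ` D)"
        using b D(3) by (intro sigma_sets_vimage_mem[where \<Omega>="space N"]) auto
      then have 2: "snd -` b \<inter> ?\<Omega> \<in> sigma_sets ?\<Omega> ?E" by (rule subsetD[OF sigma_sets_mono', rotated]) simp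
      have "a \<times> b = (fst -` a \<inter> ?\<Omega>) \<inter> (snd -` b \<inter> ?\<Omega>)"
        using sets.sets_into_space[OF a] sets.sets_into_space[OF b] by auto
      then show "a \<times> b \<in> sigma_sets ?\<Omega> ?E"
        by (rule ssubst) (rule Int[OF 1 2])
    qed
  qed
qed

lemma countably_generated_PiM:
  assumes "countably_generated M" "countable I"
  shows "countably_generated (PiM I (\<lambda>_. M))"
proof -
  obtain C where C: "countable C" "C \<subseteq> sets M" "sets M = sigma_sets (space M) C"
    using assms(1) by (rule countably_generatedE)
  let ?\<Omega> = "\<Pi>\<^sub>E i\<in>I. space M"
  let ?E = "\<Union>i\<in>I. (\<lambda>c. (\<lambda>\<omega>. \<omega> i) -` c \<inter> ?\<Omega>) ` C"
  show ?thesis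
  proof (rule countably_generatedI)
    show "countable ?E" by (rule countable_UN[OF assms(2) countable_image[OF C(1)]])
    show "?E \<subseteq> sets (PiM I (\<lambda>_. M))"
    proof safe
      fix i c assume "i \<in> I" "c \<in> C"
      then show "(\<lambda>\<omega>. \<omega> i) -` c \<inter> ?\<Omega> \<in> sets (PiM I (\<lambda>_. M))"
        using C(2) measurable_sets[OF measurable_component_singleton[of i I "\<lambda>_. M"], of c] by (auto simp: space_PiM)
    qed
    show "sets (PiM I (\<lambda>_. M)) \<subseteq> sigma_sets (space (PiM I (\<lambda>_. M))) ?E"
      unfolding sets_PiM_single space_PiM
    proof (rule sigma_sets_mono, safe)
      fix i A assume i: "i \<in> I" and A: "A \<in> sets M"
      have "(\<lambda>\<omega>. \<omega> i) -` A \<inter> ?\<Omega> \<in> sigma_sets ?\<Omega> ((\<lambda>c. (\<lambda>\<omega>. \<omega> i) -` c \<inter> ?\<Omega>) ` C)"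
        using i A C(3) by (intro sigma_sets_vimage_mem[where \<Omega>="space M"]) auto
      moreover have "(\<lambda>c. (\<lambda>\<omega>. \<omega> i) -` c \<inter> ?\<Omega>) ` C \<subseteq> ?E" using i by blast
      note sigma_sets_mono'[OF this, of ?\<Omega>]
      ultimately have "(\<lambda>\<omega>. \<omega> i) -` A \<inter> ?\<Omega> \<in> sigma_sets ?\<Omega> ?E" by (rule rev_subsetD)
      moreover have "{\<omega> \<in> ?\<Omega>. \<omega> i \<in> A} = (\<lambda>\<omega>. \<omega> i) -` A \<inter> ?\<Omega>" by auto
      ultimately show "{\<omega> \<in> ?\<Omega>. \<omega> i \<in> A} \<in> sigma_sets ?\<Omega> ?E" by simp
    qed
  qed
qed

lemma countably_generated_normalized:
  assumes "normalized_borel_measure \<sigma>"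
  shows "countably_generated \<sigma>"
  using assms countably_generated_pair[OF countably_generated_circle_borel countably_generated_count_space]
  unfolding normalized_borel_measure_def by (metis countably_generated_cong)

text \<open>The product of countably generated spaces is countably generated, so the multiplication
  operator of the product model has a spectral measure dominated by the law of its symbol. The
  inverse of the model map carries this to the tensor power.\<close>

theorem tensor_power_spectral_measure_exists:
  assumes T: "unitary_operator H T" and \<sigma>: "is_spectral_measure H T \<sigma>"
  obtains \<tau> where "is_spectral_measure (tensor_power n H) (tensor_power_operator n H T) \<tau>"
    "absolutely_continuous (convolution_power (circle_projection \<sigma>) n) (circle_projection \<tau>)"
proof -
  let ?M = "PiM {..<n} (\<lambda>_. \<sigma>)" and ?\<phi> = "\<lambda>\<omega>. \<Prod>i<n. fst (\<omega> i) :: complex"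
  from \<sigma> obtain U0 where n\<sigma>: "normalized_borel_measure \<sigma>" and U0: "unitary_map H (L2 \<sigma>) U0"
    "\<And>x. x \<in> carrier H \<Longrightarrow> U0 (T x) = coordinate_multiplication \<sigma> (U0 x)"
    by (auto simp: is_spectral_measure_def unitarily_equivalent_def)
  obtain W where W: "unitary_map (L2 ?M) (tensor_power n H) W"
    "\<And>A. A \<in> carrier (L2 ?M) \<Longrightarrow> W (l2_mult ?M ?\<phi> A) = tensor_power_operator n H T (W A)"
    using U0(2) that by (rule tensor_power_model[where n=n, OF n\<sigma> U0(1) _ T])
  have M: "prob_space ?M" using n\<sigma> by (intro prob_space_PiM) (simp add: normalized_borel_measure_def)
  have \<phi>: "?\<phi> \<in> measurable ?M circle_borel"
    by (intro measurable_circle_prod measurable_PiM_component normalized_borel_measure_fst n\<sigma>)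
  have "countably_generated ?M"
    by (intro countably_generated_PiM countably_generated_normalized n\<sigma>) simp
  then obtain B :: "nat \<Rightarrow> _" where B: "range B \<subseteq> Pow (space ?M)" "sets ?M = sigma_sets (space ?M) (range B)"
    unfolding countably_generated_def by blast
  obtain \<tau> R where n\<tau>: "normalized_borel_measure \<tau>" and R: "unitary_map (L2 ?M) (L2 \<tau>) R"
    "\<And>A. A \<in> carrier (L2 ?M) \<Longrightarrow> R (l2_mult ?M ?\<phi> A) = coordinate_multiplication \<tau> (R A)"
    and ac: "absolutely_continuous (distr ?M circle_borel ?\<phi>) (circle_projection \<tau>)"
    using multiplication_spectral_measure[OF M \<phi> B(2,1)] by blast
  let ?V = "inv_into (carrier (L2 ?M)) W"
  have V: "unitary_map (tensor_power n H) (L2 ?M) ?V"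
    by (rule unitary_map_inv_into[OF W(1) L2_add_closed L2_smult_closed])
  have "R (?V (tensor_power_operator n H T F)) = coordinate_multiplication \<tau> (R (?V F))"
    if F: "F \<in> carrier (tensor_power n H)" for F
  proof -
    have VF: "?V F \<in> carrier (L2 ?M)" using unitary_mapD(5)[OF V F] .
    have "F \<in> W ` carrier (L2 ?M)" using F bij_betw_imp_surj_on[OF unitary_mapD(1)[OF W(1)]] by simp
    then have WV: "W (?V F) = F" by (rule f_inv_into_f)
    have "l2_mult ?M ?\<phi> (?V F) \<in> carrier (L2 ?M)"
      using \<phi> by (intro l2_mult_carrier[OF VF, of _ 1]) (auto simp: measurable_circle_borel_iff)
    then have "?V (W (l2_mult ?M ?\<phi> (?V F))) = l2_mult ?M ?\<phi> (?V F)"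
      by (rule inv_into_f_f[OF bij_betw_imp_inj_on[OF unitary_mapD(1)[OF W(1)]]])
    then show ?thesis using W(2)[OF VF] R(2)[OF VF] WV by simp
  qed
  then have "is_spectral_measure (tensor_power n H) (tensor_power_operator n H T) \<tau>"
    unfolding is_spectral_measure_def unitarily_equivalent_def
    using n\<tau> unitary_map_comp[OF V R(1)] by blast
  then show ?thesis using that ac convolution_power_projection[OF n\<sigma>] by simp
qed

section \<open>A separable Hilbert space of square-integrable functions\<close>

text \<open>The notions of metric topology and completeness only unfold for a distance that is symmetric on
  the whole type, which fails for \<open>L2 M\<close> outside its carrier. In the following copy of
  \<open>L2 M\<close>, arguments outside the carrier are read as zero.\<close>

definition L2_retract :: "'x measure \<Rightarrow> ('x \<Rightarrow> complex) set \<Rightarrow> ('x \<Rightarrow> complex) set" where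
  "L2_retract M A = (if A \<in> carrier (L2 M) then A else \<zero>\<^bsub>L2 M\<^esub>)"

text \<open>Besides the zero, \<open>hdist\<close> involves only \<open>add\<close>, through the
  additive inverse in \<open>\<ominus>\<close>, and \<open>ip\<close>; these are the operations that
  are retracted.\<close>

definition L2_total :: "'x measure \<Rightarrow> ('x \<Rightarrow> complex) set ip_module" where
  "L2_total M = \<lparr>carrier = carrier (L2 M),
           mult = undefined,
           one = undefined,
           zero = \<zero>\<^bsub>L2 M\<^esub>,
           add = (\<lambda>A B. L2_retract M A \<oplus>\<^bsub>L2 M\<^esub> L2_retract M B),
           smult = smult (L2 M),
           ip = (\<lambda>A B. ip (L2 M) (L2_retract M A) (L2_retract M B))\<rparr>"

lemma L2_total_simps [simp]:
  "carrier (L2_total M) = carrier (L2 M)" "\<zero>\<^bsub>L2_total M\<^esub> = \<zero>\<^bsub>L2 M\<^esub>"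
  "A \<oplus>\<^bsub>L2_total M\<^esub> B = L2_retract M A \<oplus>\<^bsub>L2 M\<^esub> L2_retract M B"
  "c \<odot>\<^bsub>L2_total M\<^esub> A = c \<odot>\<^bsub>L2 M\<^esub> A"
  "ip (L2_total M) A B = ip (L2 M) (L2_retract M A) (L2_retract M B)"
  by (simp_all add: L2_total_def)

lemma L2_zero_carrier: "\<zero>\<^bsub>L2 M\<^esub> \<in> carrier (L2 M)"
  unfolding zero_L2 by (rule L2_carrierI) simp

lemma L2_retract_carrier: "L2_retract M A \<in> carrier (L2 M)"
  by (simp add: L2_retract_def L2_zero_carrier)

lemma L2_retract_id [simp]: "A \<in> carrier (L2 M) \<Longrightarrow> L2_retract M A = A"
  by (simp add: L2_retract_def)

definition L2_rep :: "'x measure \<Rightarrow> ('x \<Rightarrow> complex) set \<Rightarrow> 'x \<Rightarrow> complex" where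
  "L2_rep M A = rep (L2_retract M A)"

lemma L2_rep_sq: "square_integrable M (L2_rep M A)"
  unfolding L2_rep_def by (rule square_integrable_rep[OF L2_retract_carrier])

lemma L2_rep_m: "L2_rep M A \<in> borel_measurable M"
  by (rule square_integrable_measurable[OF L2_rep_sq])

lemma L2_rep_class:
  assumes "square_integrable M f"
  shows "AE x in M. L2_rep M (ae_class M f) x = f x"
  using rep_ae_class(2)[OF square_integrable_measurable[OF assms]] L2_carrierI[OF assms] by (simp add: L2_rep_def)

lemma L2_class_rep: "A \<in> carrier (L2 M) \<Longrightarrow> ae_class M (L2_rep M A) = A"
  by (simp add: L2_rep_def ae_class_rep)

lemma L2_total_add: "A \<oplus>\<^bsub>L2_total M\<^esub> B = ae_class M (\<lambda>x. L2_rep M A x + L2_rep M B x)"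
  by (simp add: add_L2 L2_rep_def)

lemma L2_total_ip: "ip (L2_total M) A B = l2ip M (L2_rep M A) (L2_rep M B)"
  by (simp add: ip_L2 L2_rep_def)

lemma L2_total_smult: "A \<in> carrier (L2 M) \<Longrightarrow> c \<odot>\<^bsub>L2_total M\<^esub> A = ae_class M (\<lambda>x. c * L2_rep M A x)"
  by (simp add: smult_L2 L2_rep_def)

lemma L2_eqI:
  assumes "A \<in> carrier (L2 M)" "B \<in> carrier (L2 M)" "AE x in M. L2_rep M A x = L2_rep M B x"
  shows "A = B"
  using ae_class_cong[OF L2_rep_m L2_rep_m assms(3)] by (simp add: L2_class_rep assms(1,2))

lemma L2_rep_add: "AE x in M. L2_rep M (A \<oplus>\<^bsub>L2_total M\<^esub> B) x = L2_rep M A x + L2_rep M B x"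
  unfolding L2_total_add by (intro L2_rep_class square_integrable_add L2_rep_sq)

lemma L2_rep_smult: "A \<in> carrier (L2 M) \<Longrightarrow> AE x in M. L2_rep M (c \<odot>\<^bsub>L2_total M\<^esub> A) x = c * L2_rep M A x"
  unfolding L2_total_smult by (intro L2_rep_class square_integrable_cmult L2_rep_sq)

lemma L2_rep_zero: "AE x in M. L2_rep M \<zero>\<^bsub>L2 M\<^esub> x = 0"
  unfolding zero_L2 by (rule L2_rep_class) simp

lemma L2_total_add_closed: "A \<oplus>\<^bsub>L2_total M\<^esub> B \<in> carrier (L2 M)"
  unfolding L2_total_add by (intro L2_carrierI square_integrable_add L2_rep_sq)

lemma L2_total_abelian: "abelian_group (L2_total M)"
proof (rule abelian_groupI)
  show "x \<oplus>\<^bsub>L2_total M\<^esub> y \<in> carrier (L2_total M)" for x y 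
    using L2_total_add_closed[of M x y] by simp
  show "\<zero>\<^bsub>L2_total M\<^esub> \<in> carrier (L2_total M)" by (simp add: L2_zero_carrier)
  show "x \<oplus>\<^bsub>L2_total M\<^esub> y \<oplus>\<^bsub>L2_total M\<^esub> z = x \<oplus>\<^bsub>L2_total M\<^esub> (y \<oplus>\<^bsub>L2_total M\<^esub> z)" for x y z
  proof (rule L2_eqI[OF L2_total_add_closed L2_total_add_closed])
    show "AE t in M. L2_rep M (x \<oplus>\<^bsub>L2_total M\<^esub> y \<oplus>\<^bsub>L2_total M\<^esub> z) t = L2_rep M (x \<oplus>\<^bsub>L2_total M\<^esub> (y \<oplus>\<^bsub>L2_total M\<^esub> z)) t"
      using L2_rep_add[of M "x \<oplus>\<^bsub>L2_total M\<^esub> y" z] L2_rep_add[of M x y]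
        L2_rep_add[of M x "y \<oplus>\<^bsub>L2_total M\<^esub> z"] L2_rep_add[of M y z]
      by eventually_elim (simp del: L2_total_simps)
  qed
  show "x \<oplus>\<^bsub>L2_total M\<^esub> y = y \<oplus>\<^bsub>L2_total M\<^esub> x" for x y
    unfolding L2_total_add by (simp add: add.commute)
  show "\<zero>\<^bsub>L2_total M\<^esub> \<oplus>\<^bsub>L2_total M\<^esub> x = x" if "x \<in> carrier (L2_total M)" for x
  proof (rule L2_eqI[OF L2_total_add_closed])
    show "AE t in M. L2_rep M (\<zero>\<^bsub>L2_total M\<^esub> \<oplus>\<^bsub>L2_total M\<^esub> x) t = L2_rep M x t"
      using L2_rep_add[of M "\<zero>\<^bsub>L2_total M\<^esub>" x] L2_rep_zero[of M]
      by eventually_elim (simp del: L2_total_simps(3))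
  qed (use that in simp)
  show "\<exists>y\<in>carrier (L2_total M). y \<oplus>\<^bsub>L2_total M\<^esub> x = \<zero>\<^bsub>L2_total M\<^esub>" for x
  proof
    let ?y = "ae_class M (\<lambda>t. - 1 * L2_rep M x t)"
    have sq: "square_integrable M (\<lambda>t. - 1 * L2_rep M x t)" by (rule square_integrable_cmult[OF L2_rep_sq])
    show "?y \<in> carrier (L2_total M)" using L2_carrierI[OF sq] by simp
    show "?y \<oplus>\<^bsub>L2_total M\<^esub> x = \<zero>\<^bsub>L2_total M\<^esub>"
    proof (rule L2_eqI[OF L2_total_add_closed])
      show "AE t in M. L2_rep M (?y \<oplus>\<^bsub>L2_total M\<^esub> x) t = L2_rep M \<zero>\<^bsub>L2_total M\<^esub> t"
        using L2_rep_add[of M ?y x] L2_rep_zero[of M] L2_rep_class[OF sq]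
        by eventually_elim (simp del: L2_total_simps(3))
    qed (simp add: L2_zero_carrier)
  qed
qed

text \<open>The inverse is a definite description and is evaluated for every \<open>y\<close>,
  inside the carrier or not, so its uniqueness is checked through representatives instead of through
  the group laws.\<close>

lemma L2_total_minus: 
  "\<ominus>\<^bsub>L2_total M\<^esub> y \<in> carrier (L2 M)" "AE t in M. L2_rep M (\<ominus>\<^bsub>L2_total M\<^esub> y) t = - L2_rep M y t"
proof -
  let ?P = "\<lambda>z. z \<in> carrier (L2 M) \<and> y \<oplus>\<^bsub>L2_total M\<^esub> z = \<zero>\<^bsub>L2 M\<^esub> \<and> z \<oplus>\<^bsub>L2_total M\<^esub> y = \<zero>\<^bsub>L2 M\<^esub>"
  let ?z = "ae_class M (\<lambda>t. - 1 * L2_rep M y t)"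
  have sq: "square_integrable M (\<lambda>t. - 1 * L2_rep M y t)" by (rule square_integrable_cmult[OF L2_rep_sq])
  have zc: "?z \<in> carrier (L2 M)" by (rule L2_carrierI[OF sq])
  have comm: "a \<oplus>\<^bsub>L2_total M\<^esub> b = b \<oplus>\<^bsub>L2_total M\<^esub> a" for a b unfolding L2_total_add by (simp add: add.commute)
  have "y \<oplus>\<^bsub>L2_total M\<^esub> ?z = \<zero>\<^bsub>L2 M\<^esub>"
  proof (rule L2_eqI[OF L2_total_add_closed L2_zero_carrier])
    show "AE t in M. L2_rep M (y \<oplus>\<^bsub>L2_total M\<^esub> ?z) t = L2_rep M \<zero>\<^bsub>L2 M\<^esub> t"
      using L2_rep_add[of M y ?z] L2_rep_zero[of M] L2_rep_class[OF sq]
      by eventually_elim (simp del: L2_total_simps(3))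
  qed
  then have P: "?P ?z" using zc comm[of y ?z] by (simp del: L2_total_simps)
  have uniq: "z = ?z" if z: "?P z" for z
  proof (rule L2_eqI[OF _ zc])
    show "z \<in> carrier (L2 M)" using z by blast
    have e: "y \<oplus>\<^bsub>L2_total M\<^esub> z = \<zero>\<^bsub>L2 M\<^esub>" using z by blast
    show "AE t in M. L2_rep M z t = L2_rep M ?z t"
      using L2_rep_add[of M y z, unfolded e] L2_rep_zero[of M] L2_rep_class[OF sq]
      by eventually_elim (simp add: add_eq_0_iff)
  qed
  have "\<ominus>\<^bsub>L2_total M\<^esub> y = (THE z. ?P z)"
    by (simp only: a_inv_def m_inv_def monoid.simps partial_object.simps L2_total_simps(1,2))
  also have "\<dots> = ?z" using P uniq by (rule the_equality)
  finally have eq: "\<ominus>\<^bsub>L2_total M\<^esub> y = ?z" .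
  show "\<ominus>\<^bsub>L2_total M\<^esub> y \<in> carrier (L2 M)" unfolding eq by (rule zc)
  show "AE t in M. L2_rep M (\<ominus>\<^bsub>L2_total M\<^esub> y) t = - L2_rep M y t"
    unfolding eq using L2_rep_class[OF sq] by simp
qed

text \<open>The formula holds for all arguments, as nonnegativity and symmetry in
  \<open>Metric_space\<close> are demanded on the whole type.\<close>

lemma L2_total_hdist: "hdist (L2_total M) x y = l2norm M (\<lambda>t. L2_rep M x t - L2_rep M y t)"
proof -
  have "hdist (L2_total M) x y = l2norm M (L2_rep M (x \<ominus>\<^bsub>L2_total M\<^esub> y))"
    unfolding hdist_def hnorm_def L2_total_ip by (simp add: l2ip_self flip: of_real_power)
  also have "\<dots> = l2norm M (\<lambda>t. L2_rep M x t - L2_rep M y t)"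
    unfolding a_minus_def
  proof (intro l2norm_cong_AE L2_rep_m borel_measurable_diff)
    show "AE t in M. L2_rep M (x \<oplus>\<^bsub>L2_total M\<^esub> \<ominus>\<^bsub>L2_total M\<^esub> y) t = L2_rep M x t - L2_rep M y t"
      using L2_rep_add[of M x "\<ominus>\<^bsub>L2_total M\<^esub> y"] L2_total_minus(2)[of M y]
      by eventually_elim (simp del: L2_total_simps)
  qed
  finally show ?thesis .
qed

lemma L2_total_metric: "Metric_space (carrier (L2_total M)) (hdist (L2_total M))"
proof
  show "0 \<le> hdist (L2_total M) x y" for x y unfolding L2_total_hdist by simp
  show "hdist (L2_total M) x y = hdist (L2_total M) y x" for x y
    unfolding L2_total_hdist by (rule l2norm_minus_commute)
  show "hdist (L2_total M) x y = 0 \<longleftrightarrow> x = y" if "x \<in> carrier (L2_total M)" "y \<in> carrier (L2_total M)" for x y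
  proof
    assume "hdist (L2_total M) x y = 0"
    then have "AE t in M. L2_rep M x t - L2_rep M y t = 0"
      unfolding L2_total_hdist by (subst (asm) l2norm_eq_0_iff) (intro square_integrable_diff L2_rep_sq)
    then show "x = y" using that by (intro L2_eqI) (auto elim!: eventually_mono)
  qed (simp add: L2_total_hdist l2norm_def)
  show "hdist (L2_total M) x z \<le> hdist (L2_total M) x y + hdist (L2_total M) y z" for x y z
    unfolding L2_total_hdist by (intro l2norm_triangle_diff L2_rep_sq)
qed

lemma L2_total_module: "module (ring_of_type_algebra :: complex ring) (L2_total M)"
proof (rule module.intro)
  show "cring (ring_of_type_algebra :: complex ring)" by (rule cring_from_type_algebra)
  show "abelian_group (L2_total M)" by (rule L2_total_abelian)
  have sc: "c \<odot>\<^bsub>L2_total M\<^esub> x \<in> carrier (L2 M)" if "x \<in> carrier (L2 M)" for c x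
    using L2_smult_closed[OF that] by simp
  show "module_axioms (ring_of_type_algebra :: complex ring) (L2_total M)"
  proof
    fix a b :: complex and x y
    assume "x \<in> carrier (L2_total M)"
    then have x: "x \<in> carrier (L2 M)" by simp
    show "a \<odot>\<^bsub>L2_total M\<^esub> x \<in> carrier (L2_total M)" using sc[OF x] by simp
    show "(a \<oplus>\<^bsub>ring_of_type_algebra\<^esub> b) \<odot>\<^bsub>L2_total M\<^esub> x = a \<odot>\<^bsub>L2_total M\<^esub> x \<oplus>\<^bsub>L2_total M\<^esub> b \<odot>\<^bsub>L2_total M\<^esub> x"
    proof (rule L2_eqI[OF sc[OF x] L2_total_add_closed])
      show "AE t in M. L2_rep M ((a \<oplus>\<^bsub>ring_of_type_algebra\<^esub> b) \<odot>\<^bsub>L2_total M\<^esub> x) t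
          = L2_rep M (a \<odot>\<^bsub>L2_total M\<^esub> x \<oplus>\<^bsub>L2_total M\<^esub> b \<odot>\<^bsub>L2_total M\<^esub> x) t"
        using L2_rep_smult[OF x, of "a \<oplus>\<^bsub>ring_of_type_algebra\<^esub> b"] L2_rep_smult[OF x, of a] L2_rep_smult[OF x, of b]
          L2_rep_add[of M "a \<odot>\<^bsub>L2_total M\<^esub> x" "b \<odot>\<^bsub>L2_total M\<^esub> x"]
        by eventually_elim (simp del: L2_total_simps add: ring_of_type_algebra_def distrib_right)
    qed
    show "(a \<otimes>\<^bsub>ring_of_type_algebra\<^esub> b) \<odot>\<^bsub>L2_total M\<^esub> x = a \<odot>\<^bsub>L2_total M\<^esub> (b \<odot>\<^bsub>L2_total M\<^esub> x)"
    proof (rule L2_eqI[OF sc[OF x] sc[OF sc[OF x]]])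
      show "AE t in M. L2_rep M ((a \<otimes>\<^bsub>ring_of_type_algebra\<^esub> b) \<odot>\<^bsub>L2_total M\<^esub> x) t
          = L2_rep M (a \<odot>\<^bsub>L2_total M\<^esub> (b \<odot>\<^bsub>L2_total M\<^esub> x)) t"
        using L2_rep_smult[OF x, of "a \<otimes>\<^bsub>ring_of_type_algebra\<^esub> b"] L2_rep_smult[OF sc[OF x], of a b] L2_rep_smult[OF x, of b]
        by eventually_elim (simp del: L2_total_simps add: ring_of_type_algebra_def mult.assoc)
    qed
    show "\<one>\<^bsub>ring_of_type_algebra\<^esub> \<odot>\<^bsub>L2_total M\<^esub> x = x"
    proof (rule L2_eqI[OF sc[OF x] x])
      show "AE t in M. L2_rep M (\<one>\<^bsub>ring_of_type_algebra\<^esub> \<odot>\<^bsub>L2_total M\<^esub> x) t = L2_rep M x t"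
        using L2_rep_smult[OF x, of "\<one>\<^bsub>ring_of_type_algebra\<^esub>"]
        by eventually_elim (simp del: L2_total_simps add: ring_of_type_algebra_def)
    qed
    assume "y \<in> carrier (L2_total M)"
    then have y: "y \<in> carrier (L2 M)" by simp
    show "a \<odot>\<^bsub>L2_total M\<^esub> (x \<oplus>\<^bsub>L2_total M\<^esub> y) = a \<odot>\<^bsub>L2_total M\<^esub> x \<oplus>\<^bsub>L2_total M\<^esub> a \<odot>\<^bsub>L2_total M\<^esub> y"
    proof (rule L2_eqI[OF sc[OF L2_total_add_closed] L2_total_add_closed])
      show "AE t in M. L2_rep M (a \<odot>\<^bsub>L2_total M\<^esub> (x \<oplus>\<^bsub>L2_total M\<^esub> y)) t
          = L2_rep M (a \<odot>\<^bsub>L2_total M\<^esub> x \<oplus>\<^bsub>L2_total M\<^esub> a \<odot>\<^bsub>L2_total M\<^esub> y) t"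
        using L2_rep_smult[OF L2_total_add_closed[of M x y], of a] L2_rep_add[of M x y] L2_rep_smult[OF x, of a] L2_rep_smult[OF y, of a]
          L2_rep_add[of M "a \<odot>\<^bsub>L2_total M\<^esub> x" "a \<odot>\<^bsub>L2_total M\<^esub> y"]
        by eventually_elim (simp del: L2_total_simps add: distrib_left)
    qed
  qed
qed

lemma L2_total_complete:
  assumes "finite_measure M"
  shows "Metric_space.mcomplete (carrier (L2_total M)) (hdist (L2_total M))"
proof -
  interpret Metric_space "carrier (L2_total M)" "hdist (L2_total M)" by (rule L2_total_metric)
  show ?thesis unfolding mcomplete_def
  proof (intro allI impI)
    fix s assume s: "MCauchy s"
    have "\<exists>N. \<forall>p\<ge>N. \<forall>q\<ge>N. l2norm M (\<lambda>t. L2_rep M (s p) t - L2_rep M (s q) t) < e" if "e > 0" for e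
    proof -
      have "\<exists>N. \<forall>p q. N \<le> p \<longrightarrow> N \<le> q \<longrightarrow> hdist (L2_total M) (s p) (s q) < e"
        using s that by (simp only: MCauchy_def)
      then obtain N where "\<forall>p q. N \<le> p \<longrightarrow> N \<le> q \<longrightarrow> hdist (L2_total M) (s p) (s q) < e" ..
      then have "\<forall>p\<ge>N. \<forall>q\<ge>N. hdist (L2_total M) (s p) (s q) < e" by simp
      then show ?thesis unfolding L2_total_hdist ..
    qed
    from finite_measure.l2_complete[OF assms L2_rep_sq this] obtain f where
      f: "square_integrable M f" "(\<lambda>m. l2norm M (\<lambda>t. L2_rep M (s m) t - f t)) \<longlonglongrightarrow> 0" by blast
    let ?l = "ae_class M f"
    have d: "hdist (L2_total M) (s m) ?l = l2norm M (\<lambda>t. L2_rep M (s m) t - f t)" for m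
      unfolding L2_total_hdist using L2_rep_class[OF f(1)]
      by (intro l2norm_cong_AE borel_measurable_diff L2_rep_m square_integrable_measurable[OF f(1)])
         (auto elim!: eventually_mono)
    have "limitin mtopology s ?l sequentially"
      unfolding limit_metric_sequentially
    proof (intro conjI allI impI)
      show "?l \<in> carrier (L2_total M)" using L2_carrierI[OF f(1)] by simp
      fix e :: real assume "e > 0"
      then obtain N where N: "\<And>m. m \<ge> N \<Longrightarrow> l2norm M (\<lambda>t. L2_rep M (s m) t - f t) < e"
        using LIMSEQ_D[OF f(2), of e] by auto
      have "s m \<in> carrier (L2_total M)" for m using s unfolding MCauchy_def by blast
      then show "\<exists>N. \<forall>m\<ge>N. s m \<in> carrier (L2_total M) \<and> hdist (L2_total M) (s m) ?l < e"
        unfolding d using N by blast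
    qed
    then show "\<exists>x. limitin mtopology s x sequentially" by blast
  qed
qed

lemma L2_total_hilbert:
  assumes "finite_measure M"
  shows "hilbert_space (L2_total M)"
proof (rule hilbert_space.intro[OF L2_total_module], rule hilbert_space_axioms.intro)
  fix x y z and c :: complex
  show "ip (L2_total M) x (y \<oplus>\<^bsub>L2_total M\<^esub> z) = ip (L2_total M) x y + ip (L2_total M) x z"
  proof -
    have "l2ip M (L2_rep M x) (L2_rep M (y \<oplus>\<^bsub>L2_total M\<^esub> z)) = l2ip M (L2_rep M x) (\<lambda>t. L2_rep M y t + L2_rep M z t)"
      by (intro l2ip_cong_AE L2_rep_m borel_measurable_add L2_rep_add) simp
    then show ?thesis unfolding L2_total_ip by (simp only: l2ip_add_right L2_rep_sq)
  qed
  show "ip (L2_total M) y x = cnj (ip (L2_total M) x y)" unfolding L2_total_ip by (rule l2ip_commute)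
  show "0 \<le> Re (ip (L2_total M) x x)" unfolding L2_total_ip l2ip_self by simp
  show "Metric_space.mcomplete (carrier (L2_total M)) (hdist (L2_total M))" by (rule L2_total_complete[OF assms])
  assume "y \<in> carrier (L2_total M)"
  then have y: "y \<in> carrier (L2 M)" by simp
  show "ip (L2_total M) x (c \<odot>\<^bsub>L2_total M\<^esub> y) = c * ip (L2_total M) x y"
  proof -
    have "l2ip M (L2_rep M x) (L2_rep M (c \<odot>\<^bsub>L2_total M\<^esub> y)) = l2ip M (L2_rep M x) (\<lambda>t. c * L2_rep M y t)"
      by (intro l2ip_cong_AE L2_rep_m borel_measurable_times borel_measurable_const L2_rep_smult y) simp
    then show ?thesis unfolding L2_total_ip by (simp only: l2ip_cmult_right)
  qed
next
  fix x assume x: "x \<in> carrier (L2_total M)" and "ip (L2_total M) x x = 0"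
  then have "l2norm M (L2_rep M x) = 0" unfolding L2_total_ip l2ip_self by simp
  then have "AE t in M. L2_rep M x t = 0" by (simp add: l2norm_eq_0_iff L2_rep_sq)
  then have "AE t in M. L2_rep M x t = L2_rep M \<zero>\<^bsub>L2 M\<^esub> t" using L2_rep_zero by eventually_elim simp
  then show "x = \<zero>\<^bsub>L2_total M\<^esub>" using x by (simp add: L2_eqI L2_zero_carrier)
qed

section \<open>Countable total families and separability of the space of square-integrable
  functions\<close>

lemma l2norm_sum_le:
  assumes "finite I" "\<And>i. i \<in> I \<Longrightarrow> square_integrable M (f i)"
  shows "l2norm M (\<lambda>x. \<Sum>i\<in>I. f i x) \<le> (\<Sum>i\<in>I. l2norm M (f i))"
  using assms
proof (induction I rule: finite_induct)
  case empty
  show ?case by (simp add: l2norm_def)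
next
  case (insert i I)
  have "l2norm M (\<lambda>x. f i x + (\<Sum>j\<in>I. f j x)) \<le> l2norm M (f i) + l2norm M (\<lambda>x. \<Sum>j\<in>I. f j x)"
    by (intro l2norm_triangle square_integrable_sum insert.prems) auto
  also have "\<dots> \<le> l2norm M (f i) + (\<Sum>j\<in>I. l2norm M (f j))"
    using insert by (intro add_left_mono) auto
  finally show ?case using insert.hyps by simp
qed

text \<open>Closing a countable generator under finite intersections keeps it countable and gives
  the intersection-stable generator needed for totality.\<close>

lemma countable_total_family:
  assumes M: "finite_measure M" and cg: "countably_generated M"
  obtains P where "countable P" "P \<subseteq> sets M" "l2_total M P indicator"
proof -
  interpret finite_measure M by fact
  obtain C where C: "countable C" "C \<subseteq> sets M" "sets M = sigma_sets (space M) C"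
    using cg by (rule countably_generatedE)
  define P where "P = (\<lambda>J. space M \<inter> \<Inter>J) ` {J. finite J \<and> J \<subseteq> C}"
  have cP: "countable P" unfolding P_def by (intro countable_image countable_Collect_finite_subset C)
  have Ps: "A \<in> sets M" if A: "A \<in> P" for A
  proof -
    obtain J where J: "finite J" "J \<subseteq> C" "A = space M \<inter> \<Inter>J" using A unfolding P_def by blast
    have "space M \<inter> \<Inter>J \<in> sets M" using J(1,2)
    proof (induction J rule: finite_induct)
      case (insert c J)
      then have "c \<in> sets M" "space M \<inter> \<Inter>J \<in> sets M" using C(2) by blast+
      then have "c \<inter> (space M \<inter> \<Inter>J) \<in> sets M" by (rule sets.Int)
      then show ?case by (simp add: Int_left_commute)
    qed simp
    then show ?thesis using J(3) by simp
  qed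
  have sq: "square_integrable M (indicator A)" if "A \<in> P" for A
    using Ps[OF that] by (rule square_integrable_indicator)
  have spP: "space M \<in> P" unfolding P_def by (rule image_eqI[of _ _ "{}"]) auto
  have "l2_total M P indicator"
  proof (rule l2_totalI[OF sq M])
    show "sets M = sigma_sets (space M) P"
    proof
      have "C \<subseteq> P"
      proof
        fix c assume c: "c \<in> C"
        then have "c \<subseteq> space M" using C(2) sets.sets_into_space by blast
        then have "c = space M \<inter> \<Inter>{c}" by auto
        then show "c \<in> P" unfolding P_def using c by blast
      qed
      then show "sets M \<subseteq> sigma_sets (space M) P" unfolding C(3) by (rule sigma_sets_mono')
      show "sigma_sets (space M) P \<subseteq> sets M" using Ps by (intro sets.sigma_sets_subset) blast
    qed
    show "Int_stable P"
    proof (rule Int_stableI)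
      fix x y assume "x \<in> P" "y \<in> P"
      then obtain J K where JK: "finite J" "J \<subseteq> C" "finite K" "K \<subseteq> C" "x = space M \<inter> \<Inter>J" "y = space M \<inter> \<Inter>K"
        unfolding P_def by blast
      have "x \<inter> y = space M \<inter> \<Inter>(J \<union> K)" unfolding JK(5,6) by auto
      then show "x \<inter> y \<in> P" unfolding P_def using JK(1-4) by (intro image_eqI[of _ _ "J \<union> K"]) auto
    qed
    show "P \<subseteq> Pow (space M)" using Ps sets.sets_into_space by blast
    show "indicator A \<in> l2_span M P indicator" if "A \<in> P" for A
      by (rule l2_span_base[OF sq that])
    show "indicator (space M) \<in> l2_span M P indicator" by (rule l2_span_base[OF sq spP])
  qed
  with cP Ps that show ?thesis by blast
qed

text \<open>The dense set consists of the combinations of a countable total family of indicators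
  with coefficients in a countable dense set of complex numbers.\<close>

lemma L2_total_separable:
  assumes M: "finite_measure M" and cg: "countably_generated M"
  shows "separable_hilbert_space (L2_total M)"
proof -
  interpret finite_measure M by fact
  interpret MS: Metric_space "carrier (L2_total M)" "hdist (L2_total M)" by (rule L2_total_metric)
  obtain P where P: "countable P" "P \<subseteq> sets M" and total: "l2_total M P indicator"
    using countable_total_family[OF M cg] .
  obtain D :: "complex set" where D: "countable D" "\<And>U. open U \<Longrightarrow> U \<noteq> {} \<Longrightarrow> \<exists>d\<in>D. d \<in> U"
    using countable_dense_exists by blast
  \<comment> \<open>Lists encode the combinations, because lists over a countable set are visibly
    countable.\<close>
  define F where "F L x = (\<Sum>(d, A)\<leftarrow>L. d * indicator A x)" for L :: "(complex \<times> 'a set) list" and x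
  let ?Q = "(\<lambda>L. ae_class M (F L)) ` lists (D \<times> P)"
  have sqA: "square_integrable M (indicator A)" if "A \<in> P" for A
    using that P(2) by (intro square_integrable_indicator) auto
  have F_sq: "square_integrable M (F L)" if "L \<in> lists (D \<times> P)" for L
    using that
  proof (induction L)
    case Nil
    have "F [] = (\<lambda>_. 0)" by (simp add: F_def fun_eq_iff)
    then show ?case by simp
  next
    case (Cons p L)
    have "F (p # L) = (\<lambda>x. fst p * indicator (snd p) x + F L x)" by (cases p) (simp add: F_def fun_eq_iff)
    then show ?case using Cons by (auto intro!: square_integrable_add square_integrable_cmult sqA)
  qed
  define c where "c = l2norm M (\<lambda>_. 1)"
  have c0: "c \<ge> 0" by (simp add: c_def)
  have nA: "l2norm M (indicator A) \<le> c" if "A \<in> P" for A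
  proof -
    have "(\<integral>x. (cmod (indicator A x))\<^sup>2 \<partial>M) \<le> (\<integral>x. (cmod 1)\<^sup>2 \<partial>M)"
      using sqA[OF that] by (intro integral_mono) (auto simp: square_integrable_def split: split_indicator)
    then show ?thesis unfolding c_def l2norm_def by (rule real_sqrt_le_mono)
  qed
  have dense: "\<exists>y\<in>?Q. hdist (L2_total M) x y < e" if x: "x \<in> carrier (L2 M)" and e: "e > 0" for x e
  proof -
    have "L2_rep M x \<in> l2_span M P indicator" using total L2_rep_sq unfolding l2_total_def by blast
    then obtain p where p: "Poly_Mapping.keys p \<subseteq> P" "l2norm M (\<lambda>t. L2_rep M x t - comb indicator p t) < e/2"
      by (rule l2_spanE[OF _ half_gt_zero[OF e]])
    let ?K = "Poly_Mapping.keys p"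
    \<comment> \<open>Each indicator has norm at most \<open>c\<close>, so changing every
      coefficient by less than \<open>\<delta>\<close> costs at most
      \<open>card ?K * c * \<delta> < e / 2\<close>; the added ones exclude division by
      zero.\<close>
    define \<delta> where "\<delta> = e / (2 * (real (card ?K) + 1) * (c + 1))"
    have \<delta>: "\<delta> > 0" unfolding \<delta>_def using e c0 by (intro divide_pos_pos mult_pos_pos) auto
    have "\<exists>d. d \<in> D \<and> d \<in> ball (Poly_Mapping.lookup p y) \<delta>" for y
    proof -
      have "\<exists>d\<in>D. d \<in> ball (Poly_Mapping.lookup p y) \<delta>" using \<delta> by (intro D(2)) auto
      then show ?thesis unfolding Bex_def .
    qed
    then obtain d where d': "\<And>y. d y \<in> D \<and> d y \<in> ball (Poly_Mapping.lookup p y) \<delta>" by metis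
    have d: "d y \<in> D" "cmod (Poly_Mapping.lookup p y - d y) < \<delta>" for y using d'[of y] by (auto simp: dist_norm)
    obtain ys where ys: "set ys = ?K" "distinct ys" using finite_distinct_list[of ?K] by auto
    define L where "L = map (\<lambda>y. (d y, y)) ys"
    have L: "L \<in> lists (D \<times> P)" using d(1) p(1) ys(1) by (auto simp: L_def)
    have FL: "F L t = (\<Sum>y\<in>?K. d y * indicator y t)" for t
      using ys by (simp add: F_def L_def o_def sum_list_distinct_conv_sum_set)
    have sqK: "square_integrable M (indicator y)" if "y \<in> ?K" for y using that p(1) sqA by blast
    have "l2norm M (\<lambda>t. comb indicator p t - F L t)
        = l2norm M (\<lambda>t. \<Sum>y\<in>?K. (Poly_Mapping.lookup p y - d y) * indicator y t)"
      unfolding FL comb_def by (simp add: sum_subtractf left_diff_distrib)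
    also have "\<dots> \<le> (\<Sum>y\<in>?K. l2norm M (\<lambda>t. (Poly_Mapping.lookup p y - d y) * indicator y t))"
      by (intro l2norm_sum_le square_integrable_cmult sqK) auto
    also have "\<dots> \<le> (\<Sum>y\<in>?K. \<delta> * c)"
      unfolding l2norm_cmult using d(2) \<delta> p(1) nA
      by (intro sum_mono mult_mono) (auto intro: less_imp_le)
    also have "\<dots> = real (card ?K) * c * \<delta>" by simp
    also have "\<dots> < e / 2"
    proof -
      have "real (card ?K) * c < (real (card ?K) + 1) * (c + 1)"
        using c0 by (simp add: algebra_simps add_nonneg_pos)
      then have "real (card ?K) * c * \<delta> < (real (card ?K) + 1) * (c + 1) * \<delta>" using \<delta> by (rule mult_strict_right_mono)
      also have "\<dots> = e / 2" unfolding \<delta>_def using c0 by (simp add: field_simps add_nonneg_eq_0_iff)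
      finally show ?thesis .
    qed
    finally have "l2norm M (\<lambda>t. comb indicator p t - F L t) < e / 2" .
    moreover have "l2norm M (\<lambda>t. L2_rep M x t - F L t)
        \<le> l2norm M (\<lambda>t. L2_rep M x t - comb indicator p t) + l2norm M (\<lambda>t. comb indicator p t - F L t)"
      by (intro l2norm_triangle_diff L2_rep_sq F_sq L square_integrable_comb sqK)
    ultimately have b: "l2norm M (\<lambda>t. L2_rep M x t - F L t) < e" using p(2) by linarith
    have "hdist (L2_total M) x (ae_class M (F L)) = l2norm M (\<lambda>t. L2_rep M x t - F L t)"
      unfolding L2_total_hdist using L2_rep_class[OF F_sq[OF L]]
      by (intro l2norm_cong_AE borel_measurable_diff L2_rep_m square_integrable_measurable[OF F_sq[OF L]])
         (auto elim!: eventually_mono)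
    then show ?thesis using b L by (intro bexI[of _ "ae_class M (F L)"]) auto
  qed
  have Qc: "?Q \<subseteq> carrier (L2_total M)" using F_sq by (auto intro!: L2_carrierI)
  have "MS.mtopology closure_of ?Q = carrier (L2_total M)"
  proof -
    have "\<exists>y\<in>?Q. y \<in> MS.mball x e" if xe: "x \<in> carrier (L2_total M)" "e > 0" for x e
    proof -
      have "\<exists>y\<in>?Q. hdist (L2_total M) x y < e" using dense xe unfolding L2_total_simps(1) .
      then obtain y where y: "y \<in> ?Q" "hdist (L2_total M) x y < e" ..
      then have "y \<in> MS.mball x e" using Qc xe(1) by (simp only: MS.in_mball) blast
      then show ?thesis using y(1) by blast
    qed
    then show ?thesis unfolding MS.metric_closure_of by blast
  qed
  moreover have "countable ?Q" using D(1) P(1) by (intro countable_image countable_lists countable_SIGMA)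
  ultimately have "separable_space MS.mtopology"
    unfolding separable_space_def MS.topspace_mtopology using Qc by blast
  then show ?thesis using L2_total_hilbert[OF M] by (simp add: separable_hilbert_space_def)
qed

lemma L2_total_unitary: "unitary_map (L2_total M) (L2 M) (\<lambda>x. x)"
  by (rule unitary_mapI) (simp_all add: bij_betw_def)

lemma l2_mult_unitary:
  assumes \<phi>: "\<phi> \<in> borel_measurable M" "AE x in M. cmod (\<phi> x) = 1"
  shows "unitary_operator (L2 M) (l2_mult M \<phi>)"
proof (rule unitary_mapI)
  let ?\<psi> = "\<lambda>x. cnj (\<phi> x)"
  have \<psi>: "?\<psi> \<in> borel_measurable M" using \<phi>(1) by (rule borel_measurable_cnj)
  have le: "AE x in M. cmod (\<phi> x) \<le> 1" "AE x in M. cmod (?\<psi> x) \<le> 1" using \<phi>(2) by (auto elim!: eventually_mono)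
  have inv: "l2_mult M \<psi>1 (l2_mult M \<psi>2 A) = A"
    if A: "A \<in> carrier (L2 M)" and m: "\<psi>1 \<in> borel_measurable M" "\<psi>2 \<in> borel_measurable M"
      and 1: "AE x in M. \<psi>1 x * \<psi>2 x = 1" for A \<psi>1 \<psi>2
  proof -
    obtain f where f: "square_integrable M f" "A = ae_class M f" using A by (rule L2_carrierE)
    have fm: "f \<in> borel_measurable M" using f(1) by (rule square_integrable_measurable)
    have "l2_mult M \<psi>1 (l2_mult M \<psi>2 A) = ae_class M (\<lambda>x. \<psi>1 x * (\<psi>2 x * f x))"
      unfolding f(2) using fm m by (simp add: l2_mult_class)
    also have "\<dots> = A" unfolding f(2) using fm m 1
      by (intro ae_class_cong borel_measurable_times) (auto elim!: eventually_mono simp: mult.assoc[symmetric])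
    finally show ?thesis .
  qed
  have one: "AE x in M. ?\<psi> x * \<phi> x = 1" "AE x in M. \<phi> x * ?\<psi> x = 1"
    using \<phi>(2) by (auto elim!: eventually_mono simp: cnj_mult_self mult.commute[of "\<phi> _"])
  show "bij_betw (l2_mult M \<phi>) (carrier (L2 M)) (carrier (L2 M))"
  proof (rule bij_betwI[where g="l2_mult M ?\<psi>"])
    show "l2_mult M ?\<psi> (l2_mult M \<phi> A) = A" if "A \<in> carrier (L2 M)" for A
      by (rule inv[OF that \<psi> \<phi>(1) one(1)])
    show "l2_mult M \<phi> (l2_mult M ?\<psi> A) = A" if "A \<in> carrier (L2 M)" for A
      by (rule inv[OF that \<phi>(1) \<psi> one(2)])
  qed (intro Pi_I l2_mult_carrier[OF _ \<phi>(1) le(1)] l2_mult_carrier[OF _ \<psi> le(2)], assumption)+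
next
  fix A B assume A: "A \<in> carrier (L2 M)" and B: "B \<in> carrier (L2 M)"
  obtain f where f: "square_integrable M f" "A = ae_class M f" using A by (rule L2_carrierE)
  obtain g where g: "square_integrable M g" "B = ae_class M g" using B by (rule L2_carrierE)
  note m = square_integrable_measurable[OF f(1)] square_integrable_measurable[OF g(1)]
  note tm = borel_measurable_times[OF \<phi>(1) m(1)] borel_measurable_times[OF \<phi>(1) m(2)]
  have le: "AE x in M. cmod (\<phi> x) \<le> 1" using \<phi>(2) by (auto elim!: eventually_mono)
  note sq = square_integrable_bounded_mult[OF f(1) \<phi>(1) le] square_integrable_bounded_mult[OF g(1) \<phi>(1) le]
  show "l2_mult M \<phi> (A \<oplus>\<^bsub>L2 M\<^esub> B) = l2_mult M \<phi> A \<oplus>\<^bsub>L2 M\<^esub> l2_mult M \<phi> B"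
    unfolding f(2) g(2) using m tm \<phi>(1)
    by (simp add: add_L2_class l2_mult_class distrib_left borel_measurable_add)
  show "ip (L2 M) (l2_mult M \<phi> A) (l2_mult M \<phi> B) = ip (L2 M) A B"
  proof -
    have "l2ip M (\<lambda>x. \<phi> x * f x) (\<lambda>x. \<phi> x * g x) = l2ip M f g"
      unfolding l2ip_def
    proof (rule integral_cong_AE)
      show "AE x in M. cnj (\<phi> x * f x) * (\<phi> x * g x) = cnj (f x) * g x"
        using \<phi>(2)
      proof eventually_elim
        case (elim x)
        have "cnj (\<phi> x * f x) * (\<phi> x * g x) = (cnj (\<phi> x) * \<phi> x) * (cnj (f x) * g x)" by (simp add: mult_ac)
        then show ?case using elim by (simp add: cnj_mult_self)
      qed
    qed (intro borel_measurable_times borel_measurable_cnj m \<phi>(1))+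
    then show ?thesis unfolding f(2) g(2) using m \<phi>(1) sq f g
      by (simp add: l2_mult_class ip_L2_class)
  qed
next
  fix A c assume "A \<in> carrier (L2 M)"
  then obtain f where f: "square_integrable M f" "A = ae_class M f" by (rule L2_carrierE)
  note m = square_integrable_measurable[OF f(1)]
  show "l2_mult M \<phi> (c \<odot>\<^bsub>L2 M\<^esub> A) = c \<odot>\<^bsub>L2 M\<^esub> l2_mult M \<phi> A"
    unfolding f(2) using m \<phi>(1) borel_measurable_times[OF \<phi>(1) m]
    by (simp add: smult_L2_class l2_mult_class mult.left_commute borel_measurable_times)
qed

text \<open>Any normalized measure thus occurs as a spectral measure of a unitary operator, which
  reduces the existence part to a choice of \<open>\<sigma>\<close>. The space is nonzero since the
  constant \<open>1\<close> is not null for a probability measure.\<close>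

theorem normalized_measure_operator:
  assumes \<sigma>: "normalized_borel_measure \<sigma>"
  defines "H \<equiv> L2_total \<sigma>" and "T \<equiv> coordinate_multiplication \<sigma>"
  shows "separable_hilbert_space H" "carrier H \<noteq> {\<zero>\<^bsub>H\<^esub>}" "unitary_operator H T" "is_spectral_measure H T \<sigma>"
proof -
  interpret prob_space \<sigma> using \<sigma> by (simp add: normalized_borel_measure_def)
  show "separable_hilbert_space H"
    unfolding H_def by (rule L2_total_separable[OF finite_measure_axioms countably_generated_normalized[OF \<sigma>]])
  have one: "square_integrable \<sigma> (\<lambda>_. 1)" by (simp add: square_integrable_def)
  have "ae_class \<sigma> (\<lambda>_. 1) \<noteq> ae_class \<sigma> (\<lambda>_. 0)" by (subst ae_class_eq_iff) simp_all
  then show "carrier H \<noteq> {\<zero>\<^bsub>H\<^esub>}"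
    unfolding H_def L2_total_simps zero_L2 using L2_carrierI[OF one] by blast
  have fst_c: "fst \<in> measurable \<sigma> circle_borel" by (rule normalized_borel_measure_fst[OF \<sigma>])
  have U: "unitary_operator (L2 \<sigma>) T"
    unfolding T_def coordinate_multiplication_eq using fst_c
    by (intro l2_mult_unitary) (auto simp: measurable_circle_borel_iff)
  show "unitary_operator H T"
    using unitary_mapD[OF U] by (intro unitary_mapI) (simp_all add: H_def)
  show "is_spectral_measure H T \<sigma>"
    unfolding is_spectral_measure_def unitarily_equivalent_def H_def T_def using \<sigma> L2_total_unitary by blast
qed

section \<open>Digit sets with few additive collisions\<close>

text \<open>This is the sum of the squared fibre sizes of \<open>F\<close>, an unnormalised second
  moment of its distribution; the diagonal pairs are counted.\<close>

definition coll :: "'i set \<Rightarrow> ('i \<Rightarrow> 'v) \<Rightarrow> nat" where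
  "coll I F = card {(i, j). i \<in> I \<and> j \<in> I \<and> F i = F j}"

lemma card_pairs_eq:
  assumes "finite I" "finite V" "F ` I \<subseteq> V"
  shows "card {(i, j). i \<in> I \<and> j \<in> I \<and> F i = G j} = (\<Sum>v\<in>V. card {i \<in> I. F i = v} * card {j \<in> I. G j = v})"
proof -
  have "{(i, j). i \<in> I \<and> j \<in> I \<and> F i = G j} = (\<Union>v\<in>V. {i \<in> I. F i = v} \<times> {j \<in> I. G j = v})"
    using assms(3) by auto
  also have "card \<dots> = (\<Sum>v\<in>V. card ({i \<in> I. F i = v} \<times> {j \<in> I. G j = v}))"
    using assms(1,2) by (intro card_UN_disjoint) auto
  finally show ?thesis by (simp add: card_cartesian_product)
qed

text \<open>Both counts are sums over values of products of fibre sizes, so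
  \<open>2 x y \<le> x^2 + y^2\<close> compares them term by term.\<close>

lemma card_pairs_le:
  assumes "finite I"
  shows "2 * card {(i, j). i \<in> I \<and> j \<in> I \<and> F i = G j} \<le> coll I F + coll I G"
proof -
  let ?V = "F ` I \<union> G ` I"
  let ?f = "\<lambda>v. card {i \<in> I. F i = v}" and ?g = "\<lambda>v. card {i \<in> I. G i = v}"
  have V: "finite ?V" using assms by simp
  have sq: "2 * (x * y) \<le> x * x + y * y" for x y :: nat
  proof -
    have "0 \<le> (int x - int y)\<^sup>2" by simp
    then have "int (2 * (x * y)) \<le> int (x * x + y * y)" by (simp add: power2_eq_square algebra_simps)
    then show ?thesis by (simp only: of_nat_le_iff)
  qed
  have "2 * card {(i, j). i \<in> I \<and> j \<in> I \<and> F i = G j} = (\<Sum>v\<in>?V. 2 * (?f v * ?g v))"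
    by (subst card_pairs_eq[OF assms V]) (auto simp: sum_distrib_left)
  also have "\<dots> \<le> (\<Sum>v\<in>?V. ?f v * ?f v + ?g v * ?g v)" by (intro sum_mono sq)
  also have "\<dots> = coll I F + coll I G"
    unfolding coll_def sum.distrib by (subst (1 2) card_pairs_eq[OF assms V]) auto
  finally show ?thesis .
qed

text \<open>Cauchy-Schwarz for the fibre sizes over \<open>G\<close>. It converts a bound on
  collisions into a bound on the number of points that fall into a small set of values.\<close>

lemma coll_Cauchy_Schwarz:
  assumes I: "finite I" and G: "finite G"
  shows "(card {i \<in> I. F i \<in> G})\<^sup>2 \<le> card G * coll I F"
proof -
  let ?V = "G \<union> F ` I" and ?f = "\<lambda>v. card {i \<in> I. F i = v}"
  have "{i \<in> I. F i \<in> G} = (\<Union>v\<in>G. {i \<in> I. F i = v})" by auto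
  also have "card \<dots> = (\<Sum>v\<in>G. ?f v)" using I G by (intro card_UN_disjoint) auto
  finally have c: "card {i \<in> I. F i \<in> G} = (\<Sum>v\<in>G. ?f v)" .
  have "(\<Sum>v\<in>G. 1 * real (?f v))\<^sup>2 \<le> (\<Sum>v\<in>G. 1\<^sup>2) * (\<Sum>v\<in>G. (real (?f v))\<^sup>2)"
    by (rule Cauchy_Schwarz_ineq_sum)
  then have "real ((card {i \<in> I. F i \<in> G})\<^sup>2) \<le> real (card G * (\<Sum>v\<in>G. ?f v * ?f v))"
    by (simp add: c power2_eq_square)
  then have "(card {i \<in> I. F i \<in> G})\<^sup>2 \<le> card G * (\<Sum>v\<in>G. ?f v * ?f v)" by (simp only: of_nat_le_iff)
  also have "(\<Sum>v\<in>G. ?f v * ?f v) \<le> (\<Sum>v\<in>?V. ?f v * ?f v)" using I G by (intro sum_mono2) auto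
  also have "\<dots> = coll I F" unfolding coll_def using I G by (subst card_pairs_eq[of I ?V]) auto
  finally show ?thesis by simp
qed

text \<open>The number of solutions of \<open>f i \<equiv> f j + c\<close> is largest for \<open>c = 0\<close>, so the carries from the lower
  digit cannot increase the number of collisions.\<close>

lemma coll_digit_step:
  fixes f :: "'i \<Rightarrow> int" and g :: "'j \<Rightarrow> int" and m M :: int
  assumes I: "finite I" and J: "finite J" and m: "m > 0"
  shows "coll (I \<times> J) (\<lambda>(i, b). (m * f i + g b) mod (m * M)) \<le> coll I (\<lambda>i. f i mod M) * coll J (\<lambda>b. g b mod m)"
proof -
  \<comment> \<open>The pairs are grouped by their low digits \<open>b\<close> and
    \<open>b'\<close>, and \<open>E b b'\<close> collects the high digits that complete a
    collision.\<close>
  define E where "E b b' = {(i, i'). i \<in> I \<and> i' \<in> I \<and> (m * f i + g b) mod (m * M) = (m * f i' + g b') mod (m * M)}" for b b'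
  let ?B = "{(b, b'). b \<in> J \<and> b' \<in> J \<and> g b mod m = g b' mod m}"
  have fB: "finite ?B" by (rule finite_subset[of _ "J \<times> J"]) (use J in auto)
  have fE: "finite (E b b')" for b b' unfolding E_def by (rule finite_subset[of _ "I \<times> I"]) (use I in auto)
  \<comment> \<open>If any completion exists, reduction modulo \<open>m\<close> forces the low
    digits to agree modulo \<open>m\<close>; their difference is then \<open>m\<close> times a carry
    \<open>c\<close>, which merely shifts the congruence of the high digits.\<close>
  have Emod: "g b mod m = g b' mod m" "\<exists>c. E b b' \<subseteq> {(i, i'). i \<in> I \<and> i' \<in> I \<and> f i mod M = (f i' + c) mod M}"
    if ne: "(i, i') \<in> E b b'" for i i' b b'
  proof -
    have dv: "m * M dvd m * (f i - f i') + (g b - g b')" if "(i, i') \<in> E b b'" for i i'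
      using that by (simp add: E_def mod_eq_dvd_iff algebra_simps)
    then have "m dvd m * (f i - f i') + (g b - g b')" using ne by (meson dvd_mult_left)
    then have md: "m dvd g b - g b'" by (simp add: dvd_add_right_iff)
    then show "g b mod m = g b' mod m" by (simp add: mod_eq_dvd_iff)
    obtain c where c: "g b - g b' = m * c" using md by (rule dvdE)
    have "f i mod M = (f i' + (- c)) mod M" if "(i, i') \<in> E b b'" for i i'
    proof -
      have "m * M dvd m * (f i - f i' + c)" using dv[OF that] by (simp add: c distrib_left)
      then have "M dvd f i - f i' + c" using m by simp
      then show ?thesis by (simp add: mod_eq_dvd_iff algebra_simps)
    qed
    then have "E b b' \<subseteq> {(i, i'). i \<in> I \<and> i' \<in> I \<and> f i mod M = (f i' + (- c)) mod M}"
      unfolding E_def by blast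
    then show "\<exists>c. E b b' \<subseteq> {(i, i'). i \<in> I \<and> i' \<in> I \<and> f i mod M = (f i' + c) mod M}" ..
  qed
  have Ecard: "card (E b b') \<le> coll I (\<lambda>i. f i mod M)" for b b'
  proof (cases "E b b' = {}")
    case False
    then obtain i i' where "(i, i') \<in> E b b'" by auto
    from Emod(2)[OF this] obtain c where c: "E b b' \<subseteq> {(i, i'). i \<in> I \<and> i' \<in> I \<and> f i mod M = (f i' + c) mod M}" ..
    have "card (E b b') \<le> card {(i, i'). i \<in> I \<and> i' \<in> I \<and> f i mod M = (f i' + c) mod M}"
      by (rule card_mono[OF _ c], rule finite_subset[of _ "I \<times> I"]) (use I in auto)
    moreover have "2 * card {(i, i'). i \<in> I \<and> i' \<in> I \<and> f i mod M = (f i' + c) mod M}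
        \<le> coll I (\<lambda>i. f i mod M) + coll I (\<lambda>i. (f i + c) mod M)"
      by (rule card_pairs_le[OF I])
    \<comment> \<open>Adding a constant does not change which pairs collide, so the two terms
      bounding the shifted count are equal.\<close>
    moreover have "coll I (\<lambda>i. (f i + c) mod M) = coll I (\<lambda>i. f i mod M)"
      unfolding coll_def by (simp add: mod_eq_dvd_iff)
    ultimately show ?thesis by linarith
  qed simp
  let ?S = "{(p, p'). p \<in> I \<times> J \<and> p' \<in> I \<times> J \<and>
      (case p of (i, b) \<Rightarrow> (m * f i + g b) mod (m * M)) = (case p' of (i, b) \<Rightarrow> (m * f i + g b) mod (m * M))}"
  have "coll (I \<times> J) (\<lambda>(i, b). (m * f i + g b) mod (m * M)) = card ?S" by (simp add: coll_def)
  also have "card ?S \<le> card (SIGMA p:?B. E (fst p) (snd p))"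
  \<comment> \<open>The injection reorders a pair of pairs so that the low digits come first, as the
    grouping by \<open>E\<close> requires.\<close>
  proof (rule card_inj_on_le[where f="\<lambda>(p, p'). ((snd p, snd p'), (fst p, fst p'))"])
    show "inj_on (\<lambda>(p, p'). ((snd p, snd p'), (fst p, fst p'))) ?S" by (auto simp: inj_on_def)
    show "(\<lambda>(p, p'). ((snd p, snd p'), (fst p, fst p'))) ` ?S \<subseteq> (SIGMA p:?B. E (fst p) (snd p))"
    proof safe
      fix i b i' b'
      assume "i \<in> I" "b \<in> J" "i' \<in> I" "b' \<in> J" "(m * f i + g b) mod (m * M) = (m * f i' + g b') mod (m * M)"
      then have e: "(i, i') \<in> E b b'" by (simp add: E_def)
      then show "(fst (i, b), fst (i', b')) \<in> E (fst (snd (i, b), snd (i', b'))) (snd (snd (i, b), snd (i', b')))" by simp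
      show "g (snd (i, b)) mod m = g (snd (i', b')) mod m" using Emod(1)[OF e] by simp
    qed simp_all
    show "finite (SIGMA p:?B. E (fst p) (snd p))" using fB fE by (intro finite_SigmaI) auto
  qed
  also have "\<dots> = (\<Sum>p\<in>?B. card (E (fst p) (snd p)))" using fB fE by (intro card_SigmaI) auto
  also have "\<dots> \<le> (\<Sum>p\<in>?B. coll I (\<lambda>i. f i mod M))" by (intro sum_mono Ecard)
  also have "\<dots> = coll I (\<lambda>i. f i mod M) * coll J (\<lambda>b. g b mod m)" by (simp add: coll_def)
  finally show ?thesis .
qed

lemma card_filter_eq_sum: "finite A \<Longrightarrow> card {x \<in> A. P x} = (\<Sum>x\<in>A. if P x then 1 else 0)"
  by (simp add: sum.If_cases Int_def)

text \<open>A random choice of the digits \<open>a\<close> in \<open>{..<m}\<close> works: two tuples of indices with different counts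
  of some index \<open>t\<close> collide with probability at most \<open>1 / m\<close>, since \<open>m\<close> is prime to the difference of the counts.\<close>

lemma exists_few_collisions:
  fixes r q m :: nat
  assumes q: "q > 0" and m: "m > 0" and cop: "\<And>c. 0 < c \<Longrightarrow> c \<le> r \<Longrightarrow> coprime c m"
  defines "T \<equiv> {..<r} \<rightarrow>\<^sub>E {..<q}"
  shows "\<exists>a. (\<forall>i. a i < m) \<and> m * coll T (\<lambda>j. (\<Sum>s<r. int (a (j s))) mod int m) \<le> q ^ (2 * r) + m * (r ^ r * q ^ r)"
proof -
  \<comment> \<open>All choices of digits are equally likely, and probabilities are expressed by
    counting: the number of collisions is summed over \<open>F\<close>.\<close>
  define F where "F = ({..<q} \<rightarrow>\<^sub>E {..<m})"
  define S where "S a j = (\<Sum>s<r. int (a (j s)))" for a :: "nat \<Rightarrow> nat" and j :: "nat \<Rightarrow> nat"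
  define cnt where "cnt j t = card {s. s < r \<and> j s = t}" for j :: "nat \<Rightarrow> nat" and t
  have fT: "finite T" and cT: "card T = q ^ r" unfolding T_def by (simp_all add: finite_PiE card_PiE)
  have fF: "finite F" and cF: "card F = m ^ q" unfolding F_def by (simp_all add: finite_PiE card_PiE)
  have S_cnt: "S a j = (\<Sum>t<q. int (cnt j t) * int (a t))" if j: "j \<in> T" for a j
  proof -
    have "S a j = (\<Sum>t<q. \<Sum>s\<in>{s \<in> {..<r}. j s = t}. int (a (j s)))"
      unfolding S_def using j by (intro sum.group[symmetric]) (auto simp: T_def)
    also have "\<dots> = (\<Sum>t<q. int (cnt j t) * int (a t))"
      by (intro sum.cong refl) (simp add: cnt_def)
    finally show ?thesis .
  qed
  have cnt_le: "cnt j t \<le> r" for j t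
  proof -
    have "cnt j t \<le> card {..<r}" unfolding cnt_def by (rule card_mono) auto
    then show ?thesis by simp
  qed
  let ?C = "\<lambda>i j. {a \<in> F. S a i mod int m = S a j mod int m}"
  \<comment> \<open>If the values at all indices other than \<open>t\<close> are fixed, the
    congruence determines \<open>a t\<close>: its coefficient is the difference of the two counts,
    which is nonzero, at most \<open>r\<close> in absolute value, and therefore prime to
    \<open>m\<close>.\<close>
  have C_le: "card (?C i j) \<le> m ^ (q - 1)" if i: "i \<in> T" and j: "j \<in> T" and t: "t < q" "cnt i t \<noteq> cnt j t" for i j t
  proof -
    have "card (?C i j) \<le> card (({..<q} - {t}) \<rightarrow>\<^sub>E {..<m})"
    proof (rule card_inj_on_le[where f="\<lambda>a. restrict a ({..<q} - {t})"])
      show "inj_on (\<lambda>a. restrict a ({..<q} - {t})) (?C i j)"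
      proof (rule inj_onI)
        fix a a' assume a: "a \<in> ?C i j" and a': "a' \<in> ?C i j"
          and eq: "restrict a ({..<q} - {t}) = restrict a' ({..<q} - {t})"
        have e: "a u = a' u" if "u < q" "u \<noteq> t" for u using fun_cong[OF eq, of u] that by simp
        define d where "d u = int (cnt i u) - int (cnt j u)" for u
        have Sd: "S b i - S b j = d t * int (b t) + (\<Sum>u\<in>{..<q} - {t}. d u * int (b u))" for b
        proof -
          have "S b i - S b j = (\<Sum>u<q. d u * int (b u))"
            by (simp add: S_cnt[OF i] S_cnt[OF j] d_def left_diff_distrib sum_subtractf)
          also have "\<dots> = d t * int (b t) + (\<Sum>u\<in>{..<q} - {t}. d u * int (b u))"
            using t(1) by (intro sum.remove) auto
          finally show ?thesis .
        qed
        have "int m dvd (S a i - S a j) - (S a' i - S a' j)"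
          using a a' by (intro dvd_diff[of "int m" "S a i - S a j" "S a' i - S a' j"]) (simp_all add: mod_eq_dvd_iff)
        also have "(S a i - S a j) - (S a' i - S a' j) = d t * (int (a t) - int (a' t))"
        proof -
          have "(\<Sum>u\<in>{..<q} - {t}. d u * int (a u)) = (\<Sum>u\<in>{..<q} - {t}. d u * int (a' u))"
            using e by (intro sum.cong) auto
          then show ?thesis unfolding Sd by (simp add: algebra_simps)
        qed
        finally have dv: "int m dvd d t * (int (a t) - int (a' t))" .
        have "coprime (nat \<bar>d t\<bar>) m"
        proof (rule cop)
          show "0 < nat \<bar>d t\<bar>" using t(2) by (simp add: d_def)
          show "nat \<bar>d t\<bar> \<le> r" using cnt_le[of i t] cnt_le[of j t] by (simp add: d_def)
        qed
        then have "coprime (int m) (d t)" 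
          by (metis abs_ge_zero coprime_abs_left_iff coprime_commute coprime_int_iff int_nat_eq)
        then have dv2: "int m dvd int (a t) - int (a' t)" using dv by (simp add: coprime_dvd_mult_right_iff)
        have lt: "a t < m" "a' t < m" using a a' t(1) by (auto simp: F_def)
        have "\<bar>int (a t) - int (a' t)\<bar> < int m" using lt by linarith
        then have "int (a t) - int (a' t) = 0" using dv2 zdvd_imp_le[of "int m" "\<bar>int (a t) - int (a' t)\<bar>"] by fastforce
        then have at: "a t = a' t" by simp
        show "a = a'"
        proof (rule PiE_ext[of a "{..<q}" "\<lambda>_. {..<m}" a'])
          show "a \<in> {..<q} \<rightarrow>\<^sub>E {..<m}" "a' \<in> {..<q} \<rightarrow>\<^sub>E {..<m}" using a a' by (auto simp: F_def)
          show "a u = a' u" if "u \<in> {..<q}" for u using that at e by (cases "u = t") auto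
        qed
      qed
      show "(\<lambda>a. restrict a ({..<q} - {t})) ` ?C i j \<subseteq> ({..<q} - {t}) \<rightarrow>\<^sub>E {..<m}"
      proof (rule image_subsetI)
        fix a assume "a \<in> ?C i j"
        then have "a \<in> {..<q} \<rightarrow>\<^sub>E {..<m}" by (simp add: F_def)
        then show "restrict a ({..<q} - {t}) \<in> ({..<q} - {t}) \<rightarrow>\<^sub>E {..<m}"
          unfolding restrict_PiE_iff by (simp add: PiE_iff)
      qed
      show "finite (({..<q} - {t}) \<rightarrow>\<^sub>E {..<m})" by (simp add: finite_PiE)
    qed
    also have "\<dots> = m ^ (q - 1)" using t(1) by (simp add: card_PiE)
    finally show ?thesis .
  qed
  \<comment> \<open>If \<open>j\<close> uses an index that \<open>i\<close> does not, the counts of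
    this index differ. The remaining \<open>j\<close> map into at most \<open>r\<close> indices, so
    there are at most \<open>r ^ r\<close> of them for each \<open>i\<close>.\<close>
  define bad where "bad i j \<longleftrightarrow> j ` {..<r} \<subseteq> i ` {..<r}" for i j :: "nat \<Rightarrow> nat"
  have good: "\<exists>t<q. cnt i t \<noteq> cnt j t" if i: "i \<in> T" and j: "j \<in> T" and nb: "\<not> bad i j" for i j
  proof -
    obtain s where s: "s < r" "j s \<notin> i ` {..<r}" using nb unfolding bad_def by auto
    have "{u. u < r \<and> i u = j s} = {}" using s(2) by force
    then have "cnt i (j s) = 0" unfolding cnt_def by simp
    moreover have "cnt j (j s) \<noteq> 0" using s(1) by (auto simp: cnt_def)
    moreover have "j s < q" using j s(1) by (auto simp: T_def)
    ultimately show ?thesis by (intro exI[of _ "j s"]) simp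
  qed
  have bad_card: "card {j \<in> T. bad i j} \<le> r ^ r" for i
  proof -
    have "card {j \<in> T. bad i j} \<le> card ({..<r} \<rightarrow>\<^sub>E i ` {..<r})"
    proof (rule card_mono)
      show "finite ({..<r} \<rightarrow>\<^sub>E i ` {..<r})" by (simp add: finite_PiE)
      show "{j \<in> T. bad i j} \<subseteq> {..<r} \<rightarrow>\<^sub>E i ` {..<r}"
      proof
        fix j assume "j \<in> {j \<in> T. bad i j}"
        then have "j \<in> {..<r} \<rightarrow>\<^sub>E {..<q}" "j ` {..<r} \<subseteq> i ` {..<r}" by (simp_all add: T_def bad_def)
        then show "j \<in> {..<r} \<rightarrow>\<^sub>E i ` {..<r}" unfolding PiE_iff by blast
      qed
    qed
    also have "\<dots> = card (i ` {..<r}) ^ r" by (simp add: card_PiE)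
    also have "\<dots> \<le> r ^ r" using card_image_le[of "{..<r}" i] by (intro power_mono) auto
    finally show ?thesis .
  qed
  have pair: "m * card (?C i j) \<le> m ^ q + (if bad i j then m * m ^ q else 0)" if i: "i \<in> T" and j: "j \<in> T" for i j
  proof (cases "bad i j")
    case True
    have "card (?C i j) \<le> m ^ q" unfolding cF[symmetric] by (rule card_mono[OF fF]) auto
    then show ?thesis using True by (simp add: trans_le_add2)
  next
    case False
    obtain t where t: "t < q" "cnt i t \<noteq> cnt j t" using good[OF i j False] by blast
    have "m * card (?C i j) \<le> m * m ^ (q - 1)" using C_le[OF i j t] by (rule mult_left_mono) simp
    also have "\<dots> = m ^ q" using q by (simp flip: power_Suc)
    finally show ?thesis by simp
  qed
  have collS: "coll T (\<lambda>j. S a j mod int m) = (\<Sum>i\<in>T. \<Sum>j\<in>T. if S a i mod int m = S a j mod int m then 1 else 0)" for a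
  proof -
    have "{(i, j). i \<in> T \<and> j \<in> T \<and> S a i mod int m = S a j mod int m}
        = {p \<in> T \<times> T. S a (fst p) mod int m = S a (snd p) mod int m}" by auto
    then have "coll T (\<lambda>j. S a j mod int m) = (\<Sum>p\<in>T \<times> T. if S a (fst p) mod int m = S a (snd p) mod int m then 1 else 0)"
      unfolding coll_def using card_filter_eq_sum[of "T \<times> T"] fT by simp
    then show ?thesis by (simp add: sum.cartesian_product case_prod_unfold)
  qed
  have "m * (\<Sum>a\<in>F. coll T (\<lambda>j. S a j mod int m)) = (\<Sum>i\<in>T. \<Sum>j\<in>T. m * card (?C i j))"
  proof -
    have "(\<Sum>a\<in>F. coll T (\<lambda>j. S a j mod int m))
        = (\<Sum>i\<in>T. \<Sum>a\<in>F. \<Sum>j\<in>T. if S a i mod int m = S a j mod int m then 1 else 0)"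
      unfolding collS by (rule sum.swap)
    also have "\<dots> = (\<Sum>i\<in>T. \<Sum>j\<in>T. \<Sum>a\<in>F. if S a i mod int m = S a j mod int m then 1 else 0)"
      by (intro sum.cong refl sum.swap)
    also have "\<dots> = (\<Sum>i\<in>T. \<Sum>j\<in>T. card (?C i j))"
      by (simp only: card_filter_eq_sum[OF fF])
    finally show ?thesis by (simp add: sum_distrib_left)
  qed
  also have "\<dots> \<le> (\<Sum>i\<in>T. \<Sum>j\<in>T. m ^ q + (if bad i j then m * m ^ q else 0))"
    by (intro sum_mono pair)
  also have "\<dots> = (\<Sum>i\<in>T. q ^ r * m ^ q + card {j \<in> T. bad i j} * (m * m ^ q))"
    by (intro sum.cong refl) (simp add: sum.distrib cT sum.If_cases[OF fT] Int_def)
  also have "\<dots> \<le> (\<Sum>i\<in>T. q ^ r * m ^ q + r ^ r * (m * m ^ q))"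
    by (intro sum_mono add_left_mono mult_right_mono bad_card) simp
  also have "\<dots> = (\<Sum>a\<in>F. q ^ (2 * r) + m * (r ^ r * q ^ r))"
    by (simp add: cT cF algebra_simps power_add[symmetric] mult_2_right)
  finally have le: "m * (\<Sum>a\<in>F. coll T (\<lambda>j. S a j mod int m)) \<le> (\<Sum>a\<in>F. q ^ (2 * r) + m * (r ^ r * q ^ r))" .
  \<comment> \<open>First-moment argument: if every choice exceeded the bound, so would the average
    over \<open>F\<close>.\<close>
  have "\<exists>a\<in>F. m * coll T (\<lambda>j. S a j mod int m) \<le> q ^ (2 * r) + m * (r ^ r * q ^ r)"
  proof (rule ccontr)
    assume "\<not> ?thesis"
    then have "\<And>a. a \<in> F \<Longrightarrow> q ^ (2 * r) + m * (r ^ r * q ^ r) < m * coll T (\<lambda>j. S a j mod int m)"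
      by (meson not_le)
    moreover have "F \<noteq> {}" using cF m by auto
    ultimately have "(\<Sum>a\<in>F. q ^ (2 * r) + m * (r ^ r * q ^ r)) < (\<Sum>a\<in>F. m * coll T (\<lambda>j. S a j mod int m))"
      using fF by (intro sum_strict_mono) auto
    then show False using le by (simp add: sum_distrib_left)
  qed
  then obtain a where a: "a \<in> F" "m * coll T (\<lambda>j. S a j mod int m) \<le> q ^ (2 * r) + m * (r ^ r * q ^ r)" ..
  \<comment> \<open>Elements of \<open>F\<close> are undefined beyond \<open>q\<close>, while the
    bound by \<open>m\<close> is claimed for every index; the extension by zero does not affect the
    sums.\<close>
  define b where "b i = (if i < q then a i else 0)" for i
  have "b i < m" for i using a(1) m by (auto simp: b_def F_def)
  moreover have "coll T (\<lambda>j. (\<Sum>s<r. int (b (j s))) mod int m) = coll T (\<lambda>j. S a j mod int m)"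
  proof -
    have "(\<Sum>s<r. int (b (j s))) = S a j" if "j \<in> T" for j
      unfolding S_def using that by (intro sum.cong refl) (auto simp: b_def T_def)
    then show ?thesis unfolding coll_def by (intro arg_cong[where f=card]) auto
  qed
  ultimately show ?thesis using a(2) by (intro exI[of _ b]) simp
qed

text \<open>\<open>m\<close> is \<open>1\<close> modulo \<open>fact r\<close>, hence prime to every
  number up to \<open>r\<close>, and it is still of order \<open>q ^ n\<close>. The error
  \<open>m * r ^ r * q ^ r\<close> of the random choice must be at most
  \<open>q ^ (2 * r) / 2 ^ k\<close>; as \<open>r = n + 1\<close>, there is one spare factor
  \<open>q\<close> to absorb all constants.\<close>

lemma digit_parameters_exist:
  fixes n :: nat
  assumes n: "n > 0"
  shows "\<exists>q m :: nat. \<exists>a. q > 0 \<and> 2 * q ^ n \<le> m \<and> (\<forall>i. a i < m) \<and>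
    real m * real (coll ({..<Suc n} \<rightarrow>\<^sub>E {..<q}) (\<lambda>j. (\<Sum>s<Suc n. int (a (j s))) mod int m))
      \<le> real q ^ (2 * Suc n) * (1 + (1/2) ^ k)"
proof -
  define r where "r = Suc n"
  \<comment> \<open>This value gives \<open>m \<le> K * q ^ n\<close>; the other two factors of
    \<open>q\<close> pay for \<open>r ^ r\<close> and for the accuracy \<open>2 ^ k\<close>.\<close>
  define K :: nat where "K = 2 * fact r + 1"
  define q where "q = K * r ^ r * 2 ^ k"
  define m where "m = fact r * (2 * q ^ n) + 1"
  have q: "q > 0" by (simp add: q_def K_def r_def)
  have "coprime c m" if c: "0 < c" "c \<le> r" for c
  proof -
    have "c dvd fact r" using c by (intro dvd_fact) auto
    then have cd: "c dvd fact r * (2 * q ^ n)" by (rule dvd_mult2)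
    show ?thesis
    proof (rule coprimeI)
      fix d assume "d dvd c" "d dvd m"
      then have "d dvd fact r * (2 * q ^ n)" "d dvd fact r * (2 * q ^ n) + 1" using cd by (auto simp: m_def intro: dvd_trans)
      then have "d dvd 1" by (simp only: dvd_add_right_iff)
      then show "is_unit d" .
    qed
  qed
  from exists_few_collisions[OF q _ this, of r] obtain a where
    a: "\<And>i. a i < m" "m * coll ({..<r} \<rightarrow>\<^sub>E {..<q}) (\<lambda>j. (\<Sum>s<r. int (a (j s))) mod int m) \<le> q ^ (2 * r) + m * (r ^ r * q ^ r)"
    by (auto simp: m_def)
  have "fact r \<ge> (1::nat)" by simp
  then have "2 * q ^ n \<le> fact r * (2 * q ^ n)" by (metis mult_le_mono1 nat_mult_1)
  then have mq: "2 * q ^ n \<le> m" unfolding m_def by linarith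
  have "m \<le> K * q ^ n"
  proof -
    have "1 \<le> q ^ n" using q by simp
    then show ?thesis by (simp add: m_def K_def algebra_simps)
  qed
  then have "m * (r ^ r) \<le> K * q ^ n * r ^ r" by (rule mult_le_mono1)
  then have "m * (r ^ r) * 2 ^ k \<le> K * q ^ n * r ^ r * 2 ^ k" by (rule mult_le_mono1)
  also have "\<dots> = q ^ r" by (simp add: r_def q_def mult_ac)
  finally have "m * (r ^ r) * 2 ^ k \<le> q ^ r" .
  then have "real (m * (r ^ r) * 2 ^ k) \<le> real (q ^ r)" by (simp only: of_nat_le_iff)
  then have mr: "real m * real r ^ r \<le> real q ^ r * (1/2) ^ k" by (simp add: power_divide field_simps)
  have "real (m * coll ({..<r} \<rightarrow>\<^sub>E {..<q}) (\<lambda>j. (\<Sum>s<r. int (a (j s))) mod int m)) \<le> real (q ^ (2 * r) + m * (r ^ r * q ^ r))"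
    using a(2) by (simp only: of_nat_le_iff)
  also have "\<dots> = real q ^ (2 * r) + real m * real r ^ r * real q ^ r" by simp
  also have "\<dots> \<le> real q ^ (2 * r) + real q ^ r * (1/2) ^ k * real q ^ r"
    using mr by (intro add_left_mono mult_right_mono) auto
  also have "\<dots> = real q ^ (2 * r) * (1 + (1/2) ^ k)" by (simp add: algebra_simps power_add[symmetric] mult_2_right)
  finally show ?thesis using q mq a(1) unfolding r_def by (intro exI[of _ q] exI[of _ m] exI[of _ a]) simp
qed

section \<open>Random digit expansions\<close>

text \<open>Horner's scheme: divided by the product of the first \<open>l\<close> moduli, it is the
  partial sum of a mixed-radix expansion in which \<open>b 0\<close> is the most significant digit.
  The \<open>b k\<close> may be sums of digits, so carries are not resolved here.\<close>

primrec digit_sum :: "(nat \<Rightarrow> nat) \<Rightarrow> (nat \<Rightarrow> int) \<Rightarrow> nat \<Rightarrow> int" where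
  "digit_sum m b 0 = 0"
| "digit_sum m b (Suc l) = int (m l) * digit_sum m b l + b l"

lemma digit_sum_cong: "(\<And>k. k < l \<Longrightarrow> b k = b' k) \<Longrightarrow> digit_sum m b l = digit_sum m b' l"
  by (induction l) auto

lemma digit_sum_sum: "digit_sum m (\<lambda>k. \<Sum>s\<in>A. b s k) l = (\<Sum>s\<in>A. digit_sum m (b s) l)"
  by (induction l) (simp_all add: sum.distrib sum_distrib_left)

lemma prod_cis: "(\<Prod>i<(n::nat). cis (f i)) = cis (\<Sum>i<n. f i)"
  by (induction n) (simp_all add: cis_mult add.commute)

locale digits =
  fixes q m :: "nat \<Rightarrow> nat" and a :: "nat \<Rightarrow> nat \<Rightarrow> nat"
  assumes q0: "\<And>k. q k > 0" and m2: "\<And>k. m k \<ge> 2" and a_lt: "\<And>k i. a k i < m k"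
begin

definition Mp :: "nat \<Rightarrow> nat" where "Mp l = (\<Prod>k<l. m k)"

lemma Mp_0 [simp]: "Mp 0 = 1" by (simp add: Mp_def)

lemma Mp_Suc: "Mp (Suc l) = Mp l * m l" by (simp add: Mp_def)

lemma m_pos: "m k > 0" using m2[of k] by linarith

lemma Mp_pos: "Mp l > 0" using m_pos by (induction l) (auto simp: Mp_Suc)

lemma Mp_ge: "2 ^ l \<le> Mp l"
proof (induction l)
  case (Suc l)
  have "2 ^ l * 2 \<le> Mp l * m l" using Suc m2[of l] by (rule mult_le_mono)
  then show ?case by (simp add: Mp_Suc mult.commute)
qed simp

definition val :: "(nat \<Rightarrow> int) \<Rightarrow> real" where
  "val b = suminf (\<lambda>k. real_of_int (b k) / real (Mp (Suc k)))"

lemma partial_sum_eq: "(\<Sum>k<l. real_of_int (b k) / real (Mp (Suc k))) = real_of_int (digit_sum m b l) / real (Mp l)"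
proof (induction l)
  case (Suc l)
  have "real_of_int (digit_sum m b l) / real (Mp l) + real_of_int (b l) / real (Mp (Suc l))
      = real_of_int (digit_sum m b (Suc l)) / real (Mp (Suc l))"
    using Mp_pos[of l] m_pos[of l] by (simp add: Mp_Suc field_simps)
  then show ?case by (simp add: Suc)
qed simp

text \<open>Digits are at most \<open>m k - 1\<close>, so each term is at most
  \<open>1 / Mp k - 1 / Mp (Suc k)\<close>, and the tail telescopes to at most
  \<open>1 / Mp l\<close>.\<close>

lemma val_bounds:
  assumes b: "\<And>k. 0 \<le> b k" "\<And>k. b k < int (m k)"
  shows "0 \<le> val b - real_of_int (digit_sum m b l) / real (Mp l)"
    and "val b - real_of_int (digit_sum m b l) / real (Mp l) \<le> 1 / real (Mp l)"
proof -
  let ?f = "\<lambda>k. real_of_int (b k) / real (Mp (Suc k))"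
  have f0: "0 \<le> ?f k" for k using b(1)[of k] by simp
  have f1: "?f k \<le> 1 / real (Mp k) - 1 / real (Mp (Suc k))" for k
  proof -
    have "real_of_int (b k) \<le> real (m k) - 1" using b(2)[of k] by linarith
    then have "?f k \<le> (real (m k) - 1) / real (Mp (Suc k))" by (rule divide_right_mono) simp
    also have "\<dots> = 1 / real (Mp k) - 1 / real (Mp (Suc k))"
      using Mp_pos[of k] m_pos[of k] by (simp add: Mp_Suc field_simps)
    finally show ?thesis .
  qed
  have tail: "sum ?f {..<l + j} \<le> sum ?f {..<l} + (1 / real (Mp l) - 1 / real (Mp (l + j)))" for l j
  proof (induction j)
    case (Suc j)
    then show ?case using f1[of "l + j"] by simp
  qed simp
  have tail': "sum ?f {..<l + j} \<le> sum ?f {..<l} + 1 / real (Mp l)" for l j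
  proof -
    have "0 \<le> 1 / real (Mp (l + j))" by simp
    then show ?thesis using tail[of l j] by linarith
  qed
  have sm: "summable ?f"
  proof (rule summableI_nonneg_bounded[OF f0])
    show "sum ?f {..<j} \<le> 1" for j using tail'[of 0 j] by simp
  qed
  have "sum ?f {..<l} \<le> val b" unfolding val_def using sm f0 by (intro sum_le_suminf) auto
  then show "0 \<le> val b - real_of_int (digit_sum m b l) / real (Mp l)" by (simp add: partial_sum_eq)
  have "(\<lambda>j. sum ?f {..<j + l}) \<longlonglongrightarrow> val b"
    unfolding val_def using summable_LIMSEQ[OF sm] by (rule LIMSEQ_ignore_initial_segment)
  then have "val b \<le> sum ?f {..<l} + 1 / real (Mp l)"
    using tail'[of l] by (intro LIMSEQ_le_const2[of _ "val b"]) (auto simp: add.commute)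
  then show "val b - real_of_int (digit_sum m b l) / real (Mp l) \<le> 1 / real (Mp l)"
    by (simp add: partial_sum_eq)
qed

definition \<Omega> :: "(nat \<Rightarrow> nat) measure" where
  "\<Omega> = PiM UNIV (\<lambda>k. uniform_count_measure {..<q k})"

lemma prob_digit: "prob_space (uniform_count_measure {..<q k})"
  using q0[of k] by (intro prob_space_uniform_count_measure) (auto simp: lessThan_empty_iff)

lemma prob_\<Omega>: "prob_space \<Omega>"
  unfolding \<Omega>_def by (intro prob_space_PiM prob_digit)

lemma space_\<Omega>: "\<omega> \<in> space \<Omega> \<longleftrightarrow> (\<forall>k. \<omega> k < q k)"
  by (auto simp: \<Omega>_def space_PiM space_uniform_count_measure)

definition real_of_digits :: "(nat \<Rightarrow> nat) \<Rightarrow> real" where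
  "real_of_digits \<omega> = val (\<lambda>k. int (a k (\<omega> k)))"

lemma real_of_digits_measurable: "real_of_digits \<in> borel_measurable \<Omega>"
proof -
  have d: "(\<lambda>\<omega>. real_of_int (int (a k (\<omega> k))) / real (Mp (Suc k))) \<in> borel_measurable \<Omega>" for k
  proof -
    have 1: "(\<lambda>\<omega>. \<omega> k) \<in> measurable \<Omega> (uniform_count_measure {..<q k})"
      unfolding \<Omega>_def by (rule measurable_component_singleton) simp
    have 2: "(\<lambda>i. real_of_int (int (a k i)) / real (Mp (Suc k))) \<in> borel_measurable (uniform_count_measure {..<q k})"
      by (rule measurableI) (auto simp: space_uniform_count_measure sets_uniform_count_measure)
    show ?thesis by (rule measurable_compose[OF 1 2])
  qed
  show ?thesis unfolding real_of_digits_def[abs_def] val_def by (rule borel_measurable_suminf[OF d])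
qed

definition digit_law :: "complex measure" where
  "digit_law = distr \<Omega> circle_borel (\<lambda>\<omega>. cis (2 * pi * real_of_digits \<omega>))"

lemma cis_digits_measurable: "(\<lambda>\<omega>. cis (2 * pi * real_of_digits \<omega>)) \<in> measurable \<Omega> circle_borel"
  unfolding measurable_circle_borel_iff
proof
  have "continuous_on UNIV (\<lambda>x. cis (2 * pi * x))" by (intro continuous_intros)
  then have "(\<lambda>x. cis (2 * pi * x)) \<in> borel_measurable borel" by (rule borel_measurable_continuous_onI)
  then show "(\<lambda>\<omega>. cis (2 * pi * real_of_digits \<omega>)) \<in> borel_measurable \<Omega>"
    by (rule measurable_compose[OF real_of_digits_measurable])
qed simp

section \<open>Sums of independent expansions, their digit tuples, and the cells of the
  circle\<close>

definition total :: "nat \<Rightarrow> (nat \<Rightarrow> nat \<Rightarrow> nat) \<Rightarrow> real" where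
  "total N \<omega> = (\<Sum>s<N. real_of_digits (\<omega> s))"

definition PN :: "nat \<Rightarrow> (nat \<Rightarrow> nat \<Rightarrow> nat) measure" where
  "PN N = PiM {..<N} (\<lambda>_. \<Omega>)"

lemma prob_PN: "prob_space (PN N)"
  unfolding PN_def by (intro prob_space_PiM prob_\<Omega>)

lemma convolution_power_digit_law:
  "convolution_power digit_law N = distr (PN N) circle_borel (\<lambda>\<omega>. cis (2 * pi * total N \<omega>))"
  unfolding digit_law_def convolution_power_distr[OF prob_\<Omega> cis_digits_measurable] PN_def
  by (simp add: prod_cis total_def sum_distrib_left)

lemma total_circle_measurable: "(\<lambda>\<omega>. cis (2 * pi * total N \<omega>)) \<in> measurable (PN N) circle_borel"
proof -
  have "(\<lambda>\<omega>. \<Prod>s<N. cis (2 * pi * real_of_digits (\<omega> s))) \<in> measurable (PN N) circle_borel"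
    unfolding PN_def by (intro measurable_circle_prod measurable_PiM_component cis_digits_measurable)
  then show ?thesis by (simp add: prod_cis total_def sum_distrib_left)
qed

definition tuple_digits :: "nat \<Rightarrow> nat \<Rightarrow> (nat \<Rightarrow> nat \<Rightarrow> nat) set" where
  "tuple_digits N l = (\<Pi>\<^sub>E k\<in>{..<l}. {..<N} \<rightarrow>\<^sub>E {..<q k})"

definition tuple_value :: "nat \<Rightarrow> nat \<Rightarrow> (nat \<Rightarrow> nat \<Rightarrow> nat) \<Rightarrow> int" where
  "tuple_value N l i = digit_sum m (\<lambda>k. \<Sum>s<N. int (a k (i k s))) l"

text \<open>The digits are regrouped by level instead of by summand, so that the last level can be
  split off in the induction on \<open>l\<close>.\<close>

definition tuple_of :: "nat \<Rightarrow> nat \<Rightarrow> (nat \<Rightarrow> nat \<Rightarrow> nat) \<Rightarrow> nat \<Rightarrow> nat \<Rightarrow> nat" where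
  "tuple_of N l \<omega> = (\<lambda>k\<in>{..<l}. \<lambda>s\<in>{..<N}. \<omega> s k)"

lemma finite_tuple_digits: "finite (tuple_digits N l)"
  unfolding tuple_digits_def by (intro finite_PiE) auto

lemma card_tuple_digits: "card (tuple_digits N l) = (\<Prod>k<l. q k ^ N)"
  unfolding tuple_digits_def by (simp add: card_PiE)

lemma space_PN: "\<omega> \<in> space (PN N) \<Longrightarrow> s < N \<Longrightarrow> \<omega> s \<in> space \<Omega>"
  by (auto simp: PN_def space_PiM)

lemma tuple_of_mem: "\<omega> \<in> space (PN N) \<Longrightarrow> tuple_of N l \<omega> \<in> tuple_digits N l"
  using space_PN[of \<omega> N] unfolding tuple_digits_def tuple_of_def
  by (intro restrict_PiE_iff[THEN iffD2] ballI) (auto simp: space_\<Omega>)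

lemma total_bounds:
  assumes "\<omega> \<in> space (PN N)"
  shows "0 \<le> total N \<omega> - real_of_int (tuple_value N l (tuple_of N l \<omega>)) / real (Mp l)"
    and "total N \<omega> - real_of_int (tuple_value N l (tuple_of N l \<omega>)) / real (Mp l) \<le> real N / real (Mp l)"
proof -
  let ?D = "\<lambda>s. digit_sum m (\<lambda>k. int (a k (\<omega> s k))) l"
  have "tuple_value N l (tuple_of N l \<omega>) = digit_sum m (\<lambda>k. \<Sum>s<N. int (a k (\<omega> s k))) l"
    unfolding tuple_value_def by (rule digit_sum_cong) (simp add: tuple_of_def)
  then have tv: "tuple_value N l (tuple_of N l \<omega>) = (\<Sum>s<N. ?D s)" by (simp add: digit_sum_sum)
  have eq: "total N \<omega> - real_of_int (tuple_value N l (tuple_of N l \<omega>)) / real (Mp l)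
      = (\<Sum>s<N. real_of_digits (\<omega> s) - real_of_int (?D s) / real (Mp l))"
    by (simp add: total_def tv sum_subtractf sum_divide_distrib)
  have b: "0 \<le> real_of_digits (\<omega> s) - real_of_int (?D s) / real (Mp l)"
    "real_of_digits (\<omega> s) - real_of_int (?D s) / real (Mp l) \<le> 1 / real (Mp l)" for s
    unfolding real_of_digits_def using a_lt by (intro val_bounds; simp)+
  show "0 \<le> total N \<omega> - real_of_int (tuple_value N l (tuple_of N l \<omega>)) / real (Mp l)"
    unfolding eq by (intro sum_nonneg b)
  have "(\<Sum>s<N. real_of_digits (\<omega> s) - real_of_int (?D s) / real (Mp l)) \<le> (\<Sum>s<N. 1 / real (Mp l))"
    by (intro sum_mono b)
  then show "total N \<omega> - real_of_int (tuple_value N l (tuple_of N l \<omega>)) / real (Mp l) \<le> real N / real (Mp l)"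
    unfolding eq by simp
qed

text \<open>The number of the half-open arc of length \<open>2 * pi / Mp l\<close> that contains
  \<open>cis (2 * pi * t)\<close>.\<close>

definition cell :: "nat \<Rightarrow> real \<Rightarrow> int" where
  "cell l t = \<lfloor>real (Mp l) * frac t\<rfloor>"

lemma cell_range: "0 \<le> cell l t" "cell l t < int (Mp l)"
proof -
  show "0 \<le> cell l t" by (simp add: cell_def)
  have "real (Mp l) * frac t < real (Mp l) * 1" using Mp_pos[of l] frac_lt_1[of t] by (intro mult_strict_left_mono) auto
  then show "cell l t < int (Mp l)" by (simp add: cell_def floor_less_iff)
qed

lemma cell_bounds:
  "2 * pi * real_of_int (cell l t) / real (Mp l) \<le> 2 * pi * frac t"
  "2 * pi * frac t < 2 * pi * real_of_int (cell l t + 1) / real (Mp l)"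
proof -
  have M: "real (Mp l) > 0" using Mp_pos[of l] by simp
  have "real_of_int (cell l t) \<le> real (Mp l) * frac t" by (simp add: cell_def)
  then have "2 * pi * real_of_int (cell l t) \<le> 2 * pi * (real (Mp l) * frac t)" by (intro mult_left_mono) auto
  then show "2 * pi * real_of_int (cell l t) / real (Mp l) \<le> 2 * pi * frac t"
    using M by (simp add: pos_divide_le_eq mult_ac)
  have "real (Mp l) * frac t < real_of_int (cell l t + 1)" unfolding cell_def by linarith
  then have "2 * pi * (real (Mp l) * frac t) < 2 * pi * real_of_int (cell l t + 1)" by (intro mult_strict_left_mono) auto
  then show "2 * pi * frac t < 2 * pi * real_of_int (cell l t + 1) / real (Mp l)"
    using M by (simp add: pos_less_divide_eq mult_ac)
qed

text \<open>The tails of \<open>N\<close> expansions add up to at most \<open>N / Mp l\<close>, so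
  the cell differs from the truncated value by at most \<open>N\<close> steps. This is the only loss
  in passing from real numbers to finite digit tuples.\<close>

lemma cell_total:
  assumes "\<omega> \<in> space (PN N)"
  obtains d where "0 \<le> d" "d \<le> int N" "cell l (total N \<omega>) = (tuple_value N l (tuple_of N l \<omega>) + d) mod int (Mp l)"
proof
  let ?M = "real (Mp l)" and ?t = "total N \<omega>" and ?Y = "tuple_value N l (tuple_of N l \<omega>)"
  let ?d = "\<lfloor>?M * ?t\<rfloor> - ?Y"
  have M: "?M > 0" using Mp_pos[of l] by simp
  have lo: "real_of_int ?Y \<le> ?M * ?t" and hi: "?M * ?t \<le> real_of_int ?Y + real N"
    using total_bounds[OF assms, of l] M by (simp_all add: field_simps)
  show "0 \<le> ?d" using lo by (simp add: le_floor_iff)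
  show "?d \<le> int N" using hi by linarith
  have "?M * frac ?t = ?M * ?t - real_of_int (int (Mp l) * \<lfloor>?t\<rfloor>)" by (simp add: frac_def algebra_simps)
  then have "cell l ?t = \<lfloor>?M * ?t\<rfloor> - int (Mp l) * \<lfloor>?t\<rfloor>"
    unfolding cell_def by (simp only: floor_diff_of_int)
  then have "cell l ?t mod int (Mp l) = \<lfloor>?M * ?t\<rfloor> mod int (Mp l)" by (simp add: mod_diff_eq[symmetric])
  moreover have "cell l ?t mod int (Mp l) = cell l ?t" using cell_range[of l ?t] by (simp add: mod_pos_pos_trivial)
  ultimately show "cell l ?t = (?Y + ?d) mod int (Mp l)" by simp
qed

text \<open>Digits are independent across summands and levels: the event is a box of cylinders, and
  each prescribed digit at level \<open>k\<close> has probability \<open>1 / q k\<close>.\<close>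

lemma cylinder_prob:
  assumes i: "i \<in> tuple_digits N l"
  defines "C \<equiv> {\<omega> \<in> space (PN N). tuple_of N l \<omega> = i}"
  shows "C \<in> sets (PN N)" "measure (PN N) C = 1 / real (\<Prod>k<l. q k ^ N)"
proof -
  interpret \<Omega>: prob_space \<Omega> by (rule prob_\<Omega>)
  interpret S: product_sigma_finite "\<lambda>_::nat. \<Omega>" by standard
  interpret D: product_prob_space "\<lambda>k. uniform_count_measure {..<q k}" UNIV
    by (rule product_prob_spaceI) (rule prob_digit)
  interpret P: prob_space "PN N" by (rule prob_PN)
  define B where "B s = prod_emb UNIV (\<lambda>k. uniform_count_measure {..<q k}) {..<l} (\<Pi>\<^sub>E k\<in>{..<l}. {i k s})" for s
  have ik: "i k s < q k" if "k < l" "s < N" for k s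
    using i that unfolding tuple_digits_def by (auto simp: PiE_iff)
  have sing: "{i k s} \<in> sets (uniform_count_measure {..<q k})" if "k < l" "s < N" for k s
    using ik[OF that] by (simp add: sets_uniform_count_measure)
  have Bs: "B s \<in> sets \<Omega>" if "s < N" for s
    unfolding B_def \<Omega>_def using that sing by (intro sets_PiM_I) auto
  have Beq: "\<omega> \<in> B s \<longleftrightarrow> \<omega> \<in> space \<Omega> \<and> (\<forall>k<l. \<omega> k = i k s)" for \<omega> s
    unfolding B_def \<Omega>_def by (auto simp: prod_emb_def space_PiM PiE_iff)
  have emB: "emeasure \<Omega> (B s) = ennreal (1 / real (\<Prod>k<l. q k))" if "s < N" for s
  proof -
    have "emeasure \<Omega> (B s) = (\<Prod>k<l. emeasure (uniform_count_measure {..<q k}) {i k s})"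
      unfolding B_def \<Omega>_def using that sing by (intro D.emeasure_PiM_emb) auto
    also have "\<dots> = (\<Prod>k<l. ennreal (1 / real (q k)))"
      using that ik q0 by (intro prod.cong refl) (simp add: emeasure_uniform_count_measure)
    also have "\<dots> = ennreal (\<Prod>k<l. 1 / real (q k))" by (rule prod_ennreal) simp
    also have "(\<Prod>k<l. 1 / real (q k)) = 1 / real (\<Prod>k<l. q k)" by (simp add: prod_dividef)
    finally show ?thesis .
  qed
  have C: "C = (\<Pi>\<^sub>E s\<in>{..<N}. B s)"
  proof (intro equalityI subsetI)
    fix \<omega> assume "\<omega> \<in> C"
    then have w: "\<omega> \<in> space (PN N)" "tuple_of N l \<omega> = i" by (simp_all add: C_def)
    have "\<omega> s k = i k s" if "s < N" "k < l" for s k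
      using fun_cong[OF fun_cong[OF w(2), of k], of s] that by (simp add: tuple_of_def)
    then have "\<omega> s \<in> B s" if "s < N" for s using that space_PN[OF w(1) that] by (simp add: Beq)
    then show "\<omega> \<in> (\<Pi>\<^sub>E s\<in>{..<N}. B s)" using w(1) by (simp add: PN_def space_PiM PiE_iff)
  next
    fix \<omega> assume w: "\<omega> \<in> (\<Pi>\<^sub>E s\<in>{..<N}. B s)"
    then have sp: "\<omega> \<in> space (PN N)" by (auto simp: PN_def space_PiM PiE_iff Beq)
    have "tuple_of N l \<omega> = i"
    proof (rule PiE_ext[OF tuple_of_mem[OF sp, unfolded tuple_digits_def] i[unfolded tuple_digits_def]])
      fix k assume k: "k \<in> {..<l}"
      have ik': "i k \<in> {..<N} \<rightarrow>\<^sub>E {..<q k}" using i k unfolding tuple_digits_def by (rule PiE_mem)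
      show "tuple_of N l \<omega> k = i k"
      proof
        fix s show "tuple_of N l \<omega> k s = i k s"
          using w k ik' by (cases "s < N") (auto simp: tuple_of_def PiE_iff Beq extensional_def)
      qed
    qed
    then show "\<omega> \<in> C" using sp by (simp add: C_def)
  qed
  show "C \<in> sets (PN N)" unfolding C PN_def using Bs by (intro sets_PiM_I_finite) auto
  have "emeasure (PN N) C = (\<Prod>s<N. emeasure \<Omega> (B s))"
    unfolding C PN_def using Bs by (intro S.emeasure_PiM) auto
  also have "\<dots> = (\<Prod>s<N. ennreal (1 / real (\<Prod>k<l. q k)))" using emB by (intro prod.cong refl) auto
  also have "\<dots> = ennreal ((1 / real (\<Prod>k<l. q k)) ^ N)" by (simp add: ennreal_power prod_nonneg)
  also have "(1 / real (\<Prod>k<l. q k)) ^ N = 1 / real (\<Prod>k<l. q k ^ N)"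
    by (simp add: power_divide prod_power_distrib)
  finally show "measure (PN N) C = 1 / real (\<Prod>k<l. q k ^ N)"
    unfolding P.emeasure_eq_measure by (simp add: prod_nonneg)
qed

lemma tuple_event_prob:
  assumes Bad: "Bad \<subseteq> tuple_digits N l"
  defines "F \<equiv> {\<omega> \<in> space (PN N). tuple_of N l \<omega> \<in> Bad}"
  shows "F \<in> sets (PN N)" "measure (PN N) F \<le> real (card Bad) / real (\<Prod>k<l. q k ^ N)"
proof -
  interpret P: prob_space "PN N" by (rule prob_PN)
  let ?C = "\<lambda>i. {\<omega> \<in> space (PN N). tuple_of N l \<omega> = i}"
  have fin: "finite Bad" using Bad finite_tuple_digits by (rule finite_subset)
  have F: "F = (\<Union>i\<in>Bad. ?C i)" by (auto simp: F_def)
  have c: "?C i \<in> sets (PN N)" "measure (PN N) (?C i) = 1 / real (\<Prod>k<l. q k ^ N)" if "i \<in> Bad" for i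
    using cylinder_prob[of i N l] Bad that by blast+
  show "F \<in> sets (PN N)" unfolding F using fin c by (intro sets.finite_UN) auto
  have "measure (PN N) F \<le> (\<Sum>i\<in>Bad. measure (PN N) (?C i))"
    unfolding F using fin c by (intro P.finite_measure_subadditive_finite) auto
  also have "\<dots> = real (card Bad) / real (\<Prod>k<l. q k ^ N)" using c(2) by simp
  finally show "measure (PN N) F \<le> real (card Bad) / real (\<Prod>k<l. q k ^ N)" .
qed

text \<open>Passing to the next level multiplies the value by \<open>m l\<close> and adds the new
  digit sum, so the new digits are the low ones in \<open>coll_digit_step\<close>. The map
  \<open>?h\<close> separates the last entry of a tuple from the earlier ones.\<close>

lemma coll_tuple_Suc:
  "coll (tuple_digits N (Suc l)) (\<lambda>i. tuple_value N (Suc l) i mod int (Mp (Suc l)))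
    \<le> coll (tuple_digits N l) (\<lambda>i. tuple_value N l i mod int (Mp l))
      * coll ({..<N} \<rightarrow>\<^sub>E {..<q l}) (\<lambda>j. (\<Sum>s<N. int (a l (j s))) mod int (m l))"
proof -
  let ?I = "tuple_digits N l" and ?J = "{..<N} \<rightarrow>\<^sub>E {..<q l}"
  let ?g = "\<lambda>j. \<Sum>s<N. int (a l (j s))"
  let ?h = "\<lambda>i. (restrict i {..<l}, i l)"
  let ?F = "\<lambda>(i, j). (int (m l) * tuple_value N l i + ?g j) mod (int (m l) * int (Mp l))"
  have fin: "finite (?I \<times> ?J)" using finite_tuple_digits by (auto intro: finite_PiE)
  have hm: "?h i \<in> ?I \<times> ?J" if "i \<in> tuple_digits N (Suc l)" for i
    using that unfolding tuple_digits_def by (auto simp: PiE_iff)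
  have hv: "tuple_value N (Suc l) i mod int (Mp (Suc l)) = ?F (?h i)" for i
  proof -
    have "tuple_value N l (restrict i {..<l}) = tuple_value N l i"
      unfolding tuple_value_def by (rule digit_sum_cong) simp
    then show ?thesis by (simp add: tuple_value_def Mp_Suc mult.commute)
  qed
  have hinj: "i = j" if ij: "i \<in> tuple_digits N (Suc l)" "j \<in> tuple_digits N (Suc l)" and "?h i = ?h j" for i j
  proof (rule PiE_ext[OF ij[unfolded tuple_digits_def]])
    fix k assume "k \<in> {..<Suc l}"
    then consider "k < l" | "k = l" by fastforce
    then show "i k = j k"
    proof cases
      case 1
      have "restrict i {..<l} k = restrict j {..<l} k" using \<open>?h i = ?h j\<close> by simp
      then show ?thesis using 1 by simp
    qed (use \<open>?h i = ?h j\<close> in simp)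
  qed
  have "coll (tuple_digits N (Suc l)) (\<lambda>i. tuple_value N (Suc l) i mod int (Mp (Suc l))) \<le> coll (?I \<times> ?J) ?F"
    unfolding coll_def
  proof (rule card_inj_on_le[where f="\<lambda>(i, j). (?h i, ?h j)"])
    show "inj_on (\<lambda>(i, j). (?h i, ?h j)) {(i, j). i \<in> tuple_digits N (Suc l) \<and> j \<in> tuple_digits N (Suc l) \<and>
        tuple_value N (Suc l) i mod int (Mp (Suc l)) = tuple_value N (Suc l) j mod int (Mp (Suc l))}"
    proof (rule inj_onI, clarify)
      fix i j i' j' 
      assume m: "i \<in> tuple_digits N (Suc l)" "j \<in> tuple_digits N (Suc l)" "i' \<in> tuple_digits N (Suc l)" "j' \<in> tuple_digits N (Suc l)"
        and e: "restrict i {..<l} = restrict i' {..<l}" "i l = i' l" "restrict j {..<l} = restrict j' {..<l}" "j l = j' l"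
      have "?h i = ?h i'" "?h j = ?h j'" using e by simp_all
      then show "i = i' \<and> j = j'" using hinj[OF m(1,3)] hinj[OF m(2,4)] by blast
    qed
    show "(\<lambda>(i, j). (?h i, ?h j)) ` {(i, j). i \<in> tuple_digits N (Suc l) \<and> j \<in> tuple_digits N (Suc l) \<and>
        tuple_value N (Suc l) i mod int (Mp (Suc l)) = tuple_value N (Suc l) j mod int (Mp (Suc l))}
      \<subseteq> {(i, j). i \<in> ?I \<times> ?J \<and> j \<in> ?I \<times> ?J \<and> ?F i = ?F j}"
    proof (rule image_subsetI)
      fix p assume "p \<in> {(i, j). i \<in> tuple_digits N (Suc l) \<and> j \<in> tuple_digits N (Suc l) \<and>
        tuple_value N (Suc l) i mod int (Mp (Suc l)) = tuple_value N (Suc l) j mod int (Mp (Suc l))}"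
      then obtain i j where p: "p = (i, j)" "i \<in> tuple_digits N (Suc l)" "j \<in> tuple_digits N (Suc l)"
        "tuple_value N (Suc l) i mod int (Mp (Suc l)) = tuple_value N (Suc l) j mod int (Mp (Suc l))" by blast
      have "?F (?h i) = ?F (?h j)" using p(4) unfolding hv .
      then show "(case p of (i, j) \<Rightarrow> (?h i, ?h j)) \<in> {(i, j). i \<in> ?I \<times> ?J \<and> j \<in> ?I \<times> ?J \<and> ?F i = ?F j}"
        using hm[OF p(2)] hm[OF p(3)] unfolding p(1) prod.case mem_Collect_eq by blast
    qed
    show "finite {(i, j). i \<in> ?I \<times> ?J \<and> j \<in> ?I \<times> ?J \<and> ?F i = ?F j}"
      by (rule finite_subset[of _ "(?I \<times> ?J) \<times> (?I \<times> ?J)"]) (use fin in auto)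
  qed
  also have "\<dots> \<le> coll ?I (\<lambda>i. tuple_value N l i mod int (Mp l)) * coll ?J (\<lambda>j. ?g j mod int (m l))"
    using m_pos[of l] finite_tuple_digits by (intro coll_digit_step) (auto intro: finite_PiE)
  finally show ?thesis .
qed

text \<open>The bounds of the single levels multiply, and the product of the factors
  \<open>1 + (1/2) ^ k\<close> is at most the exponential of a geometric sum. The number of
  collisions thus exceeds that of a uniform distribution by at most the factor \<open>exp 2\<close>,
  uniformly in \<open>l\<close>.\<close>

lemma coll_tuple_bound:
  assumes few: "\<And>k. real (m k) * real (coll ({..<N} \<rightarrow>\<^sub>E {..<q k}) (\<lambda>j. (\<Sum>s<N. int (a k (j s))) mod int (m k)))
      \<le> real (q k) ^ (2 * N) * (1 + (1/2) ^ k)"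
  shows "real (Mp l) * real (coll (tuple_digits N l) (\<lambda>i. tuple_value N l i mod int (Mp l)))
      \<le> (real (\<Prod>k<l. q k ^ N))\<^sup>2 * exp 2"
proof -
  let ?c = "\<lambda>l. real (coll (tuple_digits N l) (\<lambda>i. tuple_value N l i mod int (Mp l)))"
  let ?d = "\<lambda>k. real (coll ({..<N} \<rightarrow>\<^sub>E {..<q k}) (\<lambda>j. (\<Sum>s<N. int (a k (j s))) mod int (m k)))"
  have "real (Mp l) * ?c l \<le> (real (\<Prod>k<l. q k ^ N))\<^sup>2 * (\<Prod>k<l. 1 + (1/2) ^ k)"
  proof (induction l)
    case 0
    have "{(i, j). i \<in> tuple_digits N 0 \<and> j \<in> tuple_digits N 0 \<and> tuple_value N 0 i mod int (Mp 0) = tuple_value N 0 j mod int (Mp 0)}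
        \<subseteq> {(\<lambda>_. undefined, \<lambda>_. undefined)}" by (auto simp: tuple_digits_def)
    then have "coll (tuple_digits N 0) (\<lambda>i. tuple_value N 0 i mod int (Mp 0)) \<le> card {(\<lambda>_::nat. undefined::nat \<Rightarrow> nat, \<lambda>_::nat. undefined::nat \<Rightarrow> nat)}"
      unfolding coll_def by (intro card_mono) auto
    then show ?case by simp
  next
    case (Suc l)
    have "real (coll (tuple_digits N (Suc l)) (\<lambda>i. tuple_value N (Suc l) i mod int (Mp (Suc l)))) \<le> ?c l * ?d l"
      using coll_tuple_Suc[of N l] by (simp only: of_nat_mult[symmetric] of_nat_le_iff)
    then have "real (Mp (Suc l)) * ?c (Suc l) \<le> real (Mp (Suc l)) * (?c l * ?d l)" by (rule mult_left_mono) simp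
    also have "\<dots> = (real (Mp l) * ?c l) * (real (m l) * ?d l)" by (simp add: Mp_Suc)
    also have "\<dots> \<le> ((real (\<Prod>k<l. q k ^ N))\<^sup>2 * (\<Prod>k<l. 1 + (1/2) ^ k)) * (real (q l) ^ (2 * N) * (1 + (1/2) ^ l))"
      by (intro mult_mono Suc few) (auto intro!: mult_nonneg_nonneg prod_nonneg)
    also have "\<dots> = (real (\<Prod>k<Suc l. q k ^ N))\<^sup>2 * (\<Prod>k<Suc l. 1 + (1/2) ^ k)"
    proof -
      have "(real (\<Prod>k<Suc l. q k ^ N))\<^sup>2 = (real (\<Prod>k<l. q k ^ N))\<^sup>2 * real (q l) ^ (2 * N)"
        by (simp add: power_mult_distrib power_even_eq)
      then show ?thesis by (simp only: prod.lessThan_Suc mult_ac)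
    qed
    finally show ?case .
  qed
  also have "\<dots> \<le> (real (\<Prod>k<l. q k ^ N))\<^sup>2 * exp 2"
  proof (rule mult_left_mono)
    have "(\<Prod>k<l. 1 + (1/2::real) ^ k) \<le> (\<Prod>k<l. exp ((1/2) ^ k))"
      by (intro prod_mono) (auto simp: exp_ge_add_one_self add.commute)
    also have "\<dots> = exp (\<Sum>k<l. (1/2) ^ k)" by (simp add: exp_sum)
    also have "(\<Sum>k<l. (1/2::real) ^ k) \<le> 2"
    proof -
      have "(\<Sum>k<l. (1/2::real) ^ k) = (1 - (1/2) ^ l) / (1 - 1/2)" by (subst sum_gp_strict) simp
      also have "\<dots> \<le> 2" by simp
      finally show ?thesis .
    qed
    finally show "(\<Prod>k<l. 1 + (1/2::real) ^ k) \<le> exp 2" by simp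
  qed simp
  finally show ?thesis .
qed

end

section \<open>Angles, Lebesgue measure on the circle, and the two comparisons for the digit
  law\<close>

lemma circle_lebesgue_emeasure:
  assumes E: "E \<in> sets circle_borel"
  shows "{x \<in> {0..<2 * pi}. cis x \<in> E} \<in> sets borel"
    and "emeasure circle_lebesgue E = emeasure lborel {x \<in> {0..<2 * pi}. cis x \<in> E}"
proof -
  have cis_b: "cis \<in> borel_measurable borel"
    by (rule borel_measurable_continuous_onI) (intro continuous_intros)
  have cis_m: "cis \<in> measurable (restrict_space lborel {0..<2 * pi}) circle_borel"
    unfolding measurable_circle_borel_iff by (auto intro!: measurable_restrict_space1 cis_b)
  have "{0..<2 * pi} \<inter> cis -` E \<in> sets (restrict_space lborel {0..<2 * pi})"
    using measurable_sets[OF cis_m E] by (simp add: space_restrict_space Int_commute)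
  then have s: "{0..<2 * pi} \<inter> cis -` E \<in> sets lborel"
    by (subst (asm) sets_restrict_space_iff) auto
  have eq: "{x \<in> {0..<2 * pi}. cis x \<in> E} = {0..<2 * pi} \<inter> cis -` E" by auto
  show "{x \<in> {0..<2 * pi}. cis x \<in> E} \<in> sets borel" unfolding eq using s by simp
  have "emeasure circle_lebesgue E = emeasure (restrict_space lborel {0..<2 * pi}) (cis -` E \<inter> space (restrict_space lborel {0..<2 * pi}))"
    unfolding circle_lebesgue_def by (rule emeasure_distr[OF cis_m E])
  also have "cis -` E \<inter> space (restrict_space lborel {0..<2 * pi}) = {0..<2 * pi} \<inter> cis -` E"
    by (simp add: space_restrict_space Int_commute)
  also have "emeasure (restrict_space lborel {0..<2 * pi}) ({0..<2 * pi} \<inter> cis -` E) = emeasure lborel ({0..<2 * pi} \<inter> cis -` E)"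
    by (rule emeasure_restrict_space) auto
  finally show "emeasure circle_lebesgue E = emeasure lborel {x \<in> {0..<2 * pi}. cis x \<in> E}" unfolding eq .
qed

lemma cis_2pi_frac: "cis (2 * pi * t) = cis (2 * pi * frac t)"
proof -
  have "2 * pi * t = 2 * pi * frac t + 2 * pi * real_of_int \<lfloor>t\<rfloor>" by (simp add: frac_def algebra_simps)
  moreover have "cis (2 * pi * real_of_int \<lfloor>t\<rfloor>) = 1" by (rule cis_multiple_2pi) simp
  ultimately show ?thesis by (simp add: cis_mult[symmetric])
qed

text \<open>The upper bound for \<open>y\<close> is not strict because \<open>y\<close> will range
  over closed arcs, the last of which ends at \<open>2 * pi\<close>; this endpoint accounts for the
  alternative \<open>x = 0\<close>.\<close>

lemma cis_eq_cis_2pi: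
  assumes "cis x = cis y" "0 \<le> x" "x < 2 * pi" "0 \<le> y" "y \<le> 2 * pi"
  shows "x = y \<or> x = 0"
proof -
  have "cis x * cis (- y) = 1" unfolding assms(1) by (simp add: cis_mult)
  then have "cos (x - y) = 1" by (simp add: cis_mult complex_eq_iff)
  then obtain k :: int where "x - y = real_of_int k * 2 * pi" using cos_one_2pi_int by auto
  then have k: "x - y = real_of_int k * (2 * pi)" by (simp only: mult.assoc)
  have "- 1 \<le> k" 
  proof -
    have "- 1 * (2 * pi) \<le> real_of_int k * (2 * pi)" using k assms by linarith
    then have "- 1 \<le> real_of_int k" by (rule mult_right_le_imp_le) simp
    then show ?thesis by linarith
  qed
  moreover have "k < 1"
  proof -
    have "real_of_int k * (2 * pi) < 1 * (2 * pi)" using k assms by linarith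
    then have "real_of_int k < 1" by (rule mult_right_less_imp_less) simp
    then show ?thesis by linarith
  qed
  ultimately consider "k = 0" | "k = - 1" by linarith
  then show ?thesis
  proof cases
    case 2
    then have "x + 2 * pi = y" using k by simp
    then show ?thesis using assms by linarith
  qed (use k in simp)
qed

lemma sum_const_ennreal:
  assumes "0 \<le> c"
  shows "(\<Sum>v\<in>G. ennreal c) = ennreal (real (card G) * c)"
proof -
  have "(\<Sum>v\<in>G. ennreal c) = ennreal (\<Sum>v\<in>G. c)" using assms by (intro sum_ennreal) auto
  then show ?thesis by (simp only: sum_constant)
qed

lemma card_atLeast0_int: "card {0..int N} = N + 1"
  by (simp add: nat_add_distrib)

context digits
begin

text \<open>The half-open angular intervals of distinct cells are disjoint and have equal length, so
  an open set of small measure contains only few of them.\<close>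

lemma cell_interval_union:
  assumes U: "open U" and G: "G \<subseteq> {v. 0 \<le> v \<and> v < int (Mp l)}"
    and sub: "\<And>v. v \<in> G \<Longrightarrow> {2 * pi * real_of_int v / real (Mp l) ..< 2 * pi * real_of_int (v + 1) / real (Mp l)} \<subseteq> U"
  shows "ennreal (real (card G) * (2 * pi / real (Mp l))) \<le> emeasure lborel U"
proof -
  let ?J = "\<lambda>v. {2 * pi * real_of_int v / real (Mp l) ..< 2 * pi * real_of_int (v + 1) / real (Mp l)}"
  have M: "real (Mp l) > 0" using Mp_pos[of l] by simp
  have fin: "finite G" by (rule finite_subset[OF G]) (rule finite_subset[of _ "{0..<int (Mp l)}"], auto)
  have mono: "2 * pi * real_of_int (v + 1) / real (Mp l) \<le> 2 * pi * real_of_int w / real (Mp l)" if "v < w" for v w :: int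
    using that M by (intro divide_right_mono mult_left_mono) auto
  have disj: "disjoint_family_on ?J G"
    unfolding disjoint_family_on_def
  proof (intro ballI impI)
    fix v w :: int assume "v \<noteq> w"
    then consider "v < w" | "w < v" by linarith
    then show "?J v \<inter> ?J w = {}" by cases (use mono[of v w] mono[of w v] in fastforce)+
  qed
  have len: "emeasure lborel (?J v) = ennreal (2 * pi / real (Mp l))" for v
  proof -
    have "2 * pi * real_of_int (v + 1) / real (Mp l) - 2 * pi * real_of_int v / real (Mp l) = 2 * pi / real (Mp l)"
      using M by (simp add: field_simps)
    moreover have "2 * pi * real_of_int v / real (Mp l) \<le> 2 * pi * real_of_int (v + 1) / real (Mp l)"
      using M by (intro divide_right_mono mult_left_mono) auto
    ultimately show ?thesis by simp
  qed
  have "ennreal (real (card G) * (2 * pi / real (Mp l))) = (\<Sum>v\<in>G. emeasure lborel (?J v))"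
    unfolding len by (rule sum_const_ennreal[symmetric]) simp
  also have "\<dots> = emeasure lborel (\<Union>v\<in>G. ?J v)"
    using fin disj by (intro sum_emeasure) auto
  also have "\<dots> \<le> emeasure lborel U"
    using sub U by (intro emeasure_mono) auto
  finally show ?thesis .
qed

text \<open>The angles of a null set are covered by a short open set \<open>U\<close>. At deep
  levels the cell of a point in the null set lies inside \<open>U\<close>; there are few such cells,
  so by Cauchy-Schwarz and the collision bound few digit tuples lead to them.\<close>

theorem digit_law_absolutely_continuous:
  assumes few: "\<And>k. real (m k) * real (coll ({..<N} \<rightarrow>\<^sub>E {..<q k}) (\<lambda>j. (\<Sum>s<N. int (a k (j s))) mod int (m k)))
      \<le> real (q k) ^ (2 * N) * (1 + (1/2) ^ k)"
  shows "absolutely_continuous circle_lebesgue (convolution_power digit_law N)"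
  unfolding absolutely_continuous_def
proof
  fix E assume E0: "E \<in> null_sets circle_lebesgue"
  interpret P: prob_space "PN N" by (rule prob_PN)
  have E: "E \<in> sets circle_borel" using E0 by (auto simp: circle_lebesgue_def)
  let ?N0 = "{x \<in> {0..<2 * pi}. cis x \<in> E}"
  have N0: "?N0 \<in> sets borel" "emeasure lborel ?N0 = 0"
    using circle_lebesgue_emeasure[OF E] E0 by (auto simp: null_sets_def)
  let ?Z = "\<lambda>\<omega>. cis (2 * pi * total N \<omega>)"
  let ?A = "?Z -` E \<inter> space (PN N)"
  have A: "?A \<in> sets (PN N)" by (rule measurable_sets[OF total_circle_measurable E])
  \<comment> \<open>The constant collects what is lost below: \<open>N + 1\<close> for the offsets
    of the cells, \<open>exp 2\<close> for the excess of collisions, and \<open>2 * pi\<close> for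
    the length of the circle.\<close>
  define c where "c = (real N + 1) * exp 2 / (2 * pi)"
  have c: "c > 0" unfolding c_def by (intro divide_pos_pos mult_pos_pos) auto
  have bound: "(measure (PN N) ?A)\<^sup>2 \<le> 0 + e" if e: "e > 0" for e :: real
  proof -
    have ec: "e / c > 0" using e c by simp
    obtain U where U: "open U" "?N0 \<subseteq> U" "emeasure lborel (U - ?N0) \<le> ennreal (e / c)"
      using outer_regular_lborel_le[OF N0(1) ec] .
    have "emeasure lborel U \<le> emeasure lborel ((U - ?N0) \<union> ?N0)"
      using U(1) N0(1) by (intro emeasure_mono) auto
    also have "\<dots> \<le> emeasure lborel (U - ?N0) + emeasure lborel ?N0"
      using U(1) N0(1) by (intro emeasure_subadditive) auto
    also have "\<dots> \<le> ennreal (e / c)" using U(3) N0(2) by simp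
    finally have Ue: "emeasure lborel U \<le> ennreal (e / c)" .
    \<comment> \<open>The cells of level \<open>l\<close> whose whole angular interval lies in
      \<open>U\<close>.\<close>
    define G where "G l = {v. 0 \<le> v \<and> v < int (Mp l) \<and>
      {2 * pi * real_of_int v / real (Mp l) ..< 2 * pi * real_of_int (v + 1) / real (Mp l)} \<subseteq> U}" for l
    have finG: "finite (G l)" for l by (rule finite_subset[of _ "{0..<int (Mp l)}"]) (auto simp: G_def)
    have cardG: "real (card (G l)) * (2 * pi / real (Mp l)) \<le> e / c" for l
    proof -
      have "ennreal (real (card (G l)) * (2 * pi / real (Mp l))) \<le> emeasure lborel U"
        by (rule cell_interval_union[OF U(1)]) (auto simp: G_def)
      then have "ennreal (real (card (G l)) * (2 * pi / real (Mp l))) \<le> ennreal (e / c)" using Ue by (rule order_trans)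
      then show ?thesis using ec by (simp add: ennreal_le_iff)
    qed
    \<comment> \<open>The residues of truncated values from which a cell of \<open>G l\<close> can
      be reached by one of the \<open>N + 1\<close> possible offsets.\<close>
    define G' where "G' l = (\<lambda>(v, d). (v - d) mod int (Mp l)) ` (G l \<times> {0..int N})" for l
    have finG': "finite (G' l)" for l unfolding G'_def using finG by auto
    have cardG': "card (G' l) \<le> card (G l) * (N + 1)" for l
    proof -
      have "card (G' l) \<le> card (G l \<times> {0..int N})" unfolding G'_def using finG by (intro card_image_le) auto
      then show ?thesis by (simp only: card_cartesian_product card_atLeast0_int)
    qed
    define Bad where "Bad l = {i \<in> tuple_digits N l. tuple_value N l i mod int (Mp l) \<in> G' l}" for l
    define F where "F l = {\<omega> \<in> space (PN N). tuple_of N l \<omega> \<in> Bad l}" for l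
    have Bsub: "Bad l \<subseteq> tuple_digits N l" for l by (auto simp: Bad_def)
    note F = tuple_event_prob[OF Bsub, folded F_def]
    have PF: "(measure (PN N) (F l))\<^sup>2 \<le> e" for l
    proof -
      let ?Q = "real (\<Prod>k<l. q k ^ N)" and ?C = "real (coll (tuple_digits N l) (\<lambda>i. tuple_value N l i mod int (Mp l)))"
      have Q: "?Q > 0" using q0 by (simp add: prod_pos)
      have M: "real (Mp l) > 0" using Mp_pos[of l] by simp
      have "(card (Bad l))\<^sup>2 \<le> card (G' l) * coll (tuple_digits N l) (\<lambda>i. tuple_value N l i mod int (Mp l))"
        unfolding Bad_def by (rule coll_Cauchy_Schwarz[OF finite_tuple_digits finG'])
      then have "real ((card (Bad l))\<^sup>2) \<le> real (card (G' l) * coll (tuple_digits N l) (\<lambda>i. tuple_value N l i mod int (Mp l)))"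
        by (simp only: of_nat_le_iff)
      then have "(real (card (Bad l)))\<^sup>2 \<le> real (card (G' l)) * ?C" by simp
      also have "\<dots> \<le> (real (card (G l)) * (real N + 1)) * (?Q\<^sup>2 * exp 2 / real (Mp l))"
      proof (rule mult_mono)
        have "real (card (G' l)) \<le> real (card (G l) * (N + 1))" using cardG'[of l] by (simp only: of_nat_le_iff)
        then show "real (card (G' l)) \<le> real (card (G l)) * (real N + 1)" by (simp add: algebra_simps)
        show "?C \<le> ?Q\<^sup>2 * exp 2 / real (Mp l)"
          using coll_tuple_bound[OF few, of l] M by (simp add: pos_le_divide_eq mult.commute)
      qed auto
      also have "\<dots> = ?Q\<^sup>2 * (c * (real (card (G l)) * (2 * pi / real (Mp l))))"
      proof -
        have cp: "c * (2 * pi) = (real N + 1) * exp 2" by (simp add: c_def)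
        have "x * g * (c * (2 * pi)) / y = x * (c * (g * (2 * pi / y)))" for x g y :: real
          by (simp only: times_divide_eq_right times_divide_eq_left mult_ac)
        note this[of "?Q\<^sup>2" "real (card (G l))" "real (Mp l)", unfolded cp]
        then show ?thesis by (simp only: times_divide_eq_right times_divide_eq_left mult_ac)
      qed
      also have "\<dots> \<le> ?Q\<^sup>2 * (c * (e / c))"
        using cardG[of l] c by (intro mult_left_mono) auto
      also have "\<dots> = ?Q\<^sup>2 * e" using c by simp
      finally have B: "(real (card (Bad l)))\<^sup>2 \<le> ?Q\<^sup>2 * e" .
      have "(measure (PN N) (F l))\<^sup>2 \<le> (real (card (Bad l)) / ?Q)\<^sup>2"
        using F(2)[of l] by (intro power_mono) auto
      also have "\<dots> = (real (card (Bad l)))\<^sup>2 / ?Q\<^sup>2" by (rule power_divide)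
      also have "\<dots> \<le> e"
      proof -
        have "?Q\<^sup>2 > 0" using Q by (rule zero_less_power)
        then show ?thesis using B by (simp only: pos_divide_le_eq mult.commute)
      qed
      finally show ?thesis .
    qed
    \<comment> \<open>The level from which the cells lie inside \<open>U\<close> depends on the
      point, so the event is covered by an increasing union. Each \<open>W L\<close> is contained in
      \<open>F L\<close>, hence the bound survives in the limit.\<close>
    define W where "W L = (\<Inter>l\<in>{L..}. F l)" for L
    have Ws: "W L \<in> sets (PN N)" for L unfolding W_def using F(1) by (intro sets.countable_INT') auto
    have cover: "?A \<subseteq> (\<Union>L. W L)"
    proof
      fix \<omega> assume w: "\<omega> \<in> ?A"
      then have ws: "\<omega> \<in> space (PN N)" by simp
      let ?t = "total N \<omega>" and ?x = "2 * pi * frac (total N \<omega>)"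
      have "?x \<in> ?N0"
      proof -
        have "2 * pi * frac ?t < 2 * pi * 1" using frac_lt_1[of ?t] by (intro mult_strict_left_mono) auto
        moreover have "cis ?x \<in> E" using w cis_2pi_frac[of ?t] by simp
        ultimately show ?thesis by simp
      qed
      then have "?x \<in> U" using U(2) by blast
      then obtain \<delta> where \<delta>: "\<delta> > 0" "ball ?x \<delta> \<subseteq> U" using U(1) open_contains_ball by blast
      \<comment> \<open>\<open>Mp l\<close> is at least \<open>2 ^ l\<close>, so from level
        \<open>L\<close> on the cells are shorter than the radius of the ball inside
        \<open>U\<close>.\<close>
      obtain L where L: "2 * pi / \<delta> < 2 ^ L" using real_arch_pow[of 2 "2 * pi / \<delta>"] by auto
      have "\<omega> \<in> F l" if l: "L \<le> l" for l
      proof -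
        let ?M = "real (Mp l)" and ?v = "cell l ?t"
        have M: "?M > 0" using Mp_pos[of l] by simp
        have "(2::real) ^ L \<le> 2 ^ l" using l by (rule power_increasing) simp
        also have "(2::real) ^ l \<le> ?M" using Mp_ge[of l] by (metis of_nat_le_iff of_nat_numeral of_nat_power)
        finally have "2 * pi / \<delta> < ?M" using L by linarith
        then have len: "2 * pi / ?M < \<delta>" using \<delta>(1) M by (simp add: field_simps)
        have split: "2 * pi * real_of_int (?v + 1) / ?M = 2 * pi * real_of_int ?v / ?M + 2 * pi / ?M"
          using M by (simp add: field_simps)
        have "{2 * pi * real_of_int ?v / ?M ..< 2 * pi * real_of_int (?v + 1) / ?M} \<subseteq> ball ?x \<delta>"
        proof
          fix y assume "y \<in> {2 * pi * real_of_int ?v / ?M ..< 2 * pi * real_of_int (?v + 1) / ?M}"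
          then have "\<bar>?x - y\<bar> < \<delta>" using cell_bounds[where l=l and t="?t"] len split by auto
          then show "y \<in> ball ?x \<delta>" by (simp add: dist_real_def)
        qed
        then have vG: "?v \<in> G l" using \<delta>(2) cell_range[where l=l and t="?t"] by (auto simp: G_def)
        obtain d where d: "0 \<le> d" "d \<le> int N" "?v = (tuple_value N l (tuple_of N l \<omega>) + d) mod int (Mp l)"
          using cell_total[OF ws] .
        have "(?v - d) mod int (Mp l) = tuple_value N l (tuple_of N l \<omega>) mod int (Mp l)"
          unfolding d(3) by (simp add: mod_diff_left_eq)
        then have "tuple_value N l (tuple_of N l \<omega>) mod int (Mp l) = (case (?v, d) of (v, d) \<Rightarrow> (v - d) mod int (Mp l))" by simp
        moreover have "(?v, d) \<in> G l \<times> {0..int N}" using vG d by simp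
        ultimately have "tuple_value N l (tuple_of N l \<omega>) mod int (Mp l) \<in> G' l" unfolding G'_def by (rule image_eqI)
        then show ?thesis using tuple_of_mem[OF ws, of l] ws by (simp add: F_def Bad_def)
      qed
      then have "\<omega> \<in> W L" by (simp add: W_def)
      then show "\<omega> \<in> (\<Union>L. W L)" by blast
    qed
    have "incseq W" unfolding W_def by (intro monoI INF_superset_mono) auto
    then have lim: "(\<lambda>L. measure (PN N) (W L)) \<longlonglongrightarrow> measure (PN N) (\<Union>L. W L)"
      using Ws by (intro P.finite_Lim_measure_incseq) auto
    have "measure (PN N) (W L) \<le> sqrt e" for L
    proof -
      have "measure (PN N) (W L) \<le> measure (PN N) (F L)"
        using F(1)[of L] by (intro P.finite_measure_mono) (auto simp: W_def)
      also have "\<dots> \<le> sqrt e" using PF[of L] by (rule real_le_rsqrt)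
      finally show ?thesis .
    qed
    then have "measure (PN N) (\<Union>L. W L) \<le> sqrt e" using lim by (intro LIMSEQ_le_const2) auto
    moreover have "measure (PN N) ?A \<le> measure (PN N) (\<Union>L. W L)"
      using cover Ws by (intro P.finite_measure_mono) auto
    ultimately have "measure (PN N) ?A \<le> sqrt e" by linarith
    then have "(measure (PN N) ?A)\<^sup>2 \<le> (sqrt e)\<^sup>2" by (rule power_mono) simp
    then show ?thesis using e by simp
  qed
  have "(measure (PN N) ?A)\<^sup>2 \<le> 0" using bound by (rule field_le_epsilon)
  then have "measure (PN N) ?A = 0" by simp
  then have "emeasure (PN N) ?A = 0" by (simp add: P.emeasure_eq_measure)
  then show "E \<in> null_sets (convolution_power digit_law N)"
    unfolding convolution_power_digit_law null_sets_def
    using E emeasure_distr[OF total_circle_measurable E] by simp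
qed

text \<open>At level \<open>l\<close> only \<open>N + 1\<close> offsets of the values of the digit
  tuples can be cells of the sum, and each level at least halves the proportion of tuples to cells.
  The measure therefore lives on a set of total length at most a constant times
  \<open>(1/2) ^ l\<close> for every \<open>l\<close>.\<close>

theorem digit_law_singular:
  assumes sparse: "\<And>k. 2 * q k ^ N \<le> m k"
  shows "mutually_singular (convolution_power digit_law N) circle_lebesgue"
proof -
  interpret P: prob_space "PN N" by (rule prob_PN)
  \<comment> \<open>Closed arcs are used since they are compact, hence Borel; the additional
    endpoints have no length.\<close>
  define K where "K l v = cis ` {2 * pi * real_of_int v / real (Mp l) .. 2 * pi * real_of_int (v + 1) / real (Mp l)}" for l v
  define G where "G l = (\<lambda>(i, d). (tuple_value N l i + d) mod int (Mp l)) ` (tuple_digits N l \<times> {0..int N})" for l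
  define A where "A = (\<Inter>l. \<Union>v\<in>G l. K l v)"
  have M: "real (Mp l) > 0" for l using Mp_pos[of l] by simp
  have finG: "finite (G l)" for l unfolding G_def using finite_tuple_digits by auto
  have Grange: "0 \<le> v \<and> v < int (Mp l)" if v: "v \<in> G l" for l v
    using v Mp_pos[of l] by (auto simp: G_def)
  have Kc: "compact (K l v)" for l v
    unfolding K_def by (intro compact_continuous_image continuous_intros) auto
  have Ks: "K l v \<in> sets circle_borel" for l v
  proof -
    have "K l v \<in> sets borel" using compact_imp_closed[OF Kc] by (rule borel_closed)
    moreover have "K l v \<subseteq> sphere 0 1" by (auto simp: K_def)
    ultimately show ?thesis unfolding circle_borel_def by (subst sets_restrict_space_iff) auto
  qed
  have Us: "(\<Union>v\<in>G l. K l v) \<in> sets circle_borel" for l using finG Ks by (intro sets.finite_UN) auto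
  have As: "A \<in> sets circle_borel" unfolding A_def using Us by (intro sets.countable_INT) auto
  have Kle: "emeasure circle_lebesgue (K l v) \<le> ennreal (2 * pi / real (Mp l))" if v: "v \<in> G l" for l v
  proof -
    let ?a = "2 * pi * real_of_int v / real (Mp l)" and ?b = "2 * pi * real_of_int (v + 1) / real (Mp l)"
    have v1: "0 \<le> v" "v + 1 \<le> int (Mp l)" using Grange[OF v] by auto
    have a0: "0 \<le> ?a" using v1 by simp
    have "real_of_int (v + 1) \<le> real_of_int (int (Mp l))" using v1(2) by (simp only: of_int_le_iff)
    then have "real_of_int (v + 1) \<le> real (Mp l)" by simp
    then have "2 * pi * real_of_int (v + 1) \<le> 2 * pi * real (Mp l)" by (intro mult_left_mono) auto
    then have b: "?b \<le> 2 * pi" using M[of l] by (simp add: pos_divide_le_eq)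
    have ab: "?a \<le> ?b" "?b - ?a = 2 * pi / real (Mp l)" using M[of l] by (auto simp: field_simps)
    \<comment> \<open>The extra point \<open>0\<close> appears when the arc ends at the angle
      \<open>2 * pi\<close>.\<close>
    have "{x \<in> {0..<2 * pi}. cis x \<in> K l v} \<subseteq> {?a..?b} \<union> {0}"
    proof
      fix x assume x: "x \<in> {x \<in> {0..<2 * pi}. cis x \<in> K l v}"
      then obtain y where y: "y \<in> {?a..?b}" "cis x = cis y" by (auto simp: K_def)
      then have "x = y \<or> x = 0" using x a0 b by (intro cis_eq_cis_2pi) auto
      then show "x \<in> {?a..?b} \<union> {0}" using y(1) by auto
    qed
    then have "emeasure lborel {x \<in> {0..<2 * pi}. cis x \<in> K l v} \<le> emeasure lborel ({?a..?b} \<union> {0})"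
      by (intro emeasure_mono) auto
    also have "\<dots> \<le> emeasure lborel {?a..?b} + emeasure lborel {0::real}"
      by (rule emeasure_subadditive) auto
    also have "\<dots> = ennreal (2 * pi / real (Mp l))" using ab by simp
    finally show ?thesis by (simp only: circle_lebesgue_emeasure(2)[OF Ks])
  qed
  have card_le: "real (card (G l)) \<le> (real N + 1) * (real (Mp l) / 2 ^ l)" for l
  proof -
    have "card (G l) \<le> card (tuple_digits N l \<times> {0..int N})"
      unfolding G_def using finite_tuple_digits by (intro card_image_le) auto
    also have "\<dots> = (\<Prod>k<l. q k ^ N) * (N + 1)" by (simp only: card_cartesian_product card_tuple_digits card_atLeast0_int)
    finally have "real (card (G l)) \<le> real ((\<Prod>k<l. q k ^ N) * (N + 1))" by (simp only: of_nat_le_iff)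
    then have 1: "real (card (G l)) \<le> real (\<Prod>k<l. q k ^ N) * (real N + 1)" by (simp add: algebra_simps)
    \<comment> \<open>Each factor \<open>m k\<close> has room for twice the number
      \<open>q k ^ N\<close> of digit choices, which yields the factor \<open>2 ^ l\<close>.\<close>
    have "(\<Prod>k<l. q k ^ N) * 2 ^ l \<le> Mp l"
    proof (induction l)
      case (Suc l)
      have "(\<Prod>k<l. q k ^ N) * 2 ^ l * (2 * q l ^ N) \<le> Mp l * m l" by (intro mult_le_mono Suc sparse)
      then show ?case by (simp add: Mp_Suc mult_ac)
    qed simp
    then have "real ((\<Prod>k<l. q k ^ N) * 2 ^ l) \<le> real (Mp l)" by (simp only: of_nat_le_iff)
    then have "real (\<Prod>k<l. q k ^ N) \<le> real (Mp l) / 2 ^ l" by (simp add: pos_le_divide_eq)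
    then have "real (\<Prod>k<l. q k ^ N) * (real N + 1) \<le> real (Mp l) / 2 ^ l * (real N + 1)" by (intro mult_right_mono) auto
    then show ?thesis using 1 by (simp add: mult.commute)
  qed
  have cl: "sets circle_lebesgue = sets circle_borel" by (simp add: circle_lebesgue_def)
  have Ale: "emeasure circle_lebesgue A \<le> ennreal ((real N + 1) * (2 * pi) * (1/2) ^ l)" for l
  proof -
    have "emeasure circle_lebesgue A \<le> emeasure circle_lebesgue (\<Union>v\<in>G l. K l v)"
      using Us[of l] by (intro emeasure_mono) (auto simp: A_def cl)
    also have "\<dots> \<le> (\<Sum>v\<in>G l. emeasure circle_lebesgue (K l v))"
      using finG Ks by (intro emeasure_subadditive_finite) (auto simp: cl)
    also have "\<dots> \<le> (\<Sum>v\<in>G l. ennreal (2 * pi / real (Mp l)))" by (intro sum_mono Kle)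
    also have "\<dots> = ennreal (real (card (G l)) * (2 * pi / real (Mp l)))"
      by (rule sum_const_ennreal) simp
    also have "\<dots> \<le> ennreal ((real N + 1) * (2 * pi) * (1/2) ^ l)"
    proof (rule ennreal_leI)
      have "real (card (G l)) * (2 * pi / real (Mp l)) \<le> (real N + 1) * (real (Mp l) / 2 ^ l) * (2 * pi / real (Mp l))"
        using card_le[of l] M[of l] by (intro mult_right_mono) auto
      also have "\<dots> = (real N + 1) * (2 * pi) * (1/2) ^ l" using M[of l] by (simp add: power_divide)
      finally show "real (card (G l)) * (2 * pi / real (Mp l)) \<le> (real N + 1) * (2 * pi) * (1/2) ^ l" .
    qed
    finally show ?thesis .
  qed
  have "(\<lambda>l. ennreal ((real N + 1) * (2 * pi) * (1/2) ^ l)) \<longlonglongrightarrow> ennreal ((real N + 1) * (2 * pi) * 0)"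
    by (intro tendsto_ennrealI tendsto_mult tendsto_const LIMSEQ_power_zero) simp
  then have "emeasure circle_lebesgue A \<le> ennreal ((real N + 1) * (2 * pi) * 0)"
    using Ale by (intro LIMSEQ_le_const[of _ "ennreal ((real N + 1) * (2 * pi) * 0)"]) auto
  then have A0: "emeasure circle_lebesgue A = 0" by simp
  have ZA: "cis (2 * pi * total N \<omega>) \<in> A" if w: "\<omega> \<in> space (PN N)" for \<omega>
    unfolding A_def
  proof
    fix l
    let ?t = "total N \<omega>" and ?v = "cell l (total N \<omega>)"
    obtain d where d: "0 \<le> d" "d \<le> int N" "?v = (tuple_value N l (tuple_of N l \<omega>) + d) mod int (Mp l)"
      using cell_total[OF w] .
    have "?v \<in> G l" unfolding G_def
      by (rule image_eqI[of _ _ "(tuple_of N l \<omega>, d)"]) (use d tuple_of_mem[OF w] in auto)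
    moreover have "cis (2 * pi * ?t) \<in> K l ?v"
      unfolding cis_2pi_frac[of ?t] K_def using cell_bounds[where l=l and t="?t"] by (intro imageI) auto
    ultimately show "cis (2 * pi * ?t) \<in> (\<Union>v\<in>G l. K l v)" by blast
  qed
  let ?D = "distr (PN N) circle_borel (\<lambda>\<omega>. cis (2 * pi * total N \<omega>))"
  have "sphere 0 1 - A \<in> sets circle_borel" using sets.compl_sets[OF As] by simp
  then have "emeasure ?D (sphere 0 1 - A) = emeasure (PN N) ((\<lambda>\<omega>. cis (2 * pi * total N \<omega>)) -` (sphere 0 1 - A) \<inter> space (PN N))"
    by (rule emeasure_distr[OF total_circle_measurable])
  also have "(\<lambda>\<omega>. cis (2 * pi * total N \<omega>)) -` (sphere 0 1 - A) \<inter> space (PN N) = {}" using ZA by auto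
  finally have "emeasure ?D (space ?D - A) = 0" by simp
  then show ?thesis
    unfolding mutually_singular_def convolution_power_digit_law
    using As A0 by (intro bexI[of _ A]) (auto simp: cl)
qed

end

text \<open>A single choice of digit parameters satisfies the sparseness condition for
  \<open>n\<close> summands and the collision bound for \<open>n + 1\<close>, so the same law serves
  for both conclusions.\<close>

theorem singular_then_absolutely_continuous_exists:
  fixes n :: nat
  assumes n: "n > 0"
  obtains \<sigma> where "normalized_borel_measure \<sigma>"
    "mutually_singular (convolution_power (circle_projection \<sigma>) n) circle_lebesgue"
    "absolutely_continuous circle_lebesgue (convolution_power (circle_projection \<sigma>) (n + 1))"
proof -
  obtain q m :: "nat \<Rightarrow> nat" and a :: "nat \<Rightarrow> nat \<Rightarrow> nat" where
    q: "\<And>k. q k > 0" and qm: "\<And>k. 2 * q k ^ n \<le> m k" and a: "\<And>k i. a k i < m k"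
    and few: "\<And>k. real (m k) * real (coll ({..<Suc n} \<rightarrow>\<^sub>E {..<q k}) (\<lambda>j. (\<Sum>s<Suc n. int (a k (j s))) mod int (m k)))
      \<le> real (q k) ^ (2 * Suc n) * (1 + (1/2) ^ k)"
    using digit_parameters_exist[OF n] by metis
  have "2 \<le> m k" for k
  proof -
    have "1 \<le> q k ^ n" using q[of k] by simp
    then show ?thesis using qm[of k] by linarith
  qed
  then interpret D: digits q m a using q a by unfold_locales
  \<comment> \<open>The law on the circle is placed on the slice \<open>0\<close> of the product
    with the naturals, so that it becomes a normalized Borel measure with the prescribed
    projection.\<close>
  let ?f = "\<lambda>\<omega>. (cis (2 * pi * D.real_of_digits \<omega>), 0 :: nat)"
  let ?\<sigma> = "distr D.\<Omega> (circle_borel \<Otimes>\<^sub>M count_space UNIV) ?f"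
  have f: "?f \<in> measurable D.\<Omega> (circle_borel \<Otimes>\<^sub>M count_space UNIV)"
    using D.cis_digits_measurable by (intro measurable_Pair) auto
  have "normalized_borel_measure ?\<sigma>"
    unfolding normalized_borel_measure_def using prob_space.prob_space_distr[OF D.prob_\<Omega> f] by simp
  moreover have "circle_projection ?\<sigma> = D.digit_law"
    unfolding circle_projection_def D.digit_law_def using f by (subst distr_distr) (auto simp: o_def)
  ultimately show ?thesis
    using that D.digit_law_singular[OF qm] D.digit_law_absolutely_continuous[OF few] by simp
qed

theorem theorem1:
  fixes n :: nat
  assumes "n > 1"
  shows
    "(\<exists>(H :: (complex \<times> nat \<Rightarrow> complex) set ip_module) T.
        separable_hilbert_space H \<and> carrier H \<noteq> {\<zero>\<^bsub>H\<^esub>} \<and> unitary_operator H T \<and>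
        has_singular_spectrum (tensor_power n H) (tensor_power_operator n H T) \<and>
        has_absolutely_continuous_spectrum
          (tensor_power (n + 1) H) (tensor_power_operator (n + 1) H T) \<and>
        (\<exists>\<sigma>. is_spectral_measure H T \<sigma>)) \<and>
     (\<forall>(H :: 'a ip_module) T \<sigma>.
        separable_hilbert_space H \<and> carrier H \<noteq> {\<zero>\<^bsub>H\<^esub>} \<and> unitary_operator H T \<and>
        has_singular_spectrum (tensor_power n H) (tensor_power_operator n H T) \<and>
        has_absolutely_continuous_spectrum
          (tensor_power (n + 1) H) (tensor_power_operator (n + 1) H T) \<and>
        is_spectral_measure H T \<sigma> \<longrightarrow>
          mutually_singular (convolution_power (circle_projection \<sigma>) n) circle_lebesgue \<and>
          absolutely_continuous circle_lebesgue (convolution_power (circle_projection \<sigma>) (n + 1)))"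
proof (intro conjI allI impI)
  obtain \<sigma> where \<sigma>: "normalized_borel_measure \<sigma>"
    "mutually_singular (convolution_power (circle_projection \<sigma>) n) circle_lebesgue"
    "absolutely_continuous circle_lebesgue (convolution_power (circle_projection \<sigma>) (n + 1))"
    using singular_then_absolutely_continuous_exists[of n] assms by auto
  note H = normalized_measure_operator[OF \<sigma>(1)]
  \<comment> \<open>Singularity is transferred only between measures on the same sigma-algebra; the
    zeroth convolution power is a \<open>return\<close> and the others are \<open>distr\<close>,
    hence the case split.\<close>
  have sets: "sets (circle_projection \<tau>) = sets (convolution_power \<mu> k)" for \<tau> \<mu> k
    by (cases k) (simp_all add: circle_projection_def circle_convolution_def)
  obtain \<tau> where \<tau>: "is_spectral_measure (tensor_power n (L2_total \<sigma>))
        (tensor_power_operator n (L2_total \<sigma>) (coordinate_multiplication \<sigma>)) \<tau>"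
    "absolutely_continuous (convolution_power (circle_projection \<sigma>) n) (circle_projection \<tau>)"
    using tensor_power_spectral_measure_exists[OF H(3,4)] .
  obtain \<tau>' where \<tau>': "is_spectral_measure (tensor_power (n + 1) (L2_total \<sigma>))
        (tensor_power_operator (n + 1) (L2_total \<sigma>) (coordinate_multiplication \<sigma>)) \<tau>'"
    "absolutely_continuous (convolution_power (circle_projection \<sigma>) (n + 1)) (circle_projection \<tau>')"
    using tensor_power_spectral_measure_exists[OF H(3,4)] .
  have "has_singular_spectrum (tensor_power n (L2_total \<sigma>))
      (tensor_power_operator n (L2_total \<sigma>) (coordinate_multiplication \<sigma>))"
    unfolding has_singular_spectrum_def
    using \<tau>(1) mutually_singular_dominated[OF \<sigma>(2) \<tau>(2) sets] by blast
  moreover have "has_absolutely_continuous_spectrum (tensor_power (n + 1) (L2_total \<sigma>))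
      (tensor_power_operator (n + 1) (L2_total \<sigma>) (coordinate_multiplication \<sigma>))"
    unfolding has_absolutely_continuous_spectrum_def
    using \<tau>'(1) absolutely_continuous_trans[OF \<sigma>(3) \<tau>'(2)] by blast
  ultimately show "\<exists>(H :: (complex \<times> nat \<Rightarrow> complex) set ip_module) T.
        separable_hilbert_space H \<and> carrier H \<noteq> {\<zero>\<^bsub>H\<^esub>} \<and> unitary_operator H T \<and>
        has_singular_spectrum (tensor_power n H) (tensor_power_operator n H T) \<and>
        has_absolutely_continuous_spectrum
          (tensor_power (n + 1) H) (tensor_power_operator (n + 1) H T) \<and>
        (\<exists>\<sigma>. is_spectral_measure H T \<sigma>)"
    using H by blast
next
  fix H :: "'a ip_module" and T \<sigma>
  assume asm: "separable_hilbert_space H \<and> carrier H \<noteq> {\<zero>\<^bsub>H\<^esub>} \<and> unitary_operator H T \<and>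
        has_singular_spectrum (tensor_power n H) (tensor_power_operator n H T) \<and>
        has_absolutely_continuous_spectrum
          (tensor_power (n + 1) H) (tensor_power_operator (n + 1) H T) \<and>
        is_spectral_measure H T \<sigma>"
  then have T: "unitary_operator H T" and \<sigma>: "is_spectral_measure H T \<sigma>" by blast+
  have sets: "sets (convolution_power \<mu> k) = sets (circle_projection \<tau>)" for \<tau> \<mu> k
    by (cases k) (simp_all add: circle_projection_def circle_convolution_def)
  show "mutually_singular (convolution_power (circle_projection \<sigma>) n) circle_lebesgue"
  proof -
    \<comment> \<open>Singularity is known for some spectral measure of the tensor power only, but
      every such measure dominates the convolution power, so this one suffices.\<close>
    obtain \<tau> where \<tau>: "is_spectral_measure (tensor_power n H) (tensor_power_operator n H T) \<tau>"
      "mutually_singular (circle_projection \<tau>) circle_lebesgue"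
      using asm unfolding has_singular_spectrum_def by blast
    show ?thesis
      by (rule mutually_singular_dominated[OF \<tau>(2) tensor_power_spectral_measure_dominates[OF T \<sigma> \<tau>(1)] sets])
  qed
  show "absolutely_continuous circle_lebesgue (convolution_power (circle_projection \<sigma>) (n + 1))"
  proof -
    obtain \<tau> where \<tau>: "is_spectral_measure (tensor_power (n + 1) H) (tensor_power_operator (n + 1) H T) \<tau>"
      "absolutely_continuous circle_lebesgue (circle_projection \<tau>)"
      using asm unfolding has_absolutely_continuous_spectrum_def by blast
    show ?thesis
      by (rule absolutely_continuous_trans[OF \<tau>(2) tensor_power_spectral_measure_dominates[OF T \<sigma> \<tau>(1)]])
  qed
qed

end
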